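(* Let $V:(0,\infty)\to\mathbb{R}$ be a potential given by $$V(x)=\sum_{k=1}^\infty c_k e^{-i\phi_k x}\gamma_k(x),$$ where $c_k\in\mathbb{C}$, $\phi_k\in\mathbb{R}$, $\gamma_k:(0,\infty)\to\mathbb{C}$, and the following conditions hold: (i) the $\gamma_k$ are functions of bounded variation with $\sup_k \mathrm{Var}(\gamma_k,(0,\infty))<\infty$; (ii) for some $p\in\mathbb{Z}$, $p\ge 2$, $\int_0^\infty\left(\sup_k|\gamma_k(x)|\right)^p dx<\infty$; (iii) for some $\alpha\in(0,\frac1{p-1})$, $\sum_{k=1}^\infty|c_k|^\alpha<\infty$. Let $H$ be the half-line Schr\"odinger operator with potential $V$ and any boundary condition $\theta\in[0,\pi)$ at $0$. Then the set $$S=\{E>0 \mid \text{not all solutions } u \text{ of } -u''(x)+V(x)u(x)=Eu(x) \text{ on } (0,\infty) \text{ are bounded}\}$$ has Hausdorff dimension at most $(p-1)\alpha$, and $[0,\infty)$ is the essential support of the absolutely continuous spectrum of $H$.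
   Context: $\mathrm{Var}(\gamma,I)=\sup_{k\in\mathbb{N}}\sup_{x_0<\dots<x_k,\ x_j\in I}\sum_{j=1}^k|\gamma(x_j)-\gamma(x_{j-1})|$ is the variation of $\gamma$ on the interval $I$. Solutions $u$ are understood with $u,u'$ locally absolutely continuous (up to $0$), the equation holding almost everywhere. The operator $H$ acts on $L^2(0,\infty)$ by $(Hu)(x)=-u''(x)+V(x)u(x)$ with domain $$D(H)=\{u\in L^2(0,\infty)\mid u,u'\in \mathrm{AC}_{\mathrm{loc}},\ -u''+Vu\in L^2,\ u'(0)\sin\theta=u(0)\cos\theta\}.$$ Here $0$ is a regular point and $+\infty$ is limit point, so $H$ is self-adjoint, and for $\operatorname{Im}z>0$ there is a nontrivial solution $u_z$ of $-u_z''+Vu_z=zu_z$ that is square integrable near $+\infty$. Set $$m(z)=\frac{u_z'(0)\cos\theta+u_z(0)\sin\theta}{u_z(0)\cos\theta-u_z'(0)\sin\theta}.$$ The canonical spectral measure is $d\mu=\frac1\pi\,\text{w-lim}_{\epsilon\downarrow0}\operatorname{Im}m(x+i\epsilon)\,dx$ (weak limit against continuous functions of compact support); $H$ is unitarily equivalent to multiplication by $x$ on $L^2(\mathbb{R},d\mu)$. That a set $\Sigma$ is the essential support of the absolutely continuous spectrum of $H$ means that the absolutely continuous part of $\mu$ is mutually absolutely continuous with Lebesgue measure restricted to $\Sigma$. *)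

theory Defs
  imports "HOL-Analysis.Analysis"
begin

definition variation :: "(real \<Rightarrow> complex) \<Rightarrow> real set \<Rightarrow> ennreal" where
  "variation g I =
     (SUP k::nat. SUP x\<in>{x::nat \<Rightarrow> real. strict_mono_on {0..k} x \<and> x ` {0..k} \<subseteq> I}.
        \<Sum>j=1..k. ennreal (norm (g (x j) - g (x (j - 1)))))"

definition absolutely_continuous_fun :: "real set \<Rightarrow> (real \<Rightarrow> complex) \<Rightarrow> bool" where
  "absolutely_continuous_fun I f \<longleftrightarrow>
     (\<forall>\<epsilon>>0. \<exists>\<delta>>0. \<forall>(n::nat) a b.
        (\<forall>j<n. a j \<le> b j \<and> {a j..b j} \<subseteq> I) \<and>
        disjoint_family_on (\<lambda>j. {a j<..<b j}) {..<n} \<and>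
        (\<Sum>j<n. b j - a j) < \<delta> \<longrightarrow>
        (\<Sum>j<n. norm (f (b j) - f (a j))) < \<epsilon>)"

text \<open>Local absolute continuity on the half-line, up to and including the endpoint 0.\<close>
definition AC_loc :: "(real \<Rightarrow> complex) \<Rightarrow> bool" where
  "AC_loc f \<longleftrightarrow> (\<forall>b>0. absolutely_continuous_fun {0..b} f)"

text \<open>The derivative on the closed half-line; it is one-sided at 0.\<close>
definition halfline_deriv :: "(real \<Rightarrow> complex) \<Rightarrow> real \<Rightarrow> complex" where
  "halfline_deriv u x = vector_derivative u (at x within {0..})"

text \<open>Solutions of \<open>- u'' + V u = z u\<close> on the half-line. Solutions are complex-valued, and
  only their values on \<open>{0..}\<close> matter.\<close>
definition schroedinger_solution :: "(real \<Rightarrow> real) \<Rightarrow> complex \<Rightarrow> (real \<Rightarrow> complex) \<Rightarrow> bool" where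
  "schroedinger_solution V z u \<longleftrightarrow>
     AC_loc u \<and>
     (\<forall>x\<ge>0. u differentiable (at x within {0..})) \<and>
     AC_loc (halfline_deriv u) \<and>
     (AE x in lborel. x > 0 \<longrightarrow>
        (\<exists>u2. (halfline_deriv u has_vector_derivative u2) (at x) \<and>
              - u2 + complex_of_real (V x) * u x = z * u x))"

definition square_integrable_at_infinity :: "(real \<Rightarrow> complex) \<Rightarrow> bool" where
  "square_integrable_at_infinity u \<longleftrightarrow>
     (\<exists>R\<ge>0. set_integrable lborel {R..} (\<lambda>x. (norm (u x))\<^sup>2))"

text \<open>In the limit point case the solution chosen here is unique up to a nonzero constant factor,
  on which \<open>weyl_m\<close> does not depend.\<close>
definition weyl_solution :: "(real \<Rightarrow> real) \<Rightarrow> complex \<Rightarrow> real \<Rightarrow> complex" where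
  "weyl_solution V z =
     (SOME u. schroedinger_solution V z u \<and> (\<exists>x\<ge>0. u x \<noteq> 0) \<and> square_integrable_at_infinity u)"

text \<open>The m-function for the boundary condition \<open>u'(0) sin \<theta> = u(0) cos \<theta>\<close>.\<close>
definition weyl_m :: "(real \<Rightarrow> real) \<Rightarrow> real \<Rightarrow> complex \<Rightarrow> complex" where
  "weyl_m V \<theta> z =
     (let u = weyl_solution V z; u0 = u 0; u1 = halfline_deriv u 0 in
        (u1 * of_real (cos \<theta>) + u0 * of_real (sin \<theta>)) /
        (u0 * of_real (cos \<theta>) - u1 * of_real (sin \<theta>)))"

text \<open>Convergence of the measures \<open>h \<epsilon> x dx\<close> to \<open>\<mu>\<close> as \<open>\<epsilon>\<close> decreases to 0, against continuous
  functions of compact support. Integrability of all these functions makes \<open>\<mu>\<close> finite on compact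
  sets, so that \<open>\<mu>\<close> is uniquely determined.\<close>
definition weak_limit_of_densities :: "(real \<Rightarrow> real \<Rightarrow> real) \<Rightarrow> real measure \<Rightarrow> bool" where
  "weak_limit_of_densities h \<mu> \<longleftrightarrow>
     sets \<mu> = sets borel \<and>
     (\<forall>f::real \<Rightarrow> real. continuous_on UNIV f \<and> compact (closure {x. f x \<noteq> 0}) \<longrightarrow>
        integrable \<mu> f \<and>
        ((\<lambda>\<epsilon>. \<integral>x. f x * h \<epsilon> x \<partial>lborel) \<longlongrightarrow> (\<integral>x. f x \<partial>\<mu>)) (at_right 0))"

definition spectral_measure :: "(real \<Rightarrow> real) \<Rightarrow> real \<Rightarrow> real measure" where
  "spectral_measure V \<theta> =
     (THE \<mu>. weak_limit_of_densities (\<lambda>\<epsilon> x. Im (weyl_m V \<theta> (Complex x \<epsilon>)) / pi) \<mu>)"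

text \<open>\<open>\<nu>\<close> is the absolutely continuous part of \<open>\<mu>\<close> in its Lebesgue decomposition \<open>\<nu> + \<sigma>\<close>.\<close>
definition is_ac_part :: "real measure \<Rightarrow> real measure \<Rightarrow> bool" where
  "is_ac_part \<mu> \<nu> \<longleftrightarrow>
     sets \<nu> = sets borel \<and> absolutely_continuous lborel \<nu> \<and>
     (\<exists>\<sigma>. sets \<sigma> = sets borel \<and>
          (\<exists>N\<in>null_sets lborel. emeasure \<sigma> (- N) = 0) \<and>
          (\<forall>A\<in>sets borel. emeasure \<mu> A = emeasure \<nu> A + emeasure \<sigma> A))"

text \<open>\<open>\<Sigma>\<close> is the essential support of the absolutely continuous spectrum of the half-line
  operator \<open>H u = - u'' + V u\<close> with boundary condition \<open>u'(0) sin \<theta> = u(0) cos \<theta>\<close>, which enters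
  through its canonical spectral measure.\<close>
definition ac_essential_support :: "(real \<Rightarrow> real) \<Rightarrow> real \<Rightarrow> real set \<Rightarrow> bool" where
  "ac_essential_support V \<theta> \<Sigma> \<longleftrightarrow>
     (\<exists>\<nu>. is_ac_part (spectral_measure V \<theta>) \<nu> \<and>
          absolutely_continuous \<nu> (density lborel (indicator \<Sigma>)) \<and>
          absolutely_continuous (density lborel (indicator \<Sigma>)) \<nu>)"

text \<open>Since \<open>0 powr 0 = 0\<close>, these agree with the usual notions for \<open>s > 0\<close> only.\<close>
definition hausdorff_content :: "real \<Rightarrow> real \<Rightarrow> 'a::metric_space set \<Rightarrow> ennreal" where
  "hausdorff_content s \<delta> A =
     (INF U\<in>{U::nat \<Rightarrow> 'a set. A \<subseteq> (\<Union>i. U i) \<and> (\<forall>i. bounded (U i) \<and> diameter (U i) \<le> \<delta>)}.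
        \<Sum>i. ennreal (diameter (U i) powr s))"

definition hausdorff_measure :: "real \<Rightarrow> 'a::metric_space set \<Rightarrow> ennreal" where
  "hausdorff_measure s A = (SUP \<delta>\<in>{0<..}. hausdorff_content s \<delta> A)"

definition hausdorff_dim :: "'a::metric_space set \<Rightarrow> ennreal" where
  "hausdorff_dim A = (INF s\<in>{s. 0 < s \<and> hausdorff_measure s A = 0}. ennreal s)"

end

theory Submission
  imports Defs "HOL-Probability.Probability" "HOL-Complex_Analysis.Complex_Analysis" "HOL-Library.Countable"
begin

text \<open>
  Bounded solutions. At energy \<open>\<kappa>\<^sup>2\<close> an approximate solution \<open>w = i \<kappa> + W\<close> of the Riccati equation
  \<open>w' + w\<^sup>2 = V - \<kappa>\<^sup>2\<close> is built by iteration: \<open>W\<close> is a sum over binary trees with at most \<open>p - 1\<close>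
  leaves, where a leaf carries a term of \<open>V\<close> and every node \<open>t\<close> contributes a divisor \<open>2 \<kappa> - \<phi>\<^sub>t\<close>,
  \<open>\<phi>\<^sub>t\<close> being the sum of the frequencies at the leaves below it. What remains are products of at
  least \<open>p\<close> amplitudes, and derivatives of the amplitudes, both of which are integrable; so all
  solutions are bounded as soon as the coefficients of the trees are summable. This holds unless a
  potential \<open>\<Sum>t. b\<^sub>t |2 \<kappa> - \<phi>\<^sub>t| powr - (p - 1) \<alpha>\<close> with summable \<open>b\<close> is infinite, which happens on a set
  of Hausdorff dimension at most \<open>(p - 1) \<alpha> < 1\<close>.

  Spectrum. Let \<open>\<phi>\<close> be the solution satisfying the boundary condition. The measures
  \<open>dE / (\<pi> (\<phi>(N)\<^sup>2 + \<phi>'(N)\<^sup>2))\<close> converge to \<open>\<mu>\<close> as \<open>N\<close> tends to infinity. Their densities are bounded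
  below locally uniformly in \<open>N\<close> where \<open>\<phi>\<close> and \<open>\<phi>'\<close> are bounded, hence almost everywhere on the
  positive half-line. For \<open>E < 0\<close> the solution \<open>\<phi>\<close> grows unless \<open>E\<close> is one of countably many eigenvalues,
  so that \<open>\<mu>\<close> has no absolutely continuous part there.\<close>

section \<open>The fundamental theorem of calculus with an exceptional set\<close>

text \<open>The amplitudes may jump, so \<open>V\<close> is continuous only off a countable set and
  a tree sum with the raw amplitudes could not be differentiated. Hence they are smoothed over unit
  cells, at a cost paid by their variation, and calculus is done with exceptional sets. The bound
  \<open>\<alpha> < 1 / (p - 1)\<close> acts twice: it gives \<open>\<alpha> \<le> 1\<close>, so
  that the coefficients are summable, and it makes the exceptional energies Lebesgue null, which
  carries boundedness over to the spectrum. In the spectral half the obstacle is that the given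
  measure is a limit in the height above the real axis, while bounded solutions speak about large
  \<open>N\<close>. The problem truncated at \<open>N\<close> therefore gets the complex boundary
  condition \<open>u'(N) = i u(N)\<close>: its m-function is holomorphic near the real axis, with
  the explicit density of the overview. Its bound \<open>C / Im z\<close>, uniform in
  \<open>N\<close>, becomes a uniform Hoelder estimate after pairing with twice differentiable test
  functions, and then the two limits may be exchanged. Negative energies rest on \<open>V\<close>
  tending to 0, so that far out \<open>V\<close> exceeds the energy.\<close>

abbreviation increments :: "(real \<Rightarrow> 'a::real_normed_vector) \<Rightarrow> (real \<times> real set) set \<Rightarrow> 'a" where
 "increments f p \<equiv> \<Sum>(x,K)\<in>p. f (Sup K) - f (Inf K)"

text \<open>A Riemann sum of \<open>g\<close> minus the total increment of \<open>f\<close> is split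
  by the position of the tags. Tags off \<open>S\<close> are handled by differentiability; tags in
  \<open>S\<close>, where \<open>g\<close> is replaced by 0, leave only increments of
  \<open>f\<close>, which \<open>small\<close> bounds. The two applications differ in why these
  increments are small.\<close>

lemma ftc_small_exception:
 fixes f :: "real \<Rightarrow> 'a::banach"
 assumes ab: "a \<le> b" and S: "negligible S"
  and deriv: "\<And>x. x \<in> {a..b} - S \<Longrightarrow> (f has_vector_derivative g x) (at x within {a..b})"
  and small: "\<And>e. e > 0 \<Longrightarrow> \<exists>\<gamma>. gauge \<gamma> \<and> (\<forall>p. p tagged_partial_division_of {a..b} \<and> \<gamma> fine p \<and>
    (\<forall>(x,K)\<in>p. x \<in> S) \<longrightarrow> norm (increments f p) \<le> e)"
 shows "(g has_integral (f b - f a)) {a..b}"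
proof -
 define g' where "g' x = (if x \<in> S then 0 else g x)" for x
 have "(g' has_integral (f b - f a)) {a..b}"
  unfolding has_integral_real
 proof (intro allI impI)
  fix e :: real assume e: "e > 0"
  \<comment> \<open>The summand 1 keeps the denominator positive when \<open>a = b\<close>.\<close>
  define e1 where "e1 = e / (4 * (b - a + 1))"
  have e1: "e1 > 0" using e ab by (simp add: e1_def)
  have "\<forall>x. \<exists>d>0. x \<in> {a..b} - S \<longrightarrow>
     (\<forall>y\<in>{a..b}. norm (y-x) < d \<longrightarrow> norm (f y - f x - (y-x) *\<^sub>R g x) \<le> e1 * norm (y-x))"
   (is "\<forall>x. \<exists>d. ?Q x d")
  proof
   fix x
   show "\<exists>d. ?Q x d"
   proof (cases "x \<in> {a..b} - S")
    case True
    then show ?thesis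
     using deriv[OF True, unfolded has_vector_derivative_def has_derivative_within_alt] e1 by blast
   next
    case False
    then show ?thesis by (intro exI[of _ 1]) auto
   qed
  qed
  from choice[OF this] obtain d where "\<forall>x. ?Q x (d x)" by blast
  then have d0: "\<And>x. 0 < d x"
   and d: "\<And>x y. \<lbrakk>x \<in> {a..b} - S; y \<in> {a..b}; norm (y-x) < d x\<rbrakk>
            \<Longrightarrow> norm (f y - f x - (y-x) *\<^sub>R g x) \<le> e1 * norm (y-x)"
   by blast+
  have "e/2 > 0" using e by simp
  from small[OF this] obtain \<gamma>0 where \<gamma>0: "gauge \<gamma>0"
   and sm0: "\<forall>p. p tagged_partial_division_of {a..b} \<and> \<gamma>0 fine p \<and>
    (\<forall>(x,K)\<in>p. x \<in> S) \<longrightarrow> norm (increments f p) \<le> e/2" by blast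
  define \<gamma> where "\<gamma> x = \<gamma>0 x \<inter> ball x (d x)" for x
  have gau: "gauge \<gamma>" using \<gamma>0 d0 unfolding \<gamma>_def by (simp add: gauge_Int gauge_ball_dependent)
  show "\<exists>\<gamma>. gauge \<gamma> \<and> (\<forall>\<D>. \<D> tagged_division_of {a..b} \<and> \<gamma> fine \<D> \<longrightarrow>
    norm ((\<Sum>(x,k)\<in>\<D>. measure lborel k *\<^sub>R g' x) - (f b - f a)) < e)"
  proof (intro exI[of _ \<gamma>] conjI gau allI impI, elim conjE)
   fix p assume p: "p tagged_division_of {a..b}" and fine: "\<gamma> fine p"
   have fin: "finite p" using p by blast
   define p1 where "p1 = {(x,K)\<in>p. x \<in> S}"
   have p1: "p1 \<subseteq> p" by (auto simp: p1_def)
   have f1: "f b - f a = (increments f p)"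
    using additive_tagged_division_1[OF ab p, of f] by simp
   have f2: "b - a = (\<Sum>(x,K)\<in>p. Sup K - Inf K)"
    using additive_tagged_division_1[OF ab p, of "\<lambda>x. x"] by simp
   let ?r = "\<lambda>(x,K). measure lborel K *\<^sub>R g' x - (f (Sup K) - f (Inf K))"
   have eq: "(\<Sum>(x,k)\<in>p. measure lborel k *\<^sub>R g' x) - (f b - f a) = sum ?r p"
    unfolding f1 sum_subtractf[symmetric] by (rule sum.cong) auto
   have split: "sum ?r p = sum ?r p1 + sum ?r (p - p1)"
    using sum.subset_diff[OF p1 fin, of ?r] by (simp add: add.commute)
   have "sum ?r p1 = - (increments f p1)"
    unfolding sum_negf[symmetric] by (rule sum.cong) (auto simp: p1_def g'_def)
   moreover have "norm (increments f p1) \<le> e/2"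
   proof -
    have 1: "p1 tagged_partial_division_of {a..b}"
     by (rule tagged_partial_division_subset[OF _ p1]) (use p in \<open>simp add: tagged_division_of_def\<close>)
    have 2: "\<gamma>0 fine p1" using fine p1 unfolding \<gamma>_def fine_def by blast
    have 3: "\<forall>(x,K)\<in>p1. x \<in> S" by (auto simp: p1_def)
    show ?thesis by (rule sm0[THEN spec, THEN mp]) (intro conjI 1 2 3)
   qed
   ultimately have n1: "norm (sum ?r p1) \<le> e/2" by simp
   have "norm (sum ?r (p - p1)) \<le> (\<Sum>(x,K)\<in>p - p1. e1 * (Sup K - Inf K))"
   proof (rule sum_norm_le, clarify)
    fix x K assume xK: "(x,K) \<in> p" "(x,K) \<notin> p1"
    have "x \<in> K" "K \<subseteq> cbox a b" using tagged_division_ofD(2,3)[OF p xK(1)] by auto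
    obtain u v where k: "K = cbox u v" using tagged_division_ofD(4)[OF p xK(1)] by blast
    have uv: "u \<le> v" using \<open>x \<in> K\<close> k by auto
    have mem: "u \<in> K" "v \<in> K" using uv k by auto
    have xS: "x \<in> {a..b} - S" using \<open>x \<in> K\<close> \<open>K \<subseteq> cbox a b\<close> xK by (auto simp: p1_def)
    have ball: "\<And>y. y \<in> K \<Longrightarrow> y \<in> ball x (d x)" using fine xK(1) unfolding \<gamma>_def fine_def by blast
    have A: "norm (f u - f x - (u - x) *\<^sub>R g x) \<le> e1 * norm (u - x)"
     using d[OF xS, of u] mem ball[OF mem(1)] \<open>K \<subseteq> cbox a b\<close> by (auto simp: dist_real_def)
    have B: "norm (f v - f x - (v - x) *\<^sub>R g x) \<le> e1 * norm (v - x)"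
     using d[OF xS, of v] mem ball[OF mem(2)] \<open>K \<subseteq> cbox a b\<close> by (auto simp: dist_real_def)
    have "norm ((v - u) *\<^sub>R g x - (f v - f u)) = norm (f u - f x - (u - x) *\<^sub>R g x - (f v - f x - (v - x) *\<^sub>R g x))"
     by (auto simp: algebra_simps)
    also have "\<dots> \<le> e1 * norm (u - x) + e1 * norm (v - x)"
     using norm_triangle_ineq4 A B by (meson add_mono order_trans)
    also have "\<dots> = e1 * (v - u)"
     using \<open>x \<in> K\<close> by (auto simp: k algebra_simps abs_if)
    finally show "norm (measure lborel K *\<^sub>R g' x - (f (Sup K) - f (Inf K))) \<le> e1 * (Sup K - Inf K)"
     using uv xS by (simp add: k g'_def)
   qed
   also have "\<dots> \<le> (\<Sum>(x,K)\<in>p. e1 * (Sup K - Inf K))"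
   proof (rule sum_mono2[OF fin])
    fix i assume "i \<in> p - (p - p1)"
    then obtain x K where i: "i = (x,K)" "(x,K) \<in> p" by (cases i) auto
    then obtain u v where "K = cbox u v" "x \<in> K" using tagged_division_ofD(2,4)[OF p] by blast
    then show "0 \<le> (case i of (x,K) \<Rightarrow> e1 * (Sup K - Inf K))" using e1 by (auto simp: i(1))
   qed auto
   also have "\<dots> = e1 * (b - a)"
    unfolding f2 sum_distrib_left by (rule sum.cong) auto
   also have "e1 * (b - a) \<le> e1 * (b - a + 1)" using e1 by simp
   also have "\<dots> = e / 4"
   proof -
    have "b - a + 1 \<noteq> 0" using ab by linarith
    then show ?thesis unfolding e1_def times_divide_eq_left by (rule nonzero_mult_divide_mult_cancel_right)
   qed
   also have "\<dots> < e / 2" using e by simp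
   finally show "norm ((\<Sum>(x,k)\<in>p. measure lborel k *\<^sub>R g' x) - (f b - f a)) < e"
    unfolding eq split using n1 norm_triangle_ineq[of "sum ?r p1" "sum ?r (p - p1)"] by linarith
  qed
 qed
 then show ?thesis
  using has_integral_spike[OF S, of "{a..b}" g g'] by (simp add: g'_def)
qed

text \<open>Each exceptional point is allowed an oscillation of \<open>f\<close> taken from a
  convergent geometric series. This suffices because a point can tag at most two nondegenerate
  intervals of a partial division, one on each side.\<close>

lemma ftc_countable:
 fixes f :: "real \<Rightarrow> 'a::banach"
 assumes ab: "a \<le> b" and S: "countable S" and cont: "continuous_on {a..b} f"
  and deriv: "\<And>x. x \<in> {a<..<b} - S \<Longrightarrow> (f has_vector_derivative g x) (at x)"
 shows "(g has_integral (f b - f a)) {a..b}"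
proof (rule ftc_small_exception[OF ab, where S = "(S \<union> {a,b}) \<inter> {a..b}"])
 let ?S = "(S \<union> {a,b}) \<inter> {a..b}"
 have cS: "countable ?S" using S by auto
 then show "negligible ?S"
  by (simp add: negligible_iff_null_sets countable_imp_null_set_lborel null_sets_completionI)
 show "(f has_vector_derivative g x) (at x within {a..b})" if "x \<in> {a..b} - ?S" for x
  using deriv[of x] that by (auto intro: has_vector_derivative_at_within)
 fix e :: real assume e: "e > 0"
 \<comment> \<open>Two endpoints per interval and two sides per point: the factor 1/4 brings the
   total to \<open>e\<close>.\<close>
 define t where "t x = e / 4 * (1/2) ^ Suc (to_nat_on ?S x)" for x
 have t0: "t x > 0" for x using e by (simp add: t_def)
 have "\<forall>x. \<exists>d>0. x \<in> {a..b} \<longrightarrow> (\<forall>y\<in>{a..b}. dist y x < d \<longrightarrow> dist (f y) (f x) < t x)"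
  (is "\<forall>x. \<exists>d. ?Q x d")
 proof
  fix x
  show "\<exists>d. ?Q x d"
  proof (cases "x \<in> {a..b}")
   case True
   then show ?thesis using cont t0[of x] unfolding continuous_on_iff by blast
  next
   case False
   then show ?thesis by (intro exI[of _ 1]) auto
  qed
 qed
 from choice[OF this] obtain d where "\<forall>x. ?Q x (d x)" by blast
 then have d0: "\<And>x. d x > 0"
  and d: "\<And>x y. x \<in> {a..b} \<Longrightarrow> y \<in> {a..b} \<Longrightarrow> dist y x < d x \<Longrightarrow> dist (f y) (f x) < t x"
  by blast+
 show "\<exists>\<gamma>. gauge \<gamma> \<and> (\<forall>p. p tagged_partial_division_of {a..b} \<and> \<gamma> fine p \<and> (\<forall>(x,K)\<in>p. x \<in> ?S) \<longrightarrow>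
    norm (increments f p) \<le> e)"
 proof (intro exI[of _ "\<lambda>x. ball x (d x)"] conjI allI impI)
  show "gauge (\<lambda>x. ball x (d x))" using d0 by (simp add: gauge_ball_dependent)
  fix p assume "p tagged_partial_division_of {a..b} \<and> (\<lambda>x. ball x (d x)) fine p \<and> (\<forall>(x,K)\<in>p. x \<in> ?S)"
  then have p: "p tagged_partial_division_of {a..b}" and fine: "(\<lambda>x. ball x (d x)) fine p"
   and tS: "\<And>x K. (x,K)\<in>p \<Longrightarrow> x \<in> ?S" by auto
  have fin: "finite p" using p by (rule tagged_partial_division_ofD(1))
  have pK: "\<exists>u v. K = cbox u v \<and> u \<le> x \<and> x \<le> v \<and> K \<subseteq> {a..b}" if "(x,K) \<in> p" for x K
   using tagged_partial_division_ofD(2,3,4)[OF p that] by auto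
  define p' where "p' = {(x,K)\<in>p. Inf K < Sup K}"
  \<comment> \<open>An interval is recovered from its tag and the side to which it extends, since
    two nondegenerate intervals with the same tag and side overlap in their interiors. Hence the
    increments can be summed over pairs of an index and a Boolean.\<close>
  define side where "side = (\<lambda>(x::real,K). (to_nat_on ?S x, Sup K > x))"
  have inj: "inj_on side p'"
  proof (rule inj_onI, clarify)
   fix x K y L assume xK: "(x,K) \<in> p'" and yL: "(y,L) \<in> p'" and eq: "side (x,K) = side (y,L)"
   have mem: "(x,K) \<in> p" "Inf K < Sup K" "(y,L) \<in> p" "Inf L < Sup L" using xK yL by (auto simp: p'_def)
   have sides: "to_nat_on ?S x = to_nat_on ?S y" "(Sup K > x) = (Sup L > y)"
    using eq by (simp_all add: side_def)
   have xy: "x = y"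
    by (rule inj_onD[OF inj_on_to_nat_on[OF cS] sides(1) tS[OF mem(1)] tS[OF mem(3)]])
   obtain u v where K: "K = cbox u v" "u \<le> x" "x \<le> v" using pK[OF mem(1)] by blast
   obtain u' v' where L: "L = cbox u' v'" "u' \<le> x" "x \<le> v'" using pK[OF mem(3)] xy by blast
   have lt: "u < v" "u' < v'" using mem(2,4) K L by simp_all
   have sd: "(v > x) = (v' > x)" using sides(2) K L lt xy by simp
   have "box u v \<inter> box u' v' \<noteq> {}"
   proof (cases "v > x")
    case True
    then have "(x + min v v') / 2 \<in> box u v \<inter> box u' v'" using K L sd by (auto simp: box_def min_def)
    then show ?thesis by blast
   next
    case False
    then have "(x + max u u') / 2 \<in> box u v \<inter> box u' v'" using K L sd lt by (auto simp: box_def max_def)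
    then show ?thesis by blast
   qed
   then have "interior K \<inter> interior L \<noteq> {}" unfolding K(1) L(1) interior_cbox .
   then have "(x,K) = (y,L)"
    using tagged_partial_division_ofD(5)[OF p mem(1,3)] by blast
   then show "x = y \<and> K = L" by simp
  qed
  have fin': "finite p'" by (rule finite_subset[OF _ fin]) (auto simp: p'_def)
  have le: "norm (f (Sup K) - f (Inf K)) \<le> e/2 * (1/2) ^ Suc (fst (side (x,K)))" if "(x,K) \<in> p'" for x K
  proof -
   have xK: "(x,K) \<in> p" using that by (auto simp: p'_def)
   obtain u v where K: "K = cbox u v" "u \<le> x" "x \<le> v" "K \<subseteq> {a..b}" using pK[OF xK] by auto
   have uv: "u \<in> K" "v \<in> K" using K by auto
   have Kb: "K \<subseteq> ball x (d x)" using fine xK unfolding fine_def by auto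
   have x: "x \<in> {a..b}" using tS[OF xK] by auto
   have "dist (f u) (f x) < t x" "dist (f v) (f x) < t x"
    using d[OF x, of u] d[OF x, of v] uv K(4) Kb by (auto simp: dist_commute subset_iff)
   then have "dist (f v) (f u) < 2 * t x" using dist_triangle2[of "f v" "f u" "f x"] by linarith
   then show ?thesis using K(2,3) unfolding K(1) by (simp add: dist_norm t_def side_def)
  qed
  have "norm (increments f p) = norm (increments f p')"
  proof (intro arg_cong[where f=norm] sum.mono_neutral_right fin)
   show "\<forall>i\<in>p - p'. (case i of (x, K) \<Rightarrow> f (Sup K) - f (Inf K)) = 0"
   proof clarify
    fix x K assume xK: "(x,K) \<in> p" "(x,K) \<notin> p'"
    obtain u v where K: "K = cbox u v" "u \<le> x" "x \<le> v" using pK[OF xK(1)] by auto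
    have "u = v" using xK K by (auto simp: p'_def)
    then show "f (Sup K) - f (Inf K) = 0" using K by simp
   qed
  qed (auto simp: p'_def)
  also have "\<dots> \<le> (\<Sum>i\<in>p'. e/2 * (1/2) ^ Suc (fst (side i)))"
   using le by (intro sum_norm_le) auto
  also have "\<dots> = (\<Sum>j\<in>side ` p'. e/2 * (1/2) ^ Suc (fst j))"
   by (simp add: sum.reindex[OF inj])
  also have "\<dots> \<le> (\<Sum>j\<in>{..Max (fst ` side ` p')} \<times> (UNIV::bool set). e/2 * (1/2) ^ Suc (fst j))"
  proof (rule sum_mono2)
   show "side ` p' \<subseteq> {..Max (fst ` side ` p')} \<times> UNIV"
   proof
    fix i assume "i \<in> side ` p'"
    then have "fst i \<le> Max (fst ` side ` p')" using fin' by (intro Max_ge) auto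
    then show "i \<in> {..Max (fst ` side ` p')} \<times> UNIV" by (cases i) auto
   qed
  qed (use e in auto)
  also have "\<dots> = (\<Sum>n\<le>Max (fst ` side ` p'). e * (1/2) ^ Suc n)"
  proof -
   have "(\<Sum>j\<in>{..m} \<times> (UNIV::bool set). e/2 * (1/2) ^ Suc (fst j))
     = (\<Sum>(n,b)\<in>{..m} \<times> (UNIV::bool set). e/2 * (1/2) ^ Suc n)" for m :: nat
    by (rule sum.cong) auto
   also have "\<dots> m = (\<Sum>n\<le>m. \<Sum>b\<in>(UNIV::bool set). e/2 * (1/2) ^ Suc n)" for m
    by (rule sum.cartesian_product[symmetric])
   finally show ?thesis by (simp add: field_simps)
  qed
  also have "\<dots> \<le> e"
  proof -
   have "(\<Sum>n\<le>m. e * (1/2) ^ Suc n) = e * (1 - (1/2) ^ Suc m)" for m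
    by (induction m) (simp_all add: field_simps)
   then show ?thesis using e by simp
  qed
  finally show "norm (increments f p) \<le> e" .
 qed
qed

text \<open>The gauge confines the intervals tagged in \<open>S\<close> to an open set
  \<open>T\<close> of measure below the \<open>\<delta>\<close> of absolute continuity. They do not
  overlap, so their total length is below \<open>\<delta>\<close> and the increments of
  \<open>f\<close> sum to at most \<open>e\<close>.\<close>

lemma ftc_absolutely_continuous:
 fixes f :: "real \<Rightarrow> complex"
 assumes ab: "a \<le> b" and S: "negligible S" and ac: "absolutely_continuous_fun {a..b} f"
  and deriv: "\<And>x. x \<in> {a..b} - S \<Longrightarrow> (f has_vector_derivative g x) (at x within {a..b})"
 shows "(g has_integral (f b - f a)) {a..b}"
proof (rule ftc_small_exception[OF ab S deriv])
 fix e :: real assume e: "e > 0"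
 obtain \<delta> where \<delta>: "\<delta> > 0" and ac': "\<And>n u v. (\<forall>j<n. u j \<le> v j \<and> {u j..v j} \<subseteq> {a..b}) \<Longrightarrow>
    disjoint_family_on (\<lambda>j. {u j<..<v j}) {..<n} \<Longrightarrow> (\<Sum>j<n. v j - u j) < \<delta> \<Longrightarrow>
    (\<Sum>j<(n::nat). norm (f (v j) - f (u j))) < e"
  using ac[unfolded absolutely_continuous_fun_def, rule_format, OF e] by blast
 have Sm: "S \<in> lmeasurable" "measure lebesgue S = 0"
  using S negligible_imp_measurable negligible_imp_measure0 by auto
 then obtain T where T: "open T" "S \<subseteq> T" "T - S \<in> lmeasurable" "emeasure lebesgue (T - S) < ennreal \<delta>"
  using sets_lebesgue_outer_open[OF _ \<delta>, of S] by blast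
 have "T = S \<union> (T - S)" using T by auto
 then have Tm: "T \<in> lmeasurable" using Sm T by (metis fmeasurable.Un)
 have "measure lebesgue T \<le> measure lebesgue S + measure lebesgue (T - S)"
  using Sm T \<open>T = S \<union> (T - S)\<close> by (metis measure_Un_le fmeasurableD)
 also have "\<dots> < \<delta>" using Sm T \<delta> by (simp add: emeasure_eq_measure2 ennreal_less_iff)
 finally have Tl: "measure lebesgue T < \<delta>" .
 define \<gamma> where "\<gamma> x = (if x \<in> S then T else UNIV)" for x
 show "\<exists>\<gamma>. gauge \<gamma> \<and> (\<forall>p. p tagged_partial_division_of {a..b} \<and> \<gamma> fine p \<and> (\<forall>(x,K)\<in>p. x \<in> S) \<longrightarrow>
    norm (increments f p) \<le> e)"
 proof (intro exI[of _ \<gamma>] conjI allI impI)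
  show "gauge \<gamma>" using T by (auto simp: gauge_def \<gamma>_def)
  fix p assume "p tagged_partial_division_of {a..b} \<and> \<gamma> fine p \<and> (\<forall>(x,K)\<in>p. x \<in> S)"
  then have p: "p tagged_partial_division_of {a..b}" and fine: "\<gamma> fine p"
   and tS: "\<And>x K. (x,K)\<in>p \<Longrightarrow> x \<in> S" by auto
  have fin: "finite p" using p by (rule tagged_partial_division_ofD(1))
  have pK: "\<exists>u v. K = cbox u v \<and> u \<le> v \<and> K \<subseteq> {a..b}" if xK: "(x,K) \<in> p" for x K
  proof -
   obtain u v where K: "K = cbox u v" using tagged_partial_division_ofD(4)[OF p xK] by blast
   moreover have "x \<in> K" "K \<subseteq> {a..b}" using tagged_partial_division_ofD(2,3)[OF p xK] by simp_all
   ultimately show ?thesis by auto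
  qed
  obtain h where h: "bij_betw h {..<card p} p" using ex_bij_betw_nat_finite[OF fin] by (auto simp: atLeast0LessThan)
  define u where "u j = Inf (snd (h j))" for j
  define v where "v j = Sup (snd (h j))" for j
  have hj: "h j \<in> p" if "j < card p" for j using h that by (auto simp: bij_betw_def)
  have uv: "snd (h j) = {u j..v j} \<and> u j \<le> v j \<and> {u j..v j} \<subseteq> {a..b}" if "j < card p" for j
  proof -
   obtain x y where K: "snd (h j) = cbox x y" "x \<le> y" "snd (h j) \<subseteq> {a..b}"
    using pK[of "fst (h j)" "snd (h j)"] hj[OF \<open>j < card p\<close>] by auto
   then show ?thesis unfolding u_def v_def by auto
  qed
  have disj: "disjoint_family_on (\<lambda>j. {u j<..<v j}) {..<card p}"
   unfolding disjoint_family_on_def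
  proof (intro ballI impI)
   fix i j assume ij: "i \<in> {..<card p}" "j \<in> {..<card p}" "i \<noteq> j"
   then have ne: "h i \<noteq> h j" using h by (auto simp: bij_betw_def inj_on_def)
   have "interior (snd (h i)) \<inter> interior (snd (h j)) = {}"
    using tagged_partial_division_ofD(5)[OF p, of "fst (h i)" "snd (h i)" "fst (h j)" "snd (h j)"] hj ij ne by auto
   moreover have "snd (h i) = {u i..v i}" "snd (h j) = {u j..v j}" using uv ij by blast+
   ultimately show "{u i<..<v i} \<inter> {u j<..<v j} = {}" by simp
  qed
  have "(\<Sum>j<card p. v j - u j) = (\<Sum>j<card p. measure lebesgue {u j<..<v j})"
   using uv by (intro sum.cong) auto
  also have "\<dots> = measure lebesgue (\<Union>j<card p. {u j<..<v j})"
   using disj by (intro measure_UNION'[symmetric]) (auto simp: pairwise_def disjoint_family_on_def disjnt_def)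
  also have "\<dots> \<le> measure lebesgue T"
  proof (rule measure_mono_fmeasurable)
   show "(\<Union>j<card p. {u j<..<v j}) \<subseteq> T"
   proof clarify
    fix j x assume "j < card p" "x \<in> {u j<..<v j}"
    then have "x \<in> snd (h j)" using uv[of j] by auto
    moreover have "snd (h j) \<subseteq> T"
    proof -
     have "(fst (h j), snd (h j)) \<in> p" using hj[OF \<open>j < card p\<close>] by simp
     then have "snd (h j) \<subseteq> \<gamma> (fst (h j))" "fst (h j) \<in> S" using fine tS unfolding fine_def by blast+
     then show ?thesis by (simp add: \<gamma>_def)
    qed
    ultimately show "x \<in> T" by blast
   qed
  qed (use Tm in auto)
  finally have len: "(\<Sum>j<card p. v j - u j) < \<delta>" using Tl by linarith
  have "norm (increments f p) \<le> (\<Sum>(x,K)\<in>p. norm (f (Sup K) - f (Inf K)))"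
   using norm_sum[of "\<lambda>(x,K). f (Sup K) - f (Inf K)" p] by (simp add: case_prod_unfold)
  also have "\<dots> = (\<Sum>j<card p. norm (f (v j) - f (u j)))"
   unfolding sum.reindex_bij_betw[OF h, symmetric] by (simp add: case_prod_unfold u_def v_def)
  also have "\<dots> \<le> e"
  proof -
   have "\<forall>j<card p. u j \<le> v j \<and> {u j..v j} \<subseteq> {a..b}" using uv by blast
   from ac'[OF this disj len] show ?thesis by simp
  qed
  finally show "norm (increments f p) \<le> e" .
 qed
qed

lemma nondecreasing_countable:
 fixes f :: "real \<Rightarrow> real"
 assumes ab: "a \<le> b" and S: "countable S" and cont: "continuous_on {a..b} f"
  and deriv: "\<And>x. x \<in> {a<..<b} - S \<Longrightarrow> (f has_vector_derivative g x) (at x)"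
  and g: "\<And>x. x \<in> {a<..<b} - S \<Longrightarrow> 0 \<le> g x"
 shows "f a \<le> f b"
proof -
 define S' where "S' = S \<union> {a,b}"
 define g' where "g' x = (if x \<in> {a<..<b} - S' then g x else 0)" for x
 have S': "countable S'" using S by (auto simp: S'_def)
 have "(g' has_integral (f b - f a)) {a..b}"
  by (rule ftc_countable[OF ab S' cont]) (use deriv in \<open>auto simp: g'_def S'_def\<close>)
 then have "0 \<le> f b - f a"
  by (rule has_integral_nonneg) (use g in \<open>auto simp: g'_def S'_def\<close>)
 then show ?thesis by simp
qed

text \<open>The integrating factor \<open>exp (- integral {a..x} h)\<close> makes its product with
  \<open>P\<close> nonincreasing; continuity of \<open>h\<close> off \<open>S\<close> is what allows
  the integral to be differentiated there.\<close>

lemma gronwall_countable: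
 fixes P h :: "real \<Rightarrow> real"
 assumes ab: "a \<le> b" and S: "countable S" and cont: "continuous_on {a..b} P"
  and deriv: "\<And>x. x \<in> {a<..<b} - S \<Longrightarrow> (P has_vector_derivative P' x) (at x)"
  and le: "\<And>x. x \<in> {a<..<b} - S \<Longrightarrow> P' x \<le> h x * P x"
  and h: "h integrable_on {a..b}" and hc: "\<And>x. x \<in> {a<..<b} - S \<Longrightarrow> isCont h x"
 shows "P b \<le> P a * exp (integral {a..b} h)"
proof -
 define F where "F x = exp (- integral {a..x} h) * P x" for x
 have "- F a \<le> - F b"
 proof (rule nondecreasing_countable[OF ab S, where f = "\<lambda>x. - F x" and g = "\<lambda>x. - (exp (- integral {a..x} h) * (P' x - h x * P x))"])
  show "continuous_on {a..b} (\<lambda>x. - F x)"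
   unfolding F_def by (intro continuous_intros cont indefinite_integral_continuous_1 h)
  fix x assume x: "x \<in> {a<..<b} - S"
  have "((\<lambda>x. integral {a..x} h) has_vector_derivative h x) (at x within {a..b})"
   using integral_has_vector_derivative_continuous_at[OF h, of x "{}"] x hc
   by (auto intro: continuous_at_imp_continuous_at_within)
  then have "((\<lambda>x. integral {a..x} h) has_vector_derivative h x) (at x)"
   using x by (simp add: at_within_interior[of x "{a..b}"])
  then have 1: "((\<lambda>x. integral {a..x} h) has_real_derivative h x) (at x)"
   by (simp add: has_real_derivative_iff_has_vector_derivative)
  have 2: "(P has_real_derivative P' x) (at x)"
   using deriv[OF x] by (simp add: has_real_derivative_iff_has_vector_derivative)
  show "((\<lambda>x. - F x) has_vector_derivative - (exp (- integral {a..x} h) * (P' x - h x * P x))) (at x)"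
   unfolding F_def has_real_derivative_iff_has_vector_derivative[symmetric]
   by (rule derivative_eq_intros 1 2 refl)+ (simp add: algebra_simps)
  show "0 \<le> - (exp (- integral {a..x} h) * (P' x - h x * P x))"
   using le[OF x] by (simp add: mult_nonneg_nonpos)
 qed
 then have "exp (- integral {a..b} h) * P b \<le> P a" by (simp add: F_def)
 then show ?thesis by (simp add: exp_minus field_simps)
qed

section \<open>Solutions of the differential equation\<close>

text \<open>Cut off to the open interval, \<open>f\<close> becomes a function on the line with
  countably many discontinuities, hence Borel measurable; the bound does the rest.\<close>

lemma integrable_continuous_off_countable:
 fixes f :: "real \<Rightarrow> 'a::euclidean_space"
 assumes D: "countable D" and cont: "\<And>x. x \<in> {a<..<b} - D \<Longrightarrow> isCont f x"
  and bound: "\<And>x. x \<in> {a<..<b} \<Longrightarrow> norm (f x) \<le> B"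
 shows "f absolutely_integrable_on {a..b}"
proof -
 define g where "g x = (if x \<in> {a<..<b} then f x else 0)" for x
 have "continuous_on (- (D \<union> {a,b})) g"
  unfolding continuous_on_eq_continuous_within
 proof
  fix x assume x: "x \<in> - (D \<union> {a,b})"
  have "isCont g x"
  proof (cases "x \<in> {a<..<b}")
   case True
   have "eventually (\<lambda>y. g y = f y) (nhds x)"
    using eventually_nhds_in_open[of "{a<..<b}" x] True by (auto simp: g_def elim!: eventually_mono)
   then show ?thesis using cont[of x] x True by (simp add: isCont_cong)
  next
   case False
   have "eventually (\<lambda>y. g y = 0) (nhds x)"
   proof -
    have "open (- {a..b})" "x \<in> - {a..b}" using False x by auto
    then have "eventually (\<lambda>y. y \<in> - {a..b}) (nhds x)" by (rule eventually_nhds_in_open)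
    then show ?thesis by (rule eventually_mono) (auto simp: g_def)
   qed
   then have "isCont g x \<longleftrightarrow> isCont (\<lambda>_. 0::'a) x" by (rule isCont_cong)
   then show ?thesis by simp
  qed
  then show "continuous (at x within - (D \<union> {a,b})) g" by (rule continuous_at_imp_continuous_within)
 qed
 then have gm: "g \<in> borel_measurable borel"
  by (rule borel_measurable_continuous_countable_exceptions[rotated]) (use D in auto)
 have "g absolutely_integrable_on {a..b}"
 proof (rule measurable_bounded_by_integrable_imp_absolutely_integrable)
  show "g \<in> borel_measurable (lebesgue_on {a..b})"
   using gm by (intro measurable_restrict_space1 measurable_completion) simp
  show "(\<lambda>x. \<bar>B\<bar>) integrable_on {a..b}" by (rule integrable_const_ivl)
  show "norm (g x) \<le> \<bar>B\<bar>" if "x \<in> {a..b}" for x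
   using bound[of x] by (auto simp: g_def)
 qed simp
 then show ?thesis
  by (rule absolutely_integrable_spike[of _ _ "{a,b}"]) (auto simp: g_def)
qed

lemma primitive_has_vector_derivative:
 fixes f :: "real \<Rightarrow> 'a::banach"
 assumes "f integrable_on {a..b}" "a < x" "x < b" "isCont f x"
 shows "((\<lambda>x. integral {a..x} f) has_vector_derivative f x) (at x)"
proof -
 have "((\<lambda>x. integral {a..x} f) has_vector_derivative f x) (at x within {a..b})"
  using integral_has_vector_derivative_continuous_at[OF assms(1), of x "{}"] assms
  by (auto intro: continuous_at_imp_continuous_at_within)
 then show ?thesis using assms by (simp add: at_within_interior[of x "{a..b}"])
qed

text \<open>The estimate behind the contraction in the existence proof: integrating against the
  weight \<open>exp (L * t)\<close> gains a factor \<open>1 / L\<close>, independently of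
  \<open>x\<close>.\<close>

lemma norm_integral_le_exp:
 fixes f :: "real \<Rightarrow> 'a::banach"
 assumes x: "x \<ge> 0" and L: "L > 0" and f: "f integrable_on {0..x}"
  and bound: "\<And>t. t \<in> {0..x} \<Longrightarrow> norm (f t) \<le> C * exp (L * t)" and C: "C \<ge> 0"
 shows "norm (integral {0..x} f) \<le> C / L * exp (L * x)"
proof -
 have hi: "((\<lambda>t. C * exp (L * t)) has_integral (C / L * exp (L * x) - C / L * exp (L * 0))) {0..x}"
 proof (rule fundamental_theorem_of_calculus[OF x])
  fix t
  show "((\<lambda>t. C / L * exp (L * t)) has_vector_derivative C * exp (L * t)) (at t within {0..x})"
   unfolding has_real_derivative_iff_has_vector_derivative[symmetric]
   by (rule derivative_eq_intros refl)+ (use L in simp)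
 qed
 have "norm (integral {0..x} f) \<le> integral {0..x} (\<lambda>t. C * exp (L * t))"
  by (rule integral_norm_bound_integral[OF f has_integral_integrable[OF hi] bound])
 also have "\<dots> = C / L * exp (L * x) - C / L" using integral_unique[OF hi] by simp
 also have "\<dots> \<le> C / L * exp (L * x)" using C L by simp
 finally show ?thesis .
qed

section \<open>Absolute continuity, and the half-line with its endpoint\<close>

lemma lipschitz_imp_absolutely_continuous_fun:
 assumes "\<And>x y. x \<in> I \<Longrightarrow> y \<in> I \<Longrightarrow> norm (f y - f x) \<le> B * \<bar>y - x\<bar>"
 shows "absolutely_continuous_fun I f"
 unfolding absolutely_continuous_fun_def
proof (intro allI impI)
 fix e :: real assume e: "e > 0"
 show "\<exists>\<delta>>0. \<forall>n a b. (\<forall>j<n. a j \<le> b j \<and> {a j..b j} \<subseteq> I) \<and>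
    disjoint_family_on (\<lambda>j. {a j<..<b j}) {..<n} \<and> (\<Sum>j<n. b j - a j) < \<delta> \<longrightarrow>
    (\<Sum>j<(n::nat). norm (f (b j) - f (a j))) < e"
 proof (intro exI[of _ "e / (\<bar>B\<bar> + 1)"] conjI allI impI)
  fix n :: nat and a b :: "nat \<Rightarrow> real"
  assume H: "(\<forall>j<n. a j \<le> b j \<and> {a j..b j} \<subseteq> I) \<and>
    disjoint_family_on (\<lambda>j. {a j<..<b j}) {..<n} \<and> (\<Sum>j<n. b j - a j) < e / (\<bar>B\<bar> + 1)"
  have "(\<Sum>j<n. norm (f (b j) - f (a j))) \<le> (\<Sum>j<n. (\<bar>B\<bar> + 1) * (b j - a j))"
  proof (rule sum_mono)
   fix j assume "j \<in> {..<n}"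
   then have ab: "a j \<le> b j" "{a j..b j} \<subseteq> I" using H by auto
   then have "norm (f (b j) - f (a j)) \<le> B * \<bar>b j - a j\<bar>" by (intro assms) auto
   also have "\<dots> \<le> (\<bar>B\<bar> + 1) * (b j - a j)" using ab by (intro mult_mono) auto
   finally show "norm (f (b j) - f (a j)) \<le> (\<bar>B\<bar> + 1) * (b j - a j)" .
  qed
  also have "\<dots> = (\<bar>B\<bar> + 1) * (\<Sum>j<n. b j - a j)" by (simp add: sum_distrib_left)
  also have "\<dots> < e" using H by (simp add: field_simps)
  finally show "(\<Sum>j<n. norm (f (b j) - f (a j))) < e" .
 qed (use e in simp)
qed

lemma absolutely_continuous_fun_imp_continuous_on:
 assumes "absolutely_continuous_fun {a..b} f" shows "continuous_on {a..b} f"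
 unfolding continuous_on_iff
proof (intro ballI allI impI)
 fix x e assume x: "x \<in> {a..b}" and e: "0 < (e::real)"
 obtain \<delta> where \<delta>: "\<delta> > 0" and ac: "\<forall>n u v. (\<forall>j<n. u j \<le> v j \<and> {u j..v j} \<subseteq> {a..b}) \<and>
    disjoint_family_on (\<lambda>j. {u j<..<v j}) {..<n} \<and> (\<Sum>j<n. v j - u j) < \<delta> \<longrightarrow>
    (\<Sum>j<(n::nat). norm (f (v j) - f (u j))) < e"
  using assms[unfolded absolutely_continuous_fun_def, rule_format, OF e] by blast
 have "dist (f y) (f x) < e" if y: "y \<in> {a..b}" "dist y x < \<delta>" for y
 proof -
  have "(\<forall>j<1. (\<lambda>_. min x y) j \<le> (\<lambda>_. max x y) j \<and> {(\<lambda>_. min x y) j..(\<lambda>_. max x y) j} \<subseteq> {a..b}) \<and>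
    disjoint_family_on (\<lambda>j. {(\<lambda>_. min x y) j<..<(\<lambda>_. max x y) j}) {..<1::nat} \<and>
    (\<Sum>j<(1::nat). (\<lambda>_. max x y) j - (\<lambda>_. min x y) j) < \<delta>"
   using x y by (auto simp: disjoint_family_on_def dist_real_def)
  from ac[THEN spec, THEN spec, THEN spec, THEN mp, OF this]
  have "norm (f (max x y) - f (min x y)) < e" by simp
  then show ?thesis by (auto simp: dist_norm max_def min_def norm_minus_commute split: if_splits)
 qed
 then show "\<exists>d>0. \<forall>x'\<in>{a..b}. dist x' x < d \<longrightarrow> dist (f x') (f x) < e" using \<delta> by blast
qed

lemma continuous_on_halfline:
 assumes "\<And>b. b > 0 \<Longrightarrow> continuous_on {0..b} f"
 shows "continuous_on {0::real..} (f :: real \<Rightarrow> 'a::topological_space)"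
 unfolding continuous_on_eq_continuous_within
proof
 fix x :: real assume x: "x \<in> {0..}"
 have "continuous (at x within {0..x+1}) f"
  using assms[of "x+1"] x unfolding continuous_on_eq_continuous_within by auto
 moreover have "at x within {0..x+1} = at x within {0..}"
  by (rule at_within_nhd[of _ "{..<x+1}"]) (use x in auto)
 ultimately show "continuous (at x within {0..}) f" by simp
qed

lemma at_within_halfline_nontrivial: "x \<ge> 0 \<Longrightarrow> at x within {0::real..} \<noteq> bot"
 using connected_imp_perfect[of "{0::real..}" x] by (auto simp: trivial_limit_within)
  (metis atLeast_eq_UNIV_iff insertE insert_absorb2 infinite_Ici finite.emptyI finite.insertI)

text \<open>The equation as a first-order system, with the derivative \<open>v\<close> carried along
  and the second equation holding at every point off the countable set \<open>D\<close>. For a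
  potential continuous off \<open>D\<close> this agrees with the almost everywhere formulation
  \<open>schroedinger_solution\<close>, as shown at the end of the section, and it can be
  differentiated pointwise.\<close>

definition ode_solution where
 "ode_solution q D z u v \<longleftrightarrow> continuous_on {0..} u \<and> continuous_on {0..} v \<and>
   (\<forall>x\<ge>0. (u has_vector_derivative v x) (at x within {0..})) \<and>
   (\<forall>x>0. x \<notin> D \<longrightarrow> (v has_vector_derivative (complex_of_real (q x) - z) * u x) (at x))"

locale bounded_potential =
 fixes q :: "real \<Rightarrow> real" and D :: "real set" and K :: real
 assumes countable_D: "countable D" and q_bound: "\<And>x. \<bar>q x\<bar> \<le> K" and q_cont: "\<And>x. x \<notin> D \<Longrightarrow> isCont q x"
begin

lemma K_nonneg: "K \<ge> 0" using q_bound[of 0] by linarith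

lemma coefficient_bound: "norm (complex_of_real (q x) - z) \<le> K + norm z"
 using norm_triangle_ineq4[of "complex_of_real (q x)" z] q_bound[of x] by simp

lemma integrable_potential_mult:
 fixes f :: "real \<Rightarrow> complex"
 assumes f: "continuous_on {0..} f" and a: "a \<ge> 0"
 shows "(\<lambda>x. (of_real (q x) - z) * f x) absolutely_integrable_on {a..b}"
proof -
 have "compact (f ` {a..b})" using a by (intro compact_continuous_image continuous_on_subset[OF f]) auto
 then obtain B where B: "\<And>x. x \<in> {a..b} \<Longrightarrow> norm (f x) \<le> B"
  by (metis bounded_iff compact_imp_bounded imageI)
 show ?thesis
 proof (rule integrable_continuous_off_countable[OF countable_D])
  fix x assume x: "x \<in> {a<..<b} - D"
  have "isCont f x" using continuous_on_interior[OF f, of x] x a by (simp add: interior_Ici[of 0])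
  moreover have "isCont q x" using q_cont x by simp
  ultimately show "isCont (\<lambda>x. (of_real (q x) - z) * f x) x" by (intro continuous_intros)
 next
  fix x assume x: "x \<in> {a<..<b}"
  show "norm ((of_real (q x) - z) * f x) \<le> (K + norm z) * B"
   unfolding norm_mult using coefficient_bound[of x z] B[of x] K_nonneg x by (intro mult_mono) auto
 qed
qed

lemma isCont_potential_mult:
 assumes f: "continuous_on {0..} f" and x: "x > 0" "x \<notin> D"
 shows "isCont (\<lambda>x. (complex_of_real (q x) - z) * f x) x"
proof -
 have "isCont f x" using continuous_on_interior[OF f, of x] x by (simp add: interior_Ici[of 0])
 moreover have "isCont q x" using q_cont x by simp
 ultimately show ?thesis by (intro continuous_intros)
qed

lemma ode_solutionI_integral:
 assumes u: "continuous_on {0..} u" and v: "continuous_on {0..} v"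
  and ui: "\<And>x. x \<ge> 0 \<Longrightarrow> u x = u 0 + integral {0..x} v"
  and vi: "\<And>x. x \<ge> 0 \<Longrightarrow> v x = v 0 + integral {0..x} (\<lambda>t. (of_real (q t) - z) * u t)"
 shows "ode_solution q D z u v"
 unfolding ode_solution_def
proof (intro conjI u v allI impI)
 fix x :: real assume x: "x \<ge> 0"
 have "((\<lambda>x. integral {0..x} v) has_vector_derivative v x) (at x within {0..x+1})"
  by (rule integral_has_vector_derivative) (use x v in \<open>auto intro: continuous_on_subset\<close>)
 then have "((\<lambda>x. u 0 + integral {0..x} v) has_vector_derivative v x) (at x within {0..x+1})"
  by (auto intro!: derivative_eq_intros)
 then have "(u has_vector_derivative v x) (at x within {0..x+1})"
 proof (rule has_vector_derivative_transform[rotated 2])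
  show "u y = u 0 + integral {0..y} v" if "y \<in> {0..x+1}" for y using that by (intro ui) simp
 qed (use x in simp)
 moreover have "at x within {0..x+1} = at x within {0..}"
  by (rule at_within_nhd[of _ "{..<x+1}"]) (use x in auto)
 ultimately show "(u has_vector_derivative v x) (at x within {0..})" by simp
next
 fix x :: real assume x: "x > 0" "x \<notin> D"
 let ?f = "\<lambda>t. (of_real (q t) - z) * u t"
 have "((\<lambda>x. integral {0..x} ?f) has_vector_derivative ?f x) (at x)"
  by (rule primitive_has_vector_derivative[of _ _ "x+1"])
    (use x isCont_potential_mult[OF u x] integrable_potential_mult[OF u order_refl]
    in \<open>auto intro: set_lebesgue_integral_eq_integral(1)\<close>)
 then have "((\<lambda>x. v 0 + integral {0..x} ?f) has_vector_derivative ?f x) (at x)"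
  by (auto intro!: derivative_eq_intros)
 then show "(v has_vector_derivative ?f x) (at x)"
 proof (rule has_vector_derivative_transform_within_open[of _ _ _ "{0<..}"])
  show "v 0 + integral {0..y} ?f = v y" if "y \<in> {0<..}" for y using that vi[of y] by simp
 qed (use x in auto)
qed

lemma ode_solution_linear:
 assumes "ode_solution q D z u v" "ode_solution q D z f g"
 shows "ode_solution q D z (\<lambda>x. a * u x + b * f x) (\<lambda>x. a * v x + b * g x)"
 unfolding ode_solution_def
proof (intro conjI allI impI)
 show "continuous_on {0..} (\<lambda>x. a * u x + b * f x)" "continuous_on {0..} (\<lambda>x. a * v x + b * g x)"
  using assms unfolding ode_solution_def by (auto intro!: continuous_intros)
 show "((\<lambda>x. a * u x + b * f x) has_vector_derivative a * v x + b * g x) (at x within {0..})" if "x \<ge> 0" for x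
  using assms that unfolding ode_solution_def
  by (intro has_vector_derivative_add has_vector_derivative_mult_right) auto
 fix x assume x: "x > 0" "x \<notin> D"
 have "((\<lambda>x. a * v x + b * g x) has_vector_derivative
   a * ((of_real (q x) - z) * u x) + b * ((of_real (q x) - z) * f x)) (at x)"
  using assms x unfolding ode_solution_def
  by (intro has_vector_derivative_add has_vector_derivative_mult_right) auto
 then show "((\<lambda>x. a * v x + b * g x) has_vector_derivative
   (of_real (q x) - z) * (a * u x + b * f x)) (at x)" by (simp add: algebra_simps)
qed

lemma ode_solution_cont_at:
 assumes "ode_solution q D z u v" shows "continuous_on {0..} u" "continuous_on {0..} v"
 using assms by (auto simp: ode_solution_def)

lemma ode_solution_deriv:
 assumes "ode_solution q D z u v" "x > 0"
 shows "(u has_vector_derivative v x) (at x)"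
  and "x \<notin> D \<Longrightarrow> (v has_vector_derivative (of_real (q x) - z) * u x) (at x)"
proof -
 have "(u has_vector_derivative v x) (at x within {0..})" using assms by (auto simp: ode_solution_def)
 then show "(u has_vector_derivative v x) (at x)"
  using assms(2) by (simp add: at_within_interior[of x "{0..}"] interior_Ici[of 0])
qed (use assms in \<open>auto simp: ode_solution_def\<close>)

text \<open>The potential cancels from the derivative of \<open>u * g - v * f\<close>. Equal
  parameters make the Wronskian constant; different ones compare solutions and give the
  orthogonality of eigenfunctions.\<close>

lemma lagrange_identity:
 assumes s: "ode_solution q D z u v" "ode_solution q D w f g" and ab: "0 \<le> a" "a \<le> b"
 shows "((\<lambda>x. (z - w) * (u x * f x)) has_integral (u b * g b - v b * f b) - (u a * g a - v a * f a)) {a..b}"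
proof (rule ftc_countable[OF ab(2) countable_D, where f = "\<lambda>x. u x * g x - v x * f x"])
 have "{a..b} \<subseteq> {0..}" using ab by auto
 then show "continuous_on {a..b} (\<lambda>x. u x * g x - v x * f x)"
  using ode_solution_cont_at[OF s(1)] ode_solution_cont_at[OF s(2)]
  by (intro continuous_intros) (auto intro: continuous_on_subset)
 fix x assume x: "x \<in> {a<..<b} - D"
 then have x0: "x > 0" "x \<notin> D" using ab by auto
 have "((\<lambda>x. u x * g x - v x * f x) has_vector_derivative
   (u x * ((of_real (q x) - w) * f x) + v x * g x) - (v x * g x + ((of_real (q x) - z) * u x) * f x)) (at x)"
  by (intro has_vector_derivative_diff has_vector_derivative_mult ode_solution_deriv[OF s(1)] ode_solution_deriv[OF s(2)] x0)
 then show "((\<lambda>x. u x * g x - v x * f x) has_vector_derivative (z - w) * (u x * f x)) (at x)"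
  by (simp add: algebra_simps)
qed

text \<open>Gronwall for \<open>|u|^2 + |v|^2\<close>. The rate depends on \<open>z\<close> only
  through \<open>norm z\<close>, which later gives bounds locally uniform in the spectral parameter;
  zero initial data give uniqueness.\<close>

lemma energy_bound:
 assumes s: "ode_solution q D z u v" and ab: "0 \<le> a" "a \<le> b"
 shows "(norm (u b))\<^sup>2 + (norm (v b))\<^sup>2 \<le> ((norm (u a))\<^sup>2 + (norm (v a))\<^sup>2) * exp ((1 + K + norm z) * (b - a))"
proof -
 let ?C = "1 + K + norm z"
 let ?P = "\<lambda>x. u x \<bullet> u x + v x \<bullet> v x"
 have "?P b \<le> ?P a * exp (integral {a..b} (\<lambda>x. ?C))"
 proof (rule gronwall_countable[OF ab(2) countable_D, where
   P' = "\<lambda>x. (u x \<bullet> v x + v x \<bullet> u x) + (v x \<bullet> ((of_real (q x) - z) * u x) + ((of_real (q x) - z) * u x) \<bullet> v x)"])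
  have "{a..b} \<subseteq> {0..}" using ab by auto
  then show "continuous_on {a..b} ?P"
   using ode_solution_cont_at[OF s] by (intro continuous_intros) (auto intro: continuous_on_subset)
  fix x assume x: "x \<in> {a<..<b} - D"
  then have x0: "x > 0" "x \<notin> D" using ab by auto
  have inner: "((\<lambda>x. f x \<bullet> g x) has_vector_derivative (f x \<bullet> g' + f' \<bullet> g x)) (at x)"
   if "(f has_vector_derivative f') (at x)" "(g has_vector_derivative g') (at x)" for f g :: "real \<Rightarrow> complex" and f' g'
   using has_derivative_inner[OF that[unfolded has_vector_derivative_def]]
   unfolding has_vector_derivative_def by (simp add: algebra_simps)
  show "(?P has_vector_derivative ((u x \<bullet> v x + v x \<bullet> u x) +
    (v x \<bullet> ((of_real (q x) - z) * u x) + ((of_real (q x) - z) * u x) \<bullet> v x))) (at x)"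
   by (intro has_vector_derivative_add inner ode_solution_deriv[OF s] x0)
  have 1: "u x \<bullet> v x \<le> norm (u x) * norm (v x)" by (rule norm_cauchy_schwarz)
  have "v x \<bullet> ((of_real (q x) - z) * u x) \<le> norm (v x) * norm ((of_real (q x) - z) * u x)"
   by (rule norm_cauchy_schwarz)
  also have "\<dots> \<le> norm (v x) * ((K + norm z) * norm (u x))"
   unfolding norm_mult using coefficient_bound by (intro mult_left_mono mult_right_mono) auto
  finally have 2: "v x \<bullet> ((of_real (q x) - z) * u x) \<le> (K + norm z) * (norm (u x) * norm (v x))"
   by (simp add: algebra_simps)
  have 3: "2 * (norm (u x) * norm (v x)) \<le> ?P x"
   using sum_squares_bound[of "norm (u x)" "norm (v x)"] by (simp add: power2_norm_eq_inner)
  have "(u x \<bullet> v x + v x \<bullet> u x) + (v x \<bullet> ((of_real (q x) - z) * u x) + ((of_real (q x) - z) * u x) \<bullet> v x)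
    \<le> ?C * (2 * (norm (u x) * norm (v x)))"
   using 1 2 by (simp add: inner_commute algebra_simps)
  also have "\<dots> \<le> ?C * ?P x" using 3 K_nonneg by (intro mult_left_mono) auto
  finally show "(u x \<bullet> v x + v x \<bullet> u x) + (v x \<bullet> ((of_real (q x) - z) * u x) + ((of_real (q x) - z) * u x) \<bullet> v x)
    \<le> ?C * ?P x" .
 qed auto
 then show ?thesis using ab by (simp add: power2_norm_eq_inner mult.commute)
qed

lemma ode_solution_unique:
 assumes s: "ode_solution q D z u v" "ode_solution q D z f g" and 0: "u 0 = f 0" "v 0 = g 0" and x: "x \<ge> 0"
 shows "u x = f x \<and> v x = g x"
 using energy_bound[OF ode_solution_linear[OF s, of 1 "-1"] order_refl x] 0
 by (simp add: sum_power2_le_zero_iff)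

text \<open>Banach's fixed point theorem on the whole half-line at once: the unknown is
  \<open>exp (- L * x)\<close> times the solution, a bounded function, and \<open>L = 2 * M\<close>
  makes the integral operator a contraction with constant 1/2.\<close>

lemma ode_solution_exists: "\<exists>u v. ode_solution q D z u v \<and> u 0 = a \<and> v 0 = b"
proof -
 define M where "M = 1 + K + norm z"
 define L where "L = 2 * M"
 have "M \<ge> 1" using K_nonneg by (simp add: M_def)
 then have M: "M \<ge> 1" "L > 0" by (simp_all add: L_def)
 define F :: "real \<Rightarrow> complex \<times> complex \<Rightarrow> complex \<times> complex"
  where "F t y = (snd y, (of_real (q t) - z) * fst y)" for t y
 have Fle: "norm (F t y) \<le> M * norm y" for t y
 proof -
  have "norm (F t y) \<le> norm (snd y) + norm ((of_real (q t) - z) * fst y)" unfolding F_def by (rule norm_Pair_le)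
  also have "\<dots> \<le> norm y + (K + norm z) * norm y"
  proof -
   have "norm (fst y) \<le> norm y" "norm (snd y) \<le> norm y"
    using norm_fst_le[of "fst y" "snd y"] norm_snd_le[of "snd y" "fst y"] by simp_all
   then show ?thesis
    unfolding norm_mult using coefficient_bound[of t z] K_nonneg by (intro add_mono mult_mono) auto
  qed
  finally show ?thesis by (simp add: M_def algebra_simps)
 qed
 have Fdiff: "F t y - F t y' = F t (y - y')" for t y y' by (simp add: F_def algebra_simps)
 have Fscale: "c *\<^sub>R F t y = F t (c *\<^sub>R y)" for t y c by (simp add: F_def scaleR_conv_of_real)
 have Fint: "(\<lambda>t. F t (f t)) integrable_on {0..x}" if f: "continuous_on {0..} f" for f x
 proof -
  have 1: "(\<lambda>t. (of_real (q t) - z) * fst (f t)) integrable_on {0..x}"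
   using integrable_potential_mult[where f = "\<lambda>t. fst (f t)" and a = 0 and z = z and b = x] f
   by (auto intro!: set_lebesgue_integral_eq_integral(1) continuous_intros)
  have 2: "(\<lambda>t. snd (f t)) integrable_on {0..x}"
   using f by (intro integrable_continuous_real continuous_intros continuous_on_subset[OF f]) auto
  have "(\<lambda>t. (snd (f t), 0) + (0, (of_real (q t) - z) * fst (f t))) integrable_on {0..x}"
  proof (rule integrable_add)
   show "(\<lambda>t. (snd (f t), 0::complex)) integrable_on {0..x}"
    using integrable_linear[OF 2, of "\<lambda>y. (y, 0)"] bounded_linear_Pair[OF bounded_linear_ident bounded_linear_zero] by (simp add: o_def)
   show "(\<lambda>t. (0::complex, (of_real (q t) - z) * fst (f t))) integrable_on {0..x}"
    using integrable_linear[OF 1, of "\<lambda>y. (0, y)"] bounded_linear_Pair[OF bounded_linear_zero bounded_linear_ident] by (simp add: o_def)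
  qed
  then show ?thesis by (simp add: F_def)
 qed
 \<comment> \<open>Bounded continuous functions live on the whole line, so \<open>max 0 x\<close>
   extends the operator by a constant to negative arguments.\<close>
 define T0 where "T0 f x = exp (- (L * max 0 x)) *\<^sub>R ((a, b) + integral {0..max 0 x} (\<lambda>t. F t (exp (L * t) *\<^sub>R f t)))"
  for f :: "real \<Rightarrow> complex \<times> complex" and x
 have ebound: "norm (integral {0..x} (\<lambda>t. F t (exp (L * t) *\<^sub>R f t))) \<le> B / 2 * exp (L * x)"
  if f: "continuous_on UNIV f" "\<And>t. norm (f t) \<le> B" and x: "x \<ge> 0" for f :: "real \<Rightarrow> complex \<times> complex" and B x
 proof -
  have B: "B \<ge> 0" using f(2)[of 0] norm_ge_zero order_trans by blast
  have "norm (integral {0..x} (\<lambda>t. F t (exp (L * t) *\<^sub>R f t))) \<le> (M * B) / L * exp (L * x)"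
  proof (rule norm_integral_le_exp[OF x M(2)])
   show "(\<lambda>t. F t (exp (L * t) *\<^sub>R f t)) integrable_on {0..x}"
    by (intro Fint continuous_intros continuous_on_subset[OF f(1)]) auto
   fix t
   have "norm (F t (exp (L * t) *\<^sub>R f t)) \<le> M * (exp (L * t) * norm (f t))" using Fle[of t "exp (L * t) *\<^sub>R f t"] by simp
   also have "\<dots> \<le> M * (exp (L * t) * B)" using f(2) M by (intro mult_left_mono) auto
   finally show "norm (F t (exp (L * t) *\<^sub>R f t)) \<le> M * B * exp (L * t)" by (simp add: algebra_simps)
  qed (use M B in auto)
  then show ?thesis using M by (simp add: L_def)
 qed
 have Tb: "T0 f \<in> bcontfun" if f: "f \<in> bcontfun" for f
 proof -
  have fc: "continuous_on UNIV f" using f by (simp add: bcontfun_def)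
  obtain B where B: "\<And>t. norm (f t) \<le> B" using f unfolding bcontfun_def bounded_iff by auto
  have ic: "continuous_on {0..} (\<lambda>x. integral {0..x} (\<lambda>t. F t (exp (L * t) *\<^sub>R f t)))"
   by (intro continuous_on_halfline indefinite_integral_continuous_1 Fint continuous_intros continuous_on_subset[OF fc]) auto
  have "continuous_on UNIV (\<lambda>x. integral {0..max 0 x} (\<lambda>t. F t (exp (L * t) *\<^sub>R f t)))"
  proof (rule continuous_on_compose2[OF ic])
   show "continuous_on UNIV (\<lambda>x::real. max 0 x)" by (intro continuous_on_max continuous_on_const continuous_on_id)
  qed auto
  then have "continuous_on UNIV (T0 f)" unfolding T0_def by (intro continuous_intros)
  moreover have "norm (T0 f x) \<le> norm (a,b) + B / 2" for x
  proof -
   have "norm (T0 f x) \<le> exp (- (L * max 0 x)) * (norm (a,b) + B / 2 * exp (L * max 0 x))"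
    unfolding T0_def norm_scaleR using ebound[OF fc B, of "max 0 x"]
    by (auto intro!: mult_left_mono norm_triangle_le add_left_mono simp del: norm_Pair)
   also have "\<dots> = exp (- (L * max 0 x)) * norm (a,b) + B / 2" by (simp add: algebra_simps exp_minus)
   also have "\<dots> \<le> norm (a,b) + B / 2" using M by (simp add: mult_left_le_one_le)
   finally show ?thesis .
  qed
  ultimately show ?thesis unfolding bcontfun_def bounded_iff by auto
 qed
 define T where "T f = Bcontfun (T0 (apply_bcontfun f))" for f
 have Tapply: "apply_bcontfun (T f) = T0 (apply_bcontfun f)" for f
  unfolding T_def by (rule Bcontfun_inverse) (rule Tb[OF apply_bcontfun])
 have contr: "dist (T f) (T g) \<le> 1/2 * dist f g" for f g
 proof (rule dist_bound)
  fix x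
  define h where "h t = apply_bcontfun f t - apply_bcontfun g t" for t
  have hc: "continuous_on UNIV h" unfolding h_def by (intro continuous_intros) auto
  have hb: "norm (h t) \<le> dist f g" for t using dist_bounded[of f t g] by (simp add: h_def dist_norm)
  have intf: "(\<lambda>t. F t (exp (L * t) *\<^sub>R apply_bcontfun f t)) integrable_on {0..y}" for f y
   by (intro Fint continuous_intros) auto
  have "T0 (apply_bcontfun f) x - T0 (apply_bcontfun g) x
    = exp (- (L * max 0 x)) *\<^sub>R integral {0..max 0 x} (\<lambda>t. F t (exp (L * t) *\<^sub>R h t))"
  proof -
   have "integral {0..y} (\<lambda>t. F t (exp (L * t) *\<^sub>R apply_bcontfun f t)) - integral {0..y} (\<lambda>t. F t (exp (L * t) *\<^sub>R apply_bcontfun g t))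
     = integral {0..y} (\<lambda>t. F t (exp (L * t) *\<^sub>R h t))" for y
    unfolding integral_diff[OF intf intf, symmetric]
    by (rule integral_cong) (simp add: Fdiff h_def scaleR_diff_right)
   then show ?thesis unfolding T0_def scaleR_diff_right[symmetric] by simp
  qed
  then have "dist (T f x) (T g x) \<le> exp (- (L * max 0 x)) * (dist f g / 2 * exp (L * max 0 x))"
   unfolding Tapply dist_norm[where 'a = "complex \<times> complex"] using ebound[OF hc hb, of "max 0 x"] by (auto intro!: mult_left_mono)
  then show "dist (T f x) (T g x) \<le> 1/2 * dist f g" by (simp add: exp_minus field_simps)
 qed
 have "\<exists>!f. T f = f" by (rule banach_fix_type[of "1/2"]) (use contr in auto)
 then obtain f where f: "T f = f" by blast
 define y where "y x = exp (L * x) *\<^sub>R apply_bcontfun f x" for x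
 have yc: "continuous_on UNIV y" unfolding y_def by (intro continuous_intros) auto
 have yi: "y x = (a, b) + integral {0..x} (\<lambda>t. F t (y t))" if "x \<ge> 0" for x
 proof -
  have "apply_bcontfun f x = T0 (apply_bcontfun f) x" using Tapply[of f] f by simp
  then show ?thesis using that unfolding y_def T0_def by (simp add: exp_minus max_def)
 qed
 have hasint: "((\<lambda>t. F t (y t)) has_integral y x - (a, b)) {0..x}" if "x \<ge> 0" for x
  using Fint[of y x] yi[OF that] yc by (auto simp: has_integral_iff intro: continuous_on_subset)
 have c: "continuous_on {0..} (\<lambda>x. fst (y x))" "continuous_on {0..} (\<lambda>x. snd (y x))"
  by (intro continuous_intros continuous_on_subset[OF yc]; simp)+
 have y0: "y 0 = (a, b)" using yi[of 0] by simp
 have "ode_solution q D z (\<lambda>x. fst (y x)) (\<lambda>x. snd (y x))"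
 proof (rule ode_solutionI_integral[OF c])
  fix x :: real assume x: "x \<ge> 0"
  show "fst (y x) = fst (y 0) + integral {0..x} (\<lambda>x. snd (y x))"
   using integral_unique[OF has_integral_linear[OF hasint[OF x] bounded_linear_fst]] y0 by (simp add: o_def F_def)
  show "snd (y x) = snd (y 0) + integral {0..x} (\<lambda>t. (of_real (q t) - z) * fst (y t))"
   using integral_unique[OF has_integral_linear[OF hasint[OF x] bounded_linear_snd]] y0 by (simp add: o_def F_def)
 qed
 then show ?thesis using y0 by (intro exI[of _ "\<lambda>x. fst (y x)"] exI[of _ "\<lambda>x. snd (y x)"]) simp
qed

text \<open>On compact intervals both derivatives are bounded, so \<open>u\<close> and
  \<open>v\<close> are Lipschitz and in particular absolutely continuous there; the exceptional set
  \<open>D\<close> is null.\<close>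

lemma ode_solution_imp_schroedinger:
 assumes s: "ode_solution q D z u v" and V: "\<And>x. x > 0 \<Longrightarrow> q x = V x"
 shows "schroedinger_solution V z u" and "\<And>x. x \<ge> 0 \<Longrightarrow> halfline_deriv u x = v x"
proof -
 have du: "(u has_vector_derivative v x) (at x within {0..})" if "x \<ge> 0" for x using s that by (auto simp: ode_solution_def)
 show hd: "halfline_deriv u x = v x" if "x \<ge> 0" for x
  unfolding halfline_deriv_def by (rule vector_derivative_within[OF at_within_halfline_nontrivial[OF that] du[OF that]])
 have lip: "absolutely_continuous_fun {0..b} f"
  if f: "continuous_on {0..} f" and g: "\<And>x. x > 0 \<Longrightarrow> x \<notin> D \<Longrightarrow> (f has_vector_derivative g x) (at x)"
   and B: "\<And>x. x \<in> {0..b} \<Longrightarrow> norm (g x) \<le> B" for f g :: "real \<Rightarrow> complex" and b B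
 proof (rule lipschitz_imp_absolutely_continuous_fun)
  have le: "norm (f y - f x) \<le> \<bar>B\<bar> * (y - x)" if "0 \<le> x" "x \<le> y" "y \<le> b" for x y
  proof -
   have "(g has_integral f y - f x) {x..y}"
    by (rule ftc_countable[OF that(2) countable_D]) (use that f g in \<open>auto intro: continuous_on_subset\<close>)
   moreover have "norm (g t) \<le> \<bar>B\<bar>" if "t \<in> {x..y}" for t
    using B[of t] that \<open>0 \<le> x\<close> \<open>y \<le> b\<close> by force
   ultimately have "norm (f y - f x) \<le> \<bar>B\<bar> * measure lborel {x..y}"
    using has_integral_bound_real[of "\<bar>B\<bar>" "{}" g "f y - f x" x y] by simp
   then show ?thesis using that by simp
  qed
  show "norm (f y - f x) \<le> \<bar>B\<bar> * \<bar>y - x\<bar>" if "x \<in> {0..b}" "y \<in> {0..b}" for x y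
   using le[of x y] le[of y x] that by (cases "x \<le> y") (auto simp: norm_minus_commute)
 qed
 have bnd: "\<exists>B. \<forall>x\<in>{0..b}. norm (f x) \<le> B" if "continuous_on {0..} f" for f :: "real \<Rightarrow> complex" and b
 proof -
  have "compact (f ` {0..b})" by (intro compact_continuous_image continuous_on_subset[OF that]) auto
  then show ?thesis by (metis bounded_iff compact_imp_bounded imageI)
 qed
 have ACu: "AC_loc u" unfolding AC_loc_def
 proof (intro allI impI)
  fix b :: real
  obtain B where "\<forall>x\<in>{0..b}. norm (v x) \<le> B" using bnd ode_solution_cont_at[OF s] by blast
  then show "absolutely_continuous_fun {0..b} u"
   using lip[OF ode_solution_cont_at(1)[OF s] ode_solution_deriv(1)[OF s]] by blast
 qed
 have ACv: "absolutely_continuous_fun {0..b} v" for b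
 proof -
  obtain B where B: "\<forall>x\<in>{0..b}. norm (u x) \<le> B" using bnd ode_solution_cont_at[OF s] by blast
  show ?thesis
  proof (rule lip[OF ode_solution_cont_at(2)[OF s] ode_solution_deriv(2)[OF s]])
   fix x assume "x \<in> {0..b}"
   then show "norm ((of_real (q x) - z) * u x) \<le> (K + norm z) * B"
    unfolding norm_mult using coefficient_bound[of x z] B K_nonneg by (intro mult_mono) auto
  qed
 qed
 have "absolutely_continuous_fun {0..b} (halfline_deriv u)" if "b > 0" for b
  unfolding absolutely_continuous_fun_def
 proof (intro allI impI)
  fix e :: real assume "e > 0"
  then obtain \<delta> where \<delta>: "\<delta> > 0" and ac: "\<forall>n a c. (\<forall>j<n. a j \<le> c j \<and> {a j..c j} \<subseteq> {0..b}) \<and>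
    disjoint_family_on (\<lambda>j. {a j<..<c j}) {..<n} \<and> (\<Sum>j<n. c j - a j) < \<delta> \<longrightarrow>
    (\<Sum>j<(n::nat). norm (v (c j) - v (a j))) < e"
   using ACv[of b, unfolded absolutely_continuous_fun_def] by blast
  show "\<exists>\<delta>>0. \<forall>n a c. (\<forall>j<n. a j \<le> c j \<and> {a j..c j} \<subseteq> {0..b}) \<and>
    disjoint_family_on (\<lambda>j. {a j<..<c j}) {..<n} \<and> (\<Sum>j<n. c j - a j) < \<delta> \<longrightarrow>
    (\<Sum>j<(n::nat). norm (halfline_deriv u (c j) - halfline_deriv u (a j))) < e"
  proof (intro exI[of _ \<delta>] conjI \<delta> allI impI)
   fix n :: nat and a c :: "nat \<Rightarrow> real"
   assume H: "(\<forall>j<n. a j \<le> c j \<and> {a j..c j} \<subseteq> {0..b}) \<and>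
    disjoint_family_on (\<lambda>j. {a j<..<c j}) {..<n} \<and> (\<Sum>j<n. c j - a j) < \<delta>"
   have "(\<Sum>j<n. norm (halfline_deriv u (c j) - halfline_deriv u (a j))) = (\<Sum>j<n. norm (v (c j) - v (a j)))"
   proof (rule sum.cong)
    fix j assume "j \<in> {..<n}"
    then have "a j \<le> c j" "{a j..c j} \<subseteq> {0..b}" using H by auto
    then show "norm (halfline_deriv u (c j) - halfline_deriv u (a j)) = norm (v (c j) - v (a j))" by (simp add: hd)
   qed simp
   also have "\<dots> < e" using ac H by blast
   finally show "(\<Sum>j<n. norm (halfline_deriv u (c j) - halfline_deriv u (a j))) < e" .
  qed
 qed
 then have ACh: "AC_loc (halfline_deriv u)" by (simp add: AC_loc_def)
 have AE: "AE x in lborel. x > 0 \<longrightarrow> (\<exists>u2. (halfline_deriv u has_vector_derivative u2) (at x) \<and>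
       - u2 + complex_of_real (V x) * u x = z * u x)"
 proof (rule AE_I'[OF countable_imp_null_set_lborel[OF countable_D]], clarify, rule ccontr)
  fix x assume x: "x > 0" "x \<notin> D" and no: "\<nexists>u2. (halfline_deriv u has_vector_derivative u2) (at x) \<and>
       - u2 + complex_of_real (V x) * u x = z * u x"
  have "(halfline_deriv u has_vector_derivative (of_real (q x) - z) * u x) (at x)"
   by (rule has_vector_derivative_transform_within_open[OF ode_solution_deriv(2)[OF s x], of "{0<..}"]) (use x hd in auto)
  then show False using no V x by (auto simp: algebra_simps)
 qed
 show "schroedinger_solution V z u"
  unfolding schroedinger_solution_def using ACu ACh AE du differentiableI_vector by blast
qed

text \<open>Absolute continuity turns the equation, known almost everywhere, into an integral
  equation. Differentiating that one recovers the equation wherever \<open>q\<close> is continuous,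
  so the unspecified null set shrinks to \<open>D\<close>.\<close>

lemma schroedinger_imp_ode_solution:
 assumes s: "schroedinger_solution V z u" and V: "\<And>x. x > 0 \<Longrightarrow> q x = V x"
 shows "ode_solution q D z u (halfline_deriv u)"
proof -
 let ?v = "halfline_deriv u"
 let ?g = "\<lambda>t. (of_real (q t) - z) * u t"
 have AC: "absolutely_continuous_fun {0..b} u" "absolutely_continuous_fun {0..b} ?v" if "b > 0" for b
  using s that by (auto simp: schroedinger_solution_def AC_loc_def)
 have uc: "continuous_on {0..} u" "continuous_on {0..} ?v"
  by (intro continuous_on_halfline absolutely_continuous_fun_imp_continuous_on AC; assumption)+
 have du: "(u has_vector_derivative ?v x) (at x within {0..})" if "x \<ge> 0" for x
  using s that unfolding halfline_deriv_def schroedinger_solution_def by (simp add: vector_derivative_works)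
 have "AE x in lborel. x > 0 \<longrightarrow> (?v has_vector_derivative ?g x) (at x)"
 proof -
  have "AE x in lborel. x > 0 \<longrightarrow> (\<exists>u2. (?v has_vector_derivative u2) (at x) \<and>
       - u2 + complex_of_real (V x) * u x = z * u x)" using s by (simp add: schroedinger_solution_def)
  then show ?thesis
  proof (rule AE_mp, intro AE_I2 impI)
   fix x assume "x > 0 \<longrightarrow> (\<exists>u2. (?v has_vector_derivative u2) (at x) \<and>
       - u2 + complex_of_real (V x) * u x = z * u x)" "x > 0"
   then obtain u2 where "(?v has_vector_derivative u2) (at x)" "- u2 + complex_of_real (V x) * u x = z * u x" by blast
   moreover have "u2 = ?g x" using calculation(2) V[OF \<open>x > 0\<close>] by (simp add: algebra_simps)
   ultimately show "(?v has_vector_derivative ?g x) (at x)" by simp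
  qed
 qed
 then obtain N where N: "N \<in> null_sets lborel" "{x. \<not> (x > 0 \<longrightarrow> (?v has_vector_derivative ?g x) (at x))} \<subseteq> N"
  by (auto elim!: AE_E simp: null_sets_def)
 have Nn: "negligible (N \<union> {0})"
  using N by (intro negligible_Un) (auto simp: negligible_iff_null_sets null_sets_completionI)
 have hi: "(?g has_integral (?v x - ?v 0)) {0..x}" if "x \<ge> 0" for x
 proof (cases "x = 0")
  case False
  then have "x > 0" using that by simp
  then show ?thesis
  proof (intro ftc_absolutely_continuous[OF that Nn AC(2)])
   fix t assume "t \<in> {0..x} - (N \<union> {0})"
   then have "t > 0" "t \<notin> N" by auto
   then have "(?v has_vector_derivative ?g t) (at t)" using N(2) by blast
   then show "(?v has_vector_derivative ?g t) (at t within {0..x})" by (rule has_vector_derivative_at_within)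
  qed
 qed (auto simp: has_integral_refl)
 show ?thesis
 proof (rule ode_solutionI_integral[OF uc])
  fix x :: real assume x: "x \<ge> 0"
  have "(?v has_integral (u x - u 0)) {0..x}"
   by (rule fundamental_theorem_of_calculus[OF x]) (auto intro: has_vector_derivative_within_subset[OF du])
  then show "u x = u 0 + integral {0..x} ?v" by (simp add: integral_unique)
  show "?v x = ?v 0 + integral {0..x} ?g" using hi[OF x] by (simp add: integral_unique)
 qed
qed

end

section \<open>Approximate solutions of the Riccati equation\<close>

lemma has_real_derivative_inner_self:
 fixes f :: "real \<Rightarrow> complex"
 assumes "(f has_vector_derivative f') (at x)"
 shows "((\<lambda>x. f x \<bullet> f x) has_real_derivative 2 * (f x \<bullet> f')) (at x)"
 using has_derivative_inner[OF assms[unfolded has_vector_derivative_def] assms[unfolded has_vector_derivative_def]]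
 unfolding has_real_derivative_iff_has_vector_derivative has_vector_derivative_def by (simp add: algebra_simps inner_commute)

lemma inner_mult_self: "x \<bullet> (w * x) = Re w * (x \<bullet> x)" for x w :: complex
 by (simp add: inner_complex_def algebra_simps)

text \<open>If \<open>w\<close> solves the Riccati equation up to \<open>\<epsilon>\<close>, then \<open>X = u' - w u\<close> and \<open>Y = u' - cnj w u\<close> satisfy
 \<open>X' = - w X - \<epsilon> u\<close> and \<open>Y' = - cnj w Y - cnj \<epsilon> u\<close>, while \<open>(Im w)' = - 2 Re w Im w + Im \<epsilon>\<close>; so the
 oscillating factor \<open>Re w\<close> cancels from the derivative of \<open>P = (|X|^2 + |Y|^2) / Im w\<close>.\<close>
lemma riccati_derivative_bound:
 fixes u v w w' \<epsilon> :: complex and q \<kappa> :: real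
 assumes \<epsilon>: "\<epsilon> = w' + w\<^sup>2 - of_real q + of_real (\<kappa>\<^sup>2)" and y: "Im w \<ge> \<kappa> / 2" and \<kappa>: "\<kappa> > 0"
 defines "X \<equiv> v - w * u" and "Y \<equiv> v - cnj w * u"
 defines "X' \<equiv> (of_real q - of_real (\<kappa>\<^sup>2)) * u - (w * v + w' * u)"
  and "Y' \<equiv> (of_real q - of_real (\<kappa>\<^sup>2)) * u - (cnj w * v + cnj w' * u)"
 shows "((2 * (X \<bullet> X') + 2 * (Y \<bullet> Y')) * Im w - (X \<bullet> X + Y \<bullet> Y) * Im w') / (Im w * Im w)
   \<le> 6 / \<kappa> * norm \<epsilon> * ((X \<bullet> X + Y \<bullet> Y) / Im w)"
proof -
 define N where "N = X \<bullet> X + Y \<bullet> Y"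
 define E where "E = X \<bullet> (\<epsilon> * u) + Y \<bullet> (cnj \<epsilon> * u)"
 have y0: "Im w > 0" using y \<kappa> by linarith
 have X': "X' = - (w * X) - \<epsilon> * u" unfolding X'_def X_def \<epsilon> by (simp add: algebra_simps power2_eq_square)
 have Y': "Y' = - (cnj w * Y) - cnj \<epsilon> * u" unfolding Y'_def Y_def \<epsilon> by (simp add: algebra_simps power2_eq_square)
 have N': "2 * (X \<bullet> X') + 2 * (Y \<bullet> Y') = - 2 * Re w * N - 2 * E"
  unfolding X' Y' inner_diff_right inner_minus_right inner_mult_self N_def E_def by (simp add: algebra_simps)
 have w': "Im w' = Im \<epsilon> - 2 * Re w * Im w" unfolding \<epsilon> by (simp add: power2_eq_square)
 have N0: "N \<ge> 0" by (simp add: N_def)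
 \<comment> \<open>Here \<open>u\<close> is recovered from \<open>X\<close> and \<open>Y\<close>, at
   the price of a division by \<open>Im w\<close>.\<close>
 have "Y - X = of_real (2 * Im w) * (\<i> * u)"
  unfolding X_def Y_def by (simp add: complex_eq_iff algebra_simps)
 then have "norm (Y - X) = 2 * Im w * norm u" using y0 by (simp add: norm_mult)
 then have u: "2 * Im w * norm u \<le> norm X + norm Y" using norm_triangle_ineq4[of Y X] by linarith
 have "\<bar>E\<bar> \<le> \<bar>X \<bullet> (\<epsilon> * u)\<bar> + \<bar>Y \<bullet> (cnj \<epsilon> * u)\<bar>" unfolding E_def by (rule abs_triangle_ineq)
 also have "\<dots> \<le> norm X * norm (\<epsilon> * u) + norm Y * norm (cnj \<epsilon> * u)"
  by (intro add_mono Cauchy_Schwarz_ineq2)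
 also have "\<dots> = norm \<epsilon> * (norm u * (norm X + norm Y))" by (simp add: norm_mult algebra_simps)
 finally have "2 * Im w * \<bar>E\<bar> \<le> 2 * Im w * (norm \<epsilon> * (norm u * (norm X + norm Y)))" using y0 by simp
 also have "\<dots> = norm \<epsilon> * ((2 * Im w * norm u) * (norm X + norm Y))" by (simp add: algebra_simps)
 also have "\<dots> \<le> norm \<epsilon> * ((norm X + norm Y) * (norm X + norm Y))"
  using u by (intro mult_left_mono mult_right_mono) auto
 also have "\<dots> \<le> norm \<epsilon> * (2 * N)"
 proof (intro mult_left_mono)
  have "2 * (norm X * norm Y) \<le> (norm X)\<^sup>2 + (norm Y)\<^sup>2" using sum_squares_bound[of "norm X" "norm Y"] by simp
  then show "(norm X + norm Y) * (norm X + norm Y) \<le> 2 * N"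
   unfolding N_def power2_norm_eq_inner[symmetric] by (simp add: algebra_simps power2_eq_square)
 qed simp
 finally have E: "2 * Im w * \<bar>E\<bar> \<le> 2 * (norm \<epsilon> * N)" by simp
 have Ie: "- (N * Im \<epsilon>) \<le> norm \<epsilon> * N"
 proof -
  have "N * (- Im \<epsilon>) \<le> N * norm \<epsilon>" using abs_Im_le_cmod[of \<epsilon>] N0 by (intro mult_left_mono) auto
  then show ?thesis by (simp add: mult.commute)
 qed
 have "(2 * (X \<bullet> X') + 2 * (Y \<bullet> Y')) * Im w - N * Im w' = - 2 * Im w * E - N * Im \<epsilon>"
  unfolding N' w' by (simp add: algebra_simps)
 also have "\<dots> \<le> 3 * (norm \<epsilon> * N)"
 proof -
  have "(2 * Im w) * (- E) \<le> (2 * Im w) * \<bar>E\<bar>" using y0 by (intro mult_left_mono) auto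
  then have "- 2 * Im w * E \<le> 2 * Im w * \<bar>E\<bar>" by simp
  then show ?thesis using E Ie by linarith
 qed
 finally have "((2 * (X \<bullet> X') + 2 * (Y \<bullet> Y')) * Im w - N * Im w') / (Im w * Im w) \<le> 3 * (norm \<epsilon> * N) / (Im w * Im w)"
  using y0 by (intro divide_right_mono) auto
 also have "\<dots> = (3 / Im w) * norm \<epsilon> * (N / Im w)" by simp
 also have "\<dots> \<le> (6 / \<kappa>) * norm \<epsilon> * (N / Im w)"
 proof (intro mult_right_mono)
  show "3 / Im w \<le> 6 / \<kappa>" using y \<kappa> y0 by (simp add: divide_simps)
 qed (use N0 y0 in auto)
 finally show ?thesis unfolding N_def .
qed

context bounded_potential
begin

text \<open>Gronwall with the coefficient \<open>6 / \<kappa> * norm \<epsilon>\<close>, whose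
  integrals are bounded, controls \<open>P\<close>; then \<open>Im w \<ge> \<kappa> / 2\<close>
  returns \<open>u\<close> and \<open>v\<close> from \<open>X\<close> and \<open>Y\<close>. Since
  \<open>w\<close> is controlled only from \<open>x0\<close> on, the compact interval before it is
  covered by continuity.\<close>

lemma riccati_bounded:
 fixes w w' :: "real \<Rightarrow> complex" and \<kappa> :: real
 defines "\<epsilon> \<equiv> \<lambda>x. w' x + (w x)\<^sup>2 - of_real (q x) + of_real (\<kappa>\<^sup>2)"
 assumes \<kappa>: "\<kappa> > 0" and x0: "x0 \<ge> 0" and S: "countable S" "D \<subseteq> S"
  and wc: "continuous_on {0..} w" and wd: "\<And>x. x > x0 \<Longrightarrow> x \<notin> S \<Longrightarrow> (w has_vector_derivative w' x) (at x)"
  and \<epsilon>c: "\<And>x. x > x0 \<Longrightarrow> x \<notin> S \<Longrightarrow> isCont (\<lambda>x. norm (\<epsilon> x)) x"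
  and Imw: "\<And>x. x \<ge> x0 \<Longrightarrow> Im (w x) \<ge> \<kappa> / 2" and wb: "\<And>x. x \<ge> x0 \<Longrightarrow> norm (w x) \<le> M"
  and \<epsilon>i: "\<And>b. b \<ge> x0 \<Longrightarrow> (\<lambda>x. norm (\<epsilon> x)) integrable_on {x0..b}"
  and \<epsilon>b: "\<And>b. b \<ge> x0 \<Longrightarrow> integral {x0..b} (\<lambda>x. norm (\<epsilon> x)) \<le> B"
  and sol: "ode_solution q D (of_real (\<kappa>\<^sup>2)) u v"
 shows "\<exists>C. \<forall>x\<ge>0. norm (u x) \<le> C \<and> norm (v x) \<le> C"
proof -
 define X where "X x = v x - w x * u x" for x
 define Y where "Y x = v x - cnj (w x) * u x" for x
 define P where "P x = (X x \<bullet> X x + Y x \<bullet> Y x) / Im (w x)" for x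
 define X' where "X' x = (of_real (q x) - of_real (\<kappa>\<^sup>2)) * u x - (w x * v x + w' x * u x)" for x
 define Y' where "Y' x = (of_real (q x) - of_real (\<kappa>\<^sup>2)) * u x - (cnj (w x) * v x + cnj (w' x) * u x)" for x
 define P' where "P' x = ((2 * (X x \<bullet> X' x) + 2 * (Y x \<bullet> Y' x)) * Im (w x) - (X x \<bullet> X x + Y x \<bullet> Y x) * Im (w' x)) / (Im (w x) * Im (w x))" for x
 have y0: "Im (w x) > 0" if "x \<ge> x0" for x using Imw[OF that] \<kappa> by linarith
 have uc: "continuous_on {0..} u" "continuous_on {0..} v" by (rule ode_solution_cont_at[OF sol])+
 have Pb: "P b \<le> P x0 * exp (6 / \<kappa> * B)" if b: "b \<ge> x0" for b
 proof -
  have sub: "{x0..b} \<subseteq> {0..}" using x0 by auto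
  have "P b \<le> P x0 * exp (integral {x0..b} (\<lambda>x. 6 / \<kappa> * norm (\<epsilon> x)))"
  proof (rule gronwall_countable[OF b S(1), where P' = P'])
   show "continuous_on {x0..b} P" unfolding P_def X_def Y_def
    using y0 by (intro continuous_intros continuous_on_subset[OF wc sub] continuous_on_subset[OF uc(1) sub] continuous_on_subset[OF uc(2) sub])
     (force simp: less_imp_neq[symmetric])+
   fix x assume x: "x \<in> {x0<..<b} - S"
   then have xx: "x > x0" "x > 0" "x \<notin> S" "x \<notin> D" "x \<ge> x0" using x0 S by auto
   have du: "(u has_vector_derivative v x) (at x)" by (rule ode_solution_deriv(1)[OF sol xx(2)])
   have dv: "(v has_vector_derivative (of_real (q x) - of_real (\<kappa>\<^sup>2)) * u x) (at x)" by (rule ode_solution_deriv(2)[OF sol xx(2,4)])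
   have dw: "(w has_vector_derivative w' x) (at x)" by (rule wd[OF xx(1,3)])
   have dcw: "((\<lambda>x. cnj (w x)) has_vector_derivative cnj (w' x)) (at x)"
    by (rule bounded_linear.has_vector_derivative[OF bounded_linear_cnj dw])
   have dy: "((\<lambda>x. Im (w x)) has_real_derivative Im (w' x)) (at x)"
    unfolding has_real_derivative_iff_has_vector_derivative
    by (rule bounded_linear.has_vector_derivative[OF bounded_linear_Im dw])
   have dX: "(X has_vector_derivative X' x) (at x)" unfolding X_def X'_def
    by (intro has_vector_derivative_diff dv has_vector_derivative_mult dw du)
   have dY: "(Y has_vector_derivative Y' x) (at x)" unfolding Y_def Y'_def
    by (intro has_vector_derivative_diff dv has_vector_derivative_mult dcw du)
   show "(P has_vector_derivative P' x) (at x)"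
    unfolding P_def P'_def has_real_derivative_iff_has_vector_derivative[symmetric]
    by (intro DERIV_divide DERIV_add has_real_derivative_inner_self dX dY dy) (use y0[OF xx(5)] in simp)
   show "P' x \<le> 6 / \<kappa> * norm (\<epsilon> x) * P x"
    unfolding P'_def P_def X'_def Y'_def X_def Y_def
    by (rule riccati_derivative_bound[OF _ Imw[OF xx(5)] \<kappa>]) (simp add: \<epsilon>_def)
   show "isCont (\<lambda>x. 6 / \<kappa> * norm (\<epsilon> x)) x" by (intro continuous_intros \<epsilon>c xx)
  next
   show "(\<lambda>x. 6 / \<kappa> * norm (\<epsilon> x)) integrable_on {x0..b}" using integrable_cmul[OF \<epsilon>i[OF b], of "6 / \<kappa>"] by simp
  qed
  also have "\<dots> \<le> P x0 * exp (6 / \<kappa> * B)"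
  proof -
   have "6 / \<kappa> * integral {x0..b} (\<lambda>x. norm (\<epsilon> x)) \<le> 6 / \<kappa> * B" using \<epsilon>b[OF b] \<kappa> by (intro mult_left_mono) auto
   moreover have "P x0 \<ge> 0" using y0[of x0] by (simp add: P_def)
   ultimately show ?thesis by (intro mult_left_mono) auto
  qed
  finally show ?thesis .
 qed
 define C0 where "C0 = sqrt (P x0 * exp (6 / \<kappa> * B) * M)"
 have XY: "norm (X x) \<le> C0 \<and> norm (Y x) \<le> C0" if x: "x \<ge> x0" for x
 proof -
  have "X x \<bullet> X x + Y x \<bullet> Y x = P x * Im (w x)" using y0[OF x] by (simp add: P_def)
  also have "\<dots> \<le> P x0 * exp (6 / \<kappa> * B) * M"
  proof (rule mult_mono[OF Pb[OF x]])
   show "Im (w x) \<le> M" using abs_Im_le_cmod[of "w x"] wb[OF x] by linarith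
  qed (use y0[of x0] y0[OF x] in \<open>auto simp: P_def\<close>)
  finally have "(norm (X x))\<^sup>2 + (norm (Y x))\<^sup>2 \<le> P x0 * exp (6 / \<kappa> * B) * M" by (simp add: power2_norm_eq_inner)
  then have "(norm (X x))\<^sup>2 \<le> P x0 * exp (6 / \<kappa> * B) * M" "(norm (Y x))\<^sup>2 \<le> P x0 * exp (6 / \<kappa> * B) * M"
   using zero_le_power2[of "norm (X x)"] zero_le_power2[of "norm (Y x)"] by linarith+
  then show ?thesis unfolding C0_def by (auto intro: real_le_rsqrt)
 qed
 have M0: "M \<ge> 0" using wb[of x0] norm_ge_zero order_trans by blast
 have C00: "C0 \<ge> 0" using XY[of x0] norm_ge_zero order_trans by blast
 have ub: "norm (u x) \<le> 2 * C0 / \<kappa>" if x: "x \<ge> x0" for x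
 proof -
  have "Y x - X x = of_real (2 * Im (w x)) * (\<i> * u x)"
   unfolding X_def Y_def by (simp add: complex_eq_iff algebra_simps)
  then have "norm (Y x - X x) = 2 * Im (w x) * norm (u x)" using y0[OF x] by (simp add: norm_mult)
  then have "2 * Im (w x) * norm (u x) \<le> 2 * C0" using norm_triangle_ineq4[of "Y x" "X x"] XY[OF x] by linarith
  moreover have "\<kappa> * norm (u x) \<le> 2 * Im (w x) * norm (u x)" using Imw[OF x] by (intro mult_right_mono) auto
  ultimately show ?thesis using \<kappa> by (simp add: field_simps)
 qed
 have vb: "norm (v x) \<le> C0 + M * (2 * C0 / \<kappa>)" if x: "x \<ge> x0" for x
 proof -
  have "v x = X x + w x * u x" by (simp add: X_def)
  then have "norm (v x) \<le> norm (X x) + norm (w x) * norm (u x)" by (metis norm_mult norm_triangle_ineq)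
  also have "\<dots> \<le> C0 + M * (2 * C0 / \<kappa>)" using XY[OF x] wb[OF x] ub[OF x] M0 by (intro add_mono mult_mono) auto
  finally show ?thesis .
 qed
 have cpt: "\<exists>C. \<forall>x\<in>{0..x0}. norm (f x) \<le> C" if "continuous_on {0..} f" for f :: "real \<Rightarrow> complex"
 proof -
  have "compact (f ` {0..x0})" by (intro compact_continuous_image continuous_on_subset[OF that]) auto
  then show ?thesis by (metis bounded_iff compact_imp_bounded imageI)
 qed
 obtain C1 C2 where C1: "\<forall>x\<in>{0..x0}. norm (u x) \<le> C1" and C2: "\<forall>x\<in>{0..x0}. norm (v x) \<le> C2"
  using cpt uc by blast
 show ?thesis
 proof (intro exI[of _ "max (max C1 C2) (max (2 * C0 / \<kappa>) (C0 + M * (2 * C0 / \<kappa>)))"] allI impI)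
  fix x :: real assume x: "x \<ge> 0"
  show "norm (u x) \<le> max (max C1 C2) (max (2 * C0 / \<kappa>) (C0 + M * (2 * C0 / \<kappa>))) \<and>
     norm (v x) \<le> max (max C1 C2) (max (2 * C0 / \<kappa>) (C0 + M * (2 * C0 / \<kappa>)))"
  proof (cases "x \<le> x0")
   case True
   then show ?thesis using C1 C2 x by (auto simp: le_max_iff_disj)
  next
   case False
   then show ?thesis using ub[of x] vb[of x] by (auto simp: le_max_iff_disj)
  qed
 qed
qed

end

section \<open>Hausdorff content of the set where a potential is infinite\<close>

lemma hausdorff_content_le:
 assumes "A \<subseteq> (\<Union>i. U i)" "\<And>i. bounded (U i)" "\<And>i. diameter (U i) \<le> \<delta>"
 shows "hausdorff_content s \<delta> A \<le> (\<Sum>i. ennreal (diameter (U i) powr s))"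
 unfolding hausdorff_content_def by (rule INF_lower) (use assms in auto)

lemma hausdorff_content_mono:
 assumes "A \<subseteq> B" shows "hausdorff_content s \<delta> A \<le> hausdorff_content s \<delta> B"
 unfolding hausdorff_content_def by (rule INF_superset_mono) (use assms in auto)

lemma hausdorff_content_less_imp_cover:
 assumes "hausdorff_content s \<delta> A < c"
 obtains U where "A \<subseteq> (\<Union>i. U i)" "\<And>i. bounded (U i)" "\<And>i. diameter (U i) \<le> \<delta>"
  "(\<Sum>i. ennreal (diameter (U i) powr s)) < c"
proof -
 have "\<exists>U\<in>{U::nat \<Rightarrow> 'a set. A \<subseteq> (\<Union>i. U i) \<and> (\<forall>i. bounded (U i) \<and> diameter (U i) \<le> \<delta>)}.
   (\<Sum>i. ennreal (diameter (U i) powr s)) < c"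
  using assms unfolding hausdorff_content_def INF_less_iff .
 then show ?thesis using that by blast
qed

text \<open>Near-optimal covers with errors \<open>e / 2 ^ (n + 1)\<close> are merged along the
  pairing function on \<open>nat\<close>. Infinite contents are treated apart, because a strict
  inequality is needed to pick a cover.\<close>

lemma hausdorff_content_UN_le:
 "hausdorff_content s \<delta> (\<Union>n::nat. A n) \<le> (\<Sum>n. hausdorff_content s \<delta> (A n))"
proof (cases "\<exists>n. hausdorff_content s \<delta> (A n) = \<infinity>")
 case True
 then obtain n where n: "hausdorff_content s \<delta> (A n) = \<infinity>" by blast
 have "hausdorff_content s \<delta> (A n) \<le> (\<Sum>n. hausdorff_content s \<delta> (A n))"
  using sum_le_suminf[of "\<lambda>n. hausdorff_content s \<delta> (A n)" "{n}"] by simp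
 then show ?thesis using n by (simp add: top_unique)
next
 case False
 show ?thesis
 proof (rule ennreal_le_epsilon)
  fix e :: real assume e: "e > 0"
  have "\<exists>U. A n \<subseteq> (\<Union>i. U i) \<and> (\<forall>i. bounded (U i)) \<and> (\<forall>i. diameter (U i) \<le> \<delta>) \<and>
    (\<Sum>i. ennreal (diameter (U i) powr s)) \<le> hausdorff_content s \<delta> (A n) + ennreal (e * (1/2) ^ Suc n)" for n
  proof -
   have fin: "hausdorff_content s \<delta> (A n) < \<infinity>" using False by (simp add: less_top)
   have pos: "0 < ennreal (e * (1/2) ^ Suc n)" using e by simp
   have "hausdorff_content s \<delta> (A n) < hausdorff_content s \<delta> (A n) + ennreal (e * (1/2) ^ Suc n)"
    using fin pos by (simp add: ennreal_add_left_cancel_less[of _ 0, simplified])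
   from hausdorff_content_less_imp_cover[OF this] obtain U where
    "A n \<subseteq> (\<Union>i. U i)" "\<And>i. bounded (U i)" "\<And>i. diameter (U i) \<le> \<delta>"
    "(\<Sum>i. ennreal (diameter (U i) powr s)) < hausdorff_content s \<delta> (A n) + ennreal (e * (1/2) ^ Suc n)" by blast
   then show ?thesis by (intro exI[of _ U] conjI allI) (simp_all add: less_imp_le)
  qed
  then have "\<exists>U. \<forall>n. A n \<subseteq> (\<Union>i. U n i) \<and> (\<forall>i. bounded (U n i)) \<and> (\<forall>i. diameter (U n i) \<le> \<delta>) \<and>
    (\<Sum>i. ennreal (diameter (U n i) powr s)) \<le> hausdorff_content s \<delta> (A n) + ennreal (e * (1/2) ^ Suc n)"
   by (intro choice allI)
  then obtain U where U: "\<And>n. A n \<subseteq> (\<Union>i. U n i)" "\<And>n i. bounded (U n i)" "\<And>n i. diameter (U n i) \<le> \<delta>"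
   and Us: "\<And>n. (\<Sum>i. ennreal (diameter (U n i) powr s)) \<le> hausdorff_content s \<delta> (A n) + ennreal (e * (1/2) ^ Suc n)"
   by blast
  define W where "W i = U (fst (prod_decode i)) (snd (prod_decode i))" for i
  have "hausdorff_content s \<delta> (\<Union>n. A n) \<le> (\<Sum>i. ennreal (diameter (W i) powr s))"
  proof (rule hausdorff_content_le)
   show "(\<Union>n. A n) \<subseteq> (\<Union>i. W i)"
   proof
    fix x assume "x \<in> (\<Union>n. A n)"
    then obtain n i where "x \<in> U n i" using U(1) by blast
    then have "x \<in> W (prod_encode (n,i))" by (simp add: W_def)
    then show "x \<in> (\<Union>i. W i)" by blast
   qed
  qed (simp_all add: W_def U)
  also have "\<dots> = (\<Sum>n. \<Sum>i. ennreal (diameter (U n i) powr s))"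
  proof -
   have "(\<Sum>i. (\<lambda>p. ennreal (diameter (U (fst p) (snd p)) powr s)) (prod_decode i))
     = (\<Sum>n. \<Sum>i. ennreal (diameter (U n i) powr s))"
    by (rule suminf_ennreal_2dimen) simp
   then show ?thesis by (simp add: W_def)
  qed
  also have "\<dots> \<le> (\<Sum>n. hausdorff_content s \<delta> (A n) + ennreal (e * (1/2) ^ Suc n))"
   by (intro suminf_le Us) auto
  also have "\<dots> = (\<Sum>n. hausdorff_content s \<delta> (A n)) + (\<Sum>n. ennreal (e * (1/2) ^ Suc n))"
   by (rule suminf_add[symmetric]) auto
  also have "(\<Sum>n. ennreal (e * (1/2) ^ Suc n)) = ennreal e"
  proof (rule suminf_ennreal_eq)
   show "(\<lambda>n. e * (1/2) ^ Suc n) sums e" using sums_mult[OF power_half_series, of e] by simp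
  qed (use e in simp)
  finally show "hausdorff_content s \<delta> (\<Union>n. A n) \<le> (\<Sum>n. hausdorff_content s \<delta> (A n)) + ennreal e" .
 qed
qed

lemma hausdorff_content_UN_null:
 assumes "\<And>n::nat. hausdorff_content s \<delta> (A n) = 0"
 shows "hausdorff_content s \<delta> (\<Union>n. A n) = 0"
 using hausdorff_content_UN_le[of s \<delta> A] assms by simp

lemma hausdorff_content_finite_cover:
 assumes J: "finite J" and A: "\<And>j. j \<in> J \<Longrightarrow> bounded (A j) \<and> diameter (A j) \<le> r" and r: "0 \<le> r" "r \<le> \<delta>" and s: "s > 0"
 shows "hausdorff_content s \<delta> (\<Union>j\<in>J. A j) \<le> ennreal (real (card J) * r powr s)"
proof -
 obtain h where h: "bij_betw h {..<card J} J" using ex_bij_betw_nat_finite[OF J] by (auto simp: atLeast0LessThan)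
 define U where "U i = (if i < card J then A (h i) else {})" for i
 have hJ: "h i \<in> J" if "i < card J" for i using h that by (auto simp: bij_betw_def)
 have "hausdorff_content s \<delta> (\<Union>j\<in>J. A j) \<le> (\<Sum>i. ennreal (diameter (U i) powr s))"
 proof (rule hausdorff_content_le)
  show "(\<Union>j\<in>J. A j) \<subseteq> (\<Union>i. U i)"
  proof clarify
   fix j x assume "j \<in> J" "x \<in> A j"
   then obtain i where "i < card J" "h i = j" using h unfolding bij_betw_def by (metis imageE lessThan_iff)
   then have "x \<in> U i" using \<open>x \<in> A j\<close> by (simp add: U_def)
   then show "x \<in> (\<Union>i. U i)" by blast
  qed
  show "bounded (U i)" for i using A[OF hJ] by (simp add: U_def)
  show "diameter (U i) \<le> \<delta>" for i
   using A[OF hJ, of i] r by (cases "i < card J") (simp_all add: U_def)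
 qed
 also have "\<dots> = (\<Sum>i<card J. ennreal (diameter (U i) powr s))"
  by (rule suminf_finite) (auto simp: U_def)
 also have "\<dots> \<le> (\<Sum>i<card J. ennreal (r powr s))"
 proof (rule sum_mono)
  fix i assume "i \<in> {..<card J}"
  then have "diameter (U i) \<le> r" "bounded (U i)" using A[OF hJ, of i] by (auto simp: U_def)
  then show "ennreal (diameter (U i) powr s) \<le> ennreal (r powr s)"
   using s diameter_ge_0 by (intro ennreal_leI powr_mono2) auto
 qed
 also have "\<dots> = ennreal (real (card J) * r powr s)"
  by (simp add: ennreal_mult ennreal_of_nat_eq_real_of_nat)
 finally show ?thesis .
qed

text \<open>Points have diameter 0, and \<open>0 powr s = 0\<close>.\<close>

lemma hausdorff_content_countable:
 assumes "countable A" "\<delta> \<ge> 0" "s > 0" shows "hausdorff_content s \<delta> A = 0"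
proof (cases "A = {}")
 case True
 then show ?thesis using hausdorff_content_finite_cover[of "{}" "\<lambda>_. {}" 0 \<delta> s] assms by simp
next
 case False
 have "hausdorff_content s \<delta> (\<Union>n. {from_nat_into A n}) = 0"
 proof (rule hausdorff_content_UN_null)
  fix n
  show "hausdorff_content s \<delta> {from_nat_into A n} = 0"
   using hausdorff_content_finite_cover[of "{n}" "\<lambda>n. {from_nat_into A n}" 0 \<delta> s] assms by simp
 qed
 also have "(\<Union>n. {from_nat_into A n}) = A" using range_from_nat_into[OF False assms(1)] by auto
 finally show ?thesis .
qed

text \<open>Borel--Cantelli for the content: \<open>A\<close> is covered by every tail of the
  sequence \<open>B\<close>, and the tails of a convergent series tend to 0.\<close>

lemma hausdorff_content_limsup_null:
 assumes A: "\<And>N. A \<subseteq> (\<Union>n. B (n + N))"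
  and B: "\<And>n. n \<ge> N0 \<Longrightarrow> hausdorff_content s \<delta> (B n) \<le> ennreal (b n)"
  and b: "\<And>n. b n \<ge> 0" "summable b"
 shows "hausdorff_content s \<delta> A = 0"
proof -
 have "hausdorff_content s \<delta> A \<le> ennreal e" if e: "e > 0" for e
 proof -
  obtain N1 where N1: "\<And>n. n \<ge> N1 \<Longrightarrow> norm (\<Sum>i. b (i + n)) < e"
   using suminf_exist_split[OF e b(2)] by blast
  define N where "N = max N0 N1"
  have sN: "summable (\<lambda>i. b (i + N))" using b(2) by (simp add: summable_iff_shift)
  have "hausdorff_content s \<delta> A \<le> hausdorff_content s \<delta> (\<Union>n. B (n + N))"
   by (rule hausdorff_content_mono[OF A])
  also have "\<dots> \<le> (\<Sum>n. hausdorff_content s \<delta> (B (n + N)))" by (rule hausdorff_content_UN_le)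
  also have "\<dots> \<le> (\<Sum>n. ennreal (b (n + N)))" by (intro suminf_le B) (auto simp: N_def)
  also have "\<dots> = ennreal (\<Sum>n. b (n + N))" using sN b by (intro suminf_ennreal2) auto
  also have "\<dots> \<le> ennreal e" using N1[of N] by (intro ennreal_leI) (auto simp: N_def)
  finally show ?thesis .
 qed
 then have "hausdorff_content s \<delta> A \<le> 0 + ennreal e" if "e > 0" for e using that by simp
 then have "hausdorff_content s \<delta> A \<le> 0" by (rule ennreal_le_epsilon)
 then show ?thesis by simp
qed

lemma hausdorff_content_lipschitz_null:
 fixes f :: "'a::metric_space \<Rightarrow> 'b::real_normed_vector"
 assumes L: "L > 0" and f: "\<And>x y. x \<in> A \<Longrightarrow> y \<in> A \<Longrightarrow> dist (f x) (f y) \<le> L * dist x y"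
  and null: "hausdorff_content s (\<delta> / L) A = 0" and s: "s > 0"
 shows "hausdorff_content s \<delta> (f ` A) = 0"
proof -
 have "hausdorff_content s \<delta> (f ` A) \<le> 0 + ennreal e" if e: "e > 0" for e
 proof -
  have "hausdorff_content s (\<delta> / L) A < ennreal (e / L powr s)" using null e L by simp
  from hausdorff_content_less_imp_cover[OF this]
  obtain U where U: "A \<subseteq> (\<Union>i. U i)" "\<And>i. bounded (U i)" "\<And>i. diameter (U i) \<le> \<delta> / L"
   and Us: "(\<Sum>i. ennreal (diameter (U i) powr s)) < ennreal (e / L powr s)" by blast
  have dd: "dist x y \<le> L * diameter (U i)" if "x \<in> f ` (U i \<inter> A)" "y \<in> f ` (U i \<inter> A)" for x y i
  proof -
   obtain u v where uv: "x = f u" "y = f v" "u \<in> U i" "u \<in> A" "v \<in> U i" "v \<in> A" using \<open>x \<in> _\<close> \<open>y \<in> _\<close> by blast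
   have "dist u v \<le> diameter (U i)" using diameter_bounded_bound[OF U(2)] uv by blast
   then have "L * dist u v \<le> L * diameter (U i)" using L by simp
   then show ?thesis using f[OF uv(4,6)] uv by simp
  qed
  have bd: "bounded (f ` (U i \<inter> A))" for i
   unfolding bounded_two_points using dd[of _ i] by blast
  have di: "diameter (f ` (U i \<inter> A)) \<le> L * diameter (U i)" for i
   by (rule diameter_le) (use dd[of _ i] L diameter_ge_0[OF U(2)] in \<open>auto simp: dist_norm\<close>)
  have "hausdorff_content s \<delta> (f ` A) \<le> (\<Sum>i. ennreal (diameter (f ` (U i \<inter> A)) powr s))"
  proof (rule hausdorff_content_le)
   show "diameter (f ` (U i \<inter> A)) \<le> \<delta>" for i
   proof -
    have "L * diameter (U i) \<le> \<delta>" using U(3)[of i] L by (simp add: field_simps)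
    then show ?thesis using di[of i] by linarith
   qed
   show "f ` A \<subseteq> (\<Union>i. f ` (U i \<inter> A))" using U(1) by blast
  qed (rule bd)
  also have "\<dots> \<le> (\<Sum>i. ennreal (L powr s) * ennreal (diameter (U i) powr s))"
  proof (intro suminf_le)
   fix i
   have "diameter (f ` (U i \<inter> A)) powr s \<le> (L * diameter (U i)) powr s"
    using s di diameter_ge_0[OF bd] by (intro powr_mono2) auto
   also have "\<dots> = L powr s * diameter (U i) powr s" using L diameter_ge_0[OF U(2)] by (simp add: powr_mult)
   finally show "ennreal (diameter (f ` (U i \<inter> A)) powr s) \<le> ennreal (L powr s) * ennreal (diameter (U i) powr s)"
    by (simp add: ennreal_mult[symmetric] ennreal_leI)
  qed auto
  also have "\<dots> = ennreal (L powr s) * (\<Sum>i. ennreal (diameter (U i) powr s))" by simp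
  also have "\<dots> \<le> ennreal (L powr s) * ennreal (e / L powr s)" using Us by (intro mult_left_mono) auto
  also have "\<dots> = ennreal e" using L e by (simp add: ennreal_mult[symmetric])
  finally show ?thesis by simp
 qed
 then have "hausdorff_content s \<delta> (f ` A) \<le> 0" by (rule ennreal_le_epsilon)
 then show ?thesis by simp
qed

lemma hausdorff_dim_le:
 assumes "\<sigma> \<ge> 0" and "\<And>s \<delta>. s > \<sigma> \<Longrightarrow> \<delta> > 0 \<Longrightarrow> hausdorff_content s \<delta> A = 0"
 shows "hausdorff_dim A \<le> ennreal \<sigma>"
proof (rule ennreal_le_epsilon)
 fix e :: real assume e: "e > 0"
 have "hausdorff_measure (\<sigma> + e) A = 0" unfolding hausdorff_measure_def using assms e by simp
 then have "hausdorff_dim A \<le> ennreal (\<sigma> + e)" unfolding hausdorff_dim_def using assms(1) e by (intro INF_lower) auto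
 then show "hausdorff_dim A \<le> ennreal \<sigma> + ennreal e" using assms(1) e by simp
qed

text \<open>A set of diameter \<open>d\<close> lies in an interval of length \<open>2 * d\<close>,
  so a cover of small total diameter gives an outer set of small measure. This converts a dimension
  bound below 1 into an almost everywhere statement.\<close>

lemma hausdorff_content_1_null_imp_negligible:
 fixes A :: "real set"
 assumes null: "hausdorff_content 1 \<delta> A = 0"
 shows "negligible A"
 unfolding negligible_outer_le
proof (intro allI impI)
 fix e :: real assume e: "e > 0"
 have "hausdorff_content 1 \<delta> A < ennreal (e / 2)" using null e by simp
 from hausdorff_content_less_imp_cover[OF this]
 obtain U where U: "A \<subseteq> (\<Union>i. U i)" "\<And>i. bounded (U i)" "\<And>i. diameter (U i) \<le> \<delta>"
  and Us: "(\<Sum>i. ennreal (diameter (U i) powr 1)) < ennreal (e / 2)" by blast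
 define c where "c i = (SOME x. x \<in> U i)" for i
 define T where "T = (\<Union>i. cball (c i) (diameter (U i)))"
 have Ut: "U i \<subseteq> cball (c i) (diameter (U i))" for i
 proof
  fix x assume x: "x \<in> U i"
  then have "c i \<in> U i" unfolding c_def by (rule someI)
  then show "x \<in> cball (c i) (diameter (U i))" using diameter_bounded_bound[OF U(2)] x by auto
 qed
 have "emeasure lborel T \<le> (\<Sum>i. emeasure lborel (cball (c i) (diameter (U i))))"
  unfolding T_def by (rule emeasure_subadditive_countably) auto
 also have "\<dots> = (\<Sum>i. 2 * ennreal (diameter (U i) powr 1))"
 proof (intro suminf_cong)
  fix i
  have d: "diameter (U i) \<ge> 0" by (rule diameter_ge_0[OF U(2)])
  have "cball (c i) (diameter (U i)) = {c i - diameter (U i)..c i + diameter (U i)}" by (rule cball_eq_atLeastAtMost)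
  then show "emeasure lborel (cball (c i) (diameter (U i))) = 2 * ennreal (diameter (U i) powr 1)"
   using d by (simp add: ennreal_mult'')
 qed
 also have "\<dots> = 2 * (\<Sum>i. ennreal (diameter (U i) powr 1))" by simp
 also have "\<dots> \<le> 2 * ennreal (e / 2)" using Us by (intro mult_left_mono) auto
 also have "\<dots> = ennreal (2 * (e / 2))" using e by (subst ennreal_mult) auto
 finally have le: "emeasure lborel T \<le> ennreal e" by simp
 have Tb: "T \<in> sets borel" unfolding T_def by auto
 have em: "emeasure lebesgue T \<le> ennreal e" using le Tb by (simp add: emeasure_completion)
 have "T \<in> lmeasurable" using Tb em by (auto simp: fmeasurable_def intro: le_less_trans)
 moreover have "measure lebesgue T \<le> e" unfolding measure_def using em e by (simp add: enn2real_leI)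
 moreover have "A \<subseteq> T" using U(1) Ut unfolding T_def by blast
 ultimately show "\<exists>T. A \<subseteq> T \<and> T \<in> lmeasurable \<and> measure lebesgue T \<le> e" by blast
qed

section \<open>Divergence of potentials, by dyadic scales\<close>

lemma infsum_finite_sum:
 fixes f :: "'j \<Rightarrow> 'i \<Rightarrow> real"
 assumes "finite F" "\<And>j. j \<in> F \<Longrightarrow> f j summable_on I"
 shows "((\<lambda>i. \<Sum>j\<in>F. f j i) has_sum (\<Sum>j\<in>F. infsum (f j) I)) I"
 using assms
proof (induction F rule: finite_induct)
 case (insert j F)
 have "((\<lambda>i. f j i + (\<Sum>j\<in>F. f j i)) has_sum (infsum (f j) I + (\<Sum>j\<in>F. infsum (f j) I))) I"
  using insert by (intro has_sum_add) auto
 then show ?case using insert by simp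
qed simp

text \<open>Since every point \<open>x i\<close> is seen by three dyadic intervals, few intervals can see much mass.\<close>
lemma dyadic_heavy_card:
 fixes b :: "'i \<Rightarrow> real" and k :: "'i \<Rightarrow> int"
 assumes b: "\<And>i. i \<in> I \<Longrightarrow> b i \<ge> 0" "b summable_on I" and t: "t > 0"
 defines "H \<equiv> {j. infsum b {i\<in>I. \<bar>k i - j\<bar> \<le> 1} > t}"
 shows "finite H \<and> real (card H) * t \<le> 3 * infsum b I"
proof -
 have sub: "b summable_on {i\<in>I. P i}" for P by (rule summable_on_subset_banach[OF b(2)]) auto
 have key: "real (card F) * t \<le> 3 * infsum b I" if F: "F \<subseteq> H" "finite F" for F
 proof -
  have hs: "((\<lambda>i. \<Sum>j\<in>F. if \<bar>k i - j\<bar> \<le> 1 then b i else 0) has_sum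
    (\<Sum>j\<in>F. infsum (\<lambda>i. if \<bar>k i - j\<bar> \<le> 1 then b i else 0) I)) I"
  proof (rule infsum_finite_sum[OF F(2)])
   fix j
   show "(\<lambda>i. if \<bar>k i - j\<bar> \<le> 1 then b i else 0) summable_on I"
    using sub[of "\<lambda>i. \<bar>k i - j\<bar> \<le> 1"] by (rule summable_on_cong_neutral[THEN iffD1, rotated -1]) auto
  qed
  have "real (card F) * t \<le> (\<Sum>j\<in>F. infsum b {i\<in>I. \<bar>k i - j\<bar> \<le> 1})"
   using sum_mono[of F "\<lambda>_. t" "\<lambda>j. infsum b {i\<in>I. \<bar>k i - j\<bar> \<le> 1}"] F by (auto simp: H_def less_imp_le subset_iff)
  also have "\<dots> = (\<Sum>j\<in>F. infsum (\<lambda>i. if \<bar>k i - j\<bar> \<le> 1 then b i else 0) I)"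
   by (intro sum.cong refl infsum_cong_neutral) auto
  also have "\<dots> = infsum (\<lambda>i. \<Sum>j\<in>F. if \<bar>k i - j\<bar> \<le> 1 then b i else 0) I"
   using infsumI[OF hs] by simp
  also have "\<dots> \<le> infsum (\<lambda>i. 3 * b i) I"
  proof (rule infsum_mono)
   show "(\<lambda>i. 3 * b i) summable_on I" by (intro summable_on_cmult_right b)
   show "(\<lambda>i. \<Sum>j\<in>F. if \<bar>k i - j\<bar> \<le> 1 then b i else 0) summable_on I"
    using hs by (rule has_sum_imp_summable)
   fix i assume i: "i \<in> I"
   have "(\<Sum>j\<in>F. if \<bar>k i - j\<bar> \<le> 1 then b i else 0) = real (card {j\<in>F. \<bar>k i - j\<bar> \<le> 1}) * b i"
    using F by (simp add: sum.inter_filter[symmetric])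
   also have "\<dots> \<le> 3 * b i"
   proof (rule mult_right_mono)
    have "card {j\<in>F. \<bar>k i - j\<bar> \<le> 1} \<le> card {k i - 1, k i, k i + 1}" by (rule card_mono) auto
    also have "\<dots> = 3" by simp
    finally show "real (card {j\<in>F. \<bar>k i - j\<bar> \<le> 1}) \<le> 3" by simp
   qed (use b i in auto)
   finally show "(\<Sum>j\<in>F. if \<bar>k i - j\<bar> \<le> 1 then b i else 0) \<le> 3 * b i" .
  qed
  also have "\<dots> = 3 * infsum b I" by (rule infsum_cmult_right) (use b in auto)
  finally show ?thesis .
 qed
 have "finite H \<and> card H \<le> nat \<lfloor>3 * infsum b I / t\<rfloor>"
 proof (rule finite_if_finite_subsets_card_bdd)
  fix G assume "G \<subseteq> H" "finite G"
  then have "real (card G) \<le> 3 * infsum b I / t" using key[of G] t by (simp add: field_simps)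
  then show "card G \<le> nat \<lfloor>3 * infsum b I / t\<rfloor>" by linarith
 qed
 then show ?thesis using key[of H] by blast
qed

lemma dyadic_scale_exists:
 fixes d :: real assumes d: "d > 0" "d < (1/2) ^ N"
 shows "\<exists>n\<ge>N. (1/2) ^ Suc n \<le> d \<and> d < (1/2) ^ n"
proof -
 obtain m where "(1/2::real) ^ m < d" using real_arch_pow_inv[OF d(1), of "1/2"] by auto
 define n0 where "n0 = (LEAST m. (1/2::real) ^ m \<le> d)"
 have n0: "(1/2::real) ^ n0 \<le> d" unfolding n0_def by (rule LeastI[of _ m]) (use \<open>(1/2) ^ m < d\<close> in auto)
 have "(1/2::real) ^ n0 < (1/2) ^ N" using n0 d by linarith
 then have lt: "N < n0" by (simp add: power_strict_decreasing_iff)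
 have "\<not> (1/2::real) ^ (n0 - 1) \<le> d"
  using not_less_Least[of "n0 - 1" "\<lambda>m. (1/2::real) ^ m \<le> d"] lt unfolding n0_def[symmetric] by auto
 then show ?thesis using n0 lt by (intro exI[of _ "n0 - 1"]) auto
qed

lemma half_powr_less_one: "a > 0 \<Longrightarrow> (1/2::real) powr a < 1"
 by (simp add: powr_def ln_div)

text \<open>Dyadic shells around \<open>y\<close>: points at distance about \<open>2 ^ - n\<close>
  contribute at most a constant times \<open>2 ^ (n * \<sigma>) * 2 ^ (- n * s')\<close>, a
  geometric series with ratio \<open>q < 1\<close>. Points at distance at least
  \<open>2 ^ - N\<close> are harmless, and a point equal to \<open>y\<close> contributes 0 because
  \<open>0 powr - \<sigma> = 0\<close>.\<close>

lemma potential_summable: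
 fixes b x :: "'i \<Rightarrow> real"
 assumes b: "\<And>i. i \<in> I \<Longrightarrow> b i \<ge> 0" "b summable_on I" and \<sigma>: "0 < \<sigma>" "\<sigma> < s'"
  and light: "\<And>n. n \<ge> N \<Longrightarrow> infsum b {i\<in>I. \<bar>y - x i\<bar> < (1/2) ^ n} \<le> ((1/2) ^ n) powr s'"
 shows "(\<lambda>i. b i * \<bar>y - x i\<bar> powr - \<sigma>) summable_on I"
proof -
 define q where "q = (1/2::real) powr (s' - \<sigma>)"
 have q: "0 < q" "q < 1" using \<sigma> unfolding q_def by (auto simp: half_powr_less_one)
 define C where "C = infsum b I * ((1/2) ^ N) powr - \<sigma> + 2 powr \<sigma> * (1 / (1 - q))"
 have sub: "b summable_on {i\<in>I. P i}" for P by (rule summable_on_subset_banach[OF b(2)]) auto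
 have bound: "(\<Sum>i\<in>F. b i * \<bar>y - x i\<bar> powr - \<sigma>) \<le> C" if F: "finite F" "F \<subseteq> I" for F
 proof -
  define G where "G = {i\<in>F. 0 < \<bar>y - x i\<bar> \<and> \<bar>y - x i\<bar> < (1/2) ^ N}"
  have "\<forall>i\<in>G. \<exists>n\<ge>N. (1/2) ^ Suc n \<le> \<bar>y - x i\<bar> \<and> \<bar>y - x i\<bar> < (1/2) ^ n"
   using dyadic_scale_exists unfolding G_def by blast
  then obtain \<nu> where \<nu>: "\<And>i. i \<in> G \<Longrightarrow> N \<le> \<nu> i \<and> (1/2) ^ Suc (\<nu> i) \<le> \<bar>y - x i\<bar> \<and> \<bar>y - x i\<bar> < (1/2) ^ \<nu> i"
   by (rule bchoice[THEN exE]) blast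
  have GF: "finite G" "G \<subseteq> F" using F by (auto simp: G_def)
  define K where "K = (\<Sum>i\<in>G. \<nu> i)"
  have K: "\<nu> i \<le> K" if "i \<in> G" for i unfolding K_def by (rule member_le_sum) (use that GF in auto)
  have bi: "b i \<ge> 0" if "i \<in> F" for i using that F b by auto
  have far: "(\<Sum>i\<in>F - G. b i * \<bar>y - x i\<bar> powr - \<sigma>) \<le> infsum b I * ((1/2) ^ N) powr - \<sigma>"
  proof -
   have "(\<Sum>i\<in>F - G. b i * \<bar>y - x i\<bar> powr - \<sigma>) \<le> (\<Sum>i\<in>F - G. b i * ((1/2) ^ N) powr - \<sigma>)"
   proof (rule sum_mono)
    fix i assume i: "i \<in> F - G"
    show "b i * \<bar>y - x i\<bar> powr - \<sigma> \<le> b i * ((1/2) ^ N) powr - \<sigma>"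
    proof (cases "y = x i")
     case False
     then have "(1/2) ^ N \<le> \<bar>y - x i\<bar>" using i by (auto simp: G_def)
     then have "\<bar>y - x i\<bar> powr - \<sigma> \<le> ((1/2) ^ N) powr - \<sigma>" using \<sigma> by (intro powr_mono2') auto
     then show ?thesis using bi i by (intro mult_left_mono) auto
    qed (use bi i in simp)
   qed
   also have "\<dots> = (\<Sum>i\<in>F - G. b i) * ((1/2) ^ N) powr - \<sigma>" by (simp add: sum_distrib_right)
   also have "\<dots> \<le> infsum b I * ((1/2) ^ N) powr - \<sigma>"
    using F b by (intro mult_right_mono finite_sum_le_infsum) auto
   finally show ?thesis .
  qed
  have near: "(\<Sum>i\<in>G. b i * \<bar>y - x i\<bar> powr - \<sigma>) \<le> 2 powr \<sigma> * (1 / (1 - q))"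
  proof -
   \<comment> \<open>Each point is charged to all balls that contain it instead of only to its
     shell, because balls are what \<open>light\<close> bounds.\<close>
   have "(\<Sum>i\<in>G. b i * \<bar>y - x i\<bar> powr - \<sigma>) \<le>
     (\<Sum>i\<in>G. \<Sum>n\<in>{N..K}. if \<bar>y - x i\<bar> < (1/2) ^ n then b i * ((1/2) ^ Suc n) powr - \<sigma> else 0)"
   proof (rule sum_mono)
    fix i assume i: "i \<in> G"
    have biG: "b i \<ge> 0" using i GF bi by auto
    have "\<bar>y - x i\<bar> powr - \<sigma> \<le> ((1/2) ^ Suc (\<nu> i)) powr - \<sigma>" using \<sigma> \<nu>[OF i] by (intro powr_mono2') auto
    then have "b i * \<bar>y - x i\<bar> powr - \<sigma> \<le> b i * ((1/2) ^ Suc (\<nu> i)) powr - \<sigma>" using biG by (intro mult_left_mono)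
    also have "\<dots> = (if \<bar>y - x i\<bar> < (1/2) ^ \<nu> i then b i * ((1/2) ^ Suc (\<nu> i)) powr - \<sigma> else 0)" using \<nu>[OF i] by simp
    also have "\<dots> \<le> (\<Sum>n\<in>{N..K}. if \<bar>y - x i\<bar> < (1/2) ^ n then b i * ((1/2) ^ Suc n) powr - \<sigma> else 0)"
     by (rule member_le_sum) (use \<nu>[OF i] K[OF i] biG in auto)
    finally show "b i * \<bar>y - x i\<bar> powr - \<sigma> \<le> \<dots>" .
   qed
   also have "\<dots> = (\<Sum>n\<in>{N..K}. \<Sum>i\<in>G. if \<bar>y - x i\<bar> < (1/2) ^ n then b i * ((1/2) ^ Suc n) powr - \<sigma> else 0)"
    by (rule sum.swap)
   also have "\<dots> \<le> (\<Sum>n\<in>{N..K}. 2 powr \<sigma> * q ^ n)"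
   proof (rule sum_mono)
    fix n assume n: "n \<in> {N..K}"
    have "(\<Sum>i\<in>G. if \<bar>y - x i\<bar> < (1/2) ^ n then b i * ((1/2) ^ Suc n) powr - \<sigma> else 0)
      = (\<Sum>i\<in>{i\<in>G. \<bar>y - x i\<bar> < (1/2) ^ n}. b i) * ((1/2) ^ Suc n) powr - \<sigma>"
     using GF by (simp add: sum.inter_filter[symmetric] sum_distrib_right del: power_Suc)
    also have "\<dots> \<le> infsum b {i\<in>I. \<bar>y - x i\<bar> < (1/2) ^ n} * ((1/2) ^ Suc n) powr - \<sigma>"
     using GF F b sub by (intro mult_right_mono finite_sum_le_infsum) auto
    also have "\<dots> \<le> ((1/2) ^ n) powr s' * ((1/2) ^ Suc n) powr - \<sigma>"
     using light n by (intro mult_right_mono) auto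
    also have "\<dots> = 2 powr \<sigma> * q ^ n"
     unfolding q_def by (simp add: powr_realpow[symmetric] powr_powr powr_add[symmetric] powr_minus powr_mult powr_divide field_simps del: powr_realpow)
    finally show "(\<Sum>i\<in>G. if \<bar>y - x i\<bar> < (1/2) ^ n then b i * ((1/2) ^ Suc n) powr - \<sigma> else 0) \<le> 2 powr \<sigma> * q ^ n" .
   qed
   also have "\<dots> = 2 powr \<sigma> * (\<Sum>n\<in>{N..K}. q ^ n)" by (simp add: sum_distrib_left)
   also have "\<dots> \<le> 2 powr \<sigma> * (\<Sum>n. q ^ n)" using q by (intro mult_left_mono sum_le_suminf summable_geometric) auto
   also have "(\<Sum>n. q ^ n) = 1 / (1 - q)" using q by (intro suminf_geometric) auto
   finally show ?thesis .
  qed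
  show ?thesis using sum.subset_diff[OF GF(2) F(1), of "\<lambda>i. b i * \<bar>y - x i\<bar> powr - \<sigma>"] far near by (simp add: C_def)
 qed
 show ?thesis
  by (rule nonneg_bdd_above_summable_on) (use b bound in \<open>auto intro!: bdd_aboveI[of _ C]\<close>)
qed

text \<open>Where the potential diverges, \<open>potential_summable\<close> fails, so balls of mass
  above \<open>2 ^ (- n * s')\<close> occur at arbitrarily small scales. Such points lie in dyadic
  intervals that see this much mass, of which there are at most \<open>3 * 2 ^ (n * s')\<close>
  times the total mass; as \<open>s' < s\<close>, their contents form a convergent series.\<close>

lemma potential_infinite_null:
 fixes b x :: "'i \<Rightarrow> real"
 assumes b: "\<And>i. i \<in> I \<Longrightarrow> b i \<ge> 0" "b summable_on I" and \<sigma>: "0 < \<sigma>" "\<sigma> < s" and \<delta>: "\<delta> > 0"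
 shows "hausdorff_content s \<delta> {y. \<not> (\<lambda>i. b i * \<bar>y - x i\<bar> powr - \<sigma>) summable_on I} = 0"
proof -
 define s' where "s' = (\<sigma> + s) / 2"
 have s': "\<sigma> < s'" "s' < s" using \<sigma> by (auto simp: s'_def)
 define k where "k n i = \<lfloor>x i * 2 ^ n\<rfloor>" for n i
 define t where "t n = ((1/2::real) ^ n) powr s'" for n
 define H where "H n = {j. infsum b {i\<in>I. \<bar>k n i - j\<bar> \<le> 1} > t n}" for n
 define B where "B n = (\<Union>j\<in>H n. {y::real. \<lfloor>y * 2 ^ n\<rfloor> = j})" for n
 define q where "q = (1/2::real) powr (s - s')"
 have q: "0 < q" "q < 1" using s' unfolding q_def by (auto simp: half_powr_less_one)
 have t0: "t n > 0" for n by (simp add: t_def)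
 have H: "finite (H n)" "real (card (H n)) * t n \<le> 3 * infsum b I" for n
  using dyadic_heavy_card[where k = "k n", OF b t0[of n]] unfolding H_def by blast+
 obtain N0 where N0: "(1/2::real) ^ N0 < \<delta>" using real_arch_pow_inv[OF \<delta>, of "1/2"] by auto
 show ?thesis
 proof (rule hausdorff_content_limsup_null)
  show "hausdorff_content s \<delta> (B n) \<le> ennreal (3 * infsum b I * q ^ n)" if n: "n \<ge> N0" for n
  proof -
   have "(1/2::real) ^ n \<le> (1/2) ^ N0" using n by (intro power_decreasing) auto
   then have d: "(1/2) ^ n \<le> \<delta>" using N0 by linarith
   have "hausdorff_content s \<delta> (B n) \<le> ennreal (real (card (H n)) * ((1/2) ^ n) powr s)"
    unfolding B_def
   proof (rule hausdorff_content_finite_cover[OF H(1) _ _ d])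
    fix j
    have dl: "dist y z \<le> (1/2) ^ n" if "\<lfloor>y * 2 ^ n\<rfloor> = j" "\<lfloor>z * 2 ^ n\<rfloor> = j" for y z :: real
    proof -
     have "\<bar>y * 2 ^ n - z * 2 ^ n\<bar> \<le> 1" using that by linarith
     then have "\<bar>y - z\<bar> * 2 ^ n \<le> 1" by (simp add: left_diff_distrib[symmetric] abs_mult)
     then show ?thesis by (simp add: dist_real_def power_one_over field_simps)
    qed
    have "bounded {y::real. \<lfloor>y * 2 ^ n\<rfloor> = j}" unfolding bounded_two_points using dl by blast
    moreover have "diameter {y::real. \<lfloor>y * 2 ^ n\<rfloor> = j} \<le> (1/2) ^ n"
     by (rule diameter_le) (use dl in \<open>auto simp: dist_norm\<close>)
    ultimately show "bounded {y::real. \<lfloor>y * 2 ^ n\<rfloor> = j} \<and> diameter {y::real. \<lfloor>y * 2 ^ n\<rfloor> = j} \<le> (1/2) ^ n" ..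
   qed (use \<sigma> in auto)
   also have "\<dots> \<le> ennreal (3 * infsum b I * q ^ n)"
   proof (rule ennreal_leI)
    have "((1/2::real) ^ n) powr s = t n * q ^ n"
     unfolding q_def t_def by (simp add: powr_realpow[symmetric] powr_powr powr_add[symmetric] algebra_simps del: powr_realpow)
    then show "real (card (H n)) * ((1/2) ^ n) powr s \<le> 3 * infsum b I * q ^ n"
     using mult_right_mono[OF H(2)[of n], of "q ^ n"] q by (simp add: mult.assoc)
   qed
   finally show ?thesis .
  qed
  show "summable (\<lambda>n. 3 * infsum b I * q ^ n)" using q by (intro summable_mult summable_geometric) auto
  show "0 \<le> 3 * infsum b I * q ^ n" for n using q b by (auto intro!: mult_nonneg_nonneg infsum_nonneg)
  fix N
  show "{y. \<not> (\<lambda>i. b i * \<bar>y - x i\<bar> powr - \<sigma>) summable_on I} \<subseteq> (\<Union>n. B (n + N))"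
  proof (rule subsetI, rule ccontr)
   fix y assume y: "y \<in> {y. \<not> (\<lambda>i. b i * \<bar>y - x i\<bar> powr - \<sigma>) summable_on I}" and nB: "y \<notin> (\<Union>n. B (n + N))"
   have "(\<lambda>i. b i * \<bar>y - x i\<bar> powr - \<sigma>) summable_on I"
   proof (rule potential_summable[OF b \<sigma>(1) s'(1), where N = N])
    fix n assume n: "n \<ge> N"
    have "y \<notin> B n" using nB n by (metis UN_I UNIV_I le_add_diff_inverse2)
    then have le: "infsum b {i\<in>I. \<bar>k n i - \<lfloor>y * 2 ^ n\<rfloor>\<bar> \<le> 1} \<le> t n" by (auto simp: B_def H_def)
    \<comment> \<open>A point closer than \<open>2 ^ - n\<close> lies in the same dyadic interval or
      in a neighbour, which is why heaviness is measured on three intervals.\<close>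
    have sub: "{i\<in>I. \<bar>y - x i\<bar> < (1/2) ^ n} \<subseteq> {i\<in>I. \<bar>k n i - \<lfloor>y * 2 ^ n\<rfloor>\<bar> \<le> 1}"
    proof clarify
     fix i assume "\<bar>y - x i\<bar> < (1/2) ^ n"
     then have "\<bar>y - x i\<bar> * 2 ^ n < 1" by (simp add: power_one_over field_simps)
     then have "\<bar>y * 2 ^ n - x i * 2 ^ n\<bar> < 1" by (simp add: left_diff_distrib[symmetric] abs_mult)
     then show "\<bar>k n i - \<lfloor>y * 2 ^ n\<rfloor>\<bar> \<le> 1" unfolding k_def by linarith
    qed
    have "infsum b {i\<in>I. \<bar>y - x i\<bar> < (1/2) ^ n} \<le> infsum b {i\<in>I. \<bar>k n i - \<lfloor>y * 2 ^ n\<rfloor>\<bar> \<le> 1}"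
     by (rule infsum_mono_neutral) (use sub b in \<open>auto intro: summable_on_subset_banach[OF b(2)]\<close>)
    then show "infsum b {i\<in>I. \<bar>y - x i\<bar> < (1/2) ^ n} \<le> ((1/2) ^ n) powr s'" using le by (simp add: t_def)
   qed
   then show False using y by simp
  qed
 qed
qed

section \<open>Small divisors on binary trees\<close>

datatype bintree = Leaf nat | Node bintree bintree

primrec leaves :: "bintree \<Rightarrow> nat" where
 "leaves (Leaf k) = 1"
| "leaves (Node l r) = leaves l + leaves r"

abbreviation trees :: "nat \<Rightarrow> bintree set" where
 "trees n \<equiv> {t. leaves t \<le> n}"

primrec freq :: "(nat \<Rightarrow> real) \<Rightarrow> bintree \<Rightarrow> real" where
 "freq \<phi> (Leaf k) = \<phi> k"
| "freq \<phi> (Node l r) = freq \<phi> l + freq \<phi> r"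

text \<open>On the mode \<open>exp (- i * freq * x)\<close> the operator
  \<open>d/dx + i \<eta>\<close> acts as multiplication by \<open>i * (\<eta> - freq)\<close>.
  Dividing by this solves, with frozen amplitudes and \<open>\<eta> = 2 * \<kappa>\<close>, the
  linearised Riccati equation: for a term of \<open>V\<close> at a leaf, for minus the product of
  two earlier terms at a node.\<close>

primrec coef :: "(nat \<Rightarrow> complex) \<Rightarrow> (nat \<Rightarrow> real) \<Rightarrow> real \<Rightarrow> bintree \<Rightarrow> complex" where
 "coef c \<phi> \<eta> (Leaf k) = c k / (\<i> * of_real (\<eta> - \<phi> k))"
| "coef c \<phi> \<eta> (Node l r) = - coef c \<phi> \<eta> l * coef c \<phi> \<eta> r / (\<i> * of_real (\<eta> - freq \<phi> (Node l r)))"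

primrec leaf_prod :: "(nat \<Rightarrow> 'a::comm_monoid_mult) \<Rightarrow> bintree \<Rightarrow> 'a" where
 "leaf_prod g (Leaf k) = g k"
| "leaf_prod g (Node l r) = leaf_prod g l * leaf_prod g r"

primrec divisor_prod :: "(nat \<Rightarrow> real) \<Rightarrow> real \<Rightarrow> bintree \<Rightarrow> real" where
 "divisor_prod \<phi> \<eta> (Leaf k) = 1 / \<bar>\<eta> - \<phi> k\<bar>"
| "divisor_prod \<phi> \<eta> (Node l r) = divisor_prod \<phi> \<eta> l * divisor_prod \<phi> \<eta> r / \<bar>\<eta> - freq \<phi> (Node l r)\<bar>"

lemma leaves_pos: "leaves t \<ge> 1"
 by (induction t) auto

lemma leaf_prod_nonneg: "(\<And>k. (g k :: real) \<ge> 0) \<Longrightarrow> leaf_prod g t \<ge> 0"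
 by (induction t) auto

lemma divisor_prod_nonneg: "divisor_prod \<phi> \<eta> t \<ge> 0"
 by (induction t) auto

lemma leaf_prod_powr: "(\<And>k. g k \<ge> 0) \<Longrightarrow> leaf_prod (\<lambda>k. g k powr a) t = (leaf_prod g t :: real) powr a"
 by (induction t) (auto simp: powr_mult leaf_prod_nonneg)

lemma norm_coef: "norm (coef c \<phi> \<eta> t) = leaf_prod (\<lambda>k. norm (c k)) t * divisor_prod \<phi> \<eta> t"
 by (induction t) (simp_all add: norm_mult norm_divide divide_simps flip: of_real_diff of_real_add)

instance bintree :: countable
 by countable_datatype

lemma leaves_le_Suc_subset:
 "n \<ge> 1 \<Longrightarrow> trees (Suc n) \<subseteq> range Leaf \<union> (\<lambda>(l,r). Node l r) ` (trees n \<times> trees n)"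
proof
 fix t assume "n \<ge> 1" "t \<in> trees (Suc n)"
 then show "t \<in> range Leaf \<union> (\<lambda>(l,r). Node l r) ` (trees n \<times> trees n)"
  by (cases t) (use leaves_pos in \<open>auto simp: image_iff intro: Suc_leD dest: le_trans\<close>, (metis Suc_le_mono add.commute add_leD1 leaves_pos le_add_diff_inverse2 plus_1_eq_Suc add_le_cancel_left order_trans)+)
qed

lemma inj_Node: "inj_on (\<lambda>(l,r). Node l r) A"
 by (auto simp: inj_on_def)

lemma summable_on_product_real:
 fixes f :: "'a \<Rightarrow> real" and g :: "'b \<Rightarrow> real"
 assumes f: "f summable_on A" "\<And>x. x \<in> A \<Longrightarrow> f x \<ge> 0" and g: "g summable_on B" "\<And>x. x \<in> B \<Longrightarrow> g x \<ge> 0"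
 shows "(\<lambda>(x,y). f x * g y) summable_on A \<times> B"
proof (rule summable_on_SigmaI)
 show "((\<lambda>y. case (x, y) of (x, y) \<Rightarrow> f x * g y) has_sum f x * infsum g B) B" for x
  using has_sum_cmult_right[OF has_sum_infsum[OF g(1)], of "f x"] by simp
 show "(\<lambda>x. f x * infsum g B) summable_on A" by (rule summable_on_cmult_left[OF f(1)])
qed (use f g in auto)

text \<open>Induction step on the number of leaves: apart from the leaves, trees in
  \<open>trees (Suc n)\<close> split into two trees from \<open>trees n\<close>, so their sum is
  bounded by a product of two sums already known.\<close>

lemma tree_summable_step:
 fixes F G :: "bintree \<Rightarrow> real"
 assumes n: "n \<ge> 1" and G: "G summable_on trees n" "\<And>t. G t \<ge> 0"
  and leaf: "(\<lambda>k. F (Leaf k)) summable_on UNIV"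
  and node: "\<And>l r. F (Node l r) \<le> G l * G r" and F: "\<And>t. F t \<ge> 0"
 shows "F summable_on trees (Suc n)"
proof -
 let ?B = "trees n \<times> trees n"
 have inj: "inj Leaf" by (auto simp: inj_on_def)
 have 1: "F summable_on range Leaf"
  using leaf summable_on_reindex[OF inj, of F] by (simp add: o_def)
 have "(\<lambda>(l,r). F (Node l r)) summable_on ?B"
  by (rule summable_on_comparison_test[OF summable_on_product_real[OF G(1) _ G(1)]]) (use G node F in auto)
 then have 2: "F summable_on (\<lambda>(l,r). Node l r) ` ?B"
  using summable_on_reindex[OF inj_Node[of ?B], of F] by (simp add: o_def case_prod_unfold)
 have "F summable_on (range Leaf \<union> (\<lambda>(l,r). Node l r) ` ?B)"
  by (rule summable_on_Un_disjoint[OF 1 2]) auto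
 then show ?thesis by (rule summable_on_subset_banach) (rule leaves_le_Suc_subset[OF n])
qed

lemma leaves_le_1: "trees 1 = range Leaf"
proof -
 have "leaves (Node l r) \<ge> 2" for l r using leaves_pos[of l] leaves_pos[of r] by simp
 then have "t \<in> range Leaf" if "leaves t \<le> 1" for t
 proof (cases t)
  case (Node l r)
  have "2 \<le> leaves (Node l r)" by fact
  then show ?thesis using that Node by simp
 qed auto
 then show ?thesis by auto
qed

lemma summable_on_leaves: "(\<lambda>k. F (Leaf k)) summable_on UNIV \<longleftrightarrow> F summable_on range Leaf"
 using summable_on_reindex[of Leaf UNIV F] by (simp add: o_def inj_on_def)

lemma leaf_prod_summable:
 fixes b :: "nat \<Rightarrow> real"
 assumes "b summable_on UNIV" "\<And>k. b k \<ge> 0" "n \<ge> 1"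
 shows "leaf_prod b summable_on trees n"
 using assms(3)
proof (induction n rule: dec_induct)
 case base
 then show ?case unfolding leaves_le_1 summable_on_leaves[symmetric] using assms by simp
next
 case (step n)
 show ?case by (rule tree_summable_step[OF step(1) step.IH]) (use assms leaf_prod_nonneg in auto)
qed

text \<open>Young's inequality with the constants dropped: according to whether
  \<open>y \<le> x powr n\<close>, one factor is estimated by a power of the other.\<close>

lemma mult_le_powr_add:
 fixes x y n :: real
 assumes "x \<ge> 0" "y \<ge> 0" "n > 0"
 shows "x * y \<le> x powr (n + 1) + y powr ((n + 1) / n)"
proof (cases "y \<le> x powr n")
 case True
 show ?thesis
 proof (cases "x = 0")
  case False
  have "x * y \<le> x powr 1 * x powr n" using True assms by (intro mult_mono) auto
  also have "\<dots> = x powr (n + 1)" unfolding powr_add[symmetric] by (simp add: add.commute)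
  finally show ?thesis by (simp add: add_increasing2)
 qed simp
next
 case False
 have y: "y > 0" using False powr_ge_zero[of x n] by linarith
 have "x = (x powr n) powr (1 / n)" using assms by (cases "x = 0") (simp_all add: powr_powr)
 also have "\<dots> \<le> y powr (1 / n)" using False assms by (intro powr_mono2) auto
 finally have "x * y \<le> y powr (1 / n) * y powr 1" using assms y by (intro mult_mono) auto
 also have "\<dots> = y powr ((n + 1) / n)"
  unfolding powr_add[symmetric] using assms by (simp add: add_divide_distrib add.commute)
 finally show ?thesis by (simp add: add_increasing)
qed

lemma powr_minus_le_one_add: "0 \<le> a \<Longrightarrow> a \<le> b \<Longrightarrow> 0 \<le> x \<Longrightarrow> x powr - a \<le> 1 + x powr - b" for x :: real
proof -
 assume H: "0 \<le> a" "a \<le> b" "0 \<le> x"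
 show ?thesis
 proof (cases "x \<ge> 1 \<or> x = 0")
  case True
  then have "x powr - a \<le> 1"
  proof
   assume "x \<ge> 1"
   then have "x powr - a \<le> x powr 0" using H by (intro powr_mono) auto
   then show ?thesis using \<open>x \<ge> 1\<close> by simp
  qed simp
  then show ?thesis by (simp add: add_increasing2)
 next
  case False
  then have "x powr - a \<le> x powr - b" using H by (intro powr_mono') auto
  then show ?thesis by simp
 qed
qed

text \<open>The terms are bounded since their powers are summable, so
  \<open>f = f powr a * f powr (1 - a)\<close> is dominated by a multiple of
  \<open>f powr a\<close>.\<close>

lemma summable_on_of_powr:
 fixes f :: "'a \<Rightarrow> real"
 assumes f: "\<And>x. x \<in> A \<Longrightarrow> f x \<ge> 0" and s: "(\<lambda>x. f x powr a) summable_on A" and a: "0 < a" "a \<le> 1"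
 shows "f summable_on A"
proof -
 define S where "S = infsum (\<lambda>x. f x powr a) A"
 define C where "C = (S powr (1 / a)) powr (1 - a)"
 show ?thesis
 proof (rule summable_on_comparison_test[OF summable_on_cmult_left[OF s, of C]])
  fix x assume x: "x \<in> A"
  have "f x powr a \<le> S"
   using finite_sum_le_infsum[OF s, of "{x}"] x by (simp add: S_def)
  then have "(f x powr a) powr (1 / a) \<le> S powr (1 / a)" using a by (intro powr_mono2) auto
  then have "f x \<le> S powr (1 / a)" using f[OF x] a by (simp add: powr_powr)
  then have "f x powr (1 - a) \<le> C" unfolding C_def using f[OF x] a by (intro powr_mono2) auto
  then have "f x powr a * f x powr (1 - a) \<le> f x powr a * C" by (intro mult_left_mono) auto
  then show "f x \<le> f x powr a * C" using f[OF x] by (simp add: powr_add[symmetric])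
 qed (use f in auto)
qed

text \<open>A product of small divisors over the nodes of a tree with \<open>n\<close> leaves is split by
 \<open>x y \<le> x^n + y^(n/(n-1))\<close> at the root. In this way no divisor ever appears to a power exceeding \<open>\<sigma>\<close>
 although the tree has \<open>2 n - 1\<close> nodes.\<close>
lemma divisor_prod_summable:
 fixes b \<phi> :: "nat \<Rightarrow> real"
 assumes b: "b summable_on UNIV" "\<And>k. b k \<ge> 0"
  and pot: "(\<lambda>t. leaf_prod b t * \<bar>\<eta> - freq \<phi> t\<bar> powr - \<sigma>) summable_on trees M"
  and n: "1 \<le> n" "n \<le> M" and s: "0 \<le> s" "real n * s \<le> \<sigma>"
 shows "(\<lambda>t. leaf_prod b t * divisor_prod \<phi> \<eta> t powr s) summable_on trees n"
 using n s
proof (induction n arbitrary: s rule: dec_induct)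
 case base
 have "(\<lambda>k. b k * (1 + \<bar>\<eta> - \<phi> k\<bar> powr - \<sigma>)) summable_on UNIV"
 proof -
  have "(\<lambda>t. leaf_prod b t * \<bar>\<eta> - freq \<phi> t\<bar> powr - \<sigma>) summable_on range Leaf"
   by (rule summable_on_subset_banach[OF pot]) (use base in auto)
  then have "(\<lambda>k. b k * \<bar>\<eta> - \<phi> k\<bar> powr - \<sigma>) summable_on UNIV"
   unfolding summable_on_leaves[symmetric] by simp
  then have "(\<lambda>k. b k + b k * \<bar>\<eta> - \<phi> k\<bar> powr - \<sigma>) summable_on UNIV" by (rule summable_on_add[OF b(1)])
  then show ?thesis by (simp add: algebra_simps)
 qed
 then have "(\<lambda>k. b k * (1 / \<bar>\<eta> - \<phi> k\<bar>) powr s) summable_on UNIV"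
 proof (rule summable_on_comparison_test)
  fix k
  have "(1 / \<bar>\<eta> - \<phi> k\<bar>) powr s = \<bar>\<eta> - \<phi> k\<bar> powr - s" by (simp add: powr_divide powr_minus_divide)
  then show "b k * (1 / \<bar>\<eta> - \<phi> k\<bar>) powr s \<le> b k * (1 + \<bar>\<eta> - \<phi> k\<bar> powr - \<sigma>)"
   using powr_minus_le_one_add[of s \<sigma> "\<bar>\<eta> - \<phi> k\<bar>"] base b by (intro mult_left_mono) auto
 qed (use b in auto)
 then show ?case unfolding leaves_le_1 summable_on_leaves[symmetric] by simp
next
 case (step n)
 \<comment> \<open>The exponent left for the subtrees by the splitting at the root. Since
   \<open>n * s' = (n + 1) * s\<close>, the hypothesis on the exponent reproduces itself with the
   same \<open>\<sigma>\<close>.\<close>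
 define s' where "s' = s * (real n + 1) / real n"
 have n: "real n > 0" using step by simp
 have sn: "s * (real n + 1) \<le> \<sigma>" using step by (simp add: algebra_simps)
 have s': "s' \<ge> 0" "real n * s' \<le> \<sigma>" using step n sn by (simp_all add: s'_def)
 define G where "G t = leaf_prod b t * divisor_prod \<phi> \<eta> t powr s'" for t
 define Q where "Q t = leaf_prod b t * (1 + \<bar>\<eta> - freq \<phi> t\<bar> powr - \<sigma>)" for t
 \<comment> \<open>The excess over the summable \<open>Q\<close>, truncated at 0: on nodes it is
   bounded by \<open>G l * G r\<close> alone, the form that \<open>tree_summable_step\<close> asks
   for.\<close>
 define F where "F t = max 0 (leaf_prod b t * divisor_prod \<phi> \<eta> t powr s - Q t)" for t
 have bp: "leaf_prod b t \<ge> 0" for t using leaf_prod_nonneg b by auto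
 have G: "G summable_on trees n" unfolding G_def using step.IH[of s'] step s' by simp
 have Q: "Q summable_on trees (Suc n)"
 proof -
  have "leaf_prod b summable_on trees (Suc n)" by (rule leaf_prod_summable[OF b]) simp
  moreover have "(\<lambda>t. leaf_prod b t * \<bar>\<eta> - freq \<phi> t\<bar> powr - \<sigma>) summable_on trees (Suc n)"
   by (rule summable_on_subset_banach[OF pot]) (use step in auto)
  ultimately have "(\<lambda>t. leaf_prod b t + leaf_prod b t * \<bar>\<eta> - freq \<phi> t\<bar> powr - \<sigma>) summable_on trees (Suc n)"
   by (rule summable_on_add)
  then show ?thesis unfolding Q_def by (simp add: algebra_simps)
 qed
 have key: "leaf_prod b t * divisor_prod \<phi> \<eta> t powr s \<le> Q t + G l * G r" if t: "t = Node l r" for t l r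
 proof -
  define d where "d = \<bar>\<eta> - freq \<phi> t\<bar>"
  let ?P = "divisor_prod \<phi> \<eta> l * divisor_prod \<phi> \<eta> r"
  have P0: "?P \<ge> 0" by (simp add: divisor_prod_nonneg)
  have "divisor_prod \<phi> \<eta> t powr s = d powr - s * ?P powr s"
   using divisor_prod_nonneg by (simp add: t d_def powr_divide powr_minus_divide)
  also have "\<dots> \<le> (d powr - s) powr (real n + 1) + (?P powr s) powr ((real n + 1) / real n)"
   by (rule mult_le_powr_add) (use n in auto)
  also have "\<dots> = d powr - (s * (real n + 1)) + ?P powr s'"
   by (simp add: powr_powr s'_def)
  also have "\<dots> \<le> (1 + d powr - \<sigma>) + divisor_prod \<phi> \<eta> l powr s' * divisor_prod \<phi> \<eta> r powr s'"
   using powr_minus_le_one_add[of "s * (real n + 1)" \<sigma> d] sn step divisor_prod_nonneg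
   by (simp add: powr_mult d_def)
  finally have "leaf_prod b t * divisor_prod \<phi> \<eta> t powr s \<le>
    leaf_prod b t * ((1 + d powr - \<sigma>) + divisor_prod \<phi> \<eta> l powr s' * divisor_prod \<phi> \<eta> r powr s')"
   using bp by (intro mult_left_mono) auto
  then show ?thesis by (simp add: Q_def G_def d_def t algebra_simps)
 qed
 have "(\<lambda>t. leaf_prod b t * divisor_prod \<phi> \<eta> t powr s) summable_on range Leaf"
 proof -
  have "(\<lambda>t. leaf_prod b t * divisor_prod \<phi> \<eta> t powr s) summable_on trees n"
   using step.IH[of s] step by (simp add: algebra_simps)
  then show ?thesis by (rule summable_on_subset_banach) (use step in auto)
 qed
 moreover have "F (Leaf k) \<le> leaf_prod b (Leaf k) * divisor_prod \<phi> \<eta> (Leaf k) powr s" for k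
  using bp[of "Leaf k"] unfolding F_def Q_def by (auto simp del: leaf_prod.simps divisor_prod.simps)
 ultimately have Fl: "(\<lambda>k. F (Leaf k)) summable_on UNIV"
  unfolding summable_on_leaves by (rule_tac summable_on_comparison_test) (auto simp: F_def)
 have "F summable_on trees (Suc n)"
 proof (rule tree_summable_step[OF _ G _ Fl])
  show "F (Node l r) \<le> G l * G r" for l r
   using key[of "Node l r" l r] bp unfolding F_def by (auto simp: G_def)
 qed (use step bp in \<open>auto simp: G_def F_def\<close>)
 then have "(\<lambda>t. Q t + F t) summable_on trees (Suc n)" by (intro summable_on_add Q)
 then show ?case
  by (rule summable_on_comparison_test) (use bp in \<open>auto simp: F_def\<close>)
qed

text \<open>With \<open>s = \<alpha>\<close> and \<open>\<sigma> = M * \<alpha>\<close> the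
  preceding estimate sums the \<open>\<alpha>\<close>-th powers of the coefficients; as
  \<open>\<alpha> \<le> 1\<close>, the coefficients follow. This is where the order
  \<open>M * \<alpha>\<close> of the potential, and thereby the dimension bound, comes from.\<close>

lemma coef_summable:
 fixes c :: "nat \<Rightarrow> complex" and \<phi> :: "nat \<Rightarrow> real"
 assumes b: "(\<lambda>k. norm (c k) powr \<alpha>) summable_on UNIV" and \<alpha>: "0 < \<alpha>" "\<alpha> \<le> 1" and M: "M \<ge> 1"
  and pot: "(\<lambda>t. leaf_prod (\<lambda>k. norm (c k) powr \<alpha>) t * \<bar>\<eta> - freq \<phi> t\<bar> powr - (real M * \<alpha>)) summable_on trees M"
 shows "(\<lambda>t. norm (coef c \<phi> \<eta> t)) summable_on trees M"
proof (rule summable_on_of_powr[OF _ _ \<alpha>])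
 have "norm (coef c \<phi> \<eta> t) powr \<alpha> = leaf_prod (\<lambda>k. norm (c k) powr \<alpha>) t * divisor_prod \<phi> \<eta> t powr \<alpha>" for t
  by (simp add: norm_coef powr_mult leaf_prod_nonneg divisor_prod_nonneg leaf_prod_powr)
 moreover have "(\<lambda>t. leaf_prod (\<lambda>k. norm (c k) powr \<alpha>) t * divisor_prod \<phi> \<eta> t powr \<alpha>) summable_on trees M"
  by (rule divisor_prod_summable[OF b _ pot M]) (use \<alpha> in auto)
 ultimately show "(\<lambda>t. norm (coef c \<phi> \<eta> t) powr \<alpha>) summable_on trees M" by simp
qed simp

section \<open>Differentiating and estimating sums over trees\<close>

lemma has_sum_product_abs:
 fixes f :: "'a \<Rightarrow> 'c::{real_normed_field,banach}" and g :: "'b \<Rightarrow> 'c"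
 assumes f: "(\<lambda>x. norm (f x)) summable_on A" and g: "(\<lambda>x. norm (g x)) summable_on B"
 shows "((\<lambda>(x,y). f x * g y) has_sum infsum f A * infsum g B) (A \<times> B)"
proof -
 have "(\<lambda>(x,y). norm (f x) * norm (g y)) summable_on A \<times> B"
  by (rule summable_on_product_real[OF f _ g]) auto
 then have "(\<lambda>p. norm ((\<lambda>(x,y). f x * g y) p)) summable_on A \<times> B"
  by (simp add: case_prod_unfold norm_mult)
 then have s: "(\<lambda>(x,y). f x * g y) summable_on A \<times> B" by (rule abs_summable_summable)
 have "infsum (\<lambda>(x,y). f x * g y) (A \<times> B) = infsum (\<lambda>x. infsum (\<lambda>y. f x * g y) B) A"
  using infsum_Sigma'_banach[OF s] by simp
 also have "\<dots> = infsum f A * infsum g B"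
  by (simp add: infsum_cmult_right' infsum_cmult_left')
 finally show ?thesis using has_sum_infsum[OF s] by simp
qed

text \<open>Obtained by integration: the sum of the derivatives converges uniformly and is
  continuous, its integral is the increment of the sum, and that integral is then
  differentiated.\<close>

lemma infsum_has_vector_derivative:
 fixes f f' :: "'i \<Rightarrow> real \<Rightarrow> complex"
 assumes d: "\<And>t x. t \<in> J \<Longrightarrow> x \<in> {a<..<b} \<Longrightarrow> (f t has_vector_derivative f' t x) (at x)"
  and c: "\<And>t. t \<in> J \<Longrightarrow> continuous_on {a<..<b} (f' t)"
  and A: "\<And>t x. t \<in> J \<Longrightarrow> x \<in> {a<..<b} \<Longrightarrow> norm (f t x) \<le> A t" "A summable_on J"
  and B: "\<And>t x. t \<in> J \<Longrightarrow> x \<in> {a<..<b} \<Longrightarrow> norm (f' t x) \<le> B t" "B summable_on J"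
  and x: "x \<in> {a<..<b}"
 shows "((\<lambda>x. infsum (\<lambda>t. f t x) J) has_vector_derivative infsum (\<lambda>t. f' t x) J) (at x)"
  and "isCont (\<lambda>x. infsum (\<lambda>t. f' t x) J) x"
proof -
 let ?F = "\<lambda>x. infsum (\<lambda>t. f t x) J" and ?D = "\<lambda>x. infsum (\<lambda>t. f' t x) J"
 have ulD: "uniform_limit {a<..<b} (\<lambda>X y. \<Sum>t\<in>X. f' t y) ?D (finite_subsets_at_top J)"
  by (rule Weierstrass_m_test_general[OF B])
 have ulF: "uniform_limit {a<..<b} (\<lambda>X y. \<Sum>t\<in>X. f t y) ?F (finite_subsets_at_top J)"
  by (rule Weierstrass_m_test_general[OF A])
 have evJ: "eventually (\<lambda>X. finite X \<and> X \<subseteq> J) (finite_subsets_at_top J)"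
  by (rule eventually_finite_subsets_at_top_weakI) auto
 have Dc: "continuous_on {a<..<b} ?D"
 proof (rule uniform_limit_theorem[OF _ ulD])
  show "eventually (\<lambda>X. continuous_on {a<..<b} (\<lambda>y. \<Sum>t\<in>X. f' t y)) (finite_subsets_at_top J)"
   using evJ by eventually_elim (auto intro!: continuous_on_sum c)
 qed simp
 then show "isCont ?D x" using x by (simp add: continuous_on_eq_continuous_at)
 obtain c0 d0 where cd: "a < c0" "c0 < x" "x < d0" "d0 < b" using x dense[of a x] dense[of x b] by auto
 have sub: "{c0..y} \<subseteq> {a<..<b}" if "y \<in> {c0..d0}" for y using that cd by auto
 have hi: "(?D has_integral ?F y - ?F c0) {c0..y}" if y: "y \<in> {c0..d0}" for y
 proof -
  have icY: "(\<lambda>y. \<Sum>t\<in>X. f' t y) integrable_on {c0..y}" if "finite X \<and> X \<subseteq> J" for X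
   by (rule integrable_continuous_real) (use that in \<open>auto intro!: continuous_on_sum intro: continuous_on_subset[OF c sub[OF y]]\<close>)
  have hX: "((\<lambda>y. \<Sum>t\<in>X. f' t y) has_integral (\<Sum>t\<in>X. f t y) - (\<Sum>t\<in>X. f t c0)) {c0..y}" if X: "finite X \<and> X \<subseteq> J" for X
  proof (rule fundamental_theorem_of_calculus)
   fix s assume "s \<in> {c0..y}"
   then have "s \<in> {a<..<b}" using sub[OF y] by blast
   then have "((\<lambda>y. \<Sum>t\<in>X. f t y) has_vector_derivative (\<Sum>t\<in>X. f' t s)) (at s)"
    using X by (intro has_vector_derivative_sum d) auto
   then show "((\<lambda>y. \<Sum>t\<in>X. f t y) has_vector_derivative (\<Sum>t\<in>X. f' t s)) (at s within {c0..y})"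
    by (rule has_vector_derivative_at_within)
  qed (use y in simp)
  \<comment> \<open>Set to 0 on index sets that are not finite subsets of \<open>J\<close>, because
    the theorem on integrals of uniform limits asks for continuity at every index.\<close>
  define g where "g X s = (if finite X \<and> X \<subseteq> J then \<Sum>t\<in>X. f' t s else 0)" for X s
  have gc: "continuous_on {c0..y} (g X)" for X
  proof (cases "finite X \<and> X \<subseteq> J")
   case True
   then have "g X = (\<lambda>s. \<Sum>t\<in>X. f' t s)" by (auto simp: g_def)
   then show ?thesis
    by (simp only:) (intro continuous_on_sum continuous_on_subset[OF c sub[OF y]]; use True in blast)
  next
   case False
   then have "g X = (\<lambda>s. 0)" by (intro ext) (simp only: g_def if_False)
   then show ?thesis by simp
  qed
  have "uniform_limit {c0..y} g ?D (finite_subsets_at_top J)"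
  proof (rule uniform_limit_on_subset[OF _ sub[OF y]])
   have "eventually (\<lambda>X. \<forall>s\<in>{a<..<b}. g X s = (\<Sum>t\<in>X. f' t s)) (finite_subsets_at_top J)"
    using evJ by eventually_elim (simp add: g_def)
   then show "uniform_limit {a<..<b} g ?D (finite_subsets_at_top J)"
    using ulD by (subst uniform_limit_cong) auto
  qed
  from uniform_limit_integral[OF this gc finite_subsets_at_top_neq_bot]
  obtain I L where IL: "\<And>X. (g X has_integral I X) {c0..y}" "(?D has_integral L) {c0..y}" "(I \<longlongrightarrow> L) (finite_subsets_at_top J)" by metis
  have "eventually (\<lambda>X. I X = (\<Sum>t\<in>X. f t y) - (\<Sum>t\<in>X. f t c0)) (finite_subsets_at_top J)"
   using evJ
  proof eventually_elim
   case (elim X)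
   then have gX: "g X = (\<lambda>s. \<Sum>t\<in>X. f' t s)" by (auto simp: g_def)
   show ?case by (rule has_integral_unique[OF IL(1)[of X, unfolded gX] hX[OF elim]])
  qed
  then have "((\<lambda>X. (\<Sum>t\<in>X. f t y) - (\<Sum>t\<in>X. f t c0)) \<longlongrightarrow> L) (finite_subsets_at_top J)"
   using IL(3) by (rule Lim_transform_eventually[rotated])
  moreover have "((\<lambda>X. (\<Sum>t\<in>X. f t y) - (\<Sum>t\<in>X. f t c0)) \<longlongrightarrow> ?F y - ?F c0) (finite_subsets_at_top J)"
   by (intro tendsto_diff tendsto_uniform_limitI[OF ulF]) (use y cd in auto)
  ultimately have "L = ?F y - ?F c0" using tendsto_unique[OF finite_subsets_at_top_neq_bot] by blast
  then show ?thesis using IL(2) by simp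
 qed
 have dc: "d0 \<in> {c0..d0}" using cd by auto
 have "((\<lambda>y. integral {c0..y} ?D) has_vector_derivative ?D x) (at x)"
  by (rule primitive_has_vector_derivative[OF has_integral_integrable[OF hi[OF dc]]]) (use cd \<open>isCont ?D x\<close> in auto)
 then have "((\<lambda>y. ?F c0 + integral {c0..y} ?D) has_vector_derivative 0 + ?D x) (at x)"
  by (intro has_vector_derivative_add has_vector_derivative_const)
 then have "((\<lambda>y. ?F c0 + integral {c0..y} ?D) has_vector_derivative ?D x) (at x)" by simp
 then show "(?F has_vector_derivative ?D x) (at x)"
 proof (rule has_vector_derivative_transform_within_open[of _ _ _ "{c0<..<d0}"])
  show "?F c0 + integral {c0..y} ?D = ?F y" if "y \<in> {c0<..<d0}" for y
   using integral_unique[OF hi[of y]] that by simp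
 qed (use cd in auto)
qed

text \<open>Carries one error per leaf: changing or differentiating a product over the leaves costs,
  up to a power of the bound, the sum of the errors of its factors.\<close>

primrec leaf_sum :: "(nat \<Rightarrow> real) \<Rightarrow> bintree \<Rightarrow> real" where
 "leaf_sum s (Leaf k) = s k"
| "leaf_sum s (Node l r) = leaf_sum s l + leaf_sum s r"

primrec leaf_prod_deriv :: "(nat \<Rightarrow> complex) \<Rightarrow> (nat \<Rightarrow> complex) \<Rightarrow> bintree \<Rightarrow> complex" where
 "leaf_prod_deriv g d (Leaf k) = d k"
| "leaf_prod_deriv g d (Node l r) = leaf_prod_deriv g d l * leaf_prod g r + leaf_prod g l * leaf_prod_deriv g d r"

lemma leaf_sum_nonneg: "(\<And>k. s k \<ge> 0) \<Longrightarrow> leaf_sum s t \<ge> 0"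
 by (induction t) auto

lemma leaf_sum_le: "(\<And>k. s k \<le> B) \<Longrightarrow> leaf_sum s t \<le> real (leaves t) * B"
 by (induction t) (auto simp: algebra_simps intro: add_mono)

lemma sum_leaf_sum: "(\<Sum>n<N. leaf_sum (\<lambda>k. s k n) t) = leaf_sum (\<lambda>k. \<Sum>n<N. s k n) t"
 by (induction t) (auto simp: sum.distrib)

lemma norm_leaf_prod_le: "(\<And>k. norm (g k) \<le> B) \<Longrightarrow> norm (leaf_prod g t :: complex) \<le> B ^ leaves t"
proof (induction t)
 case (Node l r)
 have "B \<ge> 0" using Node.prems[of 0] norm_ge_zero order_trans by blast
 then show ?case using Node by (simp add: norm_mult power_add mult_mono)
qed simp

lemma norm_leaf_prod_diff_le:
 assumes "\<And>k. norm (g k) \<le> B" "\<And>k. norm (h k) \<le> B" "\<And>k. norm (g k - h k) \<le> s k" "B \<ge> 1"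
 shows "norm (leaf_prod g t - leaf_prod h t :: complex) \<le> B ^ leaves t * leaf_sum s t"
proof (induction t)
 case (Leaf k)
 have "s k \<ge> 0" using assms(3)[of k] norm_ge_zero order_trans by blast
 then have "1 * s k \<le> B * s k" using assms(4) by (intro mult_right_mono)
 then show ?case using assms(3)[of k] by simp
next
 case (Node l r)
 have s0: "s k \<ge> 0" for k using assms(3)[of k] norm_ge_zero order_trans by blast
 have ls0: "leaf_sum s t \<ge> 0" for t by (rule leaf_sum_nonneg[OF s0])
 have "leaf_prod g (Node l r) - leaf_prod h (Node l r) = (leaf_prod g l - leaf_prod h l) * leaf_prod g r + leaf_prod h l * (leaf_prod g r - leaf_prod h r)"
  by (simp add: algebra_simps)
 then have "norm (leaf_prod g (Node l r) - leaf_prod h (Node l r)) \<le> norm (leaf_prod g l - leaf_prod h l) * norm (leaf_prod g r) + norm (leaf_prod h l) * norm (leaf_prod g r - leaf_prod h r)"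
  by (metis norm_mult norm_triangle_ineq)
 also have "\<dots> \<le> (B ^ leaves l * leaf_sum s l) * B ^ leaves r + B ^ leaves l * (B ^ leaves r * leaf_sum s r)"
  using Node norm_leaf_prod_le[of g B r] norm_leaf_prod_le[of h B l] assms(1,2,4) ls0 by (intro add_mono mult_mono) auto
 also have "\<dots> = B ^ leaves (Node l r) * leaf_sum s (Node l r)" by (simp add: power_add algebra_simps)
 finally show ?case .
qed

lemma norm_leaf_prod_deriv_le:
 assumes "\<And>k. norm (g k) \<le> B" "\<And>k. norm (d k) \<le> s k" "B \<ge> 1"
 shows "norm (leaf_prod_deriv g d t) \<le> B ^ leaves t * leaf_sum s t"
proof (induction t)
 case (Leaf k)
 have "s k \<ge> 0" using assms(2)[of k] norm_ge_zero order_trans by blast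
 then have "1 * s k \<le> B * s k" using assms(3) by (intro mult_right_mono)
 then show ?case using assms(2)[of k] by simp
next
 case (Node l r)
 have s0: "s k \<ge> 0" for k using assms(2)[of k] norm_ge_zero order_trans by blast
 have ls0: "leaf_sum s t \<ge> 0" for t by (rule leaf_sum_nonneg[OF s0])
 have "norm (leaf_prod_deriv g d (Node l r)) \<le> norm (leaf_prod_deriv g d l) * norm (leaf_prod g r) + norm (leaf_prod g l) * norm (leaf_prod_deriv g d r)"
  unfolding leaf_prod_deriv.simps by (metis norm_mult norm_triangle_ineq)
 also have "\<dots> \<le> (B ^ leaves l * leaf_sum s l) * B ^ leaves r + B ^ leaves l * (B ^ leaves r * leaf_sum s r)"
  using Node norm_leaf_prod_le[of g B r] norm_leaf_prod_le[of g B l] assms(1,3) ls0 by (intro add_mono mult_mono) auto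
 also have "\<dots> = B ^ leaves (Node l r) * leaf_sum s (Node l r)" by (simp add: power_add algebra_simps)
 finally show ?case .
qed

lemma leaf_prod_has_vector_derivative:
 assumes "\<And>k. ((\<lambda>x. g k x) has_vector_derivative d k) (at x)"
 shows "((\<lambda>x. leaf_prod (\<lambda>k. g k x) t) has_vector_derivative leaf_prod_deriv (\<lambda>k. g k x) d t) (at x)"
proof (induction t)
 case (Node l r)
 from has_vector_derivative_mult[OF Node] show ?case by (simp add: add.commute)
qed (use assms in simp)

lemma leaf_prod_continuous_on:
 fixes g :: "nat \<Rightarrow> real \<Rightarrow> complex"
 assumes "\<And>k. continuous_on S (g k)" shows "continuous_on S (\<lambda>x. leaf_prod (\<lambda>k. g k x) t)"
 by (induction t) (auto intro!: continuous_intros assms)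

lemma leaf_prod_deriv_continuous_on:
 fixes g d :: "nat \<Rightarrow> real \<Rightarrow> complex"
 assumes "\<And>k. continuous_on S (g k)" "\<And>k. continuous_on S (d k)"
 shows "continuous_on S (\<lambda>x. leaf_prod_deriv (\<lambda>k. g k x) (\<lambda>k. d k x) t)"
 by (induction t) (auto intro!: continuous_intros assms leaf_prod_continuous_on)

lemma leaf_prod_tendsto_0:
 fixes g :: "nat \<Rightarrow> real \<Rightarrow> complex"
 assumes "\<And>k. (g k \<longlongrightarrow> 0) F" shows "((\<lambda>x. leaf_prod (\<lambda>k. g k x) t) \<longlongrightarrow> 0) F"
proof (induction t)
 case (Node l r)
 from tendsto_mult[OF Node] show ?case by simp
qed (use assms in simp)

text \<open>\<open>T k\<close> abstracts the variation of \<open>\<gamma> k\<close> on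
  \<open>(0, x]\<close>: monotone, bounded and controlling increments. With \<open>C \<ge> 1\<close>
  every power of \<open>C\<close> is bounded by the higher ones.\<close>

locale bv_amplitudes =
 fixes \<gamma> :: "nat \<Rightarrow> real \<Rightarrow> complex" and T :: "nat \<Rightarrow> real \<Rightarrow> real" and C :: real
 assumes C1: "C \<ge> 1" and T_mono: "\<And>k x y. x \<le> y \<Longrightarrow> T k x \<le> T k y"
  and T_bounds: "\<And>k x. 0 \<le> T k x" "\<And>k x. T k x \<le> C"
  and T_var: "\<And>k x y. 0 < x \<Longrightarrow> x \<le> y \<Longrightarrow> norm (\<gamma> k y - \<gamma> k x) \<le> T k y - T k x"
  and \<gamma>_bound: "\<And>k x. 0 < x \<Longrightarrow> norm (\<gamma> k x) \<le> C"
  and \<gamma>_lim: "\<And>k. (\<gamma> k \<longlongrightarrow> 0) at_top"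
begin

text \<open>Two units long, because on the cell \<open>[n, n + 1]\<close> the smoothed amplitude
  interpolates between the values at \<open>n + 1\<close> and \<open>n + 2\<close>.\<close>

definition "osc k n = T k (real n + 2) - T k (real n)"

definition "slope k n = \<gamma> k (real n + 2) - \<gamma> k (real n + 1)"

text \<open>The amplitude is replaced by the piecewise linear function through the points \<open>(n, \<gamma> (n + 1))\<close>;
 the shift by one avoids the endpoint 0.\<close>
definition "smooth k x = \<gamma> k (real (nat \<lfloor>x\<rfloor>) + 1) + of_real (x - real (nat \<lfloor>x\<rfloor>)) * slope k (nat \<lfloor>x\<rfloor>)"

lemma osc_nonneg: "osc k n \<ge> 0"
 unfolding osc_def using T_mono[of "real n" "real n + 2" k] by simp

lemma osc_le: "osc k n \<le> C"
 unfolding osc_def using T_bounds(2)[of k "real n + 2"] T_bounds(1)[of k "real n"] by linarith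

text \<open>Consecutive cells overlap in one unit, so the sum telescopes to two values of
  \<open>T k\<close>, uniformly in \<open>k\<close>.\<close>

lemma sum_osc_le: "(\<Sum>n<N. osc k n) \<le> 2 * C"
proof -
 have "(\<Sum>n<N. osc k n) = T k (real N + 1) + T k (real N) - T k 1 - T k 0"
  by (induction N) (simp_all add: osc_def algebra_simps)
 then show ?thesis using T_bounds(2)[of k "real N + 1"] T_bounds(2)[of k "real N"] T_bounds(1)[of k 1] T_bounds(1)[of k 0] by linarith
qed

lemma norm_slope_le: "norm (slope k n) \<le> osc k n"
 unfolding slope_def osc_def using T_var[of "real n + 1" "real n + 2" k] T_mono[of "real n" "real n + 1" k] by simp

lemma smooth_eq:
 assumes "real n \<le> x" "x \<le> real n + 1"
 shows "smooth k x = \<gamma> k (real n + 1) + of_real (x - real n) * slope k n"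
proof (cases "x = real n + 1")
 case True
 then have "nat \<lfloor>x\<rfloor> = n + 1" by linarith
 then show ?thesis using True by (simp add: smooth_def slope_def add.commute)
next
 case False
 then have "nat \<lfloor>x\<rfloor> = n" using assms by linarith
 then show ?thesis by (simp add: smooth_def)
qed

lemma floor_bounds: "x \<ge> 0 \<Longrightarrow> real (nat \<lfloor>x\<rfloor>) \<le> x \<and> x < real (nat \<lfloor>x\<rfloor>) + 1"
 by linarith

lemma smooth_convex:
 assumes "x \<ge> 0"
 obtains s n where "n = nat \<lfloor>x\<rfloor>" "0 \<le> s" "s \<le> 1" "smooth k x = of_real (1 - s) * \<gamma> k (real n + 1) + of_real s * \<gamma> k (real n + 2)"
proof (rule that[of "nat \<lfloor>x\<rfloor>" "x - real (nat \<lfloor>x\<rfloor>)"])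
 show "smooth k x = of_real (1 - (x - real (nat \<lfloor>x\<rfloor>))) * \<gamma> k (real (nat \<lfloor>x\<rfloor>) + 1) + of_real (x - real (nat \<lfloor>x\<rfloor>)) * \<gamma> k (real (nat \<lfloor>x\<rfloor>) + 2)"
  by (simp add: smooth_def slope_def algebra_simps)
qed (use floor_bounds[OF assms] in linarith)+

lemma norm_smooth_sub_le:
 assumes x: "x \<ge> 0" and n: "n = nat \<lfloor>x\<rfloor>" and b: "norm (\<gamma> k (real n + 1) - z) \<le> b" "norm (\<gamma> k (real n + 2) - z) \<le> b"
 shows "norm (smooth k x - z) \<le> b"
proof -
 obtain s m where s: "m = nat \<lfloor>x\<rfloor>" "0 \<le> s" "s \<le> 1" "smooth k x = of_real (1 - s) * \<gamma> k (real m + 1) + of_real s * \<gamma> k (real m + 2)"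
  using smooth_convex[OF x] by metis
 have "smooth k x - z = of_real (1 - s) * (\<gamma> k (real n + 1) - z) + of_real s * (\<gamma> k (real n + 2) - z)"
  using s n by (simp add: algebra_simps)
 then have "norm (smooth k x - z) \<le> (1 - s) * norm (\<gamma> k (real n + 1) - z) + s * norm (\<gamma> k (real n + 2) - z)"
  using s by (metis abs_of_nonneg diff_ge_0_iff_ge norm_mult norm_of_real norm_triangle_ineq)
 also have "\<dots> \<le> (1 - s) * b + s * b" using s b by (intro add_mono mult_left_mono) auto
 finally show ?thesis by (simp add: algebra_simps)
qed

lemma norm_smooth_le: "x \<ge> 0 \<Longrightarrow> norm (smooth k x) \<le> C"
proof -
 assume x: "x \<ge> 0"
 have "norm (smooth k x - 0) \<le> C"
 proof (rule norm_smooth_sub_le[OF x refl])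
  have p: "0 < real (nat \<lfloor>x\<rfloor>) + 1" "0 < real (nat \<lfloor>x\<rfloor>) + 2" by (intro add_nonneg_pos; simp)+
  show "norm (\<gamma> k (real (nat \<lfloor>x\<rfloor>) + 1) - 0) \<le> C" "norm (\<gamma> k (real (nat \<lfloor>x\<rfloor>) + 2) - 0) \<le> C"
   using \<gamma>_bound[OF p(1), of k] \<gamma>_bound[OF p(2), of k] by (simp_all only: diff_zero)
 qed
 then show ?thesis by simp
qed

lemma norm_smooth_diff_le:
 assumes "x > 0" shows "norm (smooth k x - \<gamma> k x) \<le> osc k (nat \<lfloor>x\<rfloor>)"
proof (rule norm_smooth_sub_le[OF _ refl])
 let ?n = "nat \<lfloor>x\<rfloor>"
 have x: "real ?n \<le> x" "x \<le> real ?n + 1" using floor_bounds[of x] assms by auto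
 have "T k (real ?n) \<le> T k x" by (rule T_mono[OF x(1)])
 moreover have "norm (\<gamma> k (real ?n + 1) - \<gamma> k x) \<le> T k (real ?n + 1) - T k x" by (rule T_var[OF assms x(2)])
 moreover have "norm (\<gamma> k (real ?n + 2) - \<gamma> k x) \<le> T k (real ?n + 2) - T k x" by (rule T_var[OF assms]) (rule order_trans[OF x(2)], simp)
 moreover have "T k (real ?n + 1) \<le> T k (real ?n + 2)" by (rule T_mono) simp
 ultimately show "norm (\<gamma> k (real ?n + 1) - \<gamma> k x) \<le> osc k ?n" "norm (\<gamma> k (real ?n + 2) - \<gamma> k x) \<le> osc k ?n"
  unfolding osc_def by linarith+
qed (use assms in simp)

lemma smooth_continuous_on: "continuous_on {0..} (smooth k)"
proof (rule continuous_on_halfline)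
 fix b :: real assume "b > 0"
 have piece: "continuous_on {real n..real n + 1} (smooth k)" for n
 proof -
  have "continuous_on {real n..real n + 1} (\<lambda>x. \<gamma> k (real n + 1) + of_real (x - real n) * slope k n)" by (intro continuous_intros)
  then show ?thesis by (rule continuous_on_eq) (rule smooth_eq[symmetric]; simp)
 qed
 have "continuous_on {0..real N} (smooth k)" for N
 proof (induction N)
  case (Suc N)
  have "{0..real (Suc N)} = {0..real N} \<union> {real N..real N + 1}" by auto
  then show ?case using continuous_on_closed_Un[OF _ _ Suc piece[of N]] by simp
 qed simp
 moreover obtain N :: nat where "b \<le> real N" using real_arch_simple by blast
 ultimately show "continuous_on {0..b} (smooth k)" by (meson atLeastatMost_subset_iff continuous_on_subset order_refl)
qed

lemma smooth_deriv:
 assumes "real n < x" "x < real n + 1" shows "(smooth k has_vector_derivative slope k n) (at x)"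
proof -
 have "((\<lambda>x. \<gamma> k (real n + 1) + of_real (x - real n) * slope k n) has_vector_derivative 0 + of_real (1 - 0) * slope k n) (at x)"
  by (intro has_vector_derivative_add has_vector_derivative_const has_vector_derivative_mult_left has_vector_derivative_of_real DERIV_diff DERIV_ident DERIV_const)
 then have "((\<lambda>x. \<gamma> k (real n + 1) + of_real (x - real n) * slope k n) has_vector_derivative slope k n) (at x)" by simp
 then show ?thesis
 proof (rule has_vector_derivative_transform_within_open)
  show "\<gamma> k (real n + 1) + of_real (y - real n) * slope k n = smooth k y" if "y \<in> {real n<..<real n + 1}" for y
   using that by (intro smooth_eq[symmetric]) auto
 qed (use assms in auto)
qed

lemma smooth_tendsto_0: "(smooth k \<longlongrightarrow> 0) at_top"
proof (rule tendstoI)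
 fix e :: real assume e: "e > 0"
 obtain X where X: "\<And>x. x \<ge> X \<Longrightarrow> norm (\<gamma> k x) < e / 2"
  using tendstoD[OF \<gamma>_lim, of "e/2" k] e by (auto simp: eventually_at_top_linorder)
 show "eventually (\<lambda>x. dist (smooth k x) 0 < e) at_top"
  unfolding eventually_at_top_linorder
 proof (intro exI[of _ "max 0 X"] allI impI)
  fix x assume x: "x \<ge> max 0 X"
  have "norm (smooth k x - 0) \<le> e / 2"
  proof (rule norm_smooth_sub_le[OF _ refl])
   have "x \<ge> 0" "x \<ge> X" using x by auto
   with floor_bounds[of x] have "real (nat \<lfloor>x\<rfloor>) + 1 \<ge> X" "real (nat \<lfloor>x\<rfloor>) + 2 \<ge> X" by linarith+
   then show "norm (\<gamma> k (real (nat \<lfloor>x\<rfloor>) + 1) - 0) \<le> e / 2" "norm (\<gamma> k (real (nat \<lfloor>x\<rfloor>) + 2) - 0) \<le> e / 2"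
    using X by (simp_all add: less_imp_le)
  qed (use x in simp)
  then show "dist (smooth k x) 0 < e" using e by simp
 qed
qed

end

section \<open>The approximate Riccati solution as a sum over trees\<close>

lemma infsum_norm_le:
 fixes f :: "'i \<Rightarrow> 'b::banach"
 assumes g: "g summable_on J" and f: "\<And>t. t \<in> J \<Longrightarrow> norm (f t) \<le> g t"
 shows "f summable_on J" and "norm (infsum f J) \<le> infsum g J"
proof -
 have "(\<lambda>t. norm (f t)) summable_on J" by (rule summable_on_comparison_test[OF g f]) auto
 then show s: "f summable_on J" by (rule abs_summable_summable)
 show "norm (infsum f J) \<le> infsum g J" by (rule norm_infsum_le[OF has_sum_infsum[OF s] has_sum_infsum[OF g] f])
qed

lemma has_sum_diff:
 fixes f g :: "'i \<Rightarrow> 'b::real_normed_vector"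
 assumes "(f has_sum a) J" "(g has_sum b) J" shows "((\<lambda>t. f t - g t) has_sum (a - b)) J"
 using has_sum_add[OF assms(1), of "\<lambda>t. - g t" "- b"] assms(2) by (simp add: has_sum_uminus)

lemma summable_on_diff:
 fixes f g :: "'i \<Rightarrow> 'b::real_normed_vector"
 shows "f summable_on J \<Longrightarrow> g summable_on J \<Longrightarrow> (\<lambda>t. f t - g t) summable_on J"
 using has_sum_diff unfolding summable_on_def by blast

lemma infsum_diff:
 fixes f g :: "'i \<Rightarrow> 'b::real_normed_vector"
 shows "f summable_on J \<Longrightarrow> g summable_on J \<Longrightarrow> infsum (\<lambda>t. f t - g t) J = infsum f J - infsum g J"
 by (rule infsumI[OF has_sum_diff[OF has_sum_infsum has_sum_infsum]])

text \<open>Dominated convergence for \<open>infsum\<close>: the majorant makes the finite partial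
  sums converge uniformly, so the two limits may be swapped.\<close>

lemma infsum_tendsto:
 fixes f :: "'i \<Rightarrow> real \<Rightarrow> 'b::banach"
 assumes lim: "\<And>t. t \<in> J \<Longrightarrow> (f t \<longlongrightarrow> l t) F"
  and bd: "\<And>t x. t \<in> J \<Longrightarrow> x \<in> S \<Longrightarrow> norm (f t x) \<le> A t" "\<And>t. t \<in> J \<Longrightarrow> norm (l t) \<le> A t"
  and A: "A summable_on J" and ev: "eventually (\<lambda>x. x \<in> S) F"
 shows "((\<lambda>x. infsum (\<lambda>t. f t x) J) \<longlongrightarrow> infsum l J) F"
proof (rule swap_uniform_limit'[OF _ _ _ ev finite_subsets_at_top_neq_bot])
 show "uniform_limit S (\<lambda>X x. \<Sum>t\<in>X. f t x) (\<lambda>x. infsum (\<lambda>t. f t x) J) (finite_subsets_at_top J)"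
  by (rule Weierstrass_m_test_general[OF bd(1) A])
 have "eventually (\<lambda>X. finite X \<and> X \<subseteq> J) (finite_subsets_at_top J)"
  by (rule eventually_finite_subsets_at_top_weakI) auto
 then show "eventually (\<lambda>X. ((\<lambda>x. \<Sum>t\<in>X. f t x) \<longlongrightarrow> (\<Sum>t\<in>X. l t)) F) (finite_subsets_at_top J)"
  by eventually_elim (auto intro!: tendsto_sum lim)
 show "((\<lambda>X. \<Sum>t\<in>X. l t) \<longlongrightarrow> infsum l J) (finite_subsets_at_top J)"
  using has_sum_infsum[OF infsum_norm_le(1)[OF A bd(2)]] unfolding has_sum_def by simp
qed

lemma infsum_continuous_on:
 fixes f :: "'i \<Rightarrow> real \<Rightarrow> 'b::banach"
 assumes c: "\<And>t. t \<in> J \<Longrightarrow> continuous_on S (f t)"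
  and bd: "\<And>t x. t \<in> J \<Longrightarrow> x \<in> S \<Longrightarrow> norm (f t x) \<le> A t" and A: "A summable_on J"
 shows "continuous_on S (\<lambda>x. infsum (\<lambda>t. f t x) J)"
 unfolding continuous_on_def
proof
 fix x assume x: "x \<in> S"
 show "((\<lambda>x. infsum (\<lambda>t. f t x) J) \<longlongrightarrow> infsum (\<lambda>t. f t x) J) (at x within S)"
 proof (rule infsum_tendsto[OF _ bd bd A])
  show "(f t \<longlongrightarrow> f t x) (at x within S)" if "t \<in> J" for t using c[OF that] x by (simp add: continuous_on_def)
 qed (use x in \<open>auto simp: eventually_at_filter\<close>)
qed

lemma step_has_integral:
 fixes \<psi> :: "nat \<Rightarrow> real"
 shows "((\<lambda>x. \<psi> (nat \<lfloor>x\<rfloor>)) has_integral (\<Sum>n<N. \<psi> n)) {0..real N}"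
proof (induction N)
 case (Suc N)
 have "((\<lambda>x. \<psi> N) has_integral \<psi> N) {real N..real (Suc N)}"
  using has_integral_const_real[of "\<psi> N" "real N" "real (Suc N)"] by simp
 then have "((\<lambda>x. \<psi> (nat \<lfloor>x\<rfloor>)) has_integral \<psi> N) {real N..real (Suc N)}"
 proof (rule has_integral_spike_finite[rotated 2])
  fix x assume "x \<in> {real N..real (Suc N)} - {real (Suc N)}"
  then have "nat \<lfloor>x\<rfloor> = N" by (auto, linarith)
  then show "\<psi> (nat \<lfloor>x\<rfloor>) = \<psi> N" by simp
 qed simp
 from has_integral_combine[OF _ _ Suc this] show ?case by simp
next
 case 0
 have "((\<lambda>x. \<psi> (nat \<lfloor>x\<rfloor>)) has_integral 0) (cbox 0 (0::real))" by (rule has_integral_refl)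
 then show ?case by simp
qed

text \<open>\<open>M + 1\<close> plays the role of \<open>p\<close>: trees have at most
  \<open>M\<close> leaves, \<open>\<Gamma>\<close> dominates all amplitudes and \<open>G\<close>
  bounds the integrals of its power \<open>M + 1\<close>. \<open>nonresonant\<close> keeps every
  divisor nonzero.\<close>

locale riccati_series = bounded_potential q D K + bv_amplitudes \<gamma> T C
 for q :: "real \<Rightarrow> real" and D K and \<gamma> :: "nat \<Rightarrow> real \<Rightarrow> complex" and T C +
 fixes c :: "nat \<Rightarrow> complex" and \<phi> :: "nat \<Rightarrow> real" and \<kappa> :: real and M :: nat and \<Gamma> :: "real \<Rightarrow> real" and G :: real
 assumes \<kappa>: "\<kappa> > 0" and M: "M \<ge> 1"
  and nonresonant: "\<And>t. leaves t \<le> M \<Longrightarrow> freq \<phi> t \<noteq> 2 * \<kappa>"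
  and coef_sum: "(\<lambda>t. norm (coef c \<phi> (2 * \<kappa>) t)) summable_on trees M"
  and c_sum: "(\<lambda>k. norm (c k)) summable_on UNIV"
  and q_series: "\<And>x. x > 0 \<Longrightarrow> complex_of_real (q x) = infsum (\<lambda>k. c k * exp (- \<i> * of_real (\<phi> k * x)) * \<gamma> k x) UNIV"
  and \<Gamma>: "\<And>x. 0 \<le> \<Gamma> x" "\<And>k x. 0 < x \<Longrightarrow> norm (\<gamma> k x) \<le> \<Gamma> x" "\<And>x. 0 < x \<Longrightarrow> \<Gamma> x \<le> C"
  and \<Gamma>_int: "\<And>b. (\<lambda>x. \<Gamma> x ^ Suc M) integrable_on {0..b}" "\<And>b. integral {0..b} (\<lambda>x. \<Gamma> x ^ Suc M) \<le> G"
begin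

abbreviation "J \<equiv> trees M"
abbreviation "cf \<equiv> coef c \<phi> (2 * \<kappa>)"

definition "wave t x = exp (- \<i> * of_real (freq \<phi> t * x))"
definition "mode t x = cf t * leaf_prod (\<lambda>k. smooth k x) t * wave t x"
text \<open>The part of the derivative of \<open>mode t\<close> on the cell
  \<open>(n, n + 1)\<close> that falls on the amplitude. It remains as an error, whereas the
  derivative of \<open>wave\<close> is inverted by the coefficients.\<close>

definition "slow n t x = cf t * leaf_prod_deriv (\<lambda>k. smooth k x) (\<lambda>k. slope k n) t * wave t x"
definition "mode_deriv n t x = slow n t x - \<i> * of_real (freq \<phi> t) * mode t x"
definition "W x = infsum (\<lambda>t. mode t x) J"
definition "W' x = infsum (\<lambda>t. mode_deriv (nat \<lfloor>x\<rfloor>) t x) J"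
definition "A = infsum (\<lambda>t. norm (cf t)) J"
text \<open>The oscillation of the amplitudes over cell \<open>n\<close>, weighted by the tree
  coefficients; \<open>\<Theta>\<close> is the same with the coefficients of \<open>V\<close>. Both
  measure errors that are later summed over the cells.\<close>

definition "\<Lambda> n = infsum (\<lambda>t. norm (cf t) * leaf_sum (\<lambda>k. osc k n) t) J"
definition "\<Theta> n = infsum (\<lambda>k. norm (c k) * osc k n) UNIV"

lemma norm_wave [simp]: "norm (wave t x) = 1" by (simp add: wave_def norm_exp_eq_Re)

lemma wave_Node: "wave (Node l r) x = wave l x * wave r x"
 by (simp add: wave_def exp_add[symmetric] algebra_simps)

lemma wave_deriv: "(wave t has_vector_derivative - \<i> * of_real (freq \<phi> t) * wave t x) (at x)"
proof -
 have "((\<lambda>z. exp (- \<i> * of_real (freq \<phi> t) * z)) has_field_derivative exp (- \<i> * of_real (freq \<phi> t) * of_real x) * (- \<i> * of_real (freq \<phi> t))) (at (of_real x))"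
  by (rule derivative_eq_intros refl)+ simp
 from has_vector_derivative_real_field[OF this]
 have "((\<lambda>x. exp (- \<i> * of_real (freq \<phi> t) * of_real x)) has_vector_derivative exp (- \<i> * of_real (freq \<phi> t) * of_real x) * (- \<i> * of_real (freq \<phi> t))) (at x)" .
 moreover have "wave t = (\<lambda>x. exp (- \<i> * of_real (freq \<phi> t) * of_real x))" by (simp add: wave_def fun_eq_iff mult.assoc)
 ultimately show ?thesis by (simp only: mult.commute)
qed

lemma CM: "n \<le> m \<Longrightarrow> C ^ n \<le> C ^ m" "C ^ n \<ge> 1" "C ^ n \<ge> 0"
proof -
 show "C ^ n \<ge> 1" by (rule one_le_power[OF C1])
 then show "C ^ n \<ge> 0" by linarith
qed (rule power_increasing[OF _ C1])

lemma leaf_prod_smooth_le: "x \<ge> 0 \<Longrightarrow> t \<in> J \<Longrightarrow> norm (leaf_prod (\<lambda>k. smooth k x) t) \<le> C ^ M"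
 using order_trans[OF norm_leaf_prod_le[of "\<lambda>k. smooth k x" C t] CM(1)[of "leaves t" M]] norm_smooth_le by simp

lemma norm_mode_le: assumes "x \<ge> 0" "t \<in> J" shows "norm (mode t x) \<le> norm (cf t) * C ^ M"
 unfolding mode_def norm_mult norm_wave mult_1_right by (intro mult_left_mono leaf_prod_smooth_le assms norm_ge_zero)

lemma osc_sum_nonneg: "leaf_sum (\<lambda>k. osc k n) t \<ge> 0" by (rule leaf_sum_nonneg[OF osc_nonneg])

lemma norm_slow_le: assumes "x \<ge> 0" "t \<in> J" shows "norm (slow n t x) \<le> C ^ M * (norm (cf t) * leaf_sum (\<lambda>k. osc k n) t)"
proof -
 have "norm (leaf_prod_deriv (\<lambda>k. smooth k x) (\<lambda>k. slope k n) t) \<le> C ^ leaves t * leaf_sum (\<lambda>k. osc k n) t"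
  by (rule norm_leaf_prod_deriv_le[OF norm_smooth_le[OF assms(1)] norm_slope_le C1])
 also have "\<dots> \<le> C ^ M * leaf_sum (\<lambda>k. osc k n) t" using assms by (intro mult_right_mono CM osc_sum_nonneg) simp
 finally have "norm (cf t) * norm (leaf_prod_deriv (\<lambda>k. smooth k x) (\<lambda>k. slope k n) t) \<le> norm (cf t) * (C ^ M * leaf_sum (\<lambda>k. osc k n) t)"
  by (rule mult_left_mono) simp
 then show ?thesis unfolding slow_def norm_mult norm_wave by (simp add: mult_ac)
qed

lemma osc_sum_le: assumes "t \<in> J" shows "leaf_sum (\<lambda>k. osc k n) t \<le> real M * C"
proof -
 have "leaf_sum (\<lambda>k. osc k n) t \<le> real (leaves t) * C" by (rule leaf_sum_le[OF osc_le])
 also have "\<dots> \<le> real M * C" using assms C1 by (intro mult_right_mono) auto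
 finally show ?thesis .
qed

lemma \<Lambda>_summable: "(\<lambda>t. norm (cf t) * leaf_sum (\<lambda>k. osc k n) t) summable_on J"
 by (rule summable_on_comparison_test[OF summable_on_cmult_left[OF coef_sum, of "real M * C"]])
  (auto intro!: mult_left_mono mult_nonneg_nonneg osc_sum_le osc_sum_nonneg)

lemma \<Theta>_summable: "(\<lambda>k. norm (c k) * osc k n) summable_on UNIV"
 by (rule summable_on_comparison_test[OF summable_on_cmult_left[OF c_sum, of C]])
  (auto intro!: mult_left_mono mult_nonneg_nonneg osc_le osc_nonneg)

text \<open>The frequencies may be unbounded, so differentiating \<open>W\<close> termwise needs
  this weighted sum. Multiplying a coefficient by its own divisor cancels the divisor: what is left
  is \<open>norm (c k)\<close> at a leaf and a product of two coefficients at a node, both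
  summable.\<close>

lemma freq_summable: "(\<lambda>t. norm (cf t) * \<bar>freq \<phi> t\<bar>) summable_on J"
proof -
 have "(\<lambda>t. norm (cf t) * \<bar>2 * \<kappa> - freq \<phi> t\<bar>) summable_on trees (Suc M)"
 proof (rule tree_summable_step[OF M coef_sum])
  have "(\<lambda>k. norm (cf (Leaf k)) * \<bar>2 * \<kappa> - freq \<phi> (Leaf k)\<bar>) summable_on UNIV"
   by (rule summable_on_comparison_test[OF c_sum]) (auto simp: norm_divide norm_mult simp flip: of_real_diff of_real_mult)
  then show "(\<lambda>k. norm (cf (Leaf k)) * \<bar>2 * \<kappa> - freq \<phi> (Leaf k)\<bar>) summable_on UNIV" .
  show "norm (cf (Node l r)) * \<bar>2 * \<kappa> - freq \<phi> (Node l r)\<bar> \<le> norm (cf l) * norm (cf r)" for l r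
  proof -
   have "norm (cf (Node l r)) = norm (cf l) * norm (cf r) / \<bar>2 * \<kappa> - freq \<phi> (Node l r)\<bar>"
    unfolding coef.simps norm_divide norm_mult norm_minus_cancel norm_of_real by simp
   then show ?thesis by simp
  qed
 qed auto
 then have "(\<lambda>t. norm (cf t) * \<bar>2 * \<kappa> - freq \<phi> t\<bar>) summable_on J"
  by (rule summable_on_subset_banach) auto
 from summable_on_add[OF summable_on_cmult_left[OF coef_sum, of "2 * \<kappa>"] this] show ?thesis
 proof (rule summable_on_comparison_test)
  fix t
  have "\<bar>freq \<phi> t\<bar> \<le> 2 * \<kappa> + \<bar>2 * \<kappa> - freq \<phi> t\<bar>" using \<kappa> by linarith
  then have "norm (cf t) * \<bar>freq \<phi> t\<bar> \<le> norm (cf t) * (2 * \<kappa> + \<bar>2 * \<kappa> - freq \<phi> t\<bar>)" by (rule mult_left_mono) simp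
  then show "norm (cf t) * \<bar>freq \<phi> t\<bar> \<le> norm (cf t) * (2 * \<kappa>) + norm (cf t) * \<bar>2 * \<kappa> - freq \<phi> t\<bar>"
   by (simp only: distrib_left)
 qed simp
qed

lemma norm_freq_mode_le: assumes "x \<ge> 0" "t \<in> J" shows "norm (\<i> * of_real (freq \<phi> t) * mode t x) \<le> norm (cf t) * \<bar>freq \<phi> t\<bar> * C ^ M"
 using mult_left_mono[OF norm_mode_le[OF assms], of "\<bar>freq \<phi> t\<bar>"] by (simp add: norm_mult mult_ac)

lemma sums_at:
 assumes x: "x \<ge> 0"
 shows "(\<lambda>t. norm (mode t x)) summable_on J" "(\<lambda>t. mode t x) summable_on J" "(\<lambda>t. slow n t x) summable_on J"
  "(\<lambda>t. \<i> * of_real (freq \<phi> t) * mode t x) summable_on J"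
proof -
 show "(\<lambda>t. norm (mode t x)) summable_on J"
  by (rule summable_on_comparison_test[OF summable_on_cmult_left[OF coef_sum, of "C ^ M"] norm_mode_le[OF x]]) auto
 then show "(\<lambda>t. mode t x) summable_on J" by (rule abs_summable_summable)
 show "(\<lambda>t. slow n t x) summable_on J"
  by (rule infsum_norm_le(1)[OF summable_on_cmult_right[OF \<Lambda>_summable] norm_slow_le[OF x]])
 show "(\<lambda>t. \<i> * of_real (freq \<phi> t) * mode t x) summable_on J"
  by (rule infsum_norm_le(1)[OF summable_on_cmult_left[OF freq_summable] norm_freq_mode_le[OF x]])
qed

lemma mode_has_deriv:
 assumes "real n < x" "x < real n + 1" shows "(mode t has_vector_derivative mode_deriv n t x) (at x)"
proof -
 have "((\<lambda>x. cf t * leaf_prod (\<lambda>k. smooth k x) t) has_vector_derivative cf t * leaf_prod_deriv (\<lambda>k. smooth k x) (\<lambda>k. slope k n) t) (at x)"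
  by (rule has_vector_derivative_mult_right[OF leaf_prod_has_vector_derivative[OF smooth_deriv[OF assms]]])
 from has_vector_derivative_mult[OF this wave_deriv[of t]]
 have "((\<lambda>x. cf t * leaf_prod (\<lambda>k. smooth k x) t * wave t x) has_vector_derivative mode_deriv n t x) (at x)"
  unfolding mode_deriv_def slow_def mode_def by (simp add: algebra_simps)
 then show ?thesis unfolding mode_def[abs_def] .
qed

lemma wave_continuous_on: "continuous_on S (wave t)"
 unfolding wave_def by (intro continuous_intros)

lemma mode_continuous_on: "continuous_on {0..} (mode t)"
 unfolding mode_def by (intro continuous_intros leaf_prod_continuous_on smooth_continuous_on wave_continuous_on)

lemma W_continuous_on: "continuous_on {0..} W"
 unfolding W_def
 by (rule infsum_continuous_on[OF mode_continuous_on _ summable_on_cmult_left[OF coef_sum, of "C ^ M"]]) (use norm_mode_le in auto)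

lemma W_tendsto_0: "(W \<longlongrightarrow> 0) at_top"
proof -
 have "((\<lambda>x. infsum (\<lambda>t. mode t x) J) \<longlongrightarrow> infsum (\<lambda>t. 0) J) at_top"
 proof (rule infsum_tendsto[OF _ _ _ summable_on_cmult_left[OF coef_sum, of "C ^ M"]])
  show "(mode t \<longlongrightarrow> 0) at_top" for t
  proof (rule Lim_null_comparison)
   show "eventually (\<lambda>x. norm (mode t x) \<le> norm (cf t * leaf_prod (\<lambda>k. smooth k x) t)) at_top"
    by (rule always_eventually) (simp add: mode_def norm_mult)
   show "((\<lambda>x. norm (cf t * leaf_prod (\<lambda>k. smooth k x) t)) \<longlongrightarrow> 0) at_top"
    by (intro tendsto_norm_zero tendsto_mult_right_zero leaf_prod_tendsto_0 smooth_tendsto_0)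
  qed
  show "norm (mode t x) \<le> norm (cf t) * C ^ M" if "t \<in> J" "x \<in> {0..}" for t x using norm_mode_le that by simp
  show "eventually (\<lambda>x. x \<in> {0::real..}) at_top" unfolding atLeast_iff by (rule eventually_ge_at_top)
 qed (use CM in simp)
 then show ?thesis by (simp add: W_def[abs_def])
qed

text \<open>Within a cell the slopes are constant, and the termwise derivative has the majorants of
  \<open>norm_slow_le\<close> and \<open>norm_freq_mode_le\<close>. The integers are excluded
  because the slopes jump there.\<close>

lemma W_deriv:
 assumes x: "x > 0" "x \<notin> range real"
 shows "(W has_vector_derivative W' x) (at x)" and "isCont W' x"
proof -
 define n where "n = nat \<lfloor>x\<rfloor>"
 have n: "real n < x" "x < real n + 1"
 proof -
  have "x \<noteq> real n" using x(2) by blast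
  then show "real n < x" "x < real n + 1" using floor_bounds[of x] x(1) unfolding n_def by linarith+
 qed
 have fl: "nat \<lfloor>y\<rfloor> = n" if "y \<in> {real n<..<real n + 1}" for y using that by (auto, linarith)
 have pos: "y \<ge> 0" if "y \<in> {real n<..<real n + 1}" for y using that by (auto intro: order_trans[OF of_nat_0_le_iff less_imp_le])
 have sub: "{real n<..<real n + 1} \<subseteq> {0..}" using pos by auto
 have B: "norm (mode_deriv n t y) \<le> C ^ M * (norm (cf t) * leaf_sum (\<lambda>k. osc k n) t) + norm (cf t) * \<bar>freq \<phi> t\<bar> * C ^ M"
  if "t \<in> J" "y \<in> {real n<..<real n + 1}" for t y
  unfolding mode_deriv_def
  by (rule order_trans[OF norm_triangle_ineq4 add_mono[OF norm_slow_le norm_freq_mode_le]]) (use pos[OF that(2)] that(1) in auto)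
 have Bs: "(\<lambda>t. C ^ M * (norm (cf t) * leaf_sum (\<lambda>k. osc k n) t) + norm (cf t) * \<bar>freq \<phi> t\<bar> * C ^ M) summable_on J"
  by (intro summable_on_add summable_on_cmult_right summable_on_cmult_left \<Lambda>_summable freq_summable)
 have c: "continuous_on {real n<..<real n + 1} (mode_deriv n t)" for t
  unfolding mode_deriv_def slow_def
  by (intro continuous_intros wave_continuous_on leaf_prod_deriv_continuous_on continuous_on_subset[OF mode_continuous_on sub] continuous_on_subset[OF smooth_continuous_on sub])
 have x': "x \<in> {real n<..<real n + 1}" using n by simp
 have ds: "(mode t has_vector_derivative mode_deriv n t y) (at y)" if "y \<in> {real n<..<real n + 1}" for t y
  using mode_has_deriv[of n y t] that by simp
 note * = infsum_has_vector_derivative[where f = mode and f' = "mode_deriv n" and J = J, OF ds c _ summable_on_cmult_left[OF coef_sum, of "C ^ M"] B Bs x']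
 have nm: "norm (mode t y) \<le> norm (cf t) * C ^ M" if "t \<in> J" "y \<in> {real n<..<real n + 1}" for t y
  by (rule norm_mode_le[OF pos[OF that(2)] that(1)])
 show "(W has_vector_derivative W' x) (at x)"
  unfolding W_def[abs_def] W'_def fl[OF x'] by (rule *(1)) (use nm in auto)
 have "isCont (\<lambda>x. infsum (\<lambda>t. mode_deriv n t x) J) x" by (rule *(2)) (use nm in auto)
 moreover have "eventually (\<lambda>y. W' y = infsum (\<lambda>t. mode_deriv n t y) J) (nhds x)"
  using eventually_nhds_in_open[OF open_greaterThanLessThan x'] by eventually_elim (simp add: W'_def fl)
 ultimately show "isCont W' x" using isCont_cong[of W' "\<lambda>y. infsum (\<lambda>t. mode_deriv n t y) J" x] by (simp only:)
qed

abbreviation "low x \<equiv> (\<lambda>(l,r). if leaves l + leaves r \<le> M then mode l x * mode r x else 0)"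
abbreviation "high x \<equiv> (\<lambda>(l,r). if leaves l + leaves r \<le> M then 0 else mode l x * mode r x)"

definition "err x = W' x + (\<i> * of_real \<kappa> + W x)\<^sup>2 - of_real (q x) + of_real (\<kappa>\<^sup>2)"

text \<open>The coefficients are chosen so that in \<open>W' + 2 i \<kappa> W\<close> the leaves reproduce \<open>q\<close>, up to smoothing,
 and the other trees cancel all products in \<open>W\<^sup>2\<close> which have at most \<open>M\<close> leaves.\<close>
lemma err_eq:
 assumes x: "x > 0"
 shows "err x = infsum (\<lambda>t. slow (nat \<lfloor>x\<rfloor>) t x) J
   + infsum (high x) (J \<times> J)
   + infsum (\<lambda>k. c k * exp (- \<i> * of_real (\<phi> k * x)) * (smooth k x - \<gamma> k x)) UNIV"
proof -
 have x0: "x \<ge> 0" using x by simp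
 define B where "B = {(l,r). leaves l + leaves r \<le> M}"
 define N where "N = (\<lambda>(l,r). Node l r)"
 define h where "h t = \<i> * of_real (2 * \<kappa> - freq \<phi> t) * mode t x" for t
 define e where "e k = c k * exp (- \<i> * of_real (\<phi> k * x))" for k
 \<comment> \<open>The trees in \<open>J\<close> that are not leaves correspond to the pairs in
   \<open>B\<close>, which are exactly the pairs whose product in the square of \<open>W\<close> is
   cancelled.\<close>
 have J: "J = range Leaf \<union> N ` B"
 proof (intro equalityI subsetI)
  fix t assume t: "t \<in> J"
  show "t \<in> range Leaf \<union> N ` B"
  proof (cases t)
   case (Node l r)
   then have "(l,r) \<in> B" "t = N (l,r)" using t by (auto simp: B_def N_def)
   then show ?thesis by blast
  qed simp
 qed (use M in \<open>auto simp: B_def N_def\<close>)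
 have hs: "h summable_on J"
  using summable_on_diff[OF summable_on_cmult_right[OF sums_at(2)[OF x0], of "2 * \<i> * of_real \<kappa>"] sums_at(4)[OF x0]]
  by (simp add: h_def[abs_def] algebra_simps)
 have hL: "h (Leaf k) = e k * smooth k x" for k
 proof -
  have "complex_of_real (2 * \<kappa> - \<phi> k) \<noteq> 0" using nonresonant[of "Leaf k"] M unfolding of_real_eq_0_iff by simp
  then show ?thesis unfolding h_def mode_def e_def wave_def coef.simps freq.simps leaf_prod.simps by (simp add: field_simps)
 qed
 have hN: "(h \<circ> N) p = - (case p of (l,r) \<Rightarrow> mode l x * mode r x)" if "p \<in> B" for p
 proof -
  obtain l r where p: "p = (l,r)" by fastforce
  have "complex_of_real (2 * \<kappa> - freq \<phi> (Node l r)) \<noteq> 0"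
   using nonresonant[of "Node l r"] that p unfolding of_real_eq_0_iff by (simp add: B_def)
  then have "\<i> * of_real (2 * \<kappa> - freq \<phi> (Node l r)) * cf (Node l r) = - cf l * cf r"
   unfolding coef.simps by (simp only: times_divide_eq_right) (simp add: divide_eq_eq)
  then have "h (Node l r) = (- cf l * cf r) * leaf_prod (\<lambda>k. smooth k x) (Node l r) * wave (Node l r) x"
   unfolding h_def mode_def by (simp only: mult.assoc[symmetric])
  then show ?thesis by (simp add: p N_def wave_Node mode_def)
 qed
 have injN: "inj_on N B" unfolding N_def by (rule inj_Node)
 have "infsum h J = infsum h (range Leaf) + infsum h (N ` B)"
  unfolding J by (rule infsum_Un_disjoint; (rule summable_on_subset_banach[OF hs])?) (auto simp: J N_def)
 also have "infsum h (range Leaf) = infsum (\<lambda>k. e k * smooth k x) UNIV"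
  by (subst infsum_reindex) (auto simp: inj_on_def o_def hL)
 also have "infsum h (N ` B) = infsum (\<lambda>p. - (case p of (l,r) \<Rightarrow> mode l x * mode r x)) B"
  unfolding infsum_reindex[OF injN] by (rule infsum_cong) (rule hN)
 also have "\<dots> = - infsum (\<lambda>(l,r). mode l x * mode r x) B" by (rule infsum_uminus)
 also have "infsum (\<lambda>(l,r). mode l x * mode r x) B = infsum (low x) (J \<times> J)"
  by (rule infsum_cong_neutral) (auto simp: B_def)
 finally have hsum: "infsum h J = infsum (\<lambda>k. e k * smooth k x) UNIV
   - infsum (low x) (J \<times> J)" by simp
 have sq: "((\<lambda>(l,r). mode l x * mode r x) has_sum W x * W x) (J \<times> J)"
  unfolding W_def by (rule has_sum_product_abs[OF sums_at(1)[OF x0] sums_at(1)[OF x0]])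
 have abs: "(\<lambda>p. norm (case p of (l,r) \<Rightarrow> mode l x * mode r x)) summable_on (J \<times> J)"
  using summable_on_product_real[OF sums_at(1)[OF x0] _ sums_at(1)[OF x0]] by (simp add: case_prod_unfold norm_mult)
 have "W x * W x = infsum (\<lambda>p. (case p of (l,r) \<Rightarrow> if leaves l + leaves r \<le> M then mode l x * mode r x else 0)
   + (case p of (l,r) \<Rightarrow> if leaves l + leaves r \<le> M then 0 else mode l x * mode r x)) (J \<times> J)"
  unfolding infsumI[OF sq, symmetric] by (rule infsum_cong) auto
 also have "\<dots> = infsum (low x) (J \<times> J)
   + infsum (high x) (J \<times> J)"
  by (rule infsum_add; rule infsum_norm_le(1)[OF abs]) (auto split: if_splits)
 finally have WW: "W x * W x = infsum (low x) (J \<times> J)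
   + infsum (high x) (J \<times> J)" .
 \<comment> \<open>The cancellation in abstract form: the sum \<open>h\<close> over trees equals
   both \<open>2 i \<kappa> W\<close> minus the frequency part of \<open>W'\<close>, and the leaf
   part minus the low products.\<close>
 have alg: "w' + sq - qq + k2 = s1 + s2 + s3"
  if "w' = s1 - f" "h = t - f" "s3 = e1 - qq" "sq = - k2 + t + ww" "h = e1 - p" "ww = p + s2" for w' sq qq k2 s1 s2 s3 f h t e1 p ww :: complex
  using that by algebra
 have 1: "W' x = infsum (\<lambda>t. slow (nat \<lfloor>x\<rfloor>) t x) J - infsum (\<lambda>t. \<i> * of_real (freq \<phi> t) * mode t x) J"
  unfolding W'_def mode_deriv_def by (rule infsum_diff[OF sums_at(3)[OF x0] sums_at(4)[OF x0]])
 have 2: "infsum h J = 2 * \<i> * of_real \<kappa> * W x - infsum (\<lambda>t. \<i> * of_real (freq \<phi> t) * mode t x) J"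
  unfolding W_def infsum_cmult_right'[symmetric]
   infsum_diff[OF summable_on_cmult_right[OF sums_at(2)[OF x0], of "2 * \<i> * of_real \<kappa>"] sums_at(4)[OF x0], symmetric]
  by (rule infsum_cong) (simp add: h_def algebra_simps)
 have 3: "infsum (\<lambda>k. e k * (smooth k x - \<gamma> k x)) UNIV = infsum (\<lambda>k. e k * smooth k x) UNIV - of_real (q x)"
 proof -
  have ne: "norm (e k) = norm (c k)" for k by (simp add: e_def norm_mult norm_exp_eq_Re)
  have "norm (e k * smooth k x) \<le> norm (c k) * C" "norm (e k * \<gamma> k x) \<le> norm (c k) * C" for k
   unfolding norm_mult ne by (intro mult_left_mono norm_smooth_le[OF x0] \<gamma>_bound[OF x] norm_ge_zero)+
  note s = this[THEN infsum_norm_le(1)[OF summable_on_cmult_left[OF c_sum, of C]]]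
  show ?thesis unfolding q_series[OF x] e_def[symmetric] infsum_diff[OF s, symmetric] by (simp add: algebra_simps)
 qed
 have 4: "(\<i> * of_real \<kappa> + W x)\<^sup>2 = - of_real (\<kappa>\<^sup>2) + 2 * \<i> * of_real \<kappa> * W x + W x * W x"
  by (simp add: power2_eq_square algebra_simps)
 show ?thesis unfolding err_def e_def[symmetric] by (rule alg[OF 1 2 3 4 hsum WW])
qed

definition "\<Psi> n = C ^ (2 * M) * ((2 * A + 1) * \<Lambda> n) + \<Theta> n"

lemma A_nonneg: "A \<ge> 0" unfolding A_def by (rule infsum_nonneg) simp
lemma \<Lambda>_nonneg: "\<Lambda> n \<ge> 0" unfolding \<Lambda>_def by (rule infsum_nonneg) (simp add: osc_sum_nonneg)
lemma \<Theta>_nonneg: "\<Theta> n \<ge> 0" unfolding \<Theta>_def by (rule infsum_nonneg) (simp add: osc_nonneg)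
lemma \<Psi>_nonneg: "\<Psi> n \<ge> 0"
 unfolding \<Psi>_def using A_nonneg by (intro add_nonneg_nonneg mult_nonneg_nonneg CM \<Lambda>_nonneg \<Theta>_nonneg) auto

text \<open>With more than \<open>M\<close> leaves, \<open>M + 1\<close> factors are bounded by
  \<open>\<Gamma>\<close> and the others by \<open>C\<close>. Replacing the smoothed amplitudes by
  the original ones, to which \<open>\<Gamma>\<close> applies, costs one oscillation per leaf. The
  bound \<open>2 * M\<close> is the largest size of a product of two trees from
  \<open>J\<close>.\<close>

lemma big_leaf_prod:
 assumes x: "x > 0" and t: "M < leaves t" "leaves t \<le> 2 * M"
 shows "norm (leaf_prod (\<lambda>k. smooth k x) t) \<le> C ^ (2 * M) * (\<Gamma> x ^ Suc M + leaf_sum (\<lambda>k. osc k (nat \<lfloor>x\<rfloor>)) t)"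
proof -
 have "norm (leaf_prod (\<lambda>k. \<gamma> k x) t) \<le> \<Gamma> x ^ leaves t" by (rule norm_leaf_prod_le[OF \<Gamma>(2)[OF x]])
 also have "\<dots> = \<Gamma> x ^ (leaves t - Suc M) * \<Gamma> x ^ Suc M" unfolding power_add[symmetric] using t by simp
 also have "\<dots> \<le> C ^ (leaves t - Suc M) * \<Gamma> x ^ Suc M" by (intro mult_right_mono power_mono \<Gamma> x zero_le_power)
 also have "\<dots> \<le> C ^ (2 * M) * \<Gamma> x ^ Suc M" using t by (intro mult_right_mono CM \<Gamma> zero_le_power) simp
 finally have 1: "norm (leaf_prod (\<lambda>k. \<gamma> k x) t) \<le> C ^ (2 * M) * \<Gamma> x ^ Suc M" .
 have "norm (leaf_prod (\<lambda>k. smooth k x) t - leaf_prod (\<lambda>k. \<gamma> k x) t) \<le> C ^ leaves t * leaf_sum (\<lambda>k. osc k (nat \<lfloor>x\<rfloor>)) t"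
  by (rule norm_leaf_prod_diff_le[OF norm_smooth_le \<gamma>_bound[OF x] norm_smooth_diff_le[OF x] C1]) (use x in simp)
 also have "\<dots> \<le> C ^ (2 * M) * leaf_sum (\<lambda>k. osc k (nat \<lfloor>x\<rfloor>)) t" using t by (intro mult_right_mono CM osc_sum_nonneg)
 finally show ?thesis
  using 1 norm_triangle_sub[of "leaf_prod (\<lambda>k. smooth k x) t" "leaf_prod (\<lambda>k. \<gamma> k x) t"] unfolding distrib_left by linarith
qed

text \<open>The three terms of \<open>err_eq\<close> are derivatives of amplitudes, products too
  long to be cancelled, and the smoothing of \<open>V\<close>. Only the second involves
  \<open>\<Gamma>\<close>; the rest is oscillation over the current cell.\<close>

lemma norm_err_le:
 assumes x: "x > 0" shows "norm (err x) \<le> C ^ (2 * M) * (A * A) * \<Gamma> x ^ Suc M + \<Psi> (nat \<lfloor>x\<rfloor>)"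
proof -
 let ?n = "nat \<lfloor>x\<rfloor>"
 have x0: "x \<ge> 0" using x by simp
 let ?ls = "leaf_sum (\<lambda>k. osc k ?n)"
 have S1: "norm (infsum (\<lambda>t. slow ?n t x) J) \<le> C ^ (2 * M) * \<Lambda> ?n"
 proof -
  have "norm (infsum (\<lambda>t. slow ?n t x) J) \<le> infsum (\<lambda>t. C ^ M * (norm (cf t) * ?ls t)) J"
   by (rule infsum_norm_le(2)[OF summable_on_cmult_right[OF \<Lambda>_summable] norm_slow_le[OF x0]])
  also have "\<dots> = C ^ M * \<Lambda> ?n" unfolding \<Lambda>_def by (rule infsum_cmult_right')
  also have "\<dots> \<le> C ^ (2 * M) * \<Lambda> ?n" by (intro mult_right_mono CM \<Lambda>_nonneg) simp
  finally show ?thesis .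
 qed
 have S3: "norm (infsum (\<lambda>k. c k * exp (- \<i> * of_real (\<phi> k * x)) * (smooth k x - \<gamma> k x)) UNIV) \<le> \<Theta> ?n"
  unfolding \<Theta>_def
 proof (rule infsum_norm_le(2)[OF \<Theta>_summable])
  fix k
  have "norm (c k) * norm (smooth k x - \<gamma> k x) \<le> norm (c k) * osc k ?n" by (intro mult_left_mono norm_smooth_diff_le x) simp
  then show "norm (c k * exp (- \<i> * of_real (\<phi> k * x)) * (smooth k x - \<gamma> k x)) \<le> norm (c k) * osc k ?n"
   by (simp add: norm_mult norm_exp_eq_Re)
 qed
 define a where "a t = norm (cf t)" for t
 define b where "b t = norm (cf t) * ?ls t" for t
 have nn: "a t \<ge> 0" "b t \<ge> 0" for t by (auto simp: a_def b_def osc_sum_nonneg)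
 have sa: "(\<lambda>t. norm (a t)) summable_on J" "(\<lambda>t. norm (b t)) summable_on J"
  using coef_sum \<Lambda>_summable[of ?n] nn by (simp_all add: a_def b_def osc_sum_nonneg)
 have "((\<lambda>p. C ^ (2 * M) * (\<Gamma> x ^ Suc M * (case p of (l,r) \<Rightarrow> a l * a r)
   + ((case p of (l,r) \<Rightarrow> b l * a r) + (case p of (l,r) \<Rightarrow> a l * b r)))) has_sum
   C ^ (2 * M) * (\<Gamma> x ^ Suc M * (A * A) + (\<Lambda> ?n * A + A * \<Lambda> ?n))) (J \<times> J)"
  unfolding A_def \<Lambda>_def unfolding b_def[symmetric] unfolding a_def[symmetric]
  by (intro has_sum_cmult_right has_sum_add has_sum_product_abs sa)
 then have g: "((\<lambda>(l,r). C ^ (2 * M) * (\<Gamma> x ^ Suc M * (a l * a r) + (b l * a r + a l * b r))) has_sum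
   C ^ (2 * M) * (\<Gamma> x ^ Suc M * (A * A) + (\<Lambda> ?n * A + A * \<Lambda> ?n))) (J \<times> J)"
  by (simp add: case_prod_unfold)
 have "norm (infsum (high x) (J \<times> J))
   \<le> infsum (\<lambda>(l,r). C ^ (2 * M) * (\<Gamma> x ^ Suc M * (a l * a r) + (b l * a r + a l * b r))) (J \<times> J)"
 proof (rule infsum_norm_le(2)[OF has_sum_imp_summable[OF g]])
  fix p assume "p \<in> J \<times> J"
  then obtain l r where p: "p = (l,r)" and lr: "leaves l \<le> M" "leaves r \<le> M" by auto
  have nonneg: "0 \<le> C ^ (2 * M) * (\<Gamma> x ^ Suc M * (a l * a r) + (b l * a r + a l * b r))"
   by (intro mult_nonneg_nonneg add_nonneg_nonneg CM nn zero_le_power \<Gamma>)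
  have "norm (mode l x * mode r x) \<le> C ^ (2 * M) * (\<Gamma> x ^ Suc M * (a l * a r) + (b l * a r + a l * b r))" if "\<not> leaves l + leaves r \<le> M"
  proof -
   have "norm (mode l x * mode r x) = (a l * a r) * norm (leaf_prod (\<lambda>k. smooth k x) (Node l r))"
    by (simp add: mode_def norm_mult a_def)
   also have "\<dots> \<le> (a l * a r) * (C ^ (2 * M) * (\<Gamma> x ^ Suc M + ?ls (Node l r)))"
    using that lr by (intro mult_left_mono big_leaf_prod x mult_nonneg_nonneg nn) auto
   also have "\<dots> = C ^ (2 * M) * (\<Gamma> x ^ Suc M * (a l * a r) + (b l * a r + a l * b r))"
    by (simp add: a_def b_def algebra_simps)
   finally show ?thesis .
  qed
  then show "norm (case p of (l,r) \<Rightarrow> if leaves l + leaves r \<le> M then 0 else mode l x * mode r x)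
    \<le> (case p of (l,r) \<Rightarrow> C ^ (2 * M) * (\<Gamma> x ^ Suc M * (a l * a r) + (b l * a r + a l * b r)))"
   unfolding p case_prod_conv using nonneg by (cases "leaves l + leaves r \<le> M") (simp_all only: if_True if_False norm_zero not_True_eq_False not_False_eq_True)
 qed
 then have S2: "norm (infsum (high x) (J \<times> J))
   \<le> C ^ (2 * M) * (\<Gamma> x ^ Suc M * (A * A) + (\<Lambda> ?n * A + A * \<Lambda> ?n))"
  unfolding infsumI[OF g] .
 have tri: "norm (u + v + w) \<le> a1 + a2 + a3" if "norm u \<le> a1" "norm v \<le> a2" "norm w \<le> a3" for u v w :: complex and a1 a2 a3
  using norm_triangle_ineq[of "u + v" w] norm_triangle_ineq[of u v] that by linarith
 show ?thesis unfolding err_eq[OF x]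
  by (rule order_trans[OF tri[OF S1 S2 S3]]) (simp add: \<Psi>_def algebra_simps)
qed

text \<open>Independent of \<open>N\<close>, because the oscillations of each amplitude add up to at
  most \<open>2 * C\<close>; hence the errors of the cells are integrable over the
  half-line.\<close>

lemma sum_\<Psi>_le: "(\<Sum>n<N. \<Psi> n) \<le> C ^ (2 * M) * ((2 * A + 1) * (A * (real M * (2 * C)))) + infsum (\<lambda>k. norm (c k)) UNIV * (2 * C)"
proof -
 have "(\<Sum>n<N. \<Lambda> n) \<le> A * (real M * (2 * C))"
 proof -
  have "((\<lambda>t. \<Sum>n<N. norm (cf t) * leaf_sum (\<lambda>k. osc k n) t) has_sum (\<Sum>n<N. \<Lambda> n)) J"
   unfolding \<Lambda>_def by (rule infsum_finite_sum) (auto intro: \<Lambda>_summable)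
  then show ?thesis
  proof (rule has_sum_mono)
   show "((\<lambda>t. norm (cf t) * (real M * (2 * C))) has_sum A * (real M * (2 * C))) J"
    unfolding A_def by (rule has_sum_cmult_left[OF has_sum_infsum[OF coef_sum]])
   fix t assume t: "t \<in> J"
   have "(\<Sum>n<N. leaf_sum (\<lambda>k. osc k n) t) \<le> real (leaves t) * (2 * C)"
    unfolding sum_leaf_sum by (rule leaf_sum_le[OF sum_osc_le])
   also have "\<dots> \<le> real M * (2 * C)" using t C1 by (intro mult_right_mono) auto
   finally show "(\<Sum>n<N. norm (cf t) * leaf_sum (\<lambda>k. osc k n) t) \<le> norm (cf t) * (real M * (2 * C))"
    unfolding sum_distrib_left[symmetric] by (rule mult_left_mono) simp
  qed
 qed
 then have "C ^ (2 * M) * ((2 * A + 1) * (\<Sum>n<N. \<Lambda> n)) \<le> C ^ (2 * M) * ((2 * A + 1) * (A * (real M * (2 * C))))"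
  using A_nonneg by (intro mult_left_mono CM) auto
 moreover have "(\<Sum>n<N. \<Theta> n) \<le> infsum (\<lambda>k. norm (c k)) UNIV * (2 * C)"
 proof -
  have "((\<lambda>k. \<Sum>n<N. norm (c k) * osc k n) has_sum (\<Sum>n<N. \<Theta> n)) UNIV"
   unfolding \<Theta>_def by (rule infsum_finite_sum) (auto intro: \<Theta>_summable)
  then show ?thesis
  proof (rule has_sum_mono)
   show "((\<lambda>k. norm (c k) * (2 * C)) has_sum infsum (\<lambda>k. norm (c k)) UNIV * (2 * C)) UNIV"
    by (rule has_sum_cmult_left[OF has_sum_infsum[OF c_sum]])
   show "(\<Sum>n<N. norm (c k) * osc k n) \<le> norm (c k) * (2 * C)" for k
    unfolding sum_distrib_left[symmetric] by (rule mult_left_mono[OF sum_osc_le]) simp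
  qed
 qed
 ultimately show ?thesis unfolding \<Psi>_def sum.distrib sum_distrib_left[symmetric] by linarith
qed

text \<open>Since \<open>W\<close> tends to 0, \<open>w = i \<kappa> + W\<close> has imaginary part
  at least \<open>\<kappa> / 2\<close> from some point on, and there its defect \<open>err\<close>
  has bounded integral; this is the situation of \<open>riccati_bounded\<close>.\<close>

theorem solutions_bounded:
 assumes sol: "ode_solution q D (of_real (\<kappa>\<^sup>2)) u v"
 shows "\<exists>C. \<forall>x\<ge>0. norm (u x) \<le> C \<and> norm (v x) \<le> C"
proof -
 define P where "P = C ^ (2 * M) * ((2 * A + 1) * (A * (real M * (2 * C)))) + infsum (\<lambda>k. norm (c k)) UNIV * (2 * C)"
 define K1 where "K1 = C ^ (2 * M) * (A * A)"
 have K1: "K1 \<ge> 0" unfolding K1_def using A_nonneg by (intro mult_nonneg_nonneg CM)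
 define F where "F x = K1 * \<Gamma> x ^ Suc M + \<Psi> (nat \<lfloor>x\<rfloor>)" for x
 have F0: "F x \<ge> 0" for x unfolding F_def by (intro add_nonneg_nonneg mult_nonneg_nonneg K1 zero_le_power \<Gamma> \<Psi>_nonneg)
 have \<Psi>P: "\<Psi> n \<le> P" for n
 proof -
  have "\<Psi> n \<le> (\<Sum>m<Suc n. \<Psi> m)" using \<Psi>_nonneg by (simp add: sum_nonneg)
  then show ?thesis unfolding P_def using sum_\<Psi>_le[of "Suc n"] by linarith
 qed
 have FC: "F x \<le> K1 * C ^ Suc M + P" if "x > 0" for x
  unfolding F_def by (intro add_mono mult_left_mono power_mono \<Gamma> that K1 \<Psi>P)
 have eF: "norm (err x) \<le> F x" if "x > 0" for x using norm_err_le[OF that] by (simp add: F_def K1_def)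
 obtain x1 where x1: "\<And>x. x \<ge> x1 \<Longrightarrow> norm (W x) < \<kappa> / 2"
  using tendstoD[OF W_tendsto_0, of "\<kappa>/2"] \<kappa> by (auto simp: eventually_at_top_linorder)
 \<comment> \<open>Kept positive, since the bound on \<open>err\<close> is available for
   \<open>x > 0\<close>.\<close>
 define x0 where "x0 = max 1 x1"
 define S where "S = D \<union> range real"
 define w where "w x = \<i> * of_real \<kappa> + W x" for x
 have w: "norm (W x) < \<kappa> / 2" if "x \<ge> x0" for x using x1[of x] that by (simp add: x0_def)
 have e: "W' x + (w x)\<^sup>2 - of_real (q x) + of_real (\<kappa>\<^sup>2) = err x" for x by (simp add: err_def w_def)
 have ec: "isCont (\<lambda>x. norm (err x)) x" if "x > 0" "x \<notin> S" for x
 proof -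
  have "x \<notin> range real" "x \<notin> D" using that by (auto simp: S_def)
  moreover have "isCont W x" using has_vector_derivative_continuous[OF W_deriv(1)] that(1) calculation(1) by blast
  ultimately show ?thesis unfolding err_def by (intro continuous_intros W_deriv(2) q_cont that)
 qed
 have ei: "(\<lambda>x. norm (err x)) integrable_on {x0..b}" for b
 proof (rule set_lebesgue_integral_eq_integral(1)[OF integrable_continuous_off_countable[of S]])
  show "countable S" using countable_D by (simp add: S_def)
  show "isCont (\<lambda>x. norm (err x)) x" if "x \<in> {x0<..<b} - S" for x using that by (intro ec) (auto simp: x0_def)
  show "norm (norm (err x)) \<le> K1 * C ^ Suc M + P" if "x \<in> {x0<..<b}" for x
  proof -
   have "x > 0" using that by (auto simp: x0_def)
   then show ?thesis using eF[of x] FC[of x] by simp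
  qed
 qed
 have eb: "integral {x0..b} (\<lambda>x. norm (err x)) \<le> K1 * G + P" if "b \<ge> x0" for b
 proof -
  obtain N :: nat where N: "b \<le> real N" using real_arch_simple by blast
  have hi: "(F has_integral K1 * integral {0..real N} (\<lambda>x. \<Gamma> x ^ Suc M) + (\<Sum>n<N. \<Psi> n)) {0..real N}"
   unfolding F_def by (intro has_integral_add has_integral_mult_right integrable_integral \<Gamma>_int step_has_integral)
  have sub: "{x0..b} \<subseteq> {0..real N}" using N by (auto simp: x0_def)
  have Fi: "F integrable_on {x0..b}" by (rule integrable_on_subinterval[OF has_integral_integrable[OF hi] sub])
  have "integral {x0..b} (\<lambda>x. norm (err x)) \<le> integral {x0..b} F"
   by (rule integral_le[OF ei Fi]) (auto intro!: eF simp: x0_def)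
  also have "\<dots> \<le> integral {0..real N} F" by (rule integral_subset_le[OF sub Fi has_integral_integrable[OF hi]]) (use F0 in simp)
  also have "\<dots> = K1 * integral {0..real N} (\<lambda>x. \<Gamma> x ^ Suc M) + (\<Sum>n<N. \<Psi> n)" by (rule integral_unique[OF hi])
  also have "\<dots> \<le> K1 * G + P" using sum_\<Psi>_le[of N] unfolding P_def[symmetric] by (intro add_mono mult_left_mono \<Gamma>_int K1)
  finally show ?thesis .
 qed
 show ?thesis
 proof (rule riccati_bounded[where w = w and w' = W' and \<kappa> = \<kappa> and ?x0.0 = x0 and S = S and M = "2 * \<kappa>" and B = "K1 * G + P" and u = u and v = v, unfolded e])
  show "\<kappa> > 0" by (rule \<kappa>)
  show "x0 \<ge> 0" by (simp add: x0_def)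
  show "countable S" "D \<subseteq> S" using countable_D by (auto simp: S_def)
  show "continuous_on {0..} w" unfolding w_def by (intro continuous_intros W_continuous_on)
  show "(w has_vector_derivative W' x) (at x)" if "x > x0" "x \<notin> S" for x
  proof -
   have "(W has_vector_derivative W' x) (at x)" by (rule W_deriv(1)) (use that in \<open>auto simp: S_def x0_def\<close>)
   from has_vector_derivative_add[OF has_vector_derivative_const this] show ?thesis unfolding w_def[abs_def] by simp
  qed
  show "isCont (\<lambda>x. norm (err x)) x" if "x > x0" "x \<notin> S" for x using that by (intro ec) (auto simp: x0_def)
  show "Im (w x) \<ge> \<kappa> / 2" if "x \<ge> x0" for x
   using w[OF that] abs_Im_le_cmod[of "W x"] by (simp add: w_def)
  show "norm (w x) \<le> 2 * \<kappa>" if "x \<ge> x0" for x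
  proof -
   have "norm (w x) \<le> norm (\<i> * complex_of_real \<kappa>) + norm (W x)" unfolding w_def by (rule norm_triangle_ineq)
   then show ?thesis using w[OF that] \<kappa> by (simp add: norm_mult)
  qed
 qed (use ei eb sol in auto)
qed

end

section \<open>Weyl--Titchmarsh theory\<close>

abbreviation energy :: "(real \<Rightarrow> complex) \<Rightarrow> real \<Rightarrow> real" where
 "energy u x \<equiv> integral {0..x} (\<lambda>t. (norm (u t))\<^sup>2)"

context bounded_potential
begin

definition sol :: "complex \<Rightarrow> complex \<Rightarrow> complex \<Rightarrow> (real \<Rightarrow> complex) \<times> (real \<Rightarrow> complex)" where
 "sol z a b = (SOME p. ode_solution q D z (fst p) (snd p) \<and> fst p 0 = a \<and> snd p 0 = b)"

definition "val z a b x = fst (sol z a b) x"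
definition "der z a b x = snd (sol z a b) x"

lemma sol_props: "ode_solution q D z (val z a b) (der z a b)" "val z a b 0 = a" "der z a b 0 = b"
proof -
 obtain u v where "ode_solution q D z u v \<and> u 0 = a \<and> v 0 = b" using ode_solution_exists by blast
 then have "\<exists>p. ode_solution q D z (fst p) (snd p) \<and> fst p 0 = a \<and> snd p 0 = b" by (intro exI[of _ "(u,v)"]) simp
 from someI_ex[OF this] have "ode_solution q D z (fst (sol z a b)) (snd (sol z a b)) \<and> fst (sol z a b) 0 = a \<and> snd (sol z a b) 0 = b"
  unfolding sol_def .
 moreover have "val z a b = fst (sol z a b)" "der z a b = snd (sol z a b)" by (simp_all add: fun_eq_iff val_def der_def)
 ultimately show "ode_solution q D z (val z a b) (der z a b)" "val z a b 0 = a" "der z a b 0 = b" by simp_all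
qed

lemma wronskian_constant:
 assumes "ode_solution q D z u v" "ode_solution q D z f g" "x \<ge> 0"
 shows "u x * g x - v x * f x = u 0 * g 0 - v 0 * f 0"
proof -
 have "((\<lambda>x. 0) has_integral (u x * g x - v x * f x) - (u 0 * g 0 - v 0 * f 0)) {0..x}"
  using lagrange_identity[OF assms(1,2) order_refl assms(3)] by simp
 then show ?thesis by simp
qed

lemma sol_bound:
 assumes "norm z \<le> R" "0 \<le> x" "x \<le> L"
 shows "norm (val z a b x) \<le> (norm a + norm b) * exp ((1 + K + R) * L)"
  and "norm (der z a b x) \<le> (norm a + norm b) * exp ((1 + K + R) * L)"
proof -
 let ?E = "exp ((1 + K + R) * L)"
 have L: "0 \<le> L" "0 \<le> R" using assms norm_ge_zero[of z] by linarith+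
 have E1: "?E \<ge> 1" using L K_nonneg by simp
 have "(norm (val z a b x))\<^sup>2 + (norm (der z a b x))\<^sup>2 \<le> ((norm a)\<^sup>2 + (norm b)\<^sup>2) * exp ((1 + K + norm z) * x)"
  using energy_bound[OF sol_props(1)[of z a b] order_refl assms(2)] by (simp add: sol_props)
 also have "\<dots> \<le> (norm a + norm b)\<^sup>2 * (?E * ?E)"
 proof (rule mult_mono)
  show "(norm a)\<^sup>2 + (norm b)\<^sup>2 \<le> (norm a + norm b)\<^sup>2" by (simp add: power2_sum)
  have "(1 + K + norm z) * x \<le> (1 + K + R) * L" using assms L K_nonneg by (intro mult_mono) auto
  then have "exp ((1 + K + norm z) * x) \<le> ?E * 1" by simp
  also have "\<dots> \<le> ?E * ?E" using E1 by (intro mult_left_mono) auto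
  finally show "exp ((1 + K + norm z) * x) \<le> ?E * ?E" .
 qed auto
 also have "\<dots> = ((norm a + norm b) * ?E)\<^sup>2" by (simp add: power_mult_distrib power2_eq_square algebra_simps)
 finally have le: "(norm (val z a b x))\<^sup>2 + (norm (der z a b x))\<^sup>2 \<le> ((norm a + norm b) * ?E)\<^sup>2" .
 have "(norm (val z a b x))\<^sup>2 \<le> ((norm a + norm b) * ?E)\<^sup>2" using le zero_le_power2[of "norm (der z a b x)"] by linarith
 then show "norm (val z a b x) \<le> (norm a + norm b) * ?E" by (rule power2_le_imp_le) simp
 have "(norm (der z a b x))\<^sup>2 \<le> ((norm a + norm b) * ?E)\<^sup>2" using le zero_le_power2[of "norm (val z a b x)"] by linarith
 then show "norm (der z a b x) \<le> (norm a + norm b) * ?E" by (rule power2_le_imp_le) simp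
qed

text \<open>The solution with value \<open>r\<close> and derivative \<open>s\<close> at \<open>x\<close>.\<close>
definition backsol :: "complex \<Rightarrow> real \<Rightarrow> complex \<Rightarrow> complex \<Rightarrow> real \<Rightarrow> complex" where
 "backsol w x r s t = (r * der w 0 1 x - s * val w 0 1 x) * val w 1 0 t + (s * val w 1 0 x - r * der w 1 0 x) * val w 0 1 t"

definition backsol_der :: "complex \<Rightarrow> real \<Rightarrow> complex \<Rightarrow> complex \<Rightarrow> real \<Rightarrow> complex" where
 "backsol_der w x r s t = (r * der w 0 1 x - s * val w 0 1 x) * der w 1 0 t + (s * val w 1 0 x - r * der w 1 0 x) * der w 0 1 t"

lemma backsol_solution: "ode_solution q D w (backsol w x r s) (backsol_der w x r s)"
 unfolding backsol_def[abs_def] backsol_der_def[abs_def] by (intro ode_solution_linear sol_props)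

lemma backsol_at: "x \<ge> 0 \<Longrightarrow> backsol w x r s x = r" "x \<ge> 0 \<Longrightarrow> backsol_der w x r s x = s"
proof -
 assume x: "x \<ge> 0"
 have W: "val w 1 0 x * der w 0 1 x - der w 1 0 x * val w 0 1 x = 1"
  using wronskian_constant[OF sol_props(1)[of w 1 0] sol_props(1)[of w 0 1] x] by (simp add: sol_props)
 have "backsol w x r s x = r * (val w 1 0 x * der w 0 1 x - der w 1 0 x * val w 0 1 x)" by (simp add: backsol_def algebra_simps)
 then show "backsol w x r s x = r" using W by simp
 have "backsol_der w x r s x = s * (val w 1 0 x * der w 0 1 x - der w 1 0 x * val w 0 1 x)" by (simp add: backsol_der_def algebra_simps)
 then show "backsol_der w x r s x = s" using W by simp
qed

lemma backsol_bound:
 assumes "norm w \<le> R" "0 \<le> t" "t \<le> L" "0 \<le> x" "x \<le> L"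
 shows "norm (backsol w x r s t) \<le> 2 * (norm r + norm s) * exp ((1 + K + R) * L) * exp ((1 + K + R) * L)"
proof -
 let ?E = "exp ((1 + K + R) * L)"
 note b = sol_bound[OF assms(1)]
 have 1: "norm (p * val w 1 0 t) \<le> (norm r + norm s) * ?E * ?E" if "norm p \<le> (norm r + norm s) * ?E" for p
  unfolding norm_mult using b(1)[OF assms(2,3), of 1 0] that by (intro mult_mono) (auto intro: mult_nonneg_nonneg)
 have 2: "norm (p * val w 0 1 t) \<le> (norm r + norm s) * ?E * ?E" if "norm p \<le> (norm r + norm s) * ?E" for p
  unfolding norm_mult using b(1)[OF assms(2,3), of 0 1] that by (intro mult_mono) (auto intro: mult_nonneg_nonneg)
 have "norm (r * der w 0 1 x - s * val w 0 1 x) \<le> norm r * norm (der w 0 1 x) + norm s * norm (val w 0 1 x)"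
  by (metis norm_mult norm_triangle_ineq4)
 also have "\<dots> \<le> norm r * ?E + norm s * ?E"
  using b[OF assms(4,5), of 0 1] by (intro add_mono mult_left_mono) auto
 finally have 3: "norm (r * der w 0 1 x - s * val w 0 1 x) \<le> (norm r + norm s) * ?E" by (simp add: algebra_simps)
 have "norm (s * val w 1 0 x - r * der w 1 0 x) \<le> norm s * norm (val w 1 0 x) + norm r * norm (der w 1 0 x)"
  by (metis norm_mult norm_triangle_ineq4)
 also have "\<dots> \<le> norm s * ?E + norm r * ?E"
  using b[OF assms(4,5), of 1 0] by (intro add_mono mult_left_mono) auto
 finally have 4: "norm (s * val w 1 0 x - r * der w 1 0 x) \<le> (norm r + norm s) * ?E" by (simp add: algebra_simps)
 show ?thesis unfolding backsol_def
  by (rule order_trans[OF norm_triangle_ineq]) (use 1[OF 3] 2[OF 4] in \<open>simp add: algebra_simps\<close>)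
qed

lemma val_mult_backsol_integrable:
 "(\<lambda>t. val z a b t * backsol w x r s t) integrable_on {0..x}"
 by (intro integrable_continuous_real continuous_intros continuous_on_subset[OF ode_solution_cont_at(1)[OF sol_props(1)]]
   continuous_on_subset[OF ode_solution_cont_at(1)[OF backsol_solution]]) auto

text \<open>Lagrange's identity with the solution at parameter \<open>w\<close> that has data
  \<open>(r, s)\<close> at \<open>x\<close>. The data \<open>(0, 1)\<close> extract the value and
  \<open>(-1, 0)\<close> the derivative, so difference quotients in the spectral parameter become
  explicit integrals.\<close>

lemma sol_difference:
 assumes x: "x \<ge> 0"
 shows "(val z a b x - val w a b x) * s - (der z a b x - der w a b x) * r
   = (z - w) * integral {0..x} (\<lambda>t. val z a b t * backsol w x r s t)"
proof -
 note L = lagrange_identity[OF sol_props(1)[of z a b] backsol_solution[of w x r s] order_refl x]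
 have "(z - w) * integral {0..x} (\<lambda>t. val z a b t * backsol w x r s t)
   = (val z a b x * s - der z a b x * r) - (a * backsol_der w x r s 0 - b * backsol w x r s 0)"
  using integral_unique[OF L] x by (simp add: backsol_at sol_props)
 moreover have "val w a b x * s - der w a b x * r = a * backsol_der w x r s 0 - b * backsol w x r s 0"
  using wronskian_constant[OF sol_props(1)[of w a b] backsol_solution[of w x r s] x] x by (simp add: backsol_at sol_props)
 moreover have "(val z a b x - val w a b x) * s - (der z a b x - der w a b x) * r
   = (val z a b x * s - der z a b x * r) - (val w a b x * s - der w a b x * r)" by (simp add: algebra_simps)
 ultimately show ?thesis by simp
qed

lemma norm_integral_le_const:
 fixes f :: "real \<Rightarrow> complex"
 assumes "f integrable_on {0..x}" "\<And>t. t \<in> {0..x} \<Longrightarrow> norm (f t) \<le> C" "0 \<le> x" "x \<le> L" "0 \<le> C"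
 shows "norm (integral {0..x} f) \<le> C * L"
proof -
 have "norm (integral {0..x} f) \<le> C * measure lborel {0..x}"
  using has_integral_bound_real[of C "{}" f "integral {0..x} f" 0 x] assms by (auto intro: integrable_integral)
 also have "\<dots> \<le> C * L" using assms by (simp add: mult_left_mono)
 finally show ?thesis .
qed

definition lip :: "complex \<Rightarrow> complex \<Rightarrow> real \<Rightarrow> real \<Rightarrow> real" where
 "lip a b R L = (norm a + norm b) * exp ((1 + K + R) * L) * (2 * exp ((1 + K + R) * L) * exp ((1 + K + R) * L)) * L"

lemma sol_lipschitz:
 assumes "norm z \<le> R" "norm w \<le> R" "0 \<le> x" "x \<le> L"
 shows "norm (val z a b x - val w a b x) \<le> lip a b R L * norm (z - w)"
  and "norm (der z a b x - der w a b x) \<le> lip a b R L * norm (z - w)"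
proof -
 have int: "norm (integral {0..x} (\<lambda>t. val z a b t * backsol w x r s t)) \<le> lip a b R L" if rs: "norm r + norm s = 1" for r s
  unfolding lip_def
 proof (rule norm_integral_le_const[OF val_mult_backsol_integrable _ assms(3,4)])
  fix t assume t: "t \<in> {0..x}"
  then have t': "0 \<le> t" "t \<le> L" using assms by auto
  show "norm (val z a b t * backsol w x r s t) \<le> (norm a + norm b) * exp ((1 + K + R) * L) * (2 * exp ((1 + K + R) * L) * exp ((1 + K + R) * L))"
   unfolding norm_mult using sol_bound(1)[OF assms(1) t', of a b] backsol_bound[OF assms(2) t' assms(3,4), of r s] rs
   by (intro mult_mono) auto
 qed auto
 have "val z a b x - val w a b x = (z - w) * integral {0..x} (\<lambda>t. val z a b t * backsol w x 0 1 t)"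
  using sol_difference[OF assms(3), of z a b w 1 0] by simp
 then show "norm (val z a b x - val w a b x) \<le> lip a b R L * norm (z - w)"
  using int[of 0 1] by (simp add: norm_mult mult_left_mono mult.commute)
 have "der z a b x - der w a b x = (z - w) * integral {0..x} (\<lambda>t. val z a b t * backsol w x (-1) 0 t)"
  using sol_difference[OF assms(3), of z a b w 0 "-1"] by simp
 then show "norm (der z a b x - der w a b x) \<le> lip a b R L * norm (z - w)"
  using int[of "-1" 0] by (simp add: norm_mult mult_left_mono mult.commute)
qed

lemma continuous_integral_back:
 assumes x: "x \<ge> 0"
 shows "((\<lambda>z. integral {0..x} (\<lambda>t. val z a b t * backsol w x r s t)) \<longlongrightarrow> integral {0..x} (\<lambda>t. val w a b t * backsol w x r s t)) (at w)"
proof -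
 define R where "R = norm w + 1"
 define C where "C = lip a b R x * (2 * (norm r + norm s) * exp ((1 + K + R) * x) * exp ((1 + K + R) * x)) * x"
 have "norm (integral {0..x} (\<lambda>t. val z a b t * backsol w x r s t) - integral {0..x} (\<lambda>t. val w a b t * backsol w x r s t)) \<le> C * norm (z - w)"
  if z: "norm (z - w) < 1" for z
 proof -
  have R: "norm z \<le> R" "norm w \<le> R" using norm_triangle_ineq2[of z w] z by (auto simp: R_def)
  have lip0: "lip a b R x \<ge> 0" using x by (auto simp: lip_def intro!: mult_nonneg_nonneg)
  have "integral {0..x} (\<lambda>t. val z a b t * backsol w x r s t) - integral {0..x} (\<lambda>t. val w a b t * backsol w x r s t)
    = integral {0..x} (\<lambda>t. val z a b t * backsol w x r s t - val w a b t * backsol w x r s t)"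
   by (rule integral_diff[symmetric]) (rule val_mult_backsol_integrable)+
  moreover have "norm (integral {0..x} (\<lambda>t. val z a b t * backsol w x r s t - val w a b t * backsol w x r s t)) \<le>
    (lip a b R x * norm (z - w)) * (2 * (norm r + norm s) * exp ((1 + K + R) * x) * exp ((1 + K + R) * x)) * x"
  proof (rule norm_integral_le_const[OF integrable_diff[OF val_mult_backsol_integrable val_mult_backsol_integrable] _ x order_refl])
   fix t assume t: "t \<in> {0..x}"
   have "norm ((val z a b t - val w a b t) * backsol w x r s t) \<le> (lip a b R x * norm (z - w)) * (2 * (norm r + norm s) * exp ((1 + K + R) * x) * exp ((1 + K + R) * x))"
    unfolding norm_mult[of "val z a b t - val w a b t"] using sol_lipschitz(1)[OF R, of t x a b] backsol_bound[OF R(2), of t x x r s] t x lip0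
    by (intro mult_mono) auto
   then show "norm (val z a b t * backsol w x r s t - val w a b t * backsol w x r s t) \<le> (lip a b R x * norm (z - w)) * (2 * (norm r + norm s) * exp ((1 + K + R) * x) * exp ((1 + K + R) * x))"
    by (simp add: left_diff_distrib)
  qed (use lip0 in \<open>auto intro!: mult_nonneg_nonneg\<close>)
  ultimately show ?thesis by (simp add: C_def algebra_simps)
 qed
 then have ev: "eventually (\<lambda>z. norm (integral {0..x} (\<lambda>t. val z a b t * backsol w x r s t) - integral {0..x} (\<lambda>t. val w a b t * backsol w x r s t)) \<le> C * norm (z - w)) (at w)"
  unfolding eventually_at by (intro exI[of _ 1]) (auto simp: dist_norm)
 have "((\<lambda>z. C * norm (z - w)) \<longlongrightarrow> C * norm (w - w)) (at w)" by (intro tendsto_intros)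
 then have "((\<lambda>z. C * norm (z - w)) \<longlongrightarrow> 0) (at w)" by simp
 then have "((\<lambda>z. integral {0..x} (\<lambda>t. val z a b t * backsol w x r s t) - integral {0..x} (\<lambda>t. val w a b t * backsol w x r s t)) \<longlongrightarrow> 0) (at w)"
  by (rule Lim_null_comparison[OF ev])
 then show ?thesis by (simp add: LIM_zero_iff)
qed

text \<open>By \<open>sol_difference\<close> the difference quotient is an integral, which converges
  as \<open>z\<close> tends to \<open>w\<close> because solutions are Lipschitz in the
  parameter.\<close>

lemma sol_holomorphic:
 assumes x: "x \<ge> 0"
 shows "(\<lambda>z. val z a b x) holomorphic_on UNIV" "(\<lambda>z. der z a b x) holomorphic_on UNIV"
proof -
 have "((\<lambda>z. val z a b x) has_field_derivative integral {0..x} (\<lambda>t. val w a b t * backsol w x 0 1 t)) (at w)" for w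
  unfolding has_field_derivative_iff
 proof (rule Lim_transform_eventually[OF continuous_integral_back[OF x]])
  show "eventually (\<lambda>z. integral {0..x} (\<lambda>t. val z a b t * backsol w x 0 1 t) = (val z a b x - val w a b x) / (z - w)) (at w)"
   using sol_difference[OF x, of _ a b w 1 0] by (auto simp: eventually_at intro!: exI[of _ 1])
 qed
 then show "(\<lambda>z. val z a b x) holomorphic_on UNIV"
  unfolding holomorphic_on_def by (auto simp: field_differentiable_def)
 have "((\<lambda>z. der z a b x) has_field_derivative integral {0..x} (\<lambda>t. val w a b t * backsol w x (-1) 0 t)) (at w)" for w
  unfolding has_field_derivative_iff
 proof (rule Lim_transform_eventually[OF continuous_integral_back[OF x]])
  show "eventually (\<lambda>z. integral {0..x} (\<lambda>t. val z a b t * backsol w x (-1) 0 t) = (der z a b x - der w a b x) / (z - w)) (at w)"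
   using sol_difference[OF x, of _ a b w 0 "-1"] by (auto simp: eventually_at intro!: exI[of _ 1])
 qed
 then show "(\<lambda>z. der z a b x) holomorphic_on UNIV"
  unfolding holomorphic_on_def by (auto simp: field_differentiable_def)
qed

text \<open>The real potential drops out of the imaginary part of the derivative of
  \<open>cnj u * v\<close>. This identity is the source of the positivity of \<open>Im m\<close> and
  of the Weyl disks.\<close>

lemma im_identity:
 assumes s: "ode_solution q D z u v" and ab: "0 \<le> a" "a \<le> b"
 shows "((\<lambda>x. Im z * (norm (u x))\<^sup>2) has_integral Im (cnj (u a) * v a) - Im (cnj (u b) * v b)) {a..b}"
proof -
 have sub: "{a..b} \<subseteq> {0..}" using ab by auto
 have "((\<lambda>x. Im z * (norm (u x))\<^sup>2) has_integral (- Im (cnj (u b) * v b)) - (- Im (cnj (u a) * v a))) {a..b}"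
 proof (rule ftc_countable[OF ab(2) countable_D, where f = "\<lambda>x. - Im (cnj (u x) * v x)"])
  show "continuous_on {a..b} (\<lambda>x. - Im (cnj (u x) * v x))"
   by (intro continuous_intros continuous_on_subset[OF ode_solution_cont_at(1)[OF s] sub] continuous_on_subset[OF ode_solution_cont_at(2)[OF s] sub])
  fix x assume "x \<in> {a<..<b} - D"
  then have x: "x > 0" "x \<notin> D" using ab by auto
  note du = ode_solution_deriv(1)[OF s x(1)] and dv = ode_solution_deriv(2)[OF s x]
  have "((\<lambda>x. cnj (u x) * v x) has_vector_derivative cnj (u x) * ((of_real (q x) - z) * u x) + cnj (v x) * v x) (at x)"
   by (intro has_vector_derivative_mult dv bounded_linear.has_vector_derivative[OF bounded_linear_cnj du])
  then have "((\<lambda>x. - Im (cnj (u x) * v x)) has_vector_derivative - Im (cnj (u x) * ((of_real (q x) - z) * u x) + cnj (v x) * v x)) (at x)"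
   by (intro has_vector_derivative_minus bounded_linear.has_vector_derivative[OF bounded_linear_Im])
  moreover have "- Im (cnj (u x) * ((of_real (q x) - z) * u x) + cnj (v x) * v x) = Im z * (norm (u x))\<^sup>2"
   unfolding cmod_power2 by (simp add: power2_eq_square algebra_simps)
  ultimately show "((\<lambda>x. - Im (cnj (u x) * v x)) has_vector_derivative Im z * (norm (u x))\<^sup>2) (at x)" by simp
 qed
 then show ?thesis by (simp add: algebra_simps)
qed

lemma norm_square_integrable:
 assumes s: "ode_solution q D z u v" and a: "0 \<le> a"
 shows "(\<lambda>x. (norm (u x))\<^sup>2) integrable_on {a..b}" "(\<lambda>x. (norm (v x))\<^sup>2) integrable_on {a..b}"
 using a by (auto intro!: integrable_continuous_real continuous_intros
   intro: continuous_on_subset[OF ode_solution_cont_at(1)[OF s]] continuous_on_subset[OF ode_solution_cont_at(2)[OF s]])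

lemma energy_diff_le:
 assumes "ode_solution q D z u v" "ode_solution q D z f g"
 shows "energy (\<lambda>t. u t - f t) x \<le> 2 * energy u x + 2 * energy f x"
proof -
 note i = norm_square_integrable(1)[OF assms(1) order_refl, of x] norm_square_integrable(1)[OF assms(2) order_refl, of x]
 note i2 = integrable_cmul[OF i(1), of 2] integrable_cmul[OF i(2), of 2]
 have "energy (\<lambda>t. u t - f t) x \<le> integral {0..x} (\<lambda>t. 2 * (norm (u t))\<^sup>2 + 2 * (norm (f t))\<^sup>2)"
 proof (rule integral_le)
  show "(\<lambda>t. (norm (u t - f t))\<^sup>2) integrable_on {0..x}"
   using norm_square_integrable(1)[OF ode_solution_linear[OF assms, of 1 "-1"] order_refl, of x] by simp
  show "(\<lambda>t. 2 * (norm (u t))\<^sup>2 + 2 * (norm (f t))\<^sup>2) integrable_on {0..x}" using integrable_add[OF i2] by simp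
  fix t
  have "(norm (u t - f t))\<^sup>2 \<le> (norm (u t) + norm (f t))\<^sup>2" by (intro power_mono norm_triangle_ineq4) auto
  also have "\<dots> \<le> 2 * (norm (u t))\<^sup>2 + 2 * (norm (f t))\<^sup>2"
   using sum_squares_bound[of "norm (u t)" "norm (f t)"] by (simp add: power2_sum)
  finally show "(norm (u t - f t))\<^sup>2 \<le> 2 * (norm (u t))\<^sup>2 + 2 * (norm (f t))\<^sup>2" .
 qed
 then show ?thesis using integral_add[OF i2] by simp
qed

end

lemma integral_unbounded:
 fixes f :: "real \<Rightarrow> real"
 assumes ab: "a \<le> b" and i: "\<And>x. x \<ge> a \<Longrightarrow> f integrable_on {a..x}" and f0: "\<And>x. x \<ge> a \<Longrightarrow> f x \<ge> 0"
  and c: "c > 0" "\<And>x. x \<ge> b \<Longrightarrow> f x \<ge> c" and B: "\<And>x. x \<ge> a \<Longrightarrow> integral {a..x} f \<le> B"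
 shows False
proof -
 define y where "y = b + (\<bar>B\<bar> + 1) / c"
 have y: "y \<ge> b" using c by (simp add: y_def)
 have "\<bar>B\<bar> + 1 = integral {b..y} (\<lambda>t. c)" using c by (simp add: y_def)
 also have "\<dots> \<le> integral {b..y} f"
  using c y ab by (intro integral_le integrable_const_ivl integrable_on_subinterval[OF i[of y]]) auto
 also have "\<dots> \<le> integral {a..y} f"
  using y ab f0 by (intro integral_subset_le integrable_on_subinterval[OF i[of y]] i) auto
 finally show False using B[of y] y ab by linarith
qed

section \<open>The m-function of the problem truncated at \<open>N\<close>, and the limit point
  case\<close>

locale weyl_potential = bounded_potential +
 fixes \<theta> :: real
begin

text \<open>\<open>phi\<close> satisfies the boundary condition at 0, and \<open>psi\<close>
  completes it to a system with Wronskian 1, normalised so that the quotient in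
  \<open>weyl_m\<close> gives exactly \<open>m\<close> for \<open>psi + m * phi\<close>.\<close>

definition "phi z x = val z (of_real (sin \<theta>)) (of_real (cos \<theta>)) x"
definition "dphi z x = der z (of_real (sin \<theta>)) (of_real (cos \<theta>)) x"
definition "psi z x = val z (of_real (cos \<theta>)) (of_real (- sin \<theta>)) x"
definition "dpsi z x = der z (of_real (cos \<theta>)) (of_real (- sin \<theta>)) x"

lemma phi_sol: "ode_solution q D z (phi z) (dphi z)"
 unfolding phi_def[abs_def] dphi_def[abs_def] by (rule sol_props(1))

lemma psi_sol: "ode_solution q D z (psi z) (dpsi z)"
 unfolding psi_def[abs_def] dpsi_def[abs_def] by (rule sol_props(1))

lemma phi_psi_0: "phi z 0 = of_real (sin \<theta>)" "dphi z 0 = of_real (cos \<theta>)" "psi z 0 = of_real (cos \<theta>)" "dpsi z 0 = of_real (- sin \<theta>)"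
 by (simp_all add: phi_def dphi_def psi_def dpsi_def sol_props)

lemma cos_sin_sq: "complex_of_real (cos \<theta>) * complex_of_real (cos \<theta>) + complex_of_real (sin \<theta>) * complex_of_real (sin \<theta>) = 1"
 unfolding of_real_mult[symmetric] of_real_add[symmetric] using sin_cos_squared_add3[of \<theta>] by simp

lemma wronskian_phi_psi: "x \<ge> 0 \<Longrightarrow> psi z x * dphi z x - dpsi z x * phi z x = 1"
 using wronskian_constant[OF psi_sol phi_sol, of x z] cos_sin_sq by (simp add: phi_psi_0)

definition "ucomb m z x = psi z x + m * phi z x"
definition "ducomb m z x = dpsi z x + m * dphi z x"

lemma ucomb_sol: "ode_solution q D z (ucomb m z) (ducomb m z)"
 using ode_solution_linear[OF psi_sol phi_sol, of z 1 m] by (simp add: ucomb_def[abs_def] ducomb_def[abs_def])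

lemma im_ucomb_0: "Im (cnj (ucomb m z 0) * ducomb m z 0) = Im m"
proof -
 have "cos \<theta> * cos \<theta> + sin \<theta> * sin \<theta> = 1" using sin_cos_squared_add3[of \<theta>] by simp
 then have "Im m * (cos \<theta> * cos \<theta>) + Im m * (sin \<theta> * sin \<theta>) = Im m"
  by (metis distrib_left mult.right_neutral)
 then show ?thesis by (simp add: ucomb_def ducomb_def phi_psi_0 algebra_simps)
qed

lemma im_ucomb:
 assumes "N \<ge> 0"
 shows "Im m = Im (cnj (ucomb m z N) * ducomb m z N) + Im z * energy (ucomb m z) N"
proof -
 have "Im z * energy (ucomb m z) N = Im m - Im (cnj (ucomb m z N) * ducomb m z N)"
  using integral_unique[OF im_identity[OF ucomb_sol order_refl assms, of z m]] unfolding im_ucomb_0 by simp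
 then show ?thesis by linarith
qed

text \<open>\<open>mN N z\<close> is the \<open>m\<close> for which \<open>psi + m * phi\<close>
  satisfies \<open>u' = i u\<close> at \<open>N\<close>. A real condition at \<open>N\<close> would
  put poles on the real axis; with this one \<open>den\<close> has no zero in the closed upper
  half-plane.\<close>

definition "den N z = dphi z N - \<i> * phi z N"
definition "num N z = dpsi z N - \<i> * psi z N"
definition "mN N z = - num N z / den N z"

text \<open>At a zero of \<open>den\<close>, \<open>phi\<close> satisfies \<open>u' = i u\<close> at
  \<open>N\<close>. The identity for imaginary parts then equates a nonnegative and a nonpositive
  number, so \<open>phi\<close> and \<open>dphi\<close> vanish at \<open>N\<close>, against the
  Wronskian.\<close>

lemma den_nonzero:
 assumes N: "N \<ge> 0" and z: "Im z \<ge> 0"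
 shows "den N z \<noteq> 0"
proof
 assume 0: "den N z = 0"
 then have d: "dphi z N = \<i> * phi z N" by (simp add: den_def)
 have "Im z * energy (phi z) N = - Im (cnj (phi z N) * dphi z N)"
  using integral_unique[OF im_identity[OF phi_sol order_refl N, of z]] by (simp add: phi_psi_0)
 also have "\<dots> = - (norm (phi z N))\<^sup>2" unfolding d cmod_power2 by (simp add: power2_eq_square)
 finally have "Im z * energy (phi z) N = - (norm (phi z N))\<^sup>2" .
 moreover have "0 \<le> Im z * energy (phi z) N"
  using z by (intro mult_nonneg_nonneg integral_nonneg norm_square_integrable[OF phi_sol]) auto
 ultimately have "phi z N = 0" by simp
 then show False using wronskian_phi_psi[OF N, of z] d by simp
qed

lemma mN_boundary:
 assumes "N \<ge> 0" "Im z \<ge> 0"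
 shows "ducomb (mN N z) z N = \<i> * ucomb (mN N z) z N"
proof -
 have "mN N z * den N z = - num N z" using den_nonzero[OF assms] by (simp add: mN_def)
 then show ?thesis unfolding den_def num_def ducomb_def ucomb_def by (simp add: algebra_simps)
qed

lemma im_mN:
 assumes "N \<ge> 0" "Im z \<ge> 0"
 shows "Im (mN N z) = (norm (ucomb (mN N z) z N))\<^sup>2 + Im z * energy (ucomb (mN N z) z) N"
proof -
 have "Im (cnj (ucomb (mN N z) z N) * ducomb (mN N z) z N) = (norm (ucomb (mN N z) z N))\<^sup>2"
  unfolding mN_boundary[OF assms] cmod_power2 by (simp add: power2_eq_square)
 then show ?thesis using im_ucomb[OF assms(1), of "mN N z" z] by simp
qed

text \<open>Carmona's formula.\<close>
lemma im_mN_real: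
 assumes "N \<ge> 0"
 shows "Im (mN N (of_real E)) = 1 / (norm (den N (of_real E)))\<^sup>2"
proof -
 let ?z = "complex_of_real E"
 let ?u = "ucomb (mN N ?z) ?z"
 have "?u N * dphi ?z N - ducomb (mN N ?z) ?z N * phi ?z N = 1"
  using wronskian_constant[OF ucomb_sol phi_sol assms, of ?z] cos_sin_sq
  by (simp add: ucomb_def ducomb_def phi_psi_0 algebra_simps)
 then have "?u N * den N ?z = 1" using mN_boundary[OF assms, of ?z] by (simp add: den_def algebra_simps)
 then have "norm (?u N) * norm (den N ?z) = 1" by (metis norm_mult norm_one)
 then have "norm (?u N) = 1 / norm (den N ?z)" by (metis nonzero_eq_divide_eq mult_zero_right zero_neq_one)
 then show ?thesis using im_mN[OF assms, of ?z] by (simp add: power_divide)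
qed

lemma holomorphic_den_num: "N \<ge> 0 \<Longrightarrow> (\<lambda>z. den N z) holomorphic_on UNIV" "N \<ge> 0 \<Longrightarrow> (\<lambda>z. num N z) holomorphic_on UNIV"
 unfolding den_def num_def phi_def dphi_def psi_def dpsi_def by (intro holomorphic_intros sol_holomorphic; assumption)+

lemma mN_holomorphic:
 assumes "N \<ge> 0"
 shows "open {z. den N z \<noteq> 0}" "(\<lambda>z. mN N z) holomorphic_on {z. den N z \<noteq> 0}"
proof -
 have "continuous_on UNIV (\<lambda>z. den N z)" using holomorphic_den_num[OF assms] by (simp add: holomorphic_on_imp_continuous_on)
 then have "open ((\<lambda>z. den N z) -` (- {0}))" by (intro open_vimage) auto
 moreover have "(\<lambda>z. den N z) -` (- {0}) = {z. den N z \<noteq> 0}" by auto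
 ultimately show "open {z. den N z \<noteq> 0}" by simp
 show "(\<lambda>z. mN N z) holomorphic_on {z. den N z \<noteq> 0}" unfolding mN_def
  by (intro holomorphic_intros holomorphic_on_subset[OF holomorphic_den_num(1)[OF assms]] holomorphic_on_subset[OF holomorphic_den_num(2)[OF assms]]) auto
qed

text \<open>Together with positivity this bounds the energy of \<open>phi\<close> on
  \<open>[0, 1]\<close> from below, uniformly for \<open>z\<close> in a ball.\<close>

lemma phi_L2_continuous:
 "continuous_on (cball 0 R) (\<lambda>z. energy (phi z) 1)"
proof -
 define B where "B = (norm (complex_of_real (sin \<theta>)) + norm (complex_of_real (cos \<theta>))) * exp ((1 + K + R) * 1)"
 define L where "L = lip (complex_of_real (sin \<theta>)) (complex_of_real (cos \<theta>)) R 1"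
 have L0: "L \<ge> 0" by (auto simp: L_def lip_def intro!: mult_nonneg_nonneg)
 have B0: "B \<ge> 0" by (auto simp: B_def intro!: mult_nonneg_nonneg)
 have "\<bar>energy (phi z) 1 - energy (phi w) 1\<bar> \<le> (L * (2 * B)) * norm (z - w)"
  if z: "z \<in> cball 0 R" "w \<in> cball 0 R" for z w
 proof -
  have zw: "norm z \<le> R" "norm w \<le> R" using z by auto
  have "norm (integral {0..1} (\<lambda>x. (norm (phi z x))\<^sup>2 - (norm (phi w x))\<^sup>2)) \<le> integral {0..1} (\<lambda>x::real. (L * (2 * B)) * norm (z - w))"
  proof (rule integral_norm_bound_integral)
   show "(\<lambda>x. (norm (phi z x))\<^sup>2 - (norm (phi w x))\<^sup>2) integrable_on {0..1}"
    by (intro integrable_diff norm_square_integrable[OF phi_sol]) auto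
   fix x :: real assume x: "x \<in> {0..1}"
   have b: "norm (phi z x) \<le> B" "norm (phi w x) \<le> B"
    unfolding phi_def B_def by (intro sol_bound zw; use x in simp)+
   have "norm (phi z x - phi w x) \<le> L * norm (z - w)"
    unfolding phi_def L_def by (rule sol_lipschitz(1)[OF zw]) (use x in auto)
   moreover have "\<bar>norm (phi z x) - norm (phi w x)\<bar> \<le> norm (phi z x - phi w x)" by (rule norm_triangle_ineq3)
   ultimately have "\<bar>norm (phi z x) - norm (phi w x)\<bar> \<le> L * norm (z - w)" by linarith
   then have "\<bar>norm (phi z x) - norm (phi w x)\<bar> * (norm (phi z x) + norm (phi w x)) \<le> (L * norm (z - w)) * (2 * B)"
    using b L0 by (intro mult_mono) auto
   moreover have "norm ((norm (phi z x))\<^sup>2 - (norm (phi w x))\<^sup>2) = \<bar>norm (phi z x) - norm (phi w x)\<bar> * (norm (phi z x) + norm (phi w x))"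
    by (simp add: power2_eq_square square_diff_square_factored abs_mult)
   ultimately show "norm ((norm (phi z x))\<^sup>2 - (norm (phi w x))\<^sup>2) \<le> (L * (2 * B)) * norm (z - w)" by (simp add: algebra_simps)
  qed (rule integrable_const_ivl)
  then show ?thesis
   using integral_diff[OF norm_square_integrable(1)[OF phi_sol order_refl] norm_square_integrable(1)[OF phi_sol order_refl], of 1 z w] by simp
 qed
 then have "(L * (2 * B))-lipschitz_on (cball 0 R) (\<lambda>z. energy (phi z) 1)"
  using L0 B0 by (intro lipschitz_onI) (auto simp: dist_norm)
 then show ?thesis by (rule lipschitz_on_continuous_on)
qed

lemma phi_L2_positive: "energy (phi z) 1 > 0"
proof (rule ccontr)
 assume "\<not> ?thesis"
 moreover have "energy (phi z) 1 \<ge> 0" by (intro integral_nonneg norm_square_integrable[OF phi_sol]) auto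
 ultimately have z: "energy (phi z) 1 = 0" by simp
 have c: "continuous_on {0..1} (\<lambda>x. (norm (phi z x))\<^sup>2)"
  by (intro continuous_intros continuous_on_subset[OF ode_solution_cont_at(1)[OF phi_sol]]) auto
 have "((\<lambda>x. (norm (phi z x))\<^sup>2) has_integral 0) (cbox 0 1)"
  using norm_square_integrable(1)[OF phi_sol[of z] order_refl, of 1] z by (simp add: has_integral_iff)
 then have 0: "phi z x = 0" if "x \<in> {0..1}" for x
  using has_integral_0_cbox_imp_0[of 0 1 "\<lambda>x. (norm (phi z x))\<^sup>2" x] c that by simp
 have "(phi z has_vector_derivative 0) (at (1/2))"
  by (rule has_vector_derivative_transform_within_open[of "\<lambda>_. 0" _ _ "{0<..<1}"]) (use 0 in auto)
 moreover have "(phi z has_vector_derivative dphi z (1/2)) (at (1/2))" by (rule ode_solution_deriv(1)[OF phi_sol]) simp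
 ultimately have "dphi z (1/2) = 0" using vector_derivative_unique_at by blast
 then show False using wronskian_phi_psi[of "1/2" z] 0[of "1/2"] by simp
qed

text \<open>In the Weyl disk \<open>Im z * energy u 1 \<le> Im m\<close>, while
  \<open>m * phi = u - psi\<close> has energy at least \<open>a * (norm m)^2\<close>. Hence
  \<open>Im z * a * (norm m)^2 / 2\<close> is at most \<open>norm m\<close> plus a constant:
  quadratic in \<open>m\<close> on the left, linear on the right.\<close>

lemma weyl_disk_bound:
 "\<exists>C>0. \<forall>z m. norm z \<le> R \<and> 0 < Im z \<and> Im z \<le> 1 \<and> Im z * energy (ucomb m z) 1 \<le> Im m \<longrightarrow> norm m \<le> C / Im z"
proof (cases "R \<ge> 0")
 case False
 then show ?thesis by (intro exI[of _ 1]) (auto, smt (verit) norm_ge_zero)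
next
 case True
 have "\<exists>z0\<in>cball 0 R. \<forall>z\<in>cball 0 R. energy (phi z0) 1 \<le> energy (phi z) 1"
  by (rule continuous_attains_inf[OF _ _ phi_L2_continuous]) (use True in auto)
 then obtain z0 where "\<forall>z\<in>cball 0 R. energy (phi z0) 1 \<le> energy (phi z) 1" by blast
 then have z0: "\<And>z. norm z \<le> R \<Longrightarrow> energy (phi z0) 1 \<le> energy (phi z) 1" by auto
 define a where "a = energy (phi z0) 1"
 have a: "a > 0" unfolding a_def by (rule phi_L2_positive)
 define B where "B = (norm (complex_of_real (cos \<theta>)) + norm (complex_of_real (- sin \<theta>))) * exp ((1 + K + R) * 1)"
 show ?thesis
 proof (intro exI[of _ "2 * (1 + B\<^sup>2) / a + 1"] conjI allI impI)
  show "2 * (1 + B\<^sup>2) / a + 1 > 0" using a by (intro add_nonneg_pos divide_nonneg_pos mult_nonneg_nonneg add_nonneg_nonneg) auto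
  fix z m assume H: "norm z \<le> R \<and> 0 < Im z \<and> Im z \<le> 1 \<and> Im z * energy (ucomb m z) 1 \<le> Im m"
  show "norm m \<le> (2 * (1 + B\<^sup>2) / a + 1) / Im z"
  proof (cases "norm m \<le> 1")
   case True
   have "1 \<le> 1 / Im z" using H by simp
   also have "\<dots> \<le> (2 * (1 + B\<^sup>2) / a + 1) / Im z" using H a by (intro divide_right_mono) auto
   finally show ?thesis using True by linarith
  next
   case False
   have "(norm m)\<^sup>2 * a \<le> (norm m)\<^sup>2 * energy (phi z) 1" using z0[of z] H by (simp add: a_def mult_left_mono)
   also have "\<dots> = energy (\<lambda>x. ucomb m z x - psi z x) 1" by (simp add: ucomb_def norm_mult power_mult_distrib)
   also have "\<dots> \<le> 2 * energy (ucomb m z) 1 + 2 * energy (psi z) 1" by (rule energy_diff_le[OF ucomb_sol psi_sol])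
   also have "energy (psi z) 1 \<le> integral {0..1} (\<lambda>x::real. B\<^sup>2)"
   proof (rule integral_le[OF norm_square_integrable(1)[OF psi_sol order_refl] integrable_const_ivl])
    fix x :: real assume x: "x \<in> {0..1}"
    have "norm (psi z x) \<le> B" unfolding psi_def B_def by (rule sol_bound) (use H x in auto)
    then show "(norm (psi z x))\<^sup>2 \<le> B\<^sup>2" by (intro power_mono) auto
   qed
   finally have "(norm m)\<^sup>2 * a \<le> 2 * energy (ucomb m z) 1 + 2 * B\<^sup>2" by simp
   then have "Im z * ((norm m)\<^sup>2 * a) \<le> Im z * (2 * energy (ucomb m z) 1 + 2 * B\<^sup>2)" using H by (intro mult_left_mono) auto
   moreover have "Im z * energy (ucomb m z) 1 \<le> norm m" using H abs_Im_le_cmod[of m] by linarith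
   ultimately have 1: "Im z * ((norm m)\<^sup>2 / 2 * a) \<le> norm m + Im z * B\<^sup>2" by (simp add: algebra_simps)
   have "Im z * B\<^sup>2 \<le> 1 * B\<^sup>2" using H by (intro mult_right_mono) auto
   also have "\<dots> \<le> B\<^sup>2 * norm m" using False mult_left_mono[of 1 "norm m" "B\<^sup>2"] by simp
   finally have "Im z * ((norm m)\<^sup>2 / 2 * a) \<le> (1 + B\<^sup>2) * norm m" using 1 by (simp add: algebra_simps)
   then have "(Im z * norm m * a / 2) * norm m \<le> (1 + B\<^sup>2) * norm m" by (simp add: power2_eq_square algebra_simps)
   moreover have "0 < norm m" using False by linarith
   ultimately have "Im z * norm m * a / 2 \<le> 1 + B\<^sup>2" by (rule mult_right_le_imp_le)
   then have "norm m \<le> (2 * (1 + B\<^sup>2) / a) / Im z" using a H by (simp add: field_simps)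
   also have "\<dots> \<le> (2 * (1 + B\<^sup>2) / a + 1) / Im z" using H by (intro divide_right_mono) auto
   finally show ?thesis .
  qed
 qed
qed

lemma integral_ucomb_mono:
 assumes "0 \<le> a" "a \<le> b" shows "energy (ucomb m z) a \<le> energy (ucomb m z) b"
 using assms by (intro integral_subset_le norm_square_integrable[OF ucomb_sol]) auto

lemma mN_in_disk:
 assumes "0 \<le> k" "k \<le> N" "Im z \<ge> 0"
 shows "Im z * energy (ucomb (mN N z) z) k \<le> Im (mN N z)"
proof -
 have "Im z * energy (ucomb (mN N z) z) k \<le> Im z * energy (ucomb (mN N z) z) N"
  using assms by (intro mult_left_mono integral_ucomb_mono) auto
 then show ?thesis using im_mN[of N z] assms zero_le_power2[of "norm (ucomb (mN N z) z N)"] by linarith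
qed

lemma mN_bound:
 "\<exists>C>0. \<forall>N z. N \<ge> 1 \<and> norm z \<le> R \<and> 0 < Im z \<and> Im z \<le> 1 \<longrightarrow> norm (mN N z) \<le> C / Im z"
 using weyl_disk_bound[of R] mN_in_disk[of 1] by (meson less_imp_le zero_le_one)

text \<open>The limit point case: \<open>V\<close> is bounded, so a square integrable solution has a square integrable derivative.\<close>
lemma L2_derivative:
 assumes s: "ode_solution q D z u v" and B: "\<And>x. x \<ge> 0 \<Longrightarrow> energy u x \<le> B"
 shows "\<exists>B'. \<forall>x\<ge>0. energy v x \<le> B'"
proof (rule ccontr)
 assume no: "\<not> ?thesis"
 define C where "C = K + norm z"
 \<comment> \<open>Half the derivative of \<open>|u|^2\<close>. As
   \<open>g' \<ge> |v|^2 - C * |u|^2\<close>, an unbounded energy of \<open>v\<close> pushes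
   \<open>g\<close> above 1 for good, so \<open>|u|^2\<close> grows linearly and the energy of
   \<open>u\<close> is unbounded as well.\<close>
 define g where "g x = u x \<bullet> v x" for x
 note iu = norm_square_integrable(1)[OF s order_refl] and iv = norm_square_integrable(2)[OF s order_refl]
 have inner: "((\<lambda>x. f x \<bullet> h x) has_vector_derivative (f x \<bullet> h' + f' \<bullet> h x)) (at x)"
  if "(f has_vector_derivative f') (at x)" "(h has_vector_derivative h') (at x)" for f h :: "real \<Rightarrow> complex" and f' h' x
  using has_derivative_inner[OF that[unfolded has_vector_derivative_def]]
  unfolding has_vector_derivative_def by (simp add: algebra_simps)
 have C0: "C \<ge> 0" using K_nonneg by (simp add: C_def)
 have gb: "g x \<ge> g 0 - C * B + energy v x" if x: "x \<ge> 0" for x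
 proof -
  have sub: "{0..x} \<subseteq> {0..}" by auto
  have "((\<lambda>t. u t \<bullet> ((of_real (q t) - z) * u t) + v t \<bullet> v t) has_integral g x - g 0) {0..x}"
  proof (rule ftc_countable[OF x countable_D])
   show "continuous_on {0..x} g" unfolding g_def
    by (intro continuous_intros continuous_on_subset[OF ode_solution_cont_at(1)[OF s] sub] continuous_on_subset[OF ode_solution_cont_at(2)[OF s] sub])
   fix t assume t: "t \<in> {0<..<x} - D"
   then show "(g has_vector_derivative u t \<bullet> ((of_real (q t) - z) * u t) + v t \<bullet> v t) (at t)"
    unfolding g_def by (intro inner ode_solution_deriv[OF s]) auto
  qed
  moreover have "((\<lambda>t. (norm (v t))\<^sup>2 - C * (norm (u t))\<^sup>2) has_integral (energy v x - C * energy u x)) {0..x}"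
   by (intro has_integral_diff has_integral_mult_right integrable_integral iu iv)
  note h = calculation this
  have "energy v x - C * energy u x \<le> g x - g 0"
  proof (rule has_integral_le[OF h(2,1)])
   fix t
   have "\<bar>u t \<bullet> ((of_real (q t) - z) * u t)\<bar> \<le> norm (u t) * norm ((of_real (q t) - z) * u t)"
    by (rule Cauchy_Schwarz_ineq2)
   also have "\<dots> \<le> norm (u t) * (C * norm (u t))"
    unfolding norm_mult C_def using coefficient_bound by (intro mult_left_mono mult_right_mono) auto
   finally show "(norm (v t))\<^sup>2 - C * (norm (u t))\<^sup>2 \<le> u t \<bullet> ((of_real (q t) - z) * u t) + v t \<bullet> v t"
    by (simp add: power2_norm_eq_inner[symmetric] power2_eq_square algebra_simps)
  qed
  moreover have "C * energy u x \<le> C * B" using B[OF x] C0 by (intro mult_left_mono) auto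
  ultimately show ?thesis by linarith
 qed
 obtain x0 where x0: "x0 \<ge> 0" "energy v x0 > 1 - g 0 + C * B" using no by (meson not_le)
 have g1: "g x \<ge> 1" if "x \<ge> x0" for x
 proof -
  have "energy v x0 \<le> energy v x"
   using that x0 by (intro integral_subset_le iv) auto
  then show ?thesis using gb[of x] x0 that by linarith
 qed
 have grow: "u x \<bullet> u x \<ge> 2 * (x - x0)" if x: "x \<ge> x0" for x
 proof -
  have "u x0 \<bullet> u x0 - 2 * x0 \<le> u x \<bullet> u x - 2 * x"
  proof (rule nondecreasing_countable[OF x, of "{}" "\<lambda>x. u x \<bullet> u x - 2 * x" "\<lambda>x. (u x \<bullet> v x + v x \<bullet> u x) - 2"])
   have sub: "{x0..x} \<subseteq> {0..}" using x0 by auto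
   show "continuous_on {x0..x} (\<lambda>x. u x \<bullet> u x - 2 * x)"
    by (intro continuous_intros continuous_on_subset[OF ode_solution_cont_at(1)[OF s] sub])
   fix t assume t: "t \<in> {x0<..<x} - {}"
   have "((\<lambda>x. 2 * x) has_vector_derivative 2) (at t)" by (auto intro!: derivative_eq_intros)
   then show "((\<lambda>x. u x \<bullet> u x - 2 * x) has_vector_derivative (u t \<bullet> v t + v t \<bullet> u t) - 2) (at t)"
    using t x0 by (intro has_vector_derivative_diff inner ode_solution_deriv(1)[OF s]) auto
   show "0 \<le> (u t \<bullet> v t + v t \<bullet> u t) - 2" using g1[of t] t by (simp add: g_def inner_commute)
  qed simp
  moreover have "2 * (x - x0) \<le> b" if "a - 2 * x0 \<le> b - 2 * x" "0 \<le> a" for a b :: real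
   using that by (simp add: algebra_simps)
  ultimately show ?thesis using inner_ge_zero[of "u x0"] by blast
 qed
 define y where "y = x0 + 1 + \<bar>B\<bar>"
 have y: "x0 + 1 \<le> y" by (simp add: y_def)
 have "energy u y + 1 \<le> energy u (y + 1)"
 proof -
  have "energy u y + integral {y..y+1} (\<lambda>t. (norm (u t))\<^sup>2) = energy u (y + 1)"
   by (rule Henstock_Kurzweil_Integration.integral_combine) (use x0 y in \<open>auto intro: iu\<close>)
  moreover have "integral {y..y+1} (\<lambda>t. 2) \<le> integral {y..y+1} (\<lambda>t. (norm (u t))\<^sup>2)"
  proof (rule integral_le)
   show "(\<lambda>t. (norm (u t))\<^sup>2) integrable_on {y..y+1}" by (rule norm_square_integrable(1)[OF s]) (use x0 y in simp)
   show "2 \<le> (norm (u t))\<^sup>2" if "t \<in> {y..y+1}" for t using grow[of t] that y by (simp add: power2_norm_eq_inner)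
  qed (rule integrable_const_ivl)
  ultimately show ?thesis by simp
 qed
 moreover have "2 * \<bar>B\<bar> \<le> energy u y"
 proof -
  have "2 * \<bar>B\<bar> = integral {x0 + 1..y} (\<lambda>t. 2)" by (simp add: y_def)
  also have "\<dots> \<le> integral {x0 + 1..y} (\<lambda>t. (norm (u t))\<^sup>2)"
  proof (rule integral_le)
   show "(\<lambda>t. (norm (u t))\<^sup>2) integrable_on {x0 + 1..y}" by (rule norm_square_integrable(1)[OF s]) (use x0 in simp)
   show "2 \<le> (norm (u t))\<^sup>2" if "t \<in> {x0 + 1..y}" for t using grow[of t] that by (simp add: power2_norm_eq_inner)
  qed (rule integrable_const_ivl)
  also have "\<dots> \<le> energy u y"
   using x0 by (intro integral_subset_le norm_square_integrable(1)[OF s]) auto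
  finally show ?thesis .
 qed
 ultimately show False using B[of "y + 1"] x0 y by linarith
qed

text \<open>The Wronskian is constant and bounded by the sum of the squares of both solutions and
  their derivatives, whose integrals are bounded; so it vanishes.\<close>

lemma L2_wronskian:
 assumes s: "ode_solution q D z u v" "ode_solution q D z f g"
  and B: "\<And>x. x \<ge> 0 \<Longrightarrow> energy u x \<le> B1" "\<And>x. x \<ge> 0 \<Longrightarrow> energy f x \<le> B2"
 shows "u 0 * g 0 - v 0 * f 0 = 0"
proof (rule ccontr)
 assume ne: "u 0 * g 0 - v 0 * f 0 \<noteq> 0"
 obtain B3 where B3: "\<And>x. x \<ge> 0 \<Longrightarrow> energy v x \<le> B3" using L2_derivative[OF s(1) B(1)] by blast
 obtain B4 where B4: "\<And>x. x \<ge> 0 \<Longrightarrow> energy g x \<le> B4" using L2_derivative[OF s(2) B(2)] by blast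
 define F where "F t = ((norm (u t))\<^sup>2 + (norm (g t))\<^sup>2) + ((norm (v t))\<^sup>2 + (norm (f t))\<^sup>2)" for t
 show False
 proof (rule integral_unbounded[of 0 1 F "norm (u 0 * g 0 - v 0 * f 0)" "(B1 + B4) + (B3 + B2)"])
  fix x :: real assume x: "x \<ge> 0"
  show "F integrable_on {0..x}" unfolding F_def
   by (intro integrable_add norm_square_integrable[OF s(1) order_refl] norm_square_integrable[OF s(2) order_refl])
  have "integral {0..x} F = (energy u x + energy g x) + (energy v x + energy f x)"
   unfolding F_def
   by (simp add: integral_add integrable_add norm_square_integrable[OF s(1) order_refl] norm_square_integrable[OF s(2) order_refl])
  then show "integral {0..x} F \<le> (B1 + B4) + (B3 + B2)" using B(1)[OF x] B(2)[OF x] B3[OF x] B4[OF x] by linarith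
  show "F x \<ge> 0" by (simp add: F_def)
 next
  fix x :: real assume x: "x \<ge> 1"
  have "u 0 * g 0 - v 0 * f 0 = u x * g x - v x * f x" using wronskian_constant[OF s, of x] x by simp
  then have "norm (u 0 * g 0 - v 0 * f 0) \<le> norm (u x) * norm (g x) + norm (v x) * norm (f x)"
   by (metis norm_mult norm_triangle_ineq4)
  also have "\<dots> \<le> F x"
  proof -
   have "2 * (norm (u x) * norm (g x)) \<le> (norm (u x))\<^sup>2 + (norm (g x))\<^sup>2" "2 * (norm (v x) * norm (f x)) \<le> (norm (v x))\<^sup>2 + (norm (f x))\<^sup>2"
    using sum_squares_bound[of "norm (u x)" "norm (g x)"] sum_squares_bound[of "norm (v x)" "norm (f x)"] by simp_all
   moreover have "0 \<le> norm (u x) * norm (g x)" "0 \<le> norm (v x) * norm (f x)" by simp_all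
   ultimately show ?thesis unfolding F_def by linarith
  qed
  finally show "norm (u 0 * g 0 - v 0 * f 0) \<le> F x" .
 qed (use ne in simp_all)
qed

text \<open>The boundary data of \<open>phi\<close> are real, so the identity for imaginary parts
  has no term at 0 and bounds \<open>norm (phi z x) * norm (dphi z x)\<close> from below by
  \<open>Im z * c\<close> for \<open>x \<ge> 1\<close>. This excludes that both factors are square
  integrable.\<close>

lemma phi_not_L2:
 assumes z: "Im z > 0" and B: "\<And>x. x \<ge> 0 \<Longrightarrow> energy (phi z) x \<le> B"
 shows False
proof -
 obtain B3 where B3: "\<And>x. x \<ge> 0 \<Longrightarrow> energy (dphi z) x \<le> B3" using L2_derivative[OF phi_sol B] by blast
 define c where "c = energy (phi z) 1"
 have c: "c > 0" unfolding c_def by (rule phi_L2_positive)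
 define F where "F t = (norm (phi z t))\<^sup>2 + (norm (dphi z t))\<^sup>2" for t
 show False
 proof (rule integral_unbounded[of 0 1 F "Im z * c" "B + B3"])
  fix x :: real assume x: "x \<ge> 0"
  show "F integrable_on {0..x}" unfolding F_def by (intro integrable_add norm_square_integrable[OF phi_sol order_refl])
  have "integral {0..x} F = energy (phi z) x + energy (dphi z) x"
   unfolding F_def by (rule integral_add) (rule norm_square_integrable[OF phi_sol order_refl])+
  then show "integral {0..x} F \<le> B + B3" using B[OF x] B3[OF x] by linarith
  show "F x \<ge> 0" by (simp add: F_def)
 next
  fix x :: real assume x: "x \<ge> 1"
  have "c \<le> energy (phi z) x" unfolding c_def
   using x by (intro integral_subset_le norm_square_integrable(1)[OF phi_sol]) auto
  then have "Im z * c \<le> Im z * energy (phi z) x" using z by (intro mult_left_mono) auto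
  also have "\<dots> = - Im (cnj (phi z x) * dphi z x)"
   using integral_unique[OF im_identity[OF phi_sol order_refl, of x z]] x by (simp add: phi_psi_0)
  also have "\<dots> \<le> norm (phi z x) * norm (dphi z x)"
   using abs_Im_le_cmod[of "cnj (phi z x) * dphi z x"] by (simp add: norm_mult)
  also have "\<dots> \<le> F x"
  proof -
   have "2 * (norm (phi z x) * norm (dphi z x)) \<le> F x" using sum_squares_bound[of "norm (phi z x)" "norm (dphi z x)"] by (simp add: F_def)
   moreover have "0 \<le> norm (phi z x) * norm (dphi z x)" by simp
   ultimately show ?thesis by linarith
  qed
  finally show "Im z * c \<le> F x" .
 qed (use z c in simp_all)
qed

end

section \<open>Negative energies\<close>

context weyl_potential
begin

lemma phi_real:
 assumes x: "x \<ge> 0" shows "cnj (phi (of_real E) x) = phi (of_real E) x" "cnj (dphi (of_real E) x) = dphi (of_real E) x"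
proof -
 let ?z = "complex_of_real E"
 have "ode_solution q D ?z (\<lambda>x. cnj (phi ?z x)) (\<lambda>x. cnj (dphi ?z x))"
  unfolding ode_solution_def
 proof (intro conjI allI impI)
  show "continuous_on {0..} (\<lambda>x. cnj (phi ?z x))" "continuous_on {0..} (\<lambda>x. cnj (dphi ?z x))"
   by (intro continuous_intros ode_solution_cont_at[OF phi_sol])+
  show "((\<lambda>x. cnj (phi ?z x)) has_vector_derivative cnj (dphi ?z x)) (at x within {0..})" if "x \<ge> 0" for x
   by (rule bounded_linear.has_vector_derivative[OF bounded_linear_cnj]) (use phi_sol that in \<open>auto simp: ode_solution_def\<close>)
  show "((\<lambda>x. cnj (dphi ?z x)) has_vector_derivative (complex_of_real (q x) - ?z) * cnj (phi ?z x)) (at x)" if "x > 0" "x \<notin> D" for x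
   using bounded_linear.has_vector_derivative[OF bounded_linear_cnj ode_solution_deriv(2)[OF phi_sol[where z="?z"] that]] by simp
 qed
 from ode_solution_unique[OF this phi_sol _ _ x] show "cnj (phi ?z x) = phi ?z x" "cnj (dphi ?z x) = dphi ?z x"
  by (simp_all add: phi_psi_0)
qed

definition "pr E x = Re (phi (of_real E) x)"
definition "dpr E x = Re (dphi (of_real E) x)"

abbreviation "amp E x \<equiv> (pr E x)\<^sup>2 + (dpr E x)\<^sup>2"

lemma phi_eq_pr: "x \<ge> 0 \<Longrightarrow> phi (of_real E) x = of_real (pr E x)" "x \<ge> 0 \<Longrightarrow> dphi (of_real E) x = of_real (dpr E x)"
 using phi_real[of x E] by (simp_all add: pr_def dpr_def complex_eq_iff)

lemma im_mN_pr: "N \<ge> 0 \<Longrightarrow> Im (mN N (of_real E)) = 1 / (amp E N)"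
 using im_mN_real[of N E] by (simp add: den_def phi_eq_pr cmod_power2 add.commute)

lemma pr_continuous_on: "continuous_on {0..} (pr E)" "continuous_on {0..} (dpr E)"
 unfolding pr_def[abs_def] dpr_def[abs_def] by (intro continuous_intros ode_solution_cont_at[OF phi_sol])+

lemma pr_deriv: "x > 0 \<Longrightarrow> (pr E has_real_derivative dpr E x) (at x)"
 "x > 0 \<Longrightarrow> x \<notin> D \<Longrightarrow> (dpr E has_real_derivative (q x - E) * pr E x) (at x)"
proof -
 assume x: "x > 0"
 show "(pr E has_real_derivative dpr E x) (at x)"
  using bounded_linear.has_vector_derivative[OF bounded_linear_Re ode_solution_deriv(1)[OF phi_sol x]]
  unfolding pr_def[abs_def] dpr_def has_real_derivative_iff_has_vector_derivative .
 assume "x \<notin> D"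
 from bounded_linear.has_vector_derivative[OF bounded_linear_Re ode_solution_deriv(2)[OF phi_sol x this, of "of_real E"]]
 show "(dpr E has_real_derivative (q x - E) * pr E x) (at x)"
  unfolding pr_def dpr_def[abs_def] has_real_derivative_iff_has_vector_derivative by simp
qed

lemma pr_E_continuous: "x \<ge> 0 \<Longrightarrow> continuous_on UNIV (\<lambda>E. pr E x)" "x \<ge> 0 \<Longrightarrow> continuous_on UNIV (\<lambda>E. dpr E x)"
proof -
 assume x: "x \<ge> 0"
 have "continuous_on UNIV (\<lambda>z. phi z x)" "continuous_on UNIV (\<lambda>z. dphi z x)"
  unfolding phi_def dphi_def by (intro holomorphic_on_imp_continuous_on sol_holomorphic x)+
 then show "continuous_on UNIV (\<lambda>E. pr E x)" "continuous_on UNIV (\<lambda>E. dpr E x)"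
  unfolding pr_def dpr_def by (auto intro!: continuous_intros intro: continuous_on_compose2)
qed

text \<open>Half the derivative of \<open>(pr E)^2\<close>; it increases wherever
  \<open>q \<ge> E\<close>.\<close>

definition "pg E x = pr E x * dpr E x"

lemma pg_integral:
 assumes ab: "0 \<le> a" "a \<le> b"
 shows "((\<lambda>x. (dpr E x)\<^sup>2 + (q x - E) * (pr E x)\<^sup>2) has_integral pg E b - pg E a) {a..b}"
proof (rule ftc_countable[OF ab(2) countable_D])
 have sub: "{a..b} \<subseteq> {0..}" using ab by auto
 show "continuous_on {a..b} (pg E)" unfolding pg_def[abs_def]
  by (intro continuous_intros continuous_on_subset[OF pr_continuous_on(1) sub] continuous_on_subset[OF pr_continuous_on(2) sub])
 fix x assume "x \<in> {a<..<b} - D"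
 then have x: "x > 0" "x \<notin> D" using ab by auto
 have "(pg E has_real_derivative dpr E x * dpr E x + (q x - E) * pr E x * pr E x) (at x)"
  unfolding pg_def[abs_def] by (rule DERIV_mult[OF pr_deriv(1)[OF x(1)] pr_deriv(2)[OF x]])
 then show "(pg E has_vector_derivative (dpr E x)\<^sup>2 + (q x - E) * (pr E x)\<^sup>2) (at x)"
  by (simp add: has_real_derivative_iff_has_vector_derivative power2_eq_square mult.assoc)
qed

lemma pr_sq_integral:
 assumes ab: "0 \<le> a" "a \<le> b"
 shows "((\<lambda>x. 2 * pg E x) has_integral (pr E b)\<^sup>2 - (pr E a)\<^sup>2) {a..b}"
proof (rule ftc_countable[OF ab(2), of "{}"])
 have sub: "{a..b} \<subseteq> {0..}" using ab by auto
 show "continuous_on {a..b} (\<lambda>x. (pr E x)\<^sup>2)"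
  by (intro continuous_intros continuous_on_subset[OF pr_continuous_on(1) sub])
 fix x assume "x \<in> {a<..<b} - {}"
 then have x: "x > 0" using ab by auto
 have "((\<lambda>x. (pr E x)\<^sup>2) has_real_derivative 2 * pg E x) (at x)"
  by (rule derivative_eq_intros pr_deriv(1)[OF x] refl)+ (simp add: pg_def)
 then show "((\<lambda>x. (pr E x)\<^sup>2) has_vector_derivative 2 * pg E x) (at x)"
  by (simp add: has_real_derivative_iff_has_vector_derivative)
qed simp

lemma pr_sq_integrable: "0 \<le> a \<Longrightarrow> (\<lambda>x. (pr E x)\<^sup>2) integrable_on {a..b}" "0 \<le> a \<Longrightarrow> (\<lambda>x. (dpr E x)\<^sup>2) integrable_on {a..b}"
 by (auto intro!: integrable_continuous_real continuous_intros intro: continuous_on_subset[OF pr_continuous_on(1)] continuous_on_subset[OF pr_continuous_on(2)])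

text \<open>The candidates for eigenvalues up to \<open>b\<close>, with \<open>X\<close> chosen such
  that \<open>q\<close> exceeds these energies beyond it. Once \<open>pg\<close> is positive there
  it stays so and the solution grows, which cannot happen at an eigenvalue.\<close>

definition "evs X b = {E. E \<le> b \<and> (\<forall>x\<ge>X. pg E x \<le> 0)}"

context
 fixes X \<delta> b :: real
 assumes X: "X \<ge> 0" and \<delta>: "0 < \<delta>" "\<delta> \<le> 1" and ell: "\<And>x E. x \<ge> X \<Longrightarrow> E \<le> b \<Longrightarrow> q x - E \<ge> \<delta>"
begin

lemma pg_increase:
 assumes E: "E \<le> b" and x: "X \<le> x" "x \<le> y"
 shows "\<delta> * integral {x..y} (\<lambda>t. amp E t) \<le> pg E y - pg E x"
proof -
 have x0: "0 \<le> x" using X x by simp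
 have "((\<lambda>t. \<delta> * (amp E t)) has_integral \<delta> * integral {x..y} (\<lambda>t. amp E t)) {x..y}"
  by (intro has_integral_mult_right integrable_integral integrable_add pr_sq_integrable x0)
 then show ?thesis
 proof (rule has_integral_le[OF _ pg_integral[OF x0 x(2)]])
  fix t assume t: "t \<in> {x..y}"
  have "\<delta> * (pr E t)\<^sup>2 \<le> (q t - E) * (pr E t)\<^sup>2" using ell[of t E] t x E by (intro mult_right_mono) auto
  moreover have "\<delta> * (dpr E t)\<^sup>2 \<le> 1 * (dpr E t)\<^sup>2" using \<delta> by (intro mult_right_mono) auto
  ultimately show "\<delta> * (amp E t) \<le> (dpr E t)\<^sup>2 + (q t - E) * (pr E t)\<^sup>2" by (simp add: algebra_simps)
 qed
qed

lemma pg_mono: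
 assumes "E \<le> b" "X \<le> x" "x \<le> y" shows "pg E x \<le> pg E y"
proof -
 have "0 \<le> \<delta> * integral {x..y} (\<lambda>t. amp E t)"
  using \<delta> X assms by (intro mult_nonneg_nonneg integral_nonneg integrable_add pr_sq_integrable) auto
 then show ?thesis using pg_increase[OF assms] by linarith
qed

text \<open>At a non-eigenvalue the solution grows, so Carmona's densities tend to 0 locally uniformly.\<close>
lemma pr_grows:
 assumes E: "E \<le> b" and x: "X \<le> x0" "x0 \<le> x" and c: "pg E x0 \<ge> c"
 shows "amp E x \<ge> 2 * c * (x - x0)"
proof -
 have x0: "0 \<le> x0" using X x by simp
 have "((\<lambda>t. 2 * c) has_integral (x - x0) *\<^sub>R (2 * c)) {x0..x}" using has_integral_const_real[of "2 * c" x0 x] x by simp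
 then have "(x - x0) *\<^sub>R (2 * c) \<le> (pr E x)\<^sup>2 - (pr E x0)\<^sup>2"
 proof (rule has_integral_le[OF _ pr_sq_integral[OF x0 x(2)]])
  fix t assume t: "t \<in> {x0..x}"
  show "2 * c \<le> 2 * pg E t" using pg_mono[OF E x(1), of t] t c by simp
 qed
 moreover have "(x - x0) *\<^sub>R (2 * c) = 2 * c * (x - x0)" by simp
 ultimately show ?thesis using zero_le_power2[of "pr E x0"] zero_le_power2[of "dpr E x"] by linarith
qed

text \<open>\<open>pg\<close> increases at a rate of at least \<open>\<delta> * amp\<close> but
  stays nonpositive, so its total increase is at most \<open>- pg E X\<close>. Solutions at the
  candidates are thus square integrable, together with their derivatives.\<close>

lemma ev_total:
 assumes E: "E \<in> evs X b" and P: "\<bar>pr E X\<bar> \<le> P" "\<bar>dpr E X\<bar> \<le> P" and x: "X \<le> x"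
 shows "integral {X..x} (\<lambda>t. amp E t) \<le> P\<^sup>2 / \<delta>"
proof -
 have "E \<le> b" "pg E x \<le> 0" using E x by (auto simp: evs_def)
 have "\<bar>pg E X\<bar> \<le> P * P" unfolding pg_def abs_mult using P by (intro mult_mono) auto
 then have "\<delta> * integral {X..x} (\<lambda>t. amp E t) \<le> P\<^sup>2"
  using pg_increase[OF \<open>E \<le> b\<close> order_refl x] \<open>pg E x \<le> 0\<close> by (simp add: power2_eq_square)
 then show ?thesis using \<delta> by (simp add: field_simps)
qed

lemma pr_uniform:
 assumes L: "0 \<le> L"
 shows "\<exists>B Lp. 0 \<le> B \<and> 0 \<le> Lp \<and> (\<forall>E x. \<bar>E\<bar> \<le> R \<and> 0 \<le> x \<and> x \<le> L \<longrightarrow> \<bar>pr E x\<bar> \<le> B \<and> \<bar>dpr E x\<bar> \<le> B) \<and>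
   (\<forall>E F x. \<bar>E\<bar> \<le> R \<and> \<bar>F\<bar> \<le> R \<and> 0 \<le> x \<and> x \<le> L \<longrightarrow> \<bar>pr E x - pr F x\<bar> \<le> Lp * \<bar>E - F\<bar>)"
proof (intro exI conjI allI impI)
 let ?s = "complex_of_real (sin \<theta>)" and ?c = "complex_of_real (cos \<theta>)"
 show "0 \<le> (norm ?s + norm ?c) * exp ((1 + K + R) * L)" by (intro mult_nonneg_nonneg) auto
 show "0 \<le> lip ?s ?c R L" unfolding lip_def using L by (intro mult_nonneg_nonneg) auto
 fix E F x
 show "\<bar>pr E x\<bar> \<le> (norm ?s + norm ?c) * exp ((1 + K + R) * L)" if "\<bar>E\<bar> \<le> R \<and> 0 \<le> x \<and> x \<le> L"
  unfolding pr_def phi_def by (rule order_trans[OF abs_Re_le_cmod sol_bound(1)]) (use that in auto)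
 show "\<bar>dpr E x\<bar> \<le> (norm ?s + norm ?c) * exp ((1 + K + R) * L)" if "\<bar>E\<bar> \<le> R \<and> 0 \<le> x \<and> x \<le> L"
  unfolding dpr_def dphi_def by (rule order_trans[OF abs_Re_le_cmod sol_bound(2)]) (use that in auto)
 show "\<bar>pr E x - pr F x\<bar> \<le> lip ?s ?c R L * \<bar>E - F\<bar>" if H: "\<bar>E\<bar> \<le> R \<and> \<bar>F\<bar> \<le> R \<and> 0 \<le> x \<and> x \<le> L"
 proof -
  have "\<bar>pr E x - pr F x\<bar> \<le> norm (phi (of_real E) x - phi (of_real F) x)"
   unfolding pr_def using abs_Re_le_cmod[of "phi (of_real E) x - phi (of_real F) x"] by simp
  also have "\<dots> \<le> lip ?s ?c R L * norm (complex_of_real E - complex_of_real F)"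
   unfolding phi_def by (rule sol_lipschitz(1)) (use H in auto)
  also have "norm (complex_of_real E - complex_of_real F) = \<bar>E - F\<bar>" by (metis norm_of_real of_real_diff)
  finally show ?thesis .
 qed
qed

text \<open>Both solutions satisfy the boundary condition at 0, so \<open>E1 - E2\<close> times
  their inner product up to \<open>x\<close> is the Wronskian at \<open>x\<close>. It is dominated
  by a function of \<open>x\<close> with bounded integral and cannot stay above a positive
  constant.\<close>

lemma ev_orthogonal:
 assumes E: "E1 \<in> evs X b" "E2 \<in> evs X b" "E1 \<noteq> E2" and L: "X \<le> L" and c: "c > 0"
  "\<And>x. x \<ge> L \<Longrightarrow> integral {0..x} (\<lambda>t. pr E1 t * pr E2 t) \<ge> c"
 shows False
proof -
 define F where "F t = (amp E1 t) + (amp E2 t)" for t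
 define P where "P = max (max \<bar>pr E1 X\<bar> \<bar>dpr E1 X\<bar>) (max \<bar>pr E2 X\<bar> \<bar>dpr E2 X\<bar>)"
 have L0: "0 \<le> L" using X L by simp
 have i: "(\<lambda>t. amp E1 t) integrable_on {a..x}" "(\<lambda>t. amp E2 t) integrable_on {a..x}" if "0 \<le> a" for a x
  using that by (auto intro!: integrable_add pr_sq_integrable)
 show False
 proof (rule integral_unbounded[of L L F "\<bar>E1 - E2\<bar> * c" "P\<^sup>2 / \<delta> + P\<^sup>2 / \<delta>"])
  show "\<bar>E1 - E2\<bar> * c > 0" using E c by simp
  fix x assume x: "x \<ge> L"
  show "F integrable_on {L..x}" unfolding F_def by (intro integrable_add[OF i(1) i(2)] L0)
  show "F x \<ge> 0" by (simp add: F_def)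
  have Xx: "X \<le> x" using x L by simp
  have "integral {L..x} F \<le> integral {X..x} F"
   unfolding F_def by (intro integral_subset_le integrable_add[OF i(1) i(2)] L0 X) (use x L in auto)
  also have "\<dots> = integral {X..x} (\<lambda>t. amp E1 t) + integral {X..x} (\<lambda>t. amp E2 t)"
   unfolding F_def by (rule integral_add[OF i(1) i(2)]) (rule X)+
  also have "\<dots> \<le> P\<^sup>2 / \<delta> + P\<^sup>2 / \<delta>"
   by (intro add_mono ev_total[OF E(1) _ _ Xx] ev_total[OF E(2) _ _ Xx]) (auto simp: P_def le_max_iff_disj)
  finally show "integral {L..x} F \<le> P\<^sup>2 / \<delta> + P\<^sup>2 / \<delta>" .
  have x0: "0 \<le> x" using L0 x by simp
  have "((\<lambda>t. (complex_of_real E1 - complex_of_real E2) * (phi (of_real E1) t * phi (of_real E2) t)) has_integral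
    (phi (of_real E1) x * dphi (of_real E2) x - dphi (of_real E1) x * phi (of_real E2) x) -
    (phi (of_real E1) 0 * dphi (of_real E2) 0 - dphi (of_real E1) 0 * phi (of_real E2) 0)) {0..x}"
   by (rule lagrange_identity[OF phi_sol phi_sol order_refl x0])
  then have "((\<lambda>t. (complex_of_real E1 - complex_of_real E2) * (phi (of_real E1) t * phi (of_real E2) t)) has_integral
    complex_of_real (pr E1 x * dpr E2 x - dpr E1 x * pr E2 x)) {0..x}"
   using x0 by (simp add: phi_psi_0 phi_eq_pr)
  from has_integral_linear[OF this bounded_linear_Re]
  have "((\<lambda>t. Re ((complex_of_real E1 - complex_of_real E2) * (phi (of_real E1) t * phi (of_real E2) t))) has_integral
    (pr E1 x * dpr E2 x - dpr E1 x * pr E2 x)) {0..x}"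
   unfolding o_def Re_complex_of_real .
  moreover have "Re ((complex_of_real E1 - complex_of_real E2) * (phi (of_real E1) t * phi (of_real E2) t)) = (E1 - E2) * (pr E1 t * pr E2 t)" if "t \<in> {0..x}" for t
   using that by (simp add: phi_eq_pr)
  ultimately have "((\<lambda>t. (E1 - E2) * (pr E1 t * pr E2 t)) has_integral (pr E1 x * dpr E2 x - dpr E1 x * pr E2 x)) {0..x}"
   by (rule has_integral_eq[rotated])
  from integral_unique[OF this] have W: "(E1 - E2) * integral {0..x} (\<lambda>t. pr E1 t * pr E2 t) = pr E1 x * dpr E2 x - dpr E1 x * pr E2 x"
   by (simp only: integral_mult_right)
  have "\<bar>E1 - E2\<bar> * c \<le> \<bar>E1 - E2\<bar> * integral {0..x} (\<lambda>t. pr E1 t * pr E2 t)"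
   using c(2)[OF x] by (intro mult_left_mono) auto
  also have "\<dots> = \<bar>pr E1 x * dpr E2 x - dpr E1 x * pr E2 x\<bar>"
   unfolding W[symmetric] abs_mult using c(2)[OF x] c(1) by simp
  also have "\<dots> \<le> F x"
  proof -
   have "\<bar>pr E1 x * dpr E2 x\<bar> \<le> (pr E1 x)\<^sup>2 + (dpr E2 x)\<^sup>2" "\<bar>dpr E1 x * pr E2 x\<bar> \<le> (dpr E1 x)\<^sup>2 + (pr E2 x)\<^sup>2"
    using sum_squares_bound[of "\<bar>pr E1 x\<bar>" "\<bar>dpr E2 x\<bar>"] sum_squares_bound[of "\<bar>dpr E1 x\<bar>" "\<bar>pr E2 x\<bar>"]
     mult_nonneg_nonneg[of "\<bar>pr E1 x\<bar>" "\<bar>dpr E2 x\<bar>"] mult_nonneg_nonneg[of "\<bar>dpr E1 x\<bar>" "\<bar>pr E2 x\<bar>"]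
    unfolding abs_mult power2_abs by (linarith | simp)+
   then show ?thesis unfolding F_def by linarith
  qed
  finally show "\<bar>E1 - E2\<bar> * c \<le> F x" .
 qed simp
qed

text \<open>Beyond \<open>X\<close> the square of the solution is nonincreasing, so a zero would
  make it vanish from there on, against the Wronskian; without zeros there is no change of
  sign.\<close>

lemma evs_same_sign:
 assumes E: "E \<in> evs X b" and x: "X \<le> x" shows "pr E X * pr E x > 0"
proof -
 have neg: "pg E t \<le> 0" if "X \<le> t" for t using E that by (auto simp: evs_def)
 have nz: "pr E t \<noteq> 0" if t: "X \<le> t" for t
 proof
  assume 0: "pr E t = 0"
  have z: "pr E s = 0" if s: "t \<le> s" for s
  proof -
   have t0: "0 \<le> t" using X t by simp
   have "(pr E s)\<^sup>2 - (pr E t)\<^sup>2 \<le> 0"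
    by (rule has_integral_le[OF pr_sq_integral[OF t0 s] has_integral_0]) (use neg t in simp)
   then show ?thesis using 0 by simp
  qed
  have t1: "t + 1 > 0" using X t by simp
  have "(pr E has_real_derivative 0) (at (t + 1))"
   by (rule has_field_derivative_transform_within_open[of "\<lambda>_. 0" _ _ "{t<..}"]) (use z in auto)
  then have "dpr E (t + 1) = 0" by (rule DERIV_unique[OF pr_deriv(1)[OF t1]])
  then show False using wronskian_phi_psi[of "t + 1" "of_real E"] z[of "t + 1"] t1 by (simp add: phi_eq_pr)
 qed
 show ?thesis
 proof (rule ccontr)
  assume n: "\<not> ?thesis"
  have "continuous_on {X..x} (\<lambda>t. pr E X * pr E t)"
   using X by (intro continuous_intros continuous_on_subset[OF pr_continuous_on(1)]) auto
  then obtain t where "X \<le> t" "pr E X * pr E t = 0"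
   using IVT2'[of "\<lambda>t. pr E X * pr E t" x 0 X] n x by auto
  then show False using nz[of t] nz[of X] by simp
 qed
qed

text \<open>Eigenfunctions of nearby energies are close on \<open>[0, X + 1]\<close> and have no zeros beyond, so they
 cannot be orthogonal.\<close>
lemma evs_isolated:
 assumes E1: "E1 \<in> evs X b"
 shows "\<exists>\<eta>>0. \<forall>E2\<in>evs X b. \<bar>E2 - E1\<bar> < \<eta> \<longrightarrow> E2 = E1"
proof -
 define L where "L = X + 1"
 have L: "X \<le> L" "0 \<le> L" "1 \<le> L" using X by (auto simp: L_def)
 obtain B Lp where BL: "0 \<le> B \<and> 0 \<le> Lp \<and> (\<forall>E x. \<bar>E\<bar> \<le> \<bar>E1\<bar> + 1 \<and> 0 \<le> x \<and> x \<le> L \<longrightarrow> \<bar>pr E x\<bar> \<le> B \<and> \<bar>dpr E x\<bar> \<le> B) \<and>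
   (\<forall>E F x. \<bar>E\<bar> \<le> \<bar>E1\<bar> + 1 \<and> \<bar>F\<bar> \<le> \<bar>E1\<bar> + 1 \<and> 0 \<le> x \<and> x \<le> L \<longrightarrow> \<bar>pr E x - pr F x\<bar> \<le> Lp * \<bar>E - F\<bar>)"
  using pr_uniform[OF L(2), of "\<bar>E1\<bar> + 1"] by (elim exE)
 then have B: "0 \<le> B" "0 \<le> Lp" by auto
 define c0 where "c0 = integral {0..1} (\<lambda>x. (pr E1 x)\<^sup>2)"
 have "c0 = integral {0..1} (\<lambda>x. (norm (phi (of_real E1) x))\<^sup>2)" unfolding c0_def by (rule integral_cong) (simp add: phi_eq_pr)
 then have c0: "c0 > 0" using phi_L2_positive by simp
 have a: "\<bar>pr E1 X\<bar> > 0" using evs_same_sign[OF E1 order_refl] by auto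
 \<comment> \<open>The three bounds keep \<open>E2\<close> in the range of the Lipschitz constant,
   keep the sign of the solution at \<open>X\<close>, and keep the inner product on
   \<open>[0, L]\<close> above \<open>c0 / 2\<close>.\<close>
 define \<eta> where "\<eta> = min 1 (min (\<bar>pr E1 X\<bar> / (Lp + 1)) (c0 / 2 / (B * Lp * L + 1)))"
 have BLp: "B * Lp * L + 1 > 0" using B L by (intro add_nonneg_pos mult_nonneg_nonneg) auto
 have "\<eta> > 0" unfolding \<eta>_def using a c0 BLp B by simp
 moreover have "E2 = E1" if E2: "E2 \<in> evs X b" and close: "\<bar>E2 - E1\<bar> < \<eta>" for E2
 proof (rule ccontr)
  assume ne: "E2 \<noteq> E1"
  define d where "d = \<bar>E1 - E2\<bar>"
  have d: "0 \<le> d" "d < 1" "d < \<bar>pr E1 X\<bar> / (Lp + 1)" "d < c0 / 2 / (B * Lp * L + 1)"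
   using close by (auto simp: \<eta>_def d_def abs_minus_commute)
  have E2b: "\<bar>E2\<bar> \<le> \<bar>E1\<bar> + 1" using d(2) by (simp add: d_def)
  then have le: "\<bar>pr E1 x\<bar> \<le> B" "\<bar>pr E1 x - pr E2 x\<bar> \<le> Lp * d" if "0 \<le> x" "x \<le> L" for x
   using BL that by (auto simp: d_def)
  have "Lp * d \<le> (Lp + 1) * d" using d(1) by (intro mult_right_mono) auto
  also have "\<dots> < \<bar>pr E1 X\<bar>" using d(3) B by (simp add: pos_less_divide_eq mult.commute)
  finally have "\<bar>pr E1 X - pr E2 X\<bar> < \<bar>pr E1 X\<bar>" using le(2)[of X] X L by simp
  then have s: "pr E1 X * pr E2 X > 0" unfolding zero_less_mult_iff by linarith
  have pos: "pr E1 x * pr E2 x \<ge> 0" if "X \<le> x" for x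
   using evs_same_sign[OF E1 that] evs_same_sign[OF E2 that] s
   unfolding zero_less_mult_iff zero_le_mult_iff by linarith
  have ip: "(\<lambda>t. pr E1 t * pr E2 t) integrable_on {a..x}" if "0 \<le> a" for a x
   using that by (intro integrable_continuous_real continuous_intros continuous_on_subset[OF pr_continuous_on(1)]) auto
  have near: "integral {0..L} (\<lambda>t. pr E1 t * pr E2 t) \<ge> c0 / 2"
  proof -
   have "c0 \<le> integral {0..L} (\<lambda>x. (pr E1 x)\<^sup>2)"
    unfolding c0_def using L by (intro integral_subset_le pr_sq_integrable) auto
   moreover have "integral {0..L} (\<lambda>t. (pr E1 t)\<^sup>2 - B * Lp * d) \<le> integral {0..L} (\<lambda>t. pr E1 t * pr E2 t)"
   proof (rule integral_le)
    show "(\<lambda>t. (pr E1 t)\<^sup>2 - B * Lp * d) integrable_on {0..L}" by (intro integrable_diff pr_sq_integrable integrable_const_ivl) simp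
    show "(\<lambda>t. pr E1 t * pr E2 t) integrable_on {0..L}" by (rule ip) simp
    fix t assume "t \<in> {0..L}"
    then have "\<bar>pr E1 t\<bar> * \<bar>pr E1 t - pr E2 t\<bar> \<le> B * (Lp * d)" using le[of t] B by (intro mult_mono) auto
    then have "\<bar>pr E1 t * (pr E1 t - pr E2 t)\<bar> \<le> B * Lp * d" by (simp add: abs_mult)
    then show "(pr E1 t)\<^sup>2 - B * Lp * d \<le> pr E1 t * pr E2 t" by (simp add: power2_eq_square algebra_simps abs_le_iff)
   qed
   moreover have "integral {0..L} (\<lambda>t. (pr E1 t)\<^sup>2 - B * Lp * d) = integral {0..L} (\<lambda>t. (pr E1 t)\<^sup>2) - B * Lp * L * d"
    using L by (subst integral_diff) (auto intro!: pr_sq_integrable integrable_const_ivl)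
   moreover have "B * Lp * L * d \<le> c0 / 2"
   proof -
    have "d * (B * Lp * L + 1) < c0 / 2" using d(4) BLp by (simp only: pos_less_divide_eq)
    then show ?thesis using d(1) by (simp add: distrib_left mult.commute)
   qed
   ultimately show ?thesis by linarith
  qed
  have "integral {0..x} (\<lambda>t. pr E1 t * pr E2 t) \<ge> c0 / 2" if x: "x \<ge> L" for x
  proof -
   have "integral {0..L} (\<lambda>t. pr E1 t * pr E2 t) + integral {L..x} (\<lambda>t. pr E1 t * pr E2 t) = integral {0..x} (\<lambda>t. pr E1 t * pr E2 t)"
    by (rule Henstock_Kurzweil_Integration.integral_combine) (use x L in \<open>auto intro: ip\<close>)
   moreover have "integral {L..x} (\<lambda>t. pr E1 t * pr E2 t) \<ge> 0"
    by (rule Henstock_Kurzweil_Integration.integral_nonneg[OF ip]) (use L pos in auto)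
   ultimately show ?thesis using near by linarith
  qed
  then show False using ev_orthogonal[OF E1 E2 _ L(1), of "c0/2"] ne c0 by auto
 qed
 ultimately show ?thesis by blast
qed

text \<open>To each candidate a rational number is attached that follows it within its radius of
  isolation; two candidates sharing it would be too close.\<close>

lemma evs_countable: "countable (evs X b)"
proof -
 obtain \<eta> where \<eta>: "\<And>x. x \<in> evs X b \<Longrightarrow> \<eta> x > 0" "\<And>x y. x \<in> evs X b \<Longrightarrow> y \<in> evs X b \<Longrightarrow> \<bar>y - x\<bar> < \<eta> x \<Longrightarrow> y = x"
  using evs_isolated by metis
 have "\<exists>r\<in>\<rat>. x < r \<and> r < x + \<eta> x" if "x \<in> evs X b" for x using Rats_dense_in_real[of x "x + \<eta> x"] \<eta>(1)[OF that] by auto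
 then obtain r where r: "\<And>x. x \<in> evs X b \<Longrightarrow> r x \<in> \<rat> \<and> x < r x \<and> r x < x + \<eta> x" by metis
 have "inj_on r (evs X b)"
 proof (rule inj_onI)
  fix x y assume xy: "x \<in> evs X b" "y \<in> evs X b" "r x = r y"
  have "\<bar>y - x\<bar> < \<eta> x \<or> \<bar>x - y\<bar> < \<eta> y" using r[OF xy(1)] r[OF xy(2)] xy(3) by auto
  then show "x = y" using \<eta>(2)[OF xy(1,2)] \<eta>(2)[OF xy(2,1)] by auto
 qed
 moreover have "countable (r ` evs X b)" by (rule countable_subset[OF _ countable_rat]) (use r in auto)
 ultimately show ?thesis by (rule countable_image_inj_on[rotated])
qed

end

end

section \<open>Radon measures on the line\<close>

definition test_fun :: "(real \<Rightarrow> real) \<Rightarrow> bool" where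
 "test_fun f \<longleftrightarrow> continuous_on UNIV f \<and> compact (closure {x. f x \<noteq> 0})"

text \<open>Two derivatives, because two integrations by parts compensate the singularity
  \<open>C / Im z\<close> of the m-functions at the real axis. All three functions vanish outside
  \<open>[-S, S]\<close>, so no boundary terms arise.\<close>

definition smooth_test_fun :: "(real \<Rightarrow> real) \<Rightarrow> bool" where
 "smooth_test_fun f \<longleftrightarrow> (\<exists>f1 f2 S. S > 0 \<and> (\<forall>x. (f has_real_derivative f1 x) (at x)) \<and>
   (\<forall>x. (f1 has_real_derivative f2 x) (at x)) \<and> continuous_on UNIV f2 \<and>
   (\<forall>x. \<bar>x\<bar> \<ge> S \<longrightarrow> f x = 0 \<and> f1 x = 0 \<and> f2 x = 0))"

definition radon :: "real measure \<Rightarrow> bool" where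
 "radon \<mu> \<longleftrightarrow> sets \<mu> = sets borel \<and> (\<forall>f. test_fun f \<longrightarrow> integrable \<mu> f)"

lemma test_fun_support: "test_fun f \<Longrightarrow> \<exists>R>0. \<forall>x. \<bar>x\<bar> \<ge> R \<longrightarrow> f x = 0"
proof -
 assume "test_fun f"
 then have "bounded {x. f x \<noteq> 0}" unfolding test_fun_def by (meson bounded_subset closure_subset compact_imp_bounded)
 then obtain B where B: "\<And>x. f x \<noteq> 0 \<Longrightarrow> \<bar>x\<bar> \<le> B" by (auto simp: bounded_iff)
 show ?thesis
 proof (intro exI[of _ "\<bar>B\<bar> + 1"] conjI allI impI)
  fix x :: real assume "\<bar>B\<bar> + 1 \<le> \<bar>x\<bar>"
  then show "f x = 0" using B[of x] by linarith
 qed simp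
qed

lemma test_funI:
 assumes "continuous_on UNIV f" "\<And>x. \<bar>x\<bar> \<ge> R \<Longrightarrow> f x = 0" shows "test_fun f"
 unfolding test_fun_def
proof (intro conjI assms)
 have "\<bar>x\<bar> \<le> R" if "f x \<noteq> 0" for x using assms(2)[of x] that by linarith
 then have "bounded {x. f x \<noteq> 0}" by (auto simp: bounded_iff)
 then show "compact (closure {x. f x \<noteq> 0})" by (simp add: compact_closure)
qed

lemma test_fun_bounded:
 assumes "test_fun f" shows "\<exists>B. \<forall>x. \<bar>f x\<bar> \<le> B"
proof -
 obtain R where R: "R > 0" "\<And>x. \<bar>x\<bar> \<ge> R \<Longrightarrow> f x = 0" using test_fun_support[OF assms] by blast
 have "compact (f ` {-R..R})" using assms unfolding test_fun_def
  by (intro compact_continuous_image) (auto intro: continuous_on_subset)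
 then have "bounded (f ` {-R..R})" by (rule compact_imp_bounded)
 then obtain B where "\<forall>x\<in>{-R..R}. \<bar>f x\<bar> \<le> B" by (auto simp: bounded_iff)
 then have B: "\<And>x. x \<in> {-R..R} \<Longrightarrow> \<bar>f x\<bar> \<le> B" by blast
 have "\<bar>f x\<bar> \<le> \<bar>B\<bar>" for x
 proof (cases "\<bar>x\<bar> \<ge> R")
  case False
  then have "x \<in> {-R..R}" by auto
  then show ?thesis using B by fastforce
 qed (use R in simp)
 then show ?thesis by blast
qed

lemma test_fun_integrable:
 assumes f: "test_fun f" shows "integrable lborel f"
proof -
 obtain S where S: "S > 0" "\<And>x. \<bar>x\<bar> \<ge> S \<Longrightarrow> f x = 0" using test_fun_support[OF f] by blast
 have "continuous_on UNIV f" using f by (simp add: test_fun_def)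
 then have "set_integrable lborel {-S..S} f"
  by (intro borel_integrable_atLeastAtMost') (auto intro: continuous_on_subset)
 moreover have "(\<lambda>x. indicator {-S..S} x *\<^sub>R f x) = f"
 proof
  fix x
  show "indicator {-S..S} x *\<^sub>R f x = f x"
   using S(2)[of x] by (cases "\<bar>x\<bar> \<ge> S") (auto simp: indicator_def)
 qed
 ultimately show ?thesis unfolding set_integrable_def by (simp only:)
qed

lemma smooth_test_fun_imp_test_fun: "smooth_test_fun f \<Longrightarrow> test_fun f"
 unfolding smooth_test_fun_def
 by (auto intro!: test_funI DERIV_continuous_on intro: has_field_derivative_at_within)

definition plateau :: "real set \<Rightarrow> nat \<Rightarrow> real \<Rightarrow> real" where
 "plateau K n x = max 0 (1 - real n * infdist x K)"

lemma plateau_continuous: "continuous_on UNIV (plateau K n)"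
 unfolding plateau_def by (intro continuous_intros)

lemma plateau_bounds: "0 \<le> plateau K n x" "plateau K n x \<le> 1" "x \<in> K \<Longrightarrow> plateau K n x = 1"
 by (auto simp: plateau_def infdist_nonneg)

lemma plateau_antimono: "m \<le> n \<Longrightarrow> plateau K n x \<le> plateau K m x"
 using mult_right_mono[of "real m" "real n" "infdist x K"] infdist_nonneg[of x K] by (auto simp: plateau_def)

lemma plateau_test_fun:
 assumes "compact K" "K \<noteq> {}" "n \<ge> 1" shows "test_fun (plateau K n)"
proof -
 obtain B where B: "\<And>x. x \<in> K \<Longrightarrow> \<bar>x\<bar> \<le> B" using compact_imp_bounded[OF assms(1)] by (auto simp: bounded_iff)
 show ?thesis
 proof (rule test_funI[OF plateau_continuous])
  fix x assume x: "\<bar>x\<bar> \<ge> B + 1"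
  have "1 \<le> infdist x K"
   unfolding infdist_notempty[OF assms(2)]
  proof (rule cINF_greatest[OF assms(2)])
   fix a assume "a \<in> K"
   then show "1 \<le> dist x a" using B[of a] x by (simp add: dist_real_def)
  qed
  then have "1 \<le> real n * infdist x K" using assms(3) mult_mono[of 1 "real n" 1 "infdist x K"] by simp
  then show "plateau K n x = 0" by (simp add: plateau_def)
 qed
qed

lemma plateau_tendsto:
 assumes "closed K" "K \<noteq> {}" shows "(\<lambda>n. plateau K n x) \<longlonglongrightarrow> indicator K x"
proof (cases "x \<in> K")
 case True
 then show ?thesis by (simp add: plateau_bounds)
next
 case False
 then have d: "infdist x K > 0" using assms by (simp add: infdist_pos_not_in_closed)
 obtain N where N: "real N * infdist x K > 1" using reals_Archimedean3[OF d] by auto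
 have "plateau K n x = 0" if "n \<ge> N" for n
 proof -
  have "real N * infdist x K \<le> real n * infdist x K" using that d by (intro mult_right_mono) auto
  then show ?thesis using N by (simp add: plateau_def)
 qed
 then have "eventually (\<lambda>n. plateau K n x = indicator K x) sequentially"
  using False by (auto simp: eventually_sequentially)
 then show ?thesis by (rule tendsto_eventually)
qed

lemma radon_compact:
 assumes \<mu>: "radon \<mu>" and K: "compact K" "K \<noteq> {}"
 shows "emeasure \<mu> K < \<infinity>" "(\<lambda>n. \<integral>x. plateau K (Suc n) x \<partial>\<mu>) \<longlonglongrightarrow> measure \<mu> K"
proof -
 have s: "sets \<mu> = sets borel" using \<mu> by (simp add: radon_def)
 have Kb: "K \<in> sets \<mu>" using K s by (simp add: borel_compact)
 have int: "integrable \<mu> (plateau K (Suc n))" for n using \<mu> plateau_test_fun[OF K] by (simp add: radon_def)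
 have bm: "plateau K n \<in> borel_measurable \<mu>" for n
  using borel_measurable_continuous_onI[OF plateau_continuous[of K n]] s by (simp cong: measurable_cong_sets)
 have "(\<lambda>n. \<integral>x. plateau K (Suc n) x \<partial>\<mu>) \<longlonglongrightarrow> (\<integral>x. indicator K x \<partial>\<mu>)"
 proof (rule integral_dominated_convergence[where w = "plateau K (Suc 0)"])
  show "AE x in \<mu>. (\<lambda>n. plateau K (Suc n) x) \<longlonglongrightarrow> indicator K x"
   using LIMSEQ_Suc[OF plateau_tendsto[OF compact_imp_closed[OF K(1)] K(2)]] by auto
  show "AE x in \<mu>. norm (plateau K (Suc n) x) \<le> plateau K (Suc 0) x" for n
   using plateau_antimono[where K = K and m = "Suc 0" and n = "Suc n"] plateau_bounds(1)[where K = K] by simp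
 qed (use Kb bm int in auto)
 then show "(\<lambda>n. \<integral>x. plateau K (Suc n) x \<partial>\<mu>) \<longlonglongrightarrow> measure \<mu> K" using Kb by simp
 have "integrable \<mu> (indicator K :: real \<Rightarrow> real)"
  by (rule Bochner_Integration.integrable_bound[OF int[of 0]]) (use Kb plateau_bounds[where K = K] in \<open>auto simp: indicator_def\<close>)
 then show "emeasure \<mu> K < \<infinity>" using Kb by (simp add: integrable_indicator_iff)
qed

text \<open>Test functions determine the measure of compact sets, through the decreasing limits
  \<open>plateau\<close>, and closed intervals form a generator stable under intersection.\<close>

lemma radon_unique:
 assumes "radon \<mu>" "radon \<nu>" and eq: "\<And>f. test_fun f \<Longrightarrow> (\<integral>x. f x \<partial>\<mu>) = (\<integral>x. f x \<partial>\<nu>)"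
 shows "\<mu> = \<nu>"
proof (rule measure_eqI_generator_eq[where E = "range (\<lambda>(a,b). {a..b::real})" and \<Omega> = UNIV and A = "\<lambda>i::nat. {- real i..real i}"])
 show "Int_stable (range (\<lambda>(a,b). {a..b::real}))"
 proof (rule Int_stableI)
  fix a b assume "a \<in> range (\<lambda>(a,b). {a..b::real})" "b \<in> range (\<lambda>(a,b). {a..b::real})"
  then obtain p q r s where "a = {p..q}" "b = {r..s}" by auto
  then have "a \<inter> b = (\<lambda>(a,b). {a..b}) (max p r, min q s)" by auto
  then show "a \<inter> b \<in> range (\<lambda>(a,b). {a..b})" by blast
 qed
 have sets: "sets \<mu> = sets borel" "sets \<nu> = sets borel" using assms by (auto simp: radon_def)
 show "sets \<mu> = sigma_sets UNIV (range (\<lambda>(a,b). {a..b}))" "sets \<nu> = sigma_sets UNIV (range (\<lambda>(a,b). {a..b}))"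
  unfolding sets by (subst borel_eq_atLeastAtMost, simp)+
 fix X assume "X \<in> range (\<lambda>(a,b). {a..b::real})"
 then obtain a b where X: "X = {a..b}" by auto
 show "emeasure \<mu> X = emeasure \<nu> X"
 proof (cases "X = {}")
  case False
  have K: "compact X" by (simp add: X)
  have "measure \<mu> X = measure \<nu> X"
  proof (rule LIMSEQ_unique[OF radon_compact(2)[OF assms(1) K False]])
   have "(\<integral>x. plateau X (Suc n) x \<partial>\<mu>) = (\<integral>x. plateau X (Suc n) x \<partial>\<nu>)" for n
    using plateau_test_fun[OF K False, of "Suc n"] by (intro eq) simp
   then show "(\<lambda>n. \<integral>x. plateau X (Suc n) x \<partial>\<mu>) \<longlonglongrightarrow> measure \<nu> X"
    using radon_compact(2)[OF assms(2) K False] by simp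
  qed
  then show ?thesis using radon_compact(1)[OF assms(1) K False] radon_compact(1)[OF assms(2) K False]
   by (simp add: emeasure_eq_ennreal_measure less_top)
 qed simp
next
 show "range (\<lambda>i::nat. {- real i..real i}) \<subseteq> range (\<lambda>(a,b). {a..b::real})" by auto
 show "(\<Union>i::nat. {- real i..real i}) = UNIV"
 proof -
  have "x \<in> (\<Union>i::nat. {- real i..real i})" for x
  proof -
   obtain n :: nat where "\<bar>x\<bar> \<le> real n" using real_arch_simple by blast
   then show ?thesis by (auto intro!: exI[of _ n])
  qed
  then show ?thesis by blast
 qed
 show "emeasure \<mu> {- real i..real i} \<noteq> \<infinity>" for i
  using radon_compact(1)[OF assms(1), of "{- real i..real i}"] by simp
qed auto

text \<open>The third power makes the cut-off twice continuously differentiable at the edge.\<close>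

definition bump :: "real \<Rightarrow> real \<Rightarrow> real \<Rightarrow> real" where
 "bump c r x = (max 0 (r\<^sup>2 - (x - c)\<^sup>2)) ^ 3"

lemma max_0_power_deriv: "((\<lambda>y::real. (max 0 y) ^ Suc (Suc n)) has_real_derivative real (Suc (Suc n)) * (max 0 y) ^ Suc n) (at y)"
proof -
 consider "y > 0" | "y < 0" | "y = 0" by linarith
 then show ?thesis
 proof cases
  case 1
  have "((\<lambda>y::real. y ^ Suc (Suc n)) has_real_derivative real (Suc (Suc n)) * y ^ Suc n) (at y)"
   using DERIV_pow[of "Suc (Suc n)" y] by simp
  then have "((\<lambda>y::real. (max 0 y) ^ Suc (Suc n)) has_real_derivative real (Suc (Suc n)) * y ^ Suc n) (at y)"
   by (rule has_field_derivative_transform_within_open[of _ _ _ "{0<..}"]) (use 1 in auto)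
  then show ?thesis using 1 by simp
 next
  case 2
  have "((\<lambda>y::real. 0) has_real_derivative 0) (at y)" by simp
  then have "((\<lambda>y::real. (max 0 y) ^ Suc (Suc n)) has_real_derivative 0) (at y)"
   by (rule has_field_derivative_transform_within_open[of _ _ _ "{..<0}"]) (use 2 in auto)
  then show ?thesis using 2 by simp
 next
  case 3
  have "((\<lambda>h::real. (max 0 h) ^ Suc (Suc n) / h) \<longlongrightarrow> 0) (at 0)"
  proof (rule Lim_null_comparison)
   show "eventually (\<lambda>h::real. norm ((max 0 h) ^ Suc (Suc n) / h) \<le> \<bar>h\<bar> ^ Suc n) (at 0)"
   proof (rule always_eventually, rule allI)
    fix h :: real
    show "norm ((max 0 h) ^ Suc (Suc n) / h) \<le> \<bar>h\<bar> ^ Suc n"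
     by (cases "h > 0") (simp_all add: max_def mult_nonpos_nonneg)
   qed
   have "((\<lambda>h::real. \<bar>h\<bar> ^ Suc n) \<longlongrightarrow> \<bar>0\<bar> ^ Suc n) (at 0)" by (intro tendsto_intros)
   then show "((\<lambda>h::real. \<bar>h\<bar> ^ Suc n) \<longlongrightarrow> 0) (at 0)" by simp
  qed
  then show ?thesis using 3 by (simp add: DERIV_def)
 qed
qed

lemma smooth_test_fun_mult_bump:
 assumes p: "\<And>x. (p has_real_derivative p1 x) (at x)" "\<And>x. (p1 has_real_derivative p2 x) (at x)" "continuous_on UNIV p2"
  and r: "r > 0"
 shows "smooth_test_fun (\<lambda>x. p x * bump c r x)"
proof -
 let ?m = "\<lambda>x. max 0 (r\<^sup>2 - (x - c)\<^sup>2)"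
 define b1 where "b1 x = 3 * (?m x)\<^sup>2 * (- 2 * (x - c))" for x
 define b2 where "b2 x = 3 * (2 * ?m x * (- 2 * (x - c))) * (- 2 * (x - c)) + 3 * (?m x)\<^sup>2 * (- 2)" for x
 have inner: "((\<lambda>x. r\<^sup>2 - (x - c)\<^sup>2) has_real_derivative (- 2 * (x - c))) (at x)" for x
  by (auto intro!: derivative_eq_intros)
 have d3: "((\<lambda>x. (?m x) ^ 3) has_real_derivative 3 * (?m x)\<^sup>2 * (- 2 * (x - c))) (at x)" for x
  using DERIV_chain2[OF max_0_power_deriv[of 1] inner[of x]] by (simp add: numeral_3_eq_3 numeral_2_eq_2)
 have d2: "((\<lambda>x. (?m x)\<^sup>2) has_real_derivative 2 * ?m x * (- 2 * (x - c))) (at x)" for x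
  using DERIV_chain2[OF max_0_power_deriv[of 0] inner[of x]] by (simp add: numeral_2_eq_2)
 have B1: "(bump c r has_real_derivative b1 x) (at x)" for x
  using d3 unfolding bump_def[abs_def] b1_def .
 have B2: "(b1 has_real_derivative b2 x) (at x)" for x
  unfolding b1_def[abs_def] b2_def by (rule derivative_eq_intros d2 refl)+ (simp add: algebra_simps)
 have pc: "continuous_on UNIV p" "continuous_on UNIV p1"
  using p by (auto intro!: DERIV_continuous_on intro: has_field_derivative_at_within)
 have b2c: "continuous_on UNIV b2" "continuous_on UNIV b1" "continuous_on UNIV (bump c r)"
  unfolding b2_def[abs_def] b1_def[abs_def] bump_def[abs_def] by (intro continuous_intros)+
 have z: "bump c r x = 0 \<and> b1 x = 0 \<and> b2 x = 0" if "\<bar>x\<bar> \<ge> \<bar>c\<bar> + r" for x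
 proof -
  have "r \<le> \<bar>x - c\<bar>" using that by linarith
  then have "r\<^sup>2 \<le> (x - c)\<^sup>2" using r by (metis abs_le_square_iff abs_of_pos)
  then show ?thesis by (simp add: bump_def b1_def b2_def)
 qed
 show ?thesis unfolding smooth_test_fun_def
 proof (intro exI conjI allI impI)
  show "\<bar>c\<bar> + r > 0" using r by linarith
  show "((\<lambda>x. p x * bump c r x) has_real_derivative (p1 x * bump c r x + p x * b1 x)) (at x)" for x
   by (rule derivative_eq_intros p B1 refl)+ simp
  show "((\<lambda>x. p1 x * bump c r x + p x * b1 x) has_real_derivative (p2 x * bump c r x + p1 x * b1 x + (p1 x * b1 x + p x * b2 x))) (at x)" for x
   by (rule derivative_eq_intros p B1 B2 refl)+ (simp add: algebra_simps)
  show "continuous_on UNIV (\<lambda>x. p2 x * bump c r x + p1 x * b1 x + (p1 x * b1 x + p x * b2 x))"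
   by (intro continuous_intros pc b2c p(3))
 qed (use z in auto)
qed

lemma bump_pos: "\<bar>x - c\<bar> < r \<Longrightarrow> bump c r x > 0"
proof -
 assume "\<bar>x - c\<bar> < r"
 then have "\<bar>x - c\<bar>\<^sup>2 < r\<^sup>2" by (intro power_strict_mono) auto
 then show ?thesis by (simp add: bump_def)
qed

lemma bump_nonneg: "bump c r x \<ge> 0"
 by (simp add: bump_def)

lemma bump_zero: "r > 0 \<Longrightarrow> \<bar>x - c\<bar> \<ge> r \<Longrightarrow> bump c r x = 0"
 by (metis abs_le_square_iff abs_of_pos bump_def diff_le_0_iff_le max.orderE max.commute power_zero_numeral)

lemma smooth_test_fun_bump: "r > 0 \<Longrightarrow> smooth_test_fun (bump c r)"
 using smooth_test_fun_mult_bump[of "\<lambda>_. 1" "\<lambda>_. 0" "\<lambda>_. 0" r c] by (auto intro: continuous_intros)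

text \<open>The quotient of \<open>f\<close> by a bump is approximated by a polynomial, which is
  then multiplied back. The error is small relative to one fixed bump, so against any family of
  measures it is controlled by the integrals of a single test function.\<close>

lemma test_fun_approx:
 assumes f: "test_fun f"
 obtains r where "r > 0" "\<And>\<eta>. \<eta> > 0 \<Longrightarrow> \<exists>g. smooth_test_fun g \<and> (\<forall>x. \<bar>f x - g x\<bar> \<le> \<eta> * bump 0 r x)"
proof -
 obtain R where R: "R > 0" "\<And>x. \<bar>x\<bar> \<ge> R \<Longrightarrow> f x = 0" using test_fun_support[OF f] by blast
 define r where "r = R + 1"
 have r: "r > 0" using R by (simp add: r_def)
 \<comment> \<open>The maximum keeps the denominator positive near the edge; on the support of
   \<open>f\<close> it equals the bump.\<close>
 define h where "h x = f x / max (bump 0 r x) (bump 0 r R)" for x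
 have bR: "bump 0 r R > 0" using R by (intro bump_pos) (simp add: r_def)
 have bge: "bump 0 r x \<ge> bump 0 r R" if "\<bar>x\<bar> \<le> R" for x
 proof -
  have "x\<^sup>2 \<le> R\<^sup>2" using that R by (metis abs_le_square_iff abs_of_pos)
  then show ?thesis unfolding bump_def by (intro power_mono max.mono) auto
 qed
 have fh: "f x = h x * bump 0 r x" for x
  using R(2)[of x] bge[of x] bR by (cases "\<bar>x\<bar> \<le> R") (auto simp: h_def max_def)
 have hc: "continuous_on {-r..r} h"
  unfolding h_def
 proof (intro continuous_on_divide continuous_on_max continuous_on_const ballI)
  show "continuous_on {-r..r} f" using f unfolding test_fun_def by (auto intro: continuous_on_subset)
  show "continuous_on {-r..r} (bump 0 r)" unfolding bump_def by (intro continuous_intros)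
  show "max (bump 0 r x) (bump 0 r R) \<noteq> 0" for x using bR by (simp add: max_def)
 qed
 show ?thesis
 proof (rule that[OF r])
  fix \<eta> :: real assume "\<eta> > 0"
  then obtain p where p: "real_polynomial_function p" "\<And>x. x \<in> {-r..r} \<Longrightarrow> \<bar>h x - p x\<bar> < \<eta>"
   using Stone_Weierstrass_real_polynomial_function[OF compact_Icc hc] by blast
  obtain p1 where p1: "real_polynomial_function p1" "\<And>x. (p has_real_derivative p1 x) (at x)"
   using has_real_derivative_polynomial_function[OF p(1)] by blast
  obtain p2 where p2: "real_polynomial_function p2" "\<And>x. (p1 has_real_derivative p2 x) (at x)"
   using has_real_derivative_polynomial_function[OF p1(1)] by blast
  have p2c: "continuous_on UNIV p2"
  proof -
   obtain p3 where "\<And>x. (p2 has_real_derivative p3 x) (at x)"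
    using has_real_derivative_polynomial_function[OF p2(1)] by blast
   then show ?thesis by (intro DERIV_continuous_on) (auto intro: has_field_derivative_at_within)
  qed
  have "\<bar>f x - p x * bump 0 r x\<bar> \<le> \<eta> * bump 0 r x" for x
  proof (cases "\<bar>x\<bar> < r")
   case True
   have "\<bar>f x - p x * bump 0 r x\<bar> = \<bar>h x - p x\<bar> * bump 0 r x"
    unfolding fh left_diff_distrib[symmetric] abs_mult using bump_nonneg[of 0 r x] by simp
   also have "\<dots> \<le> \<eta> * bump 0 r x"
   proof (rule mult_right_mono[OF _ bump_nonneg])
    have "x \<in> {-r..r}" using True by auto
    from p(2)[OF this] show "\<bar>h x - p x\<bar> \<le> \<eta>" by simp
   qed
   finally show ?thesis .
  next
   case False
   then have "bump 0 r x = 0" using r by (intro bump_zero) auto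
   then show ?thesis by (simp add: fh)
  qed
  then show "\<exists>g. smooth_test_fun g \<and> (\<forall>x. \<bar>f x - g x\<bar> \<le> \<eta> * bump 0 r x)"
   using smooth_test_fun_mult_bump[OF p1(2) p2(2) p2c r, of 0] by blast
 qed
qed

lemma integral_test_fun_approx:
 assumes fg: "\<And>x. \<bar>f x - g x\<bar> \<le> \<eta> * b x" and i: "integrable M (\<lambda>x. f x * h x)" "integrable M (\<lambda>x. g x * h x)" "integrable M (\<lambda>x. b x * h x)"
  and h: "\<And>x. h x \<ge> (0::real)"
 shows "\<bar>(\<integral>x. f x * h x \<partial>M) - (\<integral>x. g x * h x \<partial>M)\<bar> \<le> \<eta> * (\<integral>x. b x * h x \<partial>M)"
proof -
 have "\<bar>(\<integral>x. f x * h x \<partial>M) - (\<integral>x. g x * h x \<partial>M)\<bar> = \<bar>\<integral>x. f x * h x - g x * h x \<partial>M\<bar>" using i by simp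
 also have "\<dots> \<le> (\<integral>x. \<bar>f x * h x - g x * h x\<bar> \<partial>M)" by (rule integral_abs_bound)
 also have "\<dots> \<le> (\<integral>x. \<eta> * (b x * h x) \<partial>M)"
 proof (rule integral_mono)
  fix x
  have "\<bar>f x * h x - g x * h x\<bar> = \<bar>f x - g x\<bar> * h x" using h[of x] by (simp add: left_diff_distrib[symmetric] abs_mult)
  also have "\<dots> \<le> \<eta> * b x * h x" using fg h by (intro mult_right_mono) auto
  finally show "\<bar>f x * h x - g x * h x\<bar> \<le> \<eta> * (b x * h x)" by (simp add: mult.assoc)
 qed (use i in \<open>auto intro!: integrable_abs\<close>)
 finally show ?thesis by simp
qed

text \<open>The passage from twice differentiable to continuous test functions: the integrals of one
  fixed bump converge, hence are eventually bounded, and they control the approximation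
  error.\<close>

lemma vague_limit_extend:
 assumes \<mu>: "radon \<mu>" and h: "\<And>i x. h i x \<ge> 0" and i: "\<And>i f. P i \<Longrightarrow> test_fun f \<Longrightarrow> integrable lborel (\<lambda>x. f x * h i x)"
  and ev: "eventually P F"
  and lim: "\<And>g. smooth_test_fun g \<Longrightarrow> ((\<lambda>i. \<integral>x. g x * h i x \<partial>lborel) \<longlongrightarrow> (\<integral>x. g x \<partial>\<mu>)) F"
  and f: "test_fun f"
 shows "((\<lambda>i. \<integral>x. f x * h i x \<partial>lborel) \<longlongrightarrow> (\<integral>x. f x \<partial>\<mu>)) F"
proof (rule tendstoI)
 fix e :: real assume e: "e > 0"
 obtain r where r: "r > 0" and ap: "\<And>\<eta>. \<eta> > 0 \<Longrightarrow> \<exists>g. smooth_test_fun g \<and> (\<forall>x. \<bar>f x - g x\<bar> \<le> \<eta> * bump 0 r x)"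
  using test_fun_approx[OF f] by metis
 define b where "b = bump 0 r"
 have b: "smooth_test_fun b" "\<And>x. b x \<ge> 0" using smooth_test_fun_bump[OF r] bump_nonneg by (auto simp: b_def)
 note bt = smooth_test_fun_imp_test_fun[OF b(1)]
 have ib: "integrable \<mu> b" using \<mu> bt by (simp add: radon_def)
 define B where "B = (\<integral>x. b x \<partial>\<mu>)"
 have B0: "B \<ge> 0" unfolding B_def by (rule integral_nonneg_AE) (use b in auto)
 define \<eta> where "\<eta> = e / (4 * (B + 1))"
 have \<eta>: "\<eta> > 0" using e B0 by (simp add: \<eta>_def)
 have \<eta>B: "\<eta> * (B + 1) = e / 4"
 proof -
  have "B + 1 \<noteq> 0" using B0 by linarith
  then show ?thesis unfolding \<eta>_def times_divide_eq_left by (rule nonzero_mult_divide_mult_cancel_right)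
 qed
 obtain g where g: "smooth_test_fun g" "\<And>x. \<bar>f x - g x\<bar> \<le> \<eta> * b x" using ap[OF \<eta>] unfolding b_def by blast
 note gt = smooth_test_fun_imp_test_fun[OF g(1)]
 have "\<bar>(\<integral>x. f x * 1 \<partial>\<mu>) - (\<integral>x. g x * 1 \<partial>\<mu>)\<bar> \<le> \<eta> * (\<integral>x. b x * 1 \<partial>\<mu>)"
  by (rule integral_test_fun_approx[OF g(2)]) (use \<mu> f gt bt in \<open>auto simp: radon_def\<close>)
 then have 1: "\<bar>(\<integral>x. f x \<partial>\<mu>) - (\<integral>x. g x \<partial>\<mu>)\<bar> \<le> \<eta> * B" by (simp add: B_def)
 have 2: "eventually (\<lambda>i. dist (\<integral>x. b x * h i x \<partial>lborel) B < 1) F"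
  using tendstoD[OF lim[OF b(1)]] unfolding B_def by simp
 have 3: "eventually (\<lambda>i. dist (\<integral>x. g x * h i x \<partial>lborel) (\<integral>x. g x \<partial>\<mu>) < e / 4) F"
  using tendstoD[OF lim[OF g(1)], of "e / 4"] e by simp
 show "eventually (\<lambda>i. dist (\<integral>x. f x * h i x \<partial>lborel) (\<integral>x. f x \<partial>\<mu>) < e) F"
  using ev 2 3
 proof eventually_elim
  case (elim j)
  have "\<bar>(\<integral>x. f x * h j x \<partial>lborel) - (\<integral>x. g x * h j x \<partial>lborel)\<bar> \<le> \<eta> * (\<integral>x. b x * h j x \<partial>lborel)"
   by (rule integral_test_fun_approx[OF g(2)]) (use i[OF elim(1)] f gt bt h in auto)
  also have "\<dots> \<le> \<eta> * (B + 1)" using elim(2) \<eta> by (intro mult_left_mono) (auto simp: dist_real_def)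
  also have "\<dots> = e / 4" by (rule \<eta>B)
  finally have 4: "\<bar>(\<integral>x. f x * h j x \<partial>lborel) - (\<integral>x. g x * h j x \<partial>lborel)\<bar> \<le> e / 4" .
  have "\<eta> * B \<le> \<eta> * (B + 1)" using \<eta> by simp
  also have "\<dots> = e / 4" by (rule \<eta>B)
  finally show ?case using 1 4 elim(3) unfolding dist_real_def by linarith
 qed
qed

text \<open>Exhaustion: \<open>N\<close> attains the supremum over Lebesgue null sets of a finite
  measure equivalent to \<open>\<mu>\<close>, so a null set disjoint from \<open>N\<close> cannot
  carry mass.\<close>

lemma lebesgue_decomposition:
 assumes s: "sets \<mu> = sets borel" and sf: "sigma_finite_measure (\<mu> :: real measure)"
 obtains N where "N \<in> null_sets lborel" "\<And>A. A \<in> null_sets lborel \<Longrightarrow> emeasure \<mu> (A - N) = 0"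
proof -
 interpret sigma_finite_measure \<mu> by (rule sf)
 obtain h where h: "h \<in> borel_measurable \<mu>" "integral\<^sup>N \<mu> h \<noteq> \<infinity>" "\<And>x. x \<in> space \<mu> \<Longrightarrow> 0 < h x \<and> h x < \<infinity>"
  using Ex_finite_integrable_function by blast
 define m where "m = density \<mu> h"
 have sm: "sets m = sets borel" by (simp add: m_def s)
 have "emeasure m (space m) = integral\<^sup>N \<mu> h"
  unfolding m_def using h by (subst emeasure_density) (auto intro!: nn_integral_cong)
 then interpret m: finite_measure m using h by (intro finite_measureI) auto
 define T where "T = measure m ` null_sets lborel"
 have T: "T \<noteq> {}" "bdd_above T" unfolding T_def
  by (auto intro!: bdd_aboveI[of _ "measure m (space m)"] m.bounded_measure)
 have "\<exists>N\<in>null_sets lborel. Sup T - 1 / real (Suc n) < measure m N" for n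
  using less_cSupE[of "Sup T - 1 / real (Suc n)" T] T by (auto simp: T_def)
 then obtain Z where Z: "\<And>n. Z n \<in> null_sets lborel" "\<And>n. Sup T - 1 / real (Suc n) < measure m (Z n)" by metis
 define N where "N = (\<Union>n. Z n)"
 have N: "N \<in> null_sets lborel" unfolding N_def using Z by auto
 have bo: "A \<in> sets m" if "A \<in> null_sets lborel" for A
  using null_setsD2[OF that] unfolding sm by simp
 have mN: "measure m N \<ge> Sup T"
 proof (rule field_le_epsilon)
  fix e :: real assume "e > 0"
  then obtain n where n: "1 / real (Suc n) < e" using nat_approx_posE by blast
  have "measure m (Z n) \<le> measure m N" unfolding N_def
   by (rule m.finite_measure_mono) (use bo[OF N] in \<open>simp_all add: N_def UN_upper\<close>)
  then show "Sup T \<le> measure m N + e" using Z(2)[of n] n by linarith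
 qed
 show ?thesis
 proof (rule that[OF N])
  fix A :: "real set" assume A: "A \<in> null_sets lborel"
  have AN: "A \<union> N \<in> null_sets lborel" using A N by (rule null_sets.Un)
  have "measure m (A \<union> N) \<le> Sup T"
   by (rule cSup_upper[OF _ T(2)]) (unfold T_def, rule imageI[OF AN])
  moreover have "measure m (A \<union> N) = measure m N + measure m (A - N)"
   using m.finite_measure_Union[of N "A - N"] bo[OF A] bo[OF N] by (simp add: Un_commute)
  ultimately have "measure m (A - N) = 0" using mN measure_nonneg[of m "A - N"] by linarith
  then have "emeasure m (A - N) = 0" by (simp add: m.emeasure_eq_measure)
  moreover have AN': "A - N \<in> sets \<mu>" using null_setsD2[OF A] null_setsD2[OF N] s by simp
  ultimately have "A - N \<in> null_sets (density \<mu> h)" unfolding m_def by (simp add: null_sets_def)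
  then have "AE x in \<mu>. x \<in> A - N \<longrightarrow> h x = 0" using null_sets_density_iff[OF h(1)] by blast
  then have "AE x in \<mu>. x \<notin> A - N"
  proof (rule AE_mp, intro AE_I2 impI)
   fix x assume "x \<in> space \<mu>" "x \<in> A - N \<longrightarrow> h x = 0"
   then show "x \<notin> A - N" using h(3)[of x] by (metis less_irrefl)
  qed
  then have "A - N \<in> null_sets \<mu>" using AN' by (simp add: AE_iff_null_sets)
  then show "emeasure \<mu> (A - N) = 0" by (rule null_setsD1)
 qed
qed

lemma radon_sigma_finite: "radon \<mu> \<Longrightarrow> sigma_finite_measure \<mu>"
proof -
 assume r: "radon \<mu>"
 have s: "sets \<mu> = sets borel" "space \<mu> = UNIV" using r sets_eq_imp_space_eq[of \<mu> borel] by (auto simp: radon_def)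
 show ?thesis
 proof (rule sigma_finite_measure.intro, intro exI[of _ "range (\<lambda>i::nat. {- real i..real i})"] conjI)
  show "\<Union> (range (\<lambda>i::nat. {- real i..real i})) = space \<mu>"
  proof -
   have "x \<in> (\<Union>i::nat. {- real i..real i})" for x
   proof -
    obtain n :: nat where "\<bar>x\<bar> \<le> real n" using real_arch_simple by blast
    then show ?thesis by (auto intro!: exI[of _ n])
   qed
   then show ?thesis using s by auto
  qed
  show "\<forall>a\<in>range (\<lambda>i::nat. {- real i..real i}). emeasure \<mu> a \<noteq> \<infinity>"
   using radon_compact(1)[OF r] by (auto simp: less_top[symmetric])
 qed (auto simp: s)
qed

text \<open>The absolutely continuous part is \<open>\<mu>\<close> restricted to the complement of
  the set \<open>N\<close> of the decomposition. \<open>neg\<close> confines it to the half-line,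
  and \<open>pos\<close> makes it charge every set of positive Lebesgue measure there.\<close>

lemma ac_essential_support_criterion:
 assumes sm: "spectral_measure V \<theta> = \<mu>" and r: "radon \<mu>"
  and neg: "Z \<in> null_sets lborel" "emeasure \<mu> ({..<0} - Z) = 0"
  and pos: "\<And>A. A \<in> sets borel \<Longrightarrow> A \<subseteq> {0..} \<Longrightarrow> emeasure \<mu> A = 0 \<Longrightarrow> A \<in> null_sets lborel"
 shows "ac_essential_support V \<theta> {0..}"
proof -
 have s: "sets \<mu> = sets borel" using r by (simp add: radon_def)
 obtain N where N: "N \<in> null_sets lborel" "\<And>A. A \<in> null_sets lborel \<Longrightarrow> emeasure \<mu> (A - N) = 0"
  using lebesgue_decomposition[OF s radon_sigma_finite[OF r]] by metis
 have Nb: "N \<in> sets borel" "Z \<in> sets borel" using null_setsD2[OF N(1)] null_setsD2[OF neg(1)] by simp_all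
 define \<nu> where "\<nu> = density \<mu> (indicator (- N))"
 define \<sigma> where "\<sigma> = density \<mu> (indicator N)"
 have em: "emeasure (density \<mu> (indicator B)) A = emeasure \<mu> (A \<inter> B)" if "A \<in> sets borel" "B \<in> sets borel" for A B
 proof -
  have "emeasure (density \<mu> (indicator B)) A = (\<integral>\<^sup>+x. indicator B x * indicator A x \<partial>\<mu>)"
   using that s by (intro emeasure_density) auto
  also have "\<dots> = (\<integral>\<^sup>+x. indicator (A \<inter> B) x \<partial>\<mu>)" by (intro nn_integral_cong) (auto simp: indicator_def)
  also have "\<dots> = emeasure \<mu> (A \<inter> B)" using that s by (intro nn_integral_indicator) auto
  finally show ?thesis .
 qed
 have em\<nu>: "emeasure \<nu> A = emeasure \<mu> (A - N)" if "A \<in> sets borel" for A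
  using em[OF that, of "- N"] Nb unfolding \<nu>_def by (simp add: Diff_eq)
 have s\<nu>: "sets \<nu> = sets borel" "sets \<sigma> = sets borel" by (simp_all add: \<nu>_def \<sigma>_def s)
 have "is_ac_part \<mu> \<nu>" unfolding is_ac_part_def
 proof (intro conjI exI[of _ \<sigma>] s\<nu> ballI)
  show "absolutely_continuous lborel \<nu>" unfolding absolutely_continuous_def
  proof
   fix A :: "real set" assume A: "A \<in> null_sets lborel"
   have Ab: "A \<in> sets borel" using null_setsD2[OF A] by simp
   show "A \<in> null_sets \<nu>" using N(2)[OF A] em\<nu>[OF Ab] s\<nu> Ab by (simp add: null_sets_def)
  qed
  show "\<exists>N\<in>null_sets lborel. emeasure \<sigma> (- N) = 0"
   using em[of "- N" N] Nb unfolding \<sigma>_def by (intro bexI[OF _ N(1)]) simp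
  fix A :: "real set" assume A: "A \<in> sets borel"
  have "emeasure \<mu> A = emeasure \<mu> (A - N) + emeasure \<mu> (A \<inter> N)"
  proof -
   have "A = (A - N) \<union> (A \<inter> N)" "(A - N) \<inter> (A \<inter> N) = {}" by auto
   then show ?thesis using plus_emeasure[of "A - N" \<mu> "A \<inter> N"] A Nb s by simp
  qed
  then show "emeasure \<mu> A = emeasure \<nu> A + emeasure \<sigma> A"
   using em\<nu>[OF A] em[OF A Nb(1)] by (simp add: \<sigma>_def)
 qed
 moreover have "absolutely_continuous \<nu> (density lborel (indicator {0..}))" unfolding absolutely_continuous_def
 proof
  fix A assume "A \<in> null_sets \<nu>"
  then have A: "A \<in> sets borel" "emeasure \<mu> (A - N) = 0" using em\<nu>[of A] s\<nu> by (simp_all add: null_sets_def)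
  have "emeasure \<mu> (A \<inter> {0..} - N) \<le> emeasure \<mu> (A - N)"
   by (rule emeasure_mono) (use A Nb s in auto)
  then have "emeasure \<mu> (A \<inter> {0..} - N) = 0" using A by simp
  then have "A \<inter> {0..} - N \<in> null_sets lborel" using A Nb by (intro pos) auto
  then have "(A \<inter> {0..} - N) \<union> N \<in> null_sets lborel" using N(1) by (rule null_sets.Un)
  then have "A \<inter> {0..} \<in> null_sets lborel" by (rule null_sets_subset) (use A in auto)
  then have "AE x in lborel. x \<notin> A \<inter> {0..}" by (rule AE_not_in)
  then have "AE x in lborel. x \<in> A \<longrightarrow> (indicator {0..} x :: ennreal) = 0" by (rule AE_mp) (auto simp: indicator_def)
  then show "A \<in> null_sets (density lborel (indicator {0..}))"
   using null_sets_density_iff[of "indicator {0..}" lborel A] A by simp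
 qed
 moreover have "absolutely_continuous (density lborel (indicator {0..})) \<nu>" unfolding absolutely_continuous_def
 proof
  fix A :: "real set" assume "A \<in> null_sets (density lborel (indicator {0..}))"
  then have A: "A \<in> sets borel" and ae: "AE x in lborel. x \<in> A \<longrightarrow> (indicator {0..} x :: ennreal) = 0"
   using null_sets_density_iff[of "indicator {0..}" lborel A] by auto
  have "AE x in lborel. x \<notin> A \<inter> {0..}" using ae by (rule AE_mp) (auto simp: indicator_def)
  then have A0: "A \<inter> {0..} \<in> null_sets lborel" using A by (simp add: AE_iff_null_sets)
  have AZ: "A \<inter> Z \<in> null_sets lborel" by (rule null_sets_subset[OF neg(1)]) (use A Nb in auto)
  have 1: "emeasure \<mu> (A \<inter> {0..} - N) = 0" "emeasure \<mu> (A \<inter> Z - N) = 0" using N(2) A0 AZ by auto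
  have "emeasure \<mu> (A - N) \<le> emeasure \<mu> ((A \<inter> {0..} - N) \<union> ((A \<inter> Z - N) \<union> ({..<0} - Z)))"
   by (rule emeasure_mono) (use A Nb s in auto)
  also have "\<dots> \<le> emeasure \<mu> (A \<inter> {0..} - N) + emeasure \<mu> ((A \<inter> Z - N) \<union> ({..<0} - Z))"
   by (rule emeasure_subadditive) (use A Nb s in auto)
  also have "\<dots> \<le> emeasure \<mu> (A \<inter> {0..} - N) + (emeasure \<mu> (A \<inter> Z - N) + emeasure \<mu> ({..<0} - Z))"
   by (intro add_left_mono emeasure_subadditive) (use A Nb s in auto)
  finally have "emeasure \<mu> (A - N) = 0" using 1 neg by simp
  then show "A \<in> null_sets \<nu>" using em\<nu>[OF A] A s\<nu> by (simp add: null_sets_def)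
 qed
 ultimately show ?thesis unfolding ac_essential_support_def sm by blast
qed

section \<open>Vague compactness of locally bounded families of measures\<close>

definition tent :: "nat \<Rightarrow> real \<Rightarrow> real" where
 "tent j x = max 0 (min 1 (real j + 1 - \<bar>x\<bar>))"

lemma tent_bounds: "0 \<le> tent j x" "tent j x \<le> 1" "\<bar>x\<bar> \<le> real j \<Longrightarrow> tent j x = 1" "\<bar>x\<bar> \<ge> real j + 1 \<Longrightarrow> tent j x = 0"
 by (auto simp: tent_def)

lemma tent_continuous: "continuous_on UNIV (tent j)"
 unfolding tent_def by (intro continuous_intros)

lemma tent_test_fun: "test_fun (tent j)"
 by (rule test_funI[OF tent_continuous, where R = "real j + 1"]) (rule tent_bounds)

lemma summable_half_powers:
 fixes a :: "nat \<Rightarrow> real"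
 assumes "\<And>j. 0 \<le> a j" "\<And>j. a j \<le> (1/2) ^ j"
 shows "summable a"
proof -
 have g: "summable (\<lambda>j. (1/2::real) ^ j)" by (rule summable_geometric) simp
 show ?thesis by (rule summable_comparison_test'[OF g, of 0]) (use assms in simp)
qed

text \<open>Local bounds allow infinite total mass. Weighting the \<open>j\<close>-th tent by
  \<open>2 ^ - j\<close> over one plus its own bound gives a positive continuous \<open>w\<close>
  for which the measures \<open>w * h n\<close> have bounded mass and uniformly small tails.\<close>

lemma weight_exists:
 fixes h :: "nat \<Rightarrow> real \<Rightarrow> real"
 assumes h: "\<And>n x. h n x \<ge> 0" "\<And>n. h n \<in> borel_measurable borel"
  and i: "\<And>n f. test_fun f \<Longrightarrow> integrable lborel (\<lambda>x. f x * h n x)"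
  and b: "\<And>f. test_fun f \<Longrightarrow> bdd_above (range (\<lambda>n. \<integral>x. f x * h n x \<partial>lborel))"
 obtains w where "continuous_on UNIV w" "\<And>x. w x > 0"
  "\<And>n. (\<integral>\<^sup>+x. ennreal (w x * h n x) \<partial>lborel) \<le> 2"
  "\<And>n J. (\<integral>\<^sup>+x. ennreal (w x * h n x) * indicator {x. \<bar>x\<bar> > real J} x \<partial>lborel) \<le> ennreal (2 * (1/2) ^ J)"
proof -
 have "\<exists>B\<ge>0. \<forall>n. (\<integral>x. tent j x * h n x \<partial>lborel) \<le> B" for j
 proof -
  obtain B where "\<And>n. (\<integral>x. tent j x * h n x \<partial>lborel) \<le> B"
   using b[OF tent_test_fun[of j]] unfolding bdd_above_def by auto
  then show ?thesis by (intro exI[of _ "max 0 B"]) (auto simp: le_max_iff_disj)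
 qed
 then obtain B where B: "\<And>j. B j \<ge> 0" "\<And>j n. (\<integral>x. tent j x * h n x \<partial>lborel) \<le> B j" by metis
 define a where "a j = (1/2) ^ j / (1 + B j)" for j
 have a0: "a j > 0" for j using B(1)[of j] by (simp add: a_def)
 have quot: "p / (1 + b) \<le> p" "p / (1 + b) * b \<le> p" if "p \<ge> 0" "b \<ge> 0" for p b :: real
  using that by (simp_all add: field_simps)
 have a1: "a j \<le> (1/2) ^ j" for j unfolding a_def by (intro quot B) simp
 have aB: "a j * B j \<le> (1/2) ^ j" for j unfolding a_def by (intro quot B) simp
 have at: "0 \<le> a j * tent j x" "a j * tent j x \<le> (1/2) ^ j" for j x
  using a0[of j] tent_bounds(1,2)[where j = j and x = x] order_trans[OF mult_left_le[of "tent j x" "a j"] a1[of j]] by simp_all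
 define w where "w x = (\<Sum>j. a j * tent j x)" for x
 have sm: "summable (\<lambda>j. a j * tent j x)" for x by (rule summable_half_powers) (use at in auto)
 have wh: "ennreal (w x * h n x) = (\<Sum>j. ennreal (a j * tent j x * h n x))" for x n
 proof -
  have "w x * h n x = (\<Sum>j. a j * tent j x * h n x)" unfolding w_def by (rule suminf_mult2[OF sm])
  moreover have "(\<Sum>j. ennreal (a j * tent j x * h n x)) = ennreal (\<Sum>j. a j * tent j x * h n x)"
   by (rule suminf_ennreal2) (use at h sm in \<open>auto intro!: summable_mult2 mult_nonneg_nonneg\<close>)
  ultimately show ?thesis by simp
 qed
 have tb: "(\<integral>\<^sup>+x. ennreal (a j * tent j x * h n x) \<partial>lborel) \<le> ennreal ((1/2) ^ j)" for j n
 proof -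
  have "(\<integral>\<^sup>+x. ennreal (a j * tent j x * h n x) \<partial>lborel) = ennreal (\<integral>x. a j * (tent j x * h n x) \<partial>lborel)"
   using i[OF tent_test_fun[of j], of n] a0[of j] tent_bounds[where j = j] h
   by (subst nn_integral_eq_integral) (auto simp: mult.assoc less_imp_le intro!: mult_nonneg_nonneg)
  also have "\<dots> \<le> ennreal (a j * B j)" using B(2)[of j n] a0[of j] by (intro ennreal_leI) (simp add: mult_left_mono)
  also have "\<dots> \<le> ennreal ((1/2) ^ j)" by (intro ennreal_leI aB)
  finally show ?thesis .
 qed
 have bm: "tent j \<in> borel_measurable borel" for j by (rule borel_measurable_continuous_onI[OF tent_continuous])
 have meas: "(\<lambda>x. ennreal (a j * tent j x * h n x)) \<in> borel_measurable lborel" for j n using bm h(2) by measurable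
 show ?thesis
 proof (rule that)
  show "continuous_on UNIV w"
  proof (rule uniform_limit_theorem[of _ "\<lambda>n x. \<Sum>j<n. a j * tent j x" sequentially])
   show "uniform_limit UNIV (\<lambda>n x. \<Sum>j<n. a j * tent j x) w sequentially" unfolding w_def
    by (rule Weierstrass_m_test[where M = "\<lambda>j. (1/2) ^ j"]) (use at in \<open>auto intro: summable_geometric\<close>)
  qed (auto intro!: always_eventually continuous_intros continuous_on_subset[OF tent_continuous])
  show "w x > 0" for x
  proof -
   obtain j :: nat where j: "\<bar>x\<bar> \<le> real j" using real_arch_simple by blast
   have "0 < a j * tent j x" using a0[of j] tent_bounds(3)[OF j] by simp
   also have "\<dots> \<le> w x" unfolding w_def using sum_le_suminf[OF sm, of "{j}"] at by simp
   finally show ?thesis .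
  qed
  fix n
  have half: "(\<Sum>j. ennreal ((1/2) ^ (j + J))) = ennreal (2 * (1/2) ^ J)" for J
  proof (rule suminf_ennreal_eq)
   have "(\<lambda>j. (1/2) ^ J * (1/2::real) ^ j) sums ((1/2) ^ J * (1 / (1 - 1/2)))" by (intro sums_mult geometric_sums) simp
   then show "(\<lambda>j. (1/2) ^ (j + J)) sums (2 * (1/2::real) ^ J)" by (simp add: power_add mult.commute)
  qed simp
  have "(\<integral>\<^sup>+x. ennreal (w x * h n x) \<partial>lborel) = (\<Sum>j. \<integral>\<^sup>+x. ennreal (a j * tent j x * h n x) \<partial>lborel)"
   unfolding wh by (rule nn_integral_suminf[OF meas])
  also have "\<dots> \<le> (\<Sum>j. ennreal ((1/2) ^ (j + 0)))" using tb by (intro suminf_le) auto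
  also have "\<dots> = 2" unfolding half by simp
  finally show "(\<integral>\<^sup>+x. ennreal (w x * h n x) \<partial>lborel) \<le> 2" .
  fix J
  have "(\<integral>\<^sup>+x. ennreal (w x * h n x) * indicator {x. \<bar>x\<bar> > real J} x \<partial>lborel)
    \<le> (\<integral>\<^sup>+x. (\<Sum>j. ennreal (a (j + J) * tent (j + J) x * h n x)) \<partial>lborel)"
  proof (rule nn_integral_mono)
   fix x
   show "ennreal (w x * h n x) * indicator {x. \<bar>x\<bar> > real J} x \<le> (\<Sum>j. ennreal (a (j + J) * tent (j + J) x * h n x))"
   proof (cases "\<bar>x\<bar> > real J")
    case True
    have "tent j x = 0" if "j < J" for j using True that by (intro tent_bounds(4)) linarith
    then have "(\<Sum>j<J. ennreal (a j * tent j x * h n x)) = 0" by (intro sum.neutral) auto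
    then have "(\<Sum>j. ennreal (a j * tent j x * h n x)) = (\<Sum>j. ennreal (a (j + J) * tent (j + J) x * h n x))"
     using suminf_offset[of "\<lambda>j. ennreal (a j * tent j x * h n x)" J] by simp
    then show ?thesis using True by (simp add: wh)
   qed simp
  qed
  also have "\<dots> = (\<Sum>j. \<integral>\<^sup>+x. ennreal (a (j + J) * tent (j + J) x * h n x) \<partial>lborel)"
   by (rule nn_integral_suminf[OF meas])
  also have "\<dots> \<le> (\<Sum>j. ennreal ((1/2) ^ (j + J)))" using tb by (intro suminf_le) auto
  finally show "(\<integral>\<^sup>+x. ennreal (w x * h n x) * indicator {x. \<bar>x\<bar> > real J} x \<partial>lborel) \<le> ennreal (2 * (1/2) ^ J)"
   unfolding half .
 qed
qed

text \<open>Multiplied by the weight and normalised, the densities become tight probability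
  measures; a weak limit of these is multiplied by the limiting mass and divided by
  \<open>w\<close>. A test function divided by \<open>w\<close> is bounded and continuous, so weak
  convergence applies to it.\<close>

lemma vague_subsequence:
 fixes h :: "nat \<Rightarrow> real \<Rightarrow> real"
 assumes h: "\<And>n x. h n x > 0" "\<And>n. continuous_on UNIV (h n)"
  and i: "\<And>n f. test_fun f \<Longrightarrow> integrable lborel (\<lambda>x. f x * h n x)"
  and b: "\<And>f. test_fun f \<Longrightarrow> bdd_above (range (\<lambda>n. \<integral>x. f x * h n x \<partial>lborel))"
 obtains \<mu> r where "radon \<mu>" "strict_mono (r :: nat \<Rightarrow> nat)"
  "\<And>f. test_fun f \<Longrightarrow> (\<lambda>n. \<integral>x. f x * h (r n) x \<partial>lborel) \<longlonglongrightarrow> (\<integral>x. f x \<partial>\<mu>)"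
proof -
 have hm: "h n \<in> borel_measurable borel" for n by (rule borel_measurable_continuous_onI[OF h(2)])
 have h0: "h n x \<ge> 0" for n x using h(1)[of n x] by simp
 obtain w where w: "continuous_on UNIV w" "\<And>x. w x > 0"
  "\<And>n. (\<integral>\<^sup>+x. ennreal (w x * h n x) \<partial>lborel) \<le> 2"
  "\<And>n J. (\<integral>\<^sup>+x. ennreal (w x * h n x) * indicator {x. \<bar>x\<bar> > real J} x \<partial>lborel) \<le> ennreal (2 * (1/2) ^ J)"
  using weight_exists[of h, OF h0 hm i b] by blast
 have wm: "w \<in> borel_measurable borel" by (rule borel_measurable_continuous_onI[OF w(1)])
 define m where "m n = enn2real (\<integral>\<^sup>+x. ennreal (w x * h n x) \<partial>lborel)" for n
 have fin: "(\<integral>\<^sup>+x. ennreal (w x * h n x) \<partial>lborel) = ennreal (m n)" for n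
  unfolding m_def using w(3)[of n] by (intro ennreal_enn2real[symmetric]) (auto intro: le_less_trans)
 have m: "0 \<le> m n" "m n \<le> 2" for n
 proof -
  have "ennreal (m n) \<le> ennreal 2" using w(3)[of n] unfolding fin by simp
  then show "m n \<le> 2" by (subst (asm) ennreal_le_iff) auto
 qed (simp add: m_def)
 obtain l r0 where r0: "strict_mono (r0 :: nat \<Rightarrow> nat)" "(\<lambda>n. m (r0 n)) \<longlonglongrightarrow> l"
 proof -
  have "\<exists>l\<in>{0..2}. \<exists>r. strict_mono r \<and> (m \<circ> r) \<longlonglongrightarrow> l"
   using compact_Icc[of "0::real" 2, unfolded compact_eq_seq_compact_metric seq_compact_def] m by simp
  then show ?thesis using that by (auto simp: o_def)
 qed
 have iwh: "integrable lborel (\<lambda>x. w x * h n x)" and mi: "m n = (\<integral>x. w x * h n x \<partial>lborel)" for n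
 proof -
  show I: "integrable lborel (\<lambda>x. w x * h n x)"
   using fin[of n] w(2) h0 wm hm by (intro integrableI_nonneg) (auto simp: less_imp_le)
  have "ennreal (m n) = ennreal (\<integral>x. w x * h n x \<partial>lborel)"
   using fin[of n] nn_integral_eq_integral[OF I] w(2) h0 by (simp add: less_imp_le)
  then show "m n = (\<integral>x. w x * h n x \<partial>lborel)"
   using m(1)[of n] Bochner_Integration.integral_nonneg[of lborel "\<lambda>x. w x * h n x"] w(2) h0 by (simp add: less_imp_le)
 qed
 have fw: "continuous_on UNIV (\<lambda>x. f x / w x)" "\<exists>B. \<forall>x. \<bar>f x / w x\<bar> \<le> B" if f: "test_fun f" for f
 proof -
  show c: "continuous_on UNIV (\<lambda>x. f x / w x)" using f w(1,2) unfolding test_fun_def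
   by (intro continuous_intros) (auto simp: less_imp_neq[symmetric] dest: less_imp_neq)
  obtain R where "R > 0" "\<forall>x. \<bar>x\<bar> \<ge> R \<longrightarrow> f x = 0" using test_fun_support[OF f] by blast
  then have "test_fun (\<lambda>x. f x / w x)" by (intro test_funI[OF c, of R]) auto
  then show "\<exists>B. \<forall>x. \<bar>f x / w x\<bar> \<le> B" by (rule test_fun_bounded)
 qed
 have eqf: "f x * h n x = f x / w x * (w x * h n x)" for f x n using w(2)[of x] by simp
 show ?thesis
 proof (cases "l = 0")
  \<comment> \<open>Masses tending to 0 cannot be normalised in the limit; here the limit is the
    zero measure.\<close>
  case True
  let ?\<mu>0 = "null_measure borel :: real measure"
  have rad: "radon ?\<mu>0" unfolding radon_def test_fun_def by (auto intro!: borel_measurable_continuous_onI)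
  show ?thesis
  proof (rule that[OF rad r0(1)])
   fix f assume f: "test_fun f"
   obtain B where B: "\<And>x. \<bar>f x / w x\<bar> \<le> B" using fw(2)[OF f] by blast
   have "norm (\<integral>x. f x * h (r0 n) x \<partial>lborel) \<le> B * m (r0 n)" for n
   proof -
    have "norm (\<integral>x. f x * h (r0 n) x \<partial>lborel) \<le> (\<integral>x. \<bar>f x * h (r0 n) x\<bar> \<partial>lborel)"
     using integral_abs_bound by simp
    also have "\<dots> \<le> (\<integral>x. B * (w x * h (r0 n) x) \<partial>lborel)"
    proof (rule integral_mono)
     fix x
     have "\<bar>f x * h (r0 n) x\<bar> = \<bar>f x / w x\<bar> * (w x * h (r0 n) x)"
      unfolding eqf[of f x "r0 n"] abs_mult using w(2)[of x] h0[of "r0 n" x] by simp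
     also have "\<dots> \<le> B * (w x * h (r0 n) x)"
      by (rule mult_right_mono[OF B]) (use w(2)[of x] h0[of "r0 n" x] in simp)
     finally show "\<bar>f x * h (r0 n) x\<bar> \<le> B * (w x * h (r0 n) x)" .
    qed (use i[OF f] iwh in auto)
    also have "\<dots> = B * m (r0 n)" by (simp add: mi)
    finally show ?thesis .
   qed
   moreover have "(\<lambda>n. B * m (r0 n)) \<longlonglongrightarrow> 0" using tendsto_mult_left[OF r0(2), of B] True by simp
   ultimately have "(\<lambda>n. \<integral>x. f x * h (r0 n) x \<partial>lborel) \<longlonglongrightarrow> 0"
    by (rule Lim_null_comparison[OF always_eventually[OF allI]])
   then show "(\<lambda>n. \<integral>x. f x * h (r0 n) x \<partial>lborel) \<longlonglongrightarrow> (\<integral>x. f x \<partial>?\<mu>0)" by simp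
  qed
 next
  case False
  have l: "l > 0" using LIMSEQ_le_const[OF r0(2), of 0] m False by force
  then have "eventually (\<lambda>n. m (r0 n) > l / 2) sequentially" using order_tendstoD(1)[OF r0(2), of "l/2"] by simp
  then obtain n0 where n0: "\<And>n. n \<ge> n0 \<Longrightarrow> m (r0 n) > l / 2" by (auto simp: eventually_sequentially)
  define s where "s n = r0 (n + n0)" for n
  have s: "strict_mono s" unfolding s_def using r0(1) by (auto simp: strict_mono_def)
  have ms: "m (s n) > l / 2" "m (s n) > 0" for n using n0[of "n + n0"] l by (auto simp: s_def intro: less_trans[OF _ n0])
  have sl: "(\<lambda>n. m (s n)) \<longlonglongrightarrow> l" unfolding s_def using LIMSEQ_ignore_initial_segment[OF r0(2)] .
  define \<rho> where "\<rho> n = density lborel (\<lambda>x. ennreal (w x * h (s n) x / m (s n)))" for n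
  have \<rho>m: "(\<lambda>x. ennreal (w x * h (s n) x / m (s n))) \<in> borel_measurable lborel" for n using wm hm by measurable
  have dv: "ennreal (w x * h (s n) x / m (s n)) = ennreal (w x * h (s n) x) / ennreal (m (s n))" for x n
   using w(2)[of x] h0[of "s n" x] ms(2)[of n] by (simp add: divide_ennreal less_imp_le)
  have \<rho>r: "real_distribution (\<rho> n)" for n
  proof (rule real_distribution.intro)
   show "prob_space (\<rho> n)"
   proof (rule prob_spaceI)
    have "emeasure (\<rho> n) (space (\<rho> n)) = (\<integral>\<^sup>+x. ennreal (w x * h (s n) x) / ennreal (m (s n)) \<partial>lborel)"
     unfolding \<rho>_def dv[symmetric] using \<rho>m by (subst emeasure_density) auto
    also have "\<dots> = ennreal (m (s n)) / ennreal (m (s n))"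
     using wm hm by (subst nn_integral_divide) (auto simp: fin)
    also have "\<dots> = 1" using ms(2)[of n] by (simp add: divide_ennreal)
    finally show "emeasure (\<rho> n) (space (\<rho> n)) = 1" .
   qed
   show "real_distribution_axioms (\<rho> n)" by (rule real_distribution_axioms.intro) (simp_all add: \<rho>_def)
  qed
  have tight: "tight \<rho>" unfolding tight_def
  proof (intro conjI allI impI \<rho>r)
   fix e :: real assume e: "e > 0"
   obtain J where J: "(1/2::real) ^ J < e * l / 4" using real_arch_pow_inv[of "e * l / 4" "1/2"] e l by auto
   have "measure (\<rho> n) {- real (Suc J)<..real (Suc J)} > 1 - e" for n
   proof -
    interpret real_distribution "\<rho> n" by (rule \<rho>r)
    have "emeasure (\<rho> n) {x. \<bar>x\<bar> > real J} = (\<integral>\<^sup>+x. (ennreal (w x * h (s n) x) * indicator {x. \<bar>x\<bar> > real J} x) / ennreal (m (s n)) \<partial>lborel)"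
     unfolding \<rho>_def using \<rho>m by (subst emeasure_density) (auto simp: dv ennreal_times_divide mult.commute intro!: nn_integral_cong)
    also have "\<dots> = (\<integral>\<^sup>+x. ennreal (w x * h (s n) x) * indicator {x. \<bar>x\<bar> > real J} x \<partial>lborel) / ennreal (m (s n))"
     using wm hm by (intro nn_integral_divide) auto
    also have "\<dots> \<le> ennreal (2 * (1/2) ^ J) / ennreal (m (s n))" by (intro divide_right_mono_ennreal w(4))
    also have "\<dots> = ennreal (2 * (1/2) ^ J / m (s n))" using ms(2)[of n] by (simp add: divide_ennreal)
    finally have "measure (\<rho> n) {x. \<bar>x\<bar> > real J} \<le> 2 * (1/2) ^ J / m (s n)"
     using ms(2)[of n] by (simp add: emeasure_eq_measure)
    also have "\<dots> \<le> 2 * (1/2) ^ J / (l / 2)" using ms[of n] l by (intro divide_left_mono) auto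
    also have "\<dots> < e" using J l by (simp add: field_simps)
    finally have t: "measure (\<rho> n) {x. \<bar>x\<bar> > real J} < e" .
    have "1 - measure (\<rho> n) {- real (Suc J)<..real (Suc J)} = measure (\<rho> n) (UNIV - {- real (Suc J)<..real (Suc J)})"
     using prob_compl[of "{- real (Suc J)<..real (Suc J)}"] by simp
    also have "\<dots> \<le> measure (\<rho> n) {x. \<bar>x\<bar> > real J}" by (rule finite_measure_mono) auto
    finally show ?thesis using t by linarith
   qed
   then show "\<exists>a b. a < b \<and> (\<forall>n. 1 - e < measure (\<rho> n) {a<..b})"
    by (intro exI[of _ "- real (Suc J)"] exI[of _ "real (Suc J)"]) auto
  qed
  obtain r1 \<rho>0 where r1: "strict_mono r1" "real_distribution \<rho>0" "weak_conv_m (\<rho> \<circ> id \<circ> r1) \<rho>0"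
   using tight_imp_convergent_subsubsequence[OF tight strict_mono_id] by blast
  interpret \<rho>0: real_distribution \<rho>0 by (rule r1(2))
  define \<mu> where "\<mu> = density \<rho>0 (\<lambda>x. ennreal (l / w x))"
  have lw: "(\<lambda>x. l / w x) \<in> borel_measurable \<rho>0" using wm by simp
  have int\<mu>: "integrable \<mu> f \<and> (\<integral>x. f x \<partial>\<mu>) = l * (\<integral>x. f x / w x \<partial>\<rho>0)" if f: "test_fun f" for f
  proof -
   obtain B where B: "\<And>x. \<bar>f x / w x\<bar> \<le> B" using fw(2)[OF f] by blast
   have fm: "f \<in> borel_measurable borel" using f by (auto simp: test_fun_def intro: borel_measurable_continuous_onI)
   have "integrable \<rho>0 (\<lambda>x. f x / w x)"
    using B fm wm by (intro \<rho>0.integrable_const_bound[of _ B]) auto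
   then have I: "integrable \<rho>0 (\<lambda>x. l / w x * f x)" using integrable_mult_right[of l \<rho>0 "\<lambda>x. f x / w x"] by simp
   have nn: "AE x in \<rho>0. 0 \<le> l / w x" using l w(2) by (intro AE_I2) (simp add: less_imp_le)
   have "integrable \<mu> f" unfolding \<mu>_def
    using I fm lw nn by (subst integrable_density) auto
   moreover have "(\<integral>x. f x \<partial>\<mu>) = (\<integral>x. l / w x * f x \<partial>\<rho>0)" unfolding \<mu>_def
    using fm lw nn by (subst integral_density) auto
   ultimately show ?thesis using integral_mult_right_zero[of \<rho>0 l "\<lambda>x. f x / w x"] by simp
  qed
  show ?thesis
  proof (rule that)
   show "radon \<mu>" unfolding radon_def using int\<mu> by (simp add: \<mu>_def)
   show "strict_mono (s \<circ> r1)" by (rule strict_mono_o[OF s r1(1)])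
   fix f assume f: "test_fun f"
   obtain B where B: "\<And>x. \<bar>f x / w x\<bar> \<le> B" using fw(2)[OF f] by blast
   have fm: "f \<in> borel_measurable borel" using f by (auto simp: test_fun_def intro: borel_measurable_continuous_onI)
   have "(\<lambda>n. \<integral>x. f x / w x \<partial>((\<rho> \<circ> id \<circ> r1) n)) \<longlonglongrightarrow> (\<integral>x. f x / w x \<partial>\<rho>0)"
   proof (rule weak_conv_imp_integral_bdd_continuous_conv[OF _ r1(2,3)])
    show "isCont (\<lambda>x. f x / w x) x" for x using fw(1)[OF f] by (simp add: continuous_on_eq_continuous_at)
    show "norm (f x / w x) \<le> B" for x using B[of x] by simp
   qed (simp add: \<rho>r)
   moreover have "(\<lambda>n. m (s (r1 n))) \<longlonglongrightarrow> l" using LIMSEQ_subseq_LIMSEQ[OF sl r1(1)] by (simp add: o_def)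
   ultimately have "(\<lambda>n. m (s (r1 n)) * (\<integral>x. f x / w x \<partial>(\<rho> (r1 n)))) \<longlonglongrightarrow> l * (\<integral>x. f x / w x \<partial>\<rho>0)"
    by (intro tendsto_mult) (simp_all add: o_def)
   moreover have "m (s n) * (\<integral>x. f x / w x \<partial>(\<rho> n)) = (\<integral>x. f x * h (s n) x \<partial>lborel)" for n
   proof -
    have "(\<integral>x. f x / w x \<partial>(\<rho> n)) = (\<integral>x. (w x * h (s n) x / m (s n)) *\<^sub>R (f x / w x) \<partial>lborel)"
     unfolding \<rho>_def using fm wm hm w(2) h0 ms(2)[of n]
     by (subst integral_density) (auto simp: less_imp_le intro!: AE_I2 divide_nonneg_nonneg mult_nonneg_nonneg)
    also have "\<dots> = (\<integral>x. f x * h (s n) x / m (s n) \<partial>lborel)"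
     by (rule Bochner_Integration.integral_cong) (use w(2) in \<open>auto simp: less_imp_neq[symmetric] field_simps dest: less_imp_neq\<close>)
    also have "\<dots> = (\<integral>x. f x * h (s n) x \<partial>lborel) / m (s n)" by simp
    finally show ?thesis using ms(2)[of n] by simp
   qed
   ultimately show "(\<lambda>n. \<integral>x. f x * h ((s \<circ> r1) n) x \<partial>lborel) \<longlonglongrightarrow> (\<integral>x. f x \<partial>\<mu>)"
    using int\<mu>[OF f] by simp
  qed
 qed
qed

section \<open>The m-function and its boundary values\<close>

lemma set_integrable_halfline:
 fixes f :: "real \<Rightarrow> real"
 assumes c: "continuous_on {0..} f" and f0: "\<And>x. x \<ge> 0 \<Longrightarrow> f x \<ge> 0"
  and B: "\<And>x. x \<ge> 0 \<Longrightarrow> integral {0..x} f \<le> B"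
 shows "set_integrable lborel {0..} f"
proof -
 have ci: "set_integrable lborel {0..real n} f" for n
  by (rule borel_integrable_atLeastAtMost') (auto intro: continuous_on_subset[OF c])
 have In: "(\<integral>x. indicator {0..real n} x * f x \<partial>lborel) = integral {0..real n} f" for n
  using set_borel_integral_eq_integral(2)[OF ci] by (simp add: set_lebesgue_integral_def)
 have "incseq (\<lambda>n. integral {0..real n} f)"
  by (intro incseq_SucI integral_subset_le set_borel_integral_eq_integral(1)[OF ci]) (use f0 in auto)
 then obtain L where L: "(\<lambda>n. integral {0..real n} f) \<longlonglongrightarrow> L" by (rule incseq_convergent[where B = B]) (use B in auto)
 have lim: "(\<lambda>n. indicator {0..real n} x * f x) \<longlonglongrightarrow> indicator {0..} x * f x" for x
 proof (rule tendsto_eventually)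
  obtain n0 :: nat where "x \<le> real n0" using real_arch_simple by blast
  then have "indicator {0..real n} x * f x = indicator {0..} x * f x" if "n \<ge> n0" for n
   using that by (auto simp: indicator_def)
  then show "eventually (\<lambda>n. indicator {0..real n} x * f x = indicator {0..} x * f x) sequentially"
   by (auto simp: eventually_sequentially)
 qed
 have i: "integrable lborel (\<lambda>x. indicator {0..real n} x * f x)" for n using ci[of n] by (simp add: set_integrable_def)
 show ?thesis unfolding set_integrable_def real_scaleR_def
 proof (rule integrable_monotone_convergence[OF i])
  show "AE x in lborel. mono (\<lambda>n. indicator {0..real n} x * f x)"
   by (intro AE_I2 monoI) (use f0 in \<open>auto simp: indicator_def\<close>)
  show "(\<lambda>n. \<integral>x. indicator {0..real n} x * f x \<partial>lborel) \<longlonglongrightarrow> L" unfolding In by (rule L)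
  show "(\<lambda>x. indicator {0..} x * f x) \<in> borel_measurable lborel"
   by (rule borel_measurable_LIMSEQ_real[OF lim borel_measurable_integrable[OF i]])
 qed (use lim in simp)
qed

text \<open>The bound \<open>C / t\<close> is not integrable at 0, but after one integration
  \<open>G1\<close> is of order \<open>1 / sqrt t\<close>, and after the second \<open>G\<close> is
  Hoelder continuous. The first integration would even give a logarithm; the power is simpler and
  integrable too.\<close>

lemma sqrt_continuity:
 fixes G G1 G2 :: "real \<Rightarrow> complex"
 assumes d0: "\<And>t. t \<in> {0..1} \<Longrightarrow> (G has_vector_derivative - \<i> * G1 t) (at t within {0..1})"
  and d1: "\<And>t. t \<in> {0..1} \<Longrightarrow> (G1 has_vector_derivative - \<i> * G2 t) (at t within {0..1})"
  and b2: "\<And>t. t \<in> {0<..1} \<Longrightarrow> norm (G2 t) \<le> C / t" and b1: "norm (G1 1) \<le> C" and t: "t \<in> {0..1}"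
 shows "norm (G t - G 0) \<le> 6 * C * sqrt t"
proof -
 have C: "C \<ge> 0" using b1 norm_ge_zero order_trans by blast
 have c: "continuous_on {0..1} G" "continuous_on {0..1} G1"
  by (rule continuous_on_vector_derivative[OF d0] continuous_on_vector_derivative[OF d1]; assumption)+
 have at: "at x within {0..1} = at x" if "0 < x" "x < 1" for x :: real using that by (rule at_within_Icc_at)
 have G1: "norm (G1 s) \<le> 3 * C / sqrt s" if s: "0 < s" "s < 1" for s
 proof -
  \<comment> \<open>The comparison function is a primitive of \<open>C / (t * sqrt t)\<close>, which
    dominates \<open>C / t\<close> on \<open>(0, 1]\<close>.\<close>
  have "norm (G1 1 - G1 s) \<le> - 2 * C / sqrt 1 - (- 2 * C / sqrt s)"
  proof (rule differentiable_bound_general[where f' = "\<lambda>t. - \<i> * G2 t" and \<phi>' = "\<lambda>t. C / (t * sqrt t)"])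
   show "continuous_on {s..1} G1" using s by (intro continuous_on_subset[OF c(2)]) auto
   show "continuous_on {s..1} (\<lambda>t. - 2 * C / sqrt t)" using s by (intro continuous_intros) auto
   fix x assume x: "s < x" "x < 1"
   show "(G1 has_vector_derivative - \<i> * G2 x) (at x)" using d1[of x] at[of x] x s by simp
   have "((\<lambda>t. - 2 * C / sqrt t) has_real_derivative C / (x * sqrt x)) (at x)"
    using x s by (auto intro!: derivative_eq_intros simp: field_simps power2_eq_square real_sqrt_mult_self)
   then show "((\<lambda>t. - 2 * C / sqrt t) has_vector_derivative C / (x * sqrt x)) (at x)"
    by (simp add: has_real_derivative_iff_has_vector_derivative)
   have "sqrt x \<le> 1" using x s by simp
   then have "x * sqrt x \<le> x * 1" using x s by (intro mult_left_mono) auto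
   then have "C / x \<le> C / (x * sqrt x)" using C x s by (intro divide_left_mono) auto
   then show "norm (- \<i> * G2 x) \<le> C / (x * sqrt x)" using b2[of x] x s by (simp add: norm_mult)
  qed (use s in simp)
  then have "norm (G1 s) \<le> C + 2 * C / sqrt s" using b1 norm_triangle_ineq2[of "G1 s" "G1 1"] C by (simp add: norm_minus_commute)
  then have 1: "norm (G1 s) \<le> C + 2 * (C / sqrt s)" by simp
  have "C \<le> C / sqrt s" using C s by (simp add: le_divide_eq mult_left_le)
  then have "norm (G1 s) \<le> 3 * (C / sqrt s)" using 1 by linarith
  then show ?thesis by simp
 qed
 show ?thesis
 proof (cases "t = 0")
  case False
  then have t0: "0 < t" "t \<le> 1" using t by auto
  have "norm (G t - G 0) \<le> 6 * C * sqrt t - 6 * C * sqrt 0"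
  proof (rule differentiable_bound_general[where f' = "\<lambda>t. - \<i> * G1 t" and \<phi>' = "\<lambda>t. 3 * C / sqrt t"])
   show "continuous_on {0..t} G" using t0 by (intro continuous_on_subset[OF c(1)]) auto
   show "continuous_on {0..t} (\<lambda>t. 6 * C * sqrt t)" by (intro continuous_intros)
   fix x assume x: "0 < x" "x < t"
   show "(G has_vector_derivative - \<i> * G1 x) (at x)" using d0[of x] at[of x] x t0 by simp
   have "((\<lambda>t. 6 * C * sqrt t) has_real_derivative 3 * C / sqrt x) (at x)"
    using x by (auto intro!: derivative_eq_intros simp: field_simps)
   then show "((\<lambda>t. 6 * C * sqrt t) has_vector_derivative 3 * C / sqrt x) (at x)"
    by (simp add: has_real_derivative_iff_has_vector_derivative)
   show "norm (- \<i> * G1 x) \<le> 3 * C / sqrt x" using G1[of x] x t0 by (simp add: norm_mult)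
  qed (use t0 in simp)
  then show ?thesis by simp
 qed simp
qed

context weyl_potential
begin

lemma phi_L2_unbounded:
 assumes "Im z > 0" shows "\<exists>k::nat. k \<ge> 1 \<and> energy (phi z) (real k) > B"
proof -
 obtain x where x: "x \<ge> 0" "energy (phi z) x > B"
  using phi_not_L2[OF assms, of B] by (meson not_le)
 obtain k :: nat where k: "max x 1 \<le> real k" using real_arch_simple by blast
 have "energy (phi z) x \<le> energy (phi z) (real k)"
  using x k by (intro integral_subset_le norm_square_integrable(1)[OF phi_sol]) auto
 then show ?thesis using x k by (intro exI[of _ k]) auto
qed

text \<open>Two solutions of the form \<open>psi + m * phi\<close> differ by a multiple of
  \<open>phi\<close>; the larger the energy of \<open>phi\<close>, the closer the
  parameters.\<close>

lemma disk_diameter: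
 assumes x: "x \<ge> 0" and y: "Im z > 0" and
  m: "Im z * energy (ucomb m z) x \<le> c" "Im z * energy (ucomb m' z) x \<le> c"
 shows "(norm (m - m'))\<^sup>2 * energy (phi z) x \<le> 4 * c / Im z"
proof -
 have "ucomb m z t - ucomb m' z t = (m - m') * phi z t" for t by (simp add: ucomb_def algebra_simps)
 then have "(norm (m - m'))\<^sup>2 * energy (phi z) x = energy (\<lambda>t. ucomb m z t - ucomb m' z t) x"
  by (simp add: norm_mult power_mult_distrib)
 also have "\<dots> \<le> 2 * energy (ucomb m z) x + 2 * energy (ucomb m' z) x" by (rule energy_diff_le[OF ucomb_sol ucomb_sol])
 also have "\<dots> \<le> 2 * (c / Im z) + 2 * (c / Im z)"
  using m y by (intro add_mono mult_left_mono) (auto simp: field_simps)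
 finally show ?thesis by simp
qed

definition "mlim z = lim (\<lambda>n. mN (real n) z)"

text \<open>For \<open>N \<ge> k0\<close> all \<open>mN N z\<close> lie in the disk of
  \<open>k0\<close>, whose diameter becomes small because the energy of \<open>phi\<close> is
  unbounded.\<close>

lemma mN_tendsto:
 assumes z: "0 < Im z" "Im z \<le> 1" shows "(\<lambda>n. mN (real n) z) \<longlonglongrightarrow> mlim z"
proof -
 obtain C where C: "C > 0" "\<And>N. N \<ge> 1 \<Longrightarrow> norm (mN N z) \<le> C / Im z" using mN_bound[of "norm z"] z by auto
 have key: "(norm (mN k z - mN n z))\<^sup>2 * energy (phi z) k0 \<le> 4 * (C / Im z) / Im z"
  if k: "1 \<le> k0" "k0 \<le> k" "k0 \<le> n" for k0 k n
 proof (rule disk_diameter)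
  have "Im (mN j z) \<le> C / Im z" if "j \<ge> 1" for j using C(2)[OF that] abs_Im_le_cmod[of "mN j z"] by linarith
  then show "Im z * energy (ucomb (mN k z) z) k0 \<le> C / Im z" "Im z * energy (ucomb (mN n z) z) k0 \<le> C / Im z"
   using mN_in_disk[of k0 k z] mN_in_disk[of k0 n z] k z by (meson order_trans less_imp_le zero_le_one)+
 qed (use k z in auto)
 have "Cauchy (\<lambda>n. mN (real n) z)"
 proof (rule metric_CauchyI)
  fix e :: real assume e: "e > 0"
  obtain k0 :: nat where k0: "k0 \<ge> 1" "energy (phi z) (real k0) > 4 * (C / Im z) / Im z / e\<^sup>2"
   using phi_L2_unbounded[OF z(1)] by blast
  define I where "I = energy (phi z) (real k0)"
  have "4 * (C / Im z) / Im z / e\<^sup>2 < I" using k0(2) by (simp only: I_def)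
  then have "4 * (C / Im z) / Im z < I * e\<^sup>2" using e by (simp only: pos_divide_less_eq zero_less_power)
  then have I: "4 * (C / Im z) / Im z < e\<^sup>2 * I" by (simp only: mult.commute)
  have I0: "I > 0" using k0(2) C z e unfolding I_def by (auto intro: le_less_trans[rotated])
  have "dist (mN (real k) z) (mN (real n) z) < e" if "k \<ge> k0" "n \<ge> k0" for k n
  proof -
   have "(norm (mN (real k) z - mN (real n) z))\<^sup>2 * I < e\<^sup>2 * I" using key[of "real k0" "real k" "real n"] that k0 I by (simp add: I_def)
   then have "(norm (mN (real k) z - mN (real n) z))\<^sup>2 < e\<^sup>2" using I0 by (simp add: mult_less_cancel_right)
   then show ?thesis unfolding dist_norm using e by (intro power_less_imp_less_base[of _ 2 e]) auto
  qed
  then show "\<exists>M. \<forall>m\<ge>M. \<forall>n\<ge>M. dist (mN (real m) z) (mN (real n) z) < e" by blast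
 qed
 then show ?thesis unfolding mlim_def by (simp add: Cauchy_convergent_iff convergent_LIMSEQ_iff)
qed

text \<open>Up to a fixed \<open>x\<close>, the energy of \<open>psi + mN n z * phi\<close> is
  bounded uniformly in large \<open>n\<close> and in \<open>x\<close>, and the bound passes to the
  limit up to a factor and a constant.\<close>

lemma mlim_L2:
 assumes z: "0 < Im z" "Im z \<le> 1"
 shows "\<exists>B. \<forall>x\<ge>0. energy (ucomb (mlim z) z) x \<le> B"
proof -
 obtain C where C: "C > 0" "\<And>N. N \<ge> 1 \<Longrightarrow> norm (mN N z) \<le> C / Im z" using mN_bound[of "norm z"] z by auto
 note ip = norm_square_integrable(1)[OF phi_sol order_refl]
 have "energy (ucomb (mlim z) z) x \<le> 2 * (C / Im z / Im z) + 2" if x: "x \<ge> 0" for x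
 proof -
  define I where "I = energy (phi z) x"
  have I0: "I \<ge> 0" unfolding I_def by (intro integral_nonneg ip) auto
  have "(\<lambda>n. (norm (mlim z - mN (real n) z))\<^sup>2 * I) \<longlonglongrightarrow> (norm (mlim z - mlim z))\<^sup>2 * I"
   by (intro tendsto_intros mN_tendsto z)
  then have "eventually (\<lambda>n. (norm (mlim z - mN (real n) z))\<^sup>2 * I < 1) sequentially"
   by (intro order_tendstoD(2)[of _ 0]) auto
  then obtain n0 where n0: "\<And>n. n \<ge> n0 \<Longrightarrow> (norm (mlim z - mN (real n) z))\<^sup>2 * I < 1" by (auto simp: eventually_sequentially)
  obtain n1 :: nat where n1: "max x 1 \<le> real n1" using real_arch_simple by blast
  define n where "n = max n0 n1"
  have n: "x \<le> real n" "1 \<le> real n" "n \<ge> n0" using n1 by (auto simp: n_def)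
  have "Im z * energy (ucomb (mN (real n) z) z) x \<le> C / Im z"
   using mN_in_disk[of x "real n" z] C(2)[of "real n"] abs_Im_le_cmod[of "mN (real n) z"] n x z by linarith
  then have d: "energy (ucomb (mN (real n) z) z) x \<le> C / Im z / Im z" using z by (simp add: field_simps)
  let ?d = "mN (real n) z - mlim z"
  have "ucomb (mlim z) z t = ucomb (mN (real n) z) z t - ?d * phi z t" for t by (simp add: ucomb_def algebra_simps)
  then have "energy (ucomb (mlim z) z) x = energy (\<lambda>t. ucomb (mN (real n) z) z t - ?d * phi z t) x" by simp
  also have "\<dots> \<le> 2 * energy (ucomb (mN (real n) z) z) x + 2 * energy (\<lambda>t. ?d * phi z t) x"
   using energy_diff_le[OF ucomb_sol ode_solution_linear[OF phi_sol phi_sol, of z ?d 0]] by simp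
  also have "energy (\<lambda>t. ?d * phi z t) x = (norm (mlim z - mN (real n) z))\<^sup>2 * I"
   by (simp add: I_def norm_mult power_mult_distrib norm_minus_commute)
  finally show ?thesis using d n0[OF n(3)] by linarith
 qed
 then show ?thesis by blast
qed

text \<open>\<open>psi + mlim z * phi\<close> shows that the choice in \<open>weyl_solution\<close>
  is possible, and it has zero Wronskian with whatever is chosen. Written out at 0, this says that
  \<open>mlim z\<close> times the denominator of \<open>weyl_m\<close> is the numerator; if the
  denominator vanished, so would both, and the chosen solution would be trivial.\<close>

lemma weyl_m_eq_mlim:
 assumes z: "0 < Im z" "Im z \<le> 1" and V: "\<And>x. x > 0 \<Longrightarrow> q x = V x"
 shows "weyl_m V \<theta> z = mlim z"
proof -
 let ?P = "\<lambda>u. schroedinger_solution V z u \<and> (\<exists>x\<ge>0. u x \<noteq> 0) \<and> square_integrable_at_infinity u"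
 define w where "w = ucomb (mlim z) z"
 define w' where "w' = ducomb (mlim z) z"
 have ws: "ode_solution q D z w w'" unfolding w_def w'_def by (rule ucomb_sol)
 obtain B where B: "\<And>x. x \<ge> 0 \<Longrightarrow> energy w x \<le> B" using mlim_L2[OF z] unfolding w_def by blast
 have "?P w"
 proof (intro conjI)
  show "schroedinger_solution V z w" by (rule ode_solution_imp_schroedinger(1)[OF ws V])
  show "\<exists>x\<ge>0. w x \<noteq> 0"
  proof (rule ccontr)
   assume "\<not> ?thesis"
   then have w0: "\<And>x. x \<ge> 0 \<Longrightarrow> w x = 0" by blast
   have "(w has_vector_derivative 0) (at 1)"
    by (rule has_vector_derivative_transform_within_open[of "\<lambda>_. 0" _ _ "{0<..}"]) (use w0 in auto)
   then have "w' 1 = 0" using ode_solution_deriv(1)[OF ws, of 1] vector_derivative_unique_at by fastforce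
   then have "w 1 * dphi z 1 - w' 1 * phi z 1 = 0" using w0[of 1] by simp
   moreover have "w 1 * dphi z 1 - w' 1 * phi z 1 = w 0 * dphi z 0 - w' 0 * phi z 0" by (rule wronskian_constant[OF ws phi_sol]) simp
   moreover have "w 0 * dphi z 0 - w' 0 * phi z 0 = 1"
    using cos_sin_sq unfolding w_def w'_def by (simp add: ucomb_def ducomb_def phi_psi_0 algebra_simps)
   ultimately show False by simp
  qed
  have "set_integrable lborel {0..} (\<lambda>x. (norm (w x))\<^sup>2)"
   by (rule set_integrable_halfline[OF _ _ B]) (auto intro!: continuous_intros ode_solution_cont_at(1)[OF ws])
  then show "square_integrable_at_infinity w" unfolding square_integrable_at_infinity_def by (intro exI[of _ 0]) auto
 qed
 define u where "u = weyl_solution V z"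
 have u: "?P u" unfolding u_def weyl_solution_def using \<open>?P w\<close> by (rule someI[where P = ?P])
 define u' where "u' = halfline_deriv u"
 have us: "ode_solution q D z u u'" unfolding u'_def by (rule schroedinger_imp_ode_solution[OF _ V]) (use u in auto)
 have "\<exists>B'. \<forall>x\<ge>0. energy u x \<le> B'"
 proof -
  obtain R where R: "R \<ge> 0" "set_integrable lborel {R..} (\<lambda>x. (norm (u x))\<^sup>2)" using u unfolding square_integrable_at_infinity_def by auto
  have ir: "(\<lambda>x. (norm (u x))\<^sup>2) integrable_on {R..}" by (rule set_borel_integral_eq_integral(1)[OF R(2)])
  note i = norm_square_integrable(1)[OF us]
  have "energy u x \<le> energy u R + integral {R..} (\<lambda>t. (norm (u t))\<^sup>2)" if x: "x \<ge> 0" for x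
  proof (cases "x \<le> R")
   case True
   have "energy u x \<le> energy u R"
    using True x by (intro integral_subset_le i) auto
   moreover have "0 \<le> integral {R..} (\<lambda>t. (norm (u t))\<^sup>2)" by (rule integral_nonneg[OF ir]) auto
   ultimately show ?thesis by linarith
  next
   case False
   have "energy u R + integral {R..x} (\<lambda>t. (norm (u t))\<^sup>2) = energy u x"
    by (rule Henstock_Kurzweil_Integration.integral_combine) (use False R in \<open>auto intro: i\<close>)
   moreover have "integral {R..x} (\<lambda>t. (norm (u t))\<^sup>2) \<le> integral {R..} (\<lambda>t. (norm (u t))\<^sup>2)"
    by (intro integral_subset_le i ir) (use R in auto)
   ultimately show ?thesis by linarith
  qed
  then show ?thesis by blast
 qed
 then obtain B' where B': "\<And>x. x \<ge> 0 \<Longrightarrow> energy u x \<le> B'" by blast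
 let ?c = "complex_of_real (cos \<theta>)" and ?s = "complex_of_real (sin \<theta>)"
 define A where "A = u 0 * ?c - u' 0 * ?s"
 define Bb where "Bb = u' 0 * ?c + u 0 * ?s"
 have "u 0 * w' 0 - u' 0 * w 0 = 0" by (rule L2_wronskian[OF us ws B' B])
 then have mA: "mlim z * A = Bb"
  unfolding w_def w'_def A_def Bb_def by (simp add: ucomb_def ducomb_def phi_psi_0 algebra_simps)
 have "A \<noteq> 0"
 proof
  assume A0: "A = 0"
  then have B0: "Bb = 0" using mA by simp
  have "u 0 * (?c * ?c + ?s * ?s) = ?c * A + ?s * Bb" unfolding A_def Bb_def by (simp add: algebra_simps)
  then have u00: "u 0 = 0" unfolding cos_sin_sq using A0 B0 by simp
  have "u' 0 * (?c * ?c + ?s * ?s) = ?c * Bb - ?s * A" unfolding A_def Bb_def by (simp add: algebra_simps)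
  then have u10: "u' 0 = 0" unfolding cos_sin_sq using A0 B0 by simp
  have "u x = 0" if "x \<ge> 0" for x
   using energy_bound[OF us order_refl that] u00 u10 by (simp add: sum_power2_le_zero_iff)
  then show False using u by blast
 qed
 then have "Bb / A = mlim z" using mA by (simp add: field_simps)
 then show ?thesis unfolding weyl_m_def Let_def A_def Bb_def u'_def u_def .
qed

text \<open>The m-function at height \<open>\<epsilon>\<close>, smeared with \<open>f\<close>. It is
  kept complex so that holomorphy can be used; imaginary parts are taken at the end.\<close>

definition "G N S f \<epsilon> = integral {-S..S} (\<lambda>x. complex_of_real (f x) * mN N (of_real x + \<i> * of_real \<epsilon>))"

lemma mN_continuous:
 assumes "N \<ge> 0" shows "continuous_on {z. Im z \<ge> 0} (\<lambda>z. mN N z)" "continuous_on {z. Im z \<ge> 0} (deriv (mN N))"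
proof -
 have sub: "{z. Im z \<ge> 0} \<subseteq> {z. den N z \<noteq> 0}" using den_nonzero[OF assms] by auto
 note h = mN_holomorphic[OF assms]
 show "continuous_on {z. Im z \<ge> 0} (\<lambda>z. mN N z)"
  by (rule continuous_on_subset[OF holomorphic_on_imp_continuous_on[OF h(2)] sub])
 show "continuous_on {z. Im z \<ge> 0} (deriv (mN N))"
  by (rule continuous_on_subset[OF holomorphic_on_imp_continuous_on[OF holomorphic_deriv[OF h(2,1)]] sub])
qed

lemma mN_has_derivative:
 assumes "N \<ge> 0" "Im z \<ge> 0" shows "(mN N has_field_derivative deriv (mN N) z) (at z)"
 using holomorphic_derivI[OF mN_holomorphic(2,1)[OF assms(1)]] den_nonzero[OF assms] by auto

text \<open>By holomorphy the derivative of \<open>mN\<close> in \<open>\<epsilon>\<close> is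
  \<open>i\<close> times its derivative in \<open>x\<close>, and integration by parts moves the
  latter to \<open>f\<close>.\<close>

lemma G_derivative:
 assumes N: "N \<ge> 0" and f: "\<And>x. (f has_real_derivative f1 x) (at x)" "continuous_on UNIV f1" and S: "S > 0" "f S = 0" "f (- S) = 0"
  and e: "\<epsilon> \<in> {0..1}"
 shows "(G N S f has_vector_derivative - \<i> * G N S f1 \<epsilon>) (at \<epsilon> within {0..1})"
proof -
 let ?z = "\<lambda>\<epsilon> x. complex_of_real x + \<i> * of_real \<epsilon>"
 have fc: "continuous_on UNIV f" by (rule DERIV_continuous_on) (rule has_field_derivative_at_within[OF f(1)])
 have cz: "continuous_on {-S..S} (\<lambda>x. g (?z \<epsilon> x))" if "continuous_on {z. Im z \<ge> 0} g" "\<epsilon> \<ge> 0" for g :: "complex \<Rightarrow> complex" and \<epsilon>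
  by (rule continuous_on_compose2[OF that(1)]) (use that in \<open>auto intro!: continuous_intros\<close>)
 have "((\<lambda>\<epsilon>. integral (cbox (-S) S) (\<lambda>x. complex_of_real (f x) * mN N (?z \<epsilon> x))) has_vector_derivative
   integral (cbox (-S) S) (\<lambda>x. complex_of_real (f x) * (\<i> * deriv (mN N) (?z \<epsilon> x)))) (at \<epsilon> within {0..1})"
 proof (rule leibniz_rule_vector_derivative)
  fix t x :: real assume t: "t \<in> {0..1}"
  have "((\<lambda>t. ?z t x) has_vector_derivative 0 + \<i> * of_real 1) (at t within {0..1})"
   by (intro has_vector_derivative_add has_vector_derivative_const has_vector_derivative_mult_right has_vector_derivative_of_real DERIV_ident)
  then have "((\<lambda>t. ?z t x) has_vector_derivative \<i>) (at t within {0..1})" by simp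
  moreover have "(mN N has_field_derivative deriv (mN N) (?z t x)) (at (?z t x) within (\<lambda>t. ?z t x) ` {0..1})"
   by (rule has_field_derivative_at_within[OF mN_has_derivative[OF N]]) (use t in simp)
  ultimately have "(mN N \<circ> (\<lambda>t. ?z t x) has_vector_derivative \<i> * deriv (mN N) (?z t x)) (at t within {0..1})"
   by (rule field_vector_diff_chain_within)
  then show "((\<lambda>t. complex_of_real (f x) * mN N (?z t x)) has_vector_derivative complex_of_real (f x) * (\<i> * deriv (mN N) (?z t x))) (at t within {0..1})"
   by (intro has_vector_derivative_mult_right) (simp add: o_def)
 next
  fix t :: real assume "t \<in> {0..1}"
  then show "(\<lambda>x. complex_of_real (f x) * mN N (?z t x)) integrable_on cbox (-S) S"
   unfolding interval_cbox[symmetric]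
   by (intro integrable_continuous_real continuous_intros cz mN_continuous N continuous_on_subset[OF fc]) auto
 next
  have "continuous_on ({0..1} \<times> cbox (-S) S) (\<lambda>p. deriv (mN N) (?z (fst p) (snd p)))"
   by (rule continuous_on_compose2[OF mN_continuous(2)[OF N]]) (auto intro!: continuous_intros)
  moreover have "continuous_on ({0..1} \<times> cbox (-S) S) (\<lambda>p. f (snd p))"
   by (rule continuous_on_compose2[OF fc]) (auto intro!: continuous_intros)
  ultimately show "continuous_on ({0..1} \<times> cbox (-S) S) (\<lambda>(t, x). complex_of_real (f x) * (\<i> * deriv (mN N) (?z t x)))"
   unfolding case_prod_unfold by (intro continuous_intros)
 qed (use e in auto)
 then have 1: "(G N S f has_vector_derivative integral {-S..S} (\<lambda>x. complex_of_real (f x) * (\<i> * deriv (mN N) (?z \<epsilon> x)))) (at \<epsilon> within {0..1})"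
  unfolding G_def[abs_def] interval_cbox .
 have "((\<lambda>x. complex_of_real (f1 x) * mN N (?z \<epsilon> x) + complex_of_real (f x) * deriv (mN N) (?z \<epsilon> x)) has_integral
   complex_of_real (f S) * mN N (?z \<epsilon> S) - complex_of_real (f (-S)) * mN N (?z \<epsilon> (-S))) {-S..S}"
 proof (rule fundamental_theorem_of_calculus)
  fix x
  have "((\<lambda>x. ?z \<epsilon> x) has_vector_derivative of_real 1 + 0) (at x)"
   by (intro has_vector_derivative_add has_vector_derivative_const has_vector_derivative_of_real DERIV_ident)
  then have "((\<lambda>x. ?z \<epsilon> x) has_vector_derivative 1) (at x)" by simp
  moreover have "(mN N has_field_derivative deriv (mN N) (?z \<epsilon> x)) (at (?z \<epsilon> x))"
   by (rule mN_has_derivative[OF N]) (use e in simp)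
  ultimately have 2: "(mN N \<circ> (\<lambda>x. ?z \<epsilon> x) has_vector_derivative 1 * deriv (mN N) (?z \<epsilon> x)) (at x)"
   by (rule field_vector_diff_chain_at)
  have "((\<lambda>x. complex_of_real (f x)) has_vector_derivative complex_of_real (f1 x)) (at x)"
   by (rule has_vector_derivative_of_real[OF f(1)])
  from has_vector_derivative_mult[OF this 2]
  have "((\<lambda>x. complex_of_real (f x) * mN N (?z \<epsilon> x)) has_vector_derivative
    complex_of_real (f1 x) * mN N (?z \<epsilon> x) + complex_of_real (f x) * deriv (mN N) (?z \<epsilon> x)) (at x)" by (simp add: o_def add.commute)
  then show "((\<lambda>x. complex_of_real (f x) * mN N (?z \<epsilon> x)) has_vector_derivative
    complex_of_real (f1 x) * mN N (?z \<epsilon> x) + complex_of_real (f x) * deriv (mN N) (?z \<epsilon> x)) (at x within {-S..S})"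
   by (rule has_vector_derivative_at_within)
 qed (use S in simp)
 then have hi0: "((\<lambda>x. complex_of_real (f1 x) * mN N (?z \<epsilon> x) + complex_of_real (f x) * deriv (mN N) (?z \<epsilon> x)) has_integral 0) {-S..S}"
  using S by simp
 have i1: "(\<lambda>x. complex_of_real (f1 x) * mN N (?z \<epsilon> x)) integrable_on {-S..S}"
  using e by (intro integrable_continuous_real continuous_intros cz mN_continuous N continuous_on_subset[OF f(2)]) auto
 have i2: "(\<lambda>x. complex_of_real (f x) * deriv (mN N) (?z \<epsilon> x)) integrable_on {-S..S}"
  using e by (intro integrable_continuous_real continuous_intros cz mN_continuous N continuous_on_subset[OF fc]) auto
 have "G N S f1 \<epsilon> + integral {-S..S} (\<lambda>x. complex_of_real (f x) * deriv (mN N) (?z \<epsilon> x)) = 0"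
  unfolding G_def using integral_add[OF i1 i2] integral_unique[OF hi0] by (simp only:)
 then have "integral {-S..S} (\<lambda>x. complex_of_real (f x) * deriv (mN N) (?z \<epsilon> x)) = - G N S f1 \<epsilon>" by (simp add: add_eq_0_iff)
 moreover have "integral {-S..S} (\<lambda>x. complex_of_real (f x) * (\<i> * deriv (mN N) (?z \<epsilon> x))) = \<i> * integral {-S..S} (\<lambda>x. complex_of_real (f x) * deriv (mN N) (?z \<epsilon> x))"
  unfolding integral_mult_right[symmetric] by (rule integral_cong) simp
 ultimately show ?thesis using 1 by simp
qed

text \<open>Two derivatives in \<open>\<epsilon>\<close> turn \<open>f\<close> into
  \<open>f1\<close> and \<open>f2\<close>, and the bound \<open>C / \<epsilon>\<close> on
  \<open>mN\<close> feeds \<open>sqrt_continuity\<close>. What matters is that the constant does not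
  depend on \<open>N\<close>.\<close>

lemma G_holder:
 assumes f: "\<And>x. (f has_real_derivative f1 x) (at x)" "\<And>x. (f1 has_real_derivative f2 x) (at x)" "continuous_on UNIV f2"
  and S: "S > 0" "f S = 0" "f (- S) = 0" "f1 S = 0" "f1 (- S) = 0"
 shows "\<exists>C. \<forall>N\<ge>1. \<forall>t\<in>{0..1}. norm (G N S f t - G N S f 0) \<le> C * sqrt t"
proof -
 have f1c: "continuous_on UNIV f1" by (rule DERIV_continuous_on) (rule has_field_derivative_at_within[OF f(2)])
 obtain C where C: "C > 0" "\<And>N z. N \<ge> 1 \<Longrightarrow> norm z \<le> S + 1 \<Longrightarrow> 0 < Im z \<Longrightarrow> Im z \<le> 1 \<Longrightarrow> norm (mN N z) \<le> C / Im z"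
  using mN_bound[of "S + 1"] by blast
 have bd: "\<exists>M. \<forall>x\<in>{-S..S}. \<bar>g x\<bar> \<le> M" if "continuous_on UNIV g" for g :: "real \<Rightarrow> real"
 proof -
  have "bounded (g ` {-S..S})" by (intro compact_imp_bounded compact_continuous_image continuous_on_subset[OF that]) auto
  then show ?thesis by (auto simp: bounded_iff)
 qed
 obtain M1 where M1: "\<And>x. x \<in> {-S..S} \<Longrightarrow> \<bar>f1 x\<bar> \<le> M1" using bd[OF f1c] by blast
 obtain M2 where M2: "\<And>x. x \<in> {-S..S} \<Longrightarrow> \<bar>f2 x\<bar> \<le> M2" using bd[OF f(3)] by blast
 define M where "M = max 0 (max M1 M2)"
 have Gb: "norm (G N S g t) \<le> (M * C * (2 * S)) / t" if N: "N \<ge> 1" and t: "t \<in> {0<..1}" and g: "continuous_on UNIV g" "\<And>x. x \<in> {-S..S} \<Longrightarrow> \<bar>g x\<bar> \<le> M" for N t g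
 proof -
  have "norm (G N S g t) \<le> (M * (C / t)) * measure lborel {-S..S}"
  proof (rule has_integral_bound_real[of _ "{}"])
   have N0: "N \<ge> 0" using N by simp
   have "continuous_on {-S..S} (\<lambda>x. mN N (of_real x + \<i> * of_real t))"
    by (rule continuous_on_compose2[OF mN_continuous(1)[OF N0]]) (use t in \<open>auto intro!: continuous_intros\<close>)
   then have "(\<lambda>x. complex_of_real (g x) * mN N (of_real x + \<i> * of_real t)) integrable_on {-S..S}"
    by (intro integrable_continuous_real continuous_intros continuous_on_subset[OF g(1)]) auto
   then show "((\<lambda>x. complex_of_real (g x) * mN N (of_real x + \<i> * of_real t)) has_integral G N S g t) {-S..S}"
    unfolding G_def by (rule integrable_integral)
   fix x assume x: "x \<in> {-S..S} - {}"
   have "norm (complex_of_real x + \<i> * of_real t) \<le> S + 1"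
    using norm_triangle_ineq[of "complex_of_real x" "\<i> * of_real t"] x t by (auto simp: norm_mult)
   then have "norm (mN N (of_real x + \<i> * of_real t)) \<le> C / t" using C(2)[OF N, of "of_real x + \<i> * of_real t"] t by simp
   then show "norm (complex_of_real (g x) * mN N (of_real x + \<i> * of_real t)) \<le> M * (C / t)"
    unfolding norm_mult using g(2)[of x] x by (intro mult_mono) (auto simp: M_def)
  qed (use C t in \<open>auto simp: M_def\<close>)
  also have "\<dots> = (M * C * (2 * S)) / t" using S by simp
  finally show ?thesis .
 qed
 have Mb: "\<And>x. x \<in> {-S..S} \<Longrightarrow> \<bar>f1 x\<bar> \<le> M" "\<And>x. x \<in> {-S..S} \<Longrightarrow> \<bar>f2 x\<bar> \<le> M"
  using M1 M2 unfolding M_def by (fastforce simp: le_max_iff_disj)+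
 show ?thesis
 proof (intro exI[of _ "6 * (M * C * (2 * S))"] allI impI ballI)
  fix N t :: real assume N: "N \<ge> 1" and t: "t \<in> {0..1}"
  have N0: "N \<ge> 0" using N by simp
  show "norm (G N S f t - G N S f 0) \<le> 6 * (M * C * (2 * S)) * sqrt t"
  proof (rule sqrt_continuity[where ?G1.0 = "G N S f1" and ?G2.0 = "G N S f2"])
   show "norm (G N S f2 t) \<le> (M * C * (2 * S)) / t" if "t \<in> {0<..1}" for t by (rule Gb[OF N that f(3) Mb(2)])
   show "norm (G N S f1 1) \<le> M * C * (2 * S)" using Gb[OF N _ f1c Mb(1), of 1] by simp
  qed (use G_derivative[OF N0 f(1) f1c S(1,2,3)] G_derivative[OF N0 f(2,3) S(1,4,5)] t in auto)
 qed
qed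

lemma im_G_eq:
 assumes N: "N \<ge> 0" and f: "continuous_on UNIV f" "\<And>x. \<bar>x\<bar> \<ge> S \<Longrightarrow> f x = 0" and t: "t \<ge> 0"
 shows "integrable lborel (\<lambda>x. f x * Im (mN N (Complex x t)))"
  and "(\<integral>x. f x * Im (mN N (Complex x t)) \<partial>lborel) = Im (G N S f t)"
proof -
 have Ce: "Complex x t = of_real x + \<i> * of_real t" for x by (simp add: complex_eq_iff)
 have c: "continuous_on {-S..S} (\<lambda>x. complex_of_real (f x) * mN N (of_real x + \<i> * of_real t))"
 proof -
  have "continuous_on {-S..S} (\<lambda>x. mN N (of_real x + \<i> * of_real t))"
   by (rule continuous_on_compose2[OF mN_continuous(1)[OF N]]) (use t in \<open>auto intro!: continuous_intros\<close>)
  then show ?thesis by (intro continuous_intros continuous_on_subset[OF f(1)]) auto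
 qed
 have eq: "f x * Im (mN N (Complex x t)) = indicator {-S..S} x *\<^sub>R Im (complex_of_real (f x) * mN N (of_real x + \<i> * of_real t))" for x
  using f(2)[of x] by (cases "\<bar>x\<bar> \<ge> S") (auto simp: Ce indicator_def)
 have si: "set_integrable lborel {-S..S} (\<lambda>x. Im (complex_of_real (f x) * mN N (of_real x + \<i> * of_real t)))"
  by (intro borel_integrable_atLeastAtMost' continuous_on_Im c)
 then show "integrable lborel (\<lambda>x. f x * Im (mN N (Complex x t)))" unfolding eq set_integrable_def .
 have "(\<integral>x. f x * Im (mN N (Complex x t)) \<partial>lborel) = integral {-S..S} (\<lambda>x. Im (complex_of_real (f x) * mN N (of_real x + \<i> * of_real t)))"
  unfolding eq using set_borel_integral_eq_integral(2)[OF si] by (simp add: set_lebesgue_integral_def)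
 also have "\<dots> = Im (G N S f t)" unfolding G_def
  using integral_unique[OF has_integral_linear[OF integrable_integral[OF integrable_continuous_real[OF c]] bounded_linear_Im]] by (simp add: o_def)
 finally show "(\<integral>x. f x * Im (mN N (Complex x t)) \<partial>lborel) = Im (G N S f t)" .
qed

lemma mlim_integral:
 assumes t: "t \<in> {0<..1}" and f: "test_fun f"
 shows "integrable lborel (\<lambda>x. f x * Im (mlim (Complex x t)))"
  and "(\<lambda>n. \<integral>x. f x * Im (mN (real n) (Complex x t)) \<partial>lborel) \<longlonglongrightarrow> (\<integral>x. f x * Im (mlim (Complex x t)) \<partial>lborel)"
proof -
 obtain S where S: "S > 0" "\<And>x. \<bar>x\<bar> \<ge> S \<Longrightarrow> f x = 0" using test_fun_support[OF f] by blast
 have fc: "continuous_on UNIV f" using f by (simp add: test_fun_def)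
 obtain C where C: "C > 0" "\<And>N z. N \<ge> 1 \<Longrightarrow> norm z \<le> S + 1 \<Longrightarrow> 0 < Im z \<Longrightarrow> Im z \<le> 1 \<Longrightarrow> norm (mN N z) \<le> C / Im z"
  using mN_bound[of "S + 1"] by blast
 let ?s = "\<lambda>n x. f x * Im (mN (real (Suc n)) (Complex x t))" and ?f = "\<lambda>x. f x * Im (mlim (Complex x t))"
 have lim: "(\<lambda>n. ?s n x) \<longlonglongrightarrow> ?f x" for x
  using t by (intro tendsto_intros LIMSEQ_Suc[OF mN_tendsto]) auto
 have meas: "?s n \<in> borel_measurable lborel" for n
  by (rule borel_measurable_integrable[OF im_G_eq(1)[where S = S, OF _ fc S(2)]]) (use t in auto)
 have bd: "norm (?s n x) \<le> \<bar>f x\<bar> * (C / t)" for n x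
 proof (cases "\<bar>x\<bar> \<ge> S")
  case False
  have "norm (Complex x t) \<le> \<bar>x\<bar> + \<bar>t\<bar>" using cmod_le[of "Complex x t"] by simp
  then have "norm (mN (real (Suc n)) (Complex x t)) \<le> C / t" using C(2)[of "real (Suc n)" "Complex x t"] t False by auto
  then have "\<bar>Im (mN (real (Suc n)) (Complex x t))\<bar> \<le> C / t" using abs_Im_le_cmod order_trans by blast
  then show ?thesis unfolding real_norm_def abs_mult by (rule mult_left_mono) simp
 qed (use S in simp)
 have 1: "?f \<in> borel_measurable lborel" by (rule borel_measurable_LIMSEQ_real[OF lim meas])
 have 2: "integrable lborel (\<lambda>x. \<bar>f x\<bar> * (C / t))" by (intro integrable_mult_left integrable_abs test_fun_integrable f)
 have 3: "AE x in lborel. (\<lambda>n. ?s n x) \<longlonglongrightarrow> ?f x" by (intro AE_I2 lim)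
 have 4: "AE x in lborel. norm (?s n x) \<le> \<bar>f x\<bar> * (C / t)" for n by (intro AE_I2 bd)
 show "integrable lborel ?f" by (rule integrable_dominated_convergence[OF 1 meas 2 3 4])
 have "(\<lambda>n. \<integral>x. ?s n x \<partial>lborel) \<longlonglongrightarrow> (\<integral>x. ?f x \<partial>lborel)" by (rule integral_dominated_convergence[OF 1 meas 2 3 4])
 then show "(\<lambda>n. \<integral>x. f x * Im (mN (real n) (Complex x t)) \<partial>lborel) \<longlonglongrightarrow> (\<integral>x. ?f x \<partial>lborel)" by (rule LIMSEQ_imp_Suc)
qed

text \<open>The limits in \<open>n\<close> and in \<open>\<epsilon>\<close> commute: for fixed
  \<open>\<epsilon>\<close> the integrals converge in \<open>n\<close>, and they differ from their
  values on the real axis by at most \<open>C * sqrt \<epsilon>\<close>, uniformly in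
  \<open>n\<close>.\<close>

lemma smooth_test_limit:
 assumes g: "smooth_test_fun g"
 shows "\<exists>L. ((\<lambda>\<epsilon>. \<integral>x. g x * Im (mlim (Complex x \<epsilon>)) \<partial>lborel) \<longlongrightarrow> L) (at_right 0) \<and>
   (\<lambda>n. \<integral>x. g x * Im (mN (real n) (of_real x)) \<partial>lborel) \<longlonglongrightarrow> L"
proof -
 obtain g1 g2 S where S: "S > 0" and d: "\<And>x. (g has_real_derivative g1 x) (at x)" "\<And>x. (g1 has_real_derivative g2 x) (at x)"
  and c2: "continuous_on UNIV g2" and z: "\<And>x. \<bar>x\<bar> \<ge> S \<Longrightarrow> g x = 0 \<and> g1 x = 0 \<and> g2 x = 0"
  using g unfolding smooth_test_fun_def by blast
 have zs: "g S = 0" "g (- S) = 0" "g1 S = 0" "g1 (- S) = 0" using z[of S] z[of "- S"] S by auto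
 have gc: "continuous_on UNIV g" by (rule DERIV_continuous_on) (rule has_field_derivative_at_within[OF d(1)])
 obtain C where C: "\<And>N t. N \<ge> 1 \<Longrightarrow> t \<in> {0..1} \<Longrightarrow> norm (G N S g t - G N S g 0) \<le> C * sqrt t"
  using G_holder[OF d c2 S zs] by blast
 define A where "A n t = (\<integral>x. g x * Im (mN (real n) (Complex x t)) \<partial>lborel)" for n t
 define Ai where "Ai t = (\<integral>x. g x * Im (mlim (Complex x t)) \<partial>lborel)" for t
 have AG: "A n t = Im (G (real n) S g t)" if "t \<ge> 0" for n t unfolding A_def by (rule im_G_eq(2)[OF _ gc]) (use z that in auto)
 have hold: "\<bar>A n t - A n 0\<bar> \<le> C * sqrt t" if "n \<ge> 1" "t \<in> {0..1}" for n t
  using C[of "real n" t] that abs_Im_le_cmod[of "G (real n) S g t - G (real n) S g 0"] by (simp add: AG)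
 have lim: "(\<lambda>n. A n t) \<longlonglongrightarrow> Ai t" if t: "t \<in> {0<..1}" for t
  unfolding A_def Ai_def by (rule mlim_integral(2)[OF t smooth_test_fun_imp_test_fun[OF g]])
 have C0: "C \<ge> 0" using order_trans[OF norm_ge_zero C[of 1 1]] by simp
 have "Cauchy (\<lambda>n. A n 0)"
 proof (rule metric_CauchyI)
  fix e :: real assume e: "e > 0"
  define d where "d = e / (4 * (C + 1))"
  define t where "t = min 1 (d\<^sup>2)"
  have d: "d > 0" using e C0 by (simp add: d_def)
  then have t: "t \<in> {0<..1}" by (simp add: t_def)
  have "sqrt t \<le> sqrt (d\<^sup>2)" by (rule real_sqrt_le_mono) (simp add: t_def)
  also have "\<dots> = d" using d by simp
  finally have "C * sqrt t \<le> (C + 1) * d" using C0 t d by (intro mult_mono) auto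
  also have "(C + 1) * d = e / 4"
  proof -
   have "C + 1 \<noteq> 0" using C0 by linarith
   then have "d * (C + 1) = e / 4"
    unfolding d_def times_divide_eq_left by (rule nonzero_mult_divide_mult_cancel_right)
   then show ?thesis by (simp only: mult.commute)
  qed
  finally have Ct: "C * sqrt t \<le> e / 4" .
  obtain n0 where n0: "\<And>m n. m \<ge> n0 \<Longrightarrow> n \<ge> n0 \<Longrightarrow> dist (A m t) (A n t) < e / 4"
   using metric_CauchyD[OF LIMSEQ_imp_Cauchy[OF lim[OF t]], of "e/4"] e by auto
  show "\<exists>M. \<forall>m\<ge>M. \<forall>n\<ge>M. dist (A m 0) (A n 0) < e"
  proof (intro exI[of _ "max 1 n0"] allI impI)
   fix m n assume mn: "m \<ge> max 1 n0" "n \<ge> max 1 n0"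
   have "\<bar>A m t - A m 0\<bar> \<le> e / 4" "\<bar>A n t - A n 0\<bar> \<le> e / 4" using hold[of m t] hold[of n t] Ct mn t by auto
   moreover have "\<bar>A m t - A n t\<bar> < e / 4" using n0[of m n] mn by (simp add: dist_real_def)
   ultimately show "dist (A m 0) (A n 0) < e" unfolding dist_real_def using e by linarith
  qed
 qed
 then obtain L where L: "(\<lambda>n. A n 0) \<longlonglongrightarrow> L" by (auto simp: Cauchy_convergent_iff convergent_def)
 have AL: "\<bar>Ai t - L\<bar> \<le> C * sqrt t" if t: "t \<in> {0<..1}" for t
 proof -
  have "(\<lambda>n. \<bar>A n t - A n 0\<bar>) \<longlonglongrightarrow> \<bar>Ai t - L\<bar>" by (intro tendsto_intros lim L t)
  moreover have "eventually (\<lambda>n. \<bar>A n t - A n 0\<bar> \<le> C * sqrt t) sequentially"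
   using hold[of _ t] t by (auto simp: eventually_sequentially intro!: exI[of _ 1])
  ultimately show ?thesis by (rule tendsto_upperbound) simp
 qed
 have "((\<lambda>t. Ai t - L) \<longlongrightarrow> 0) (at_right 0)"
 proof (rule Lim_null_comparison)
  show "eventually (\<lambda>t. norm (Ai t - L) \<le> C * sqrt t) (at_right 0)"
   using AL by (auto simp: eventually_at_right_field intro!: exI[of _ 1])
  have "((\<lambda>t. C * sqrt t) \<longlongrightarrow> C * sqrt 0) (at_right 0)" by (intro tendsto_intros)
  then show "((\<lambda>t. C * sqrt t) \<longlongrightarrow> 0) (at_right 0)" by simp
 qed
 then have "(Ai \<longlongrightarrow> L) (at_right 0)" by (simp add: LIM_zero_iff)
 moreover have "A n 0 = (\<integral>x. g x * Im (mN (real n) (of_real x)) \<partial>lborel)" for n by (simp add: A_def complex_of_real_def)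
 ultimately show ?thesis using L unfolding Ai_def by auto
qed

end

section \<open>The spectral measure\<close>

context weyl_potential
begin

definition "dens n E = Im (mN (real n) (of_real E)) / pi"

abbreviation pairing :: "nat \<Rightarrow> (real \<Rightarrow> real) \<Rightarrow> real" where
 "pairing n f \<equiv> \<integral>x. f x * dens n x \<partial>lborel"

lemma dens_eq: "dens n E = 1 / (pi * (amp E (real n)))"
 unfolding dens_def by (simp add: im_mN_pr)

lemma dens_pos: "dens n E > 0"
 unfolding dens_def using im_mN_real[of "real n" E] den_nonzero[of "real n" "of_real E"] by simp

lemma pr_sq_pos: "0 < amp E (real n)"
 using dens_pos[of n E] unfolding dens_eq zero_less_divide_1_iff by (rule zero_less_mult_pos[OF _ pi_gt_zero])

lemma dens_continuous: "continuous_on UNIV (dens n)"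
 unfolding dens_def
 by (intro continuous_intros continuous_on_compose2[OF mN_continuous(1)]) auto

lemma dens_integrable: assumes f: "test_fun f" shows "integrable lborel (\<lambda>x. f x * dens n x)"
proof -
 obtain R where R: "R > 0" "\<And>x. \<bar>x\<bar> \<ge> R \<Longrightarrow> f x = 0" using test_fun_support[OF f] by blast
 have fc: "continuous_on UNIV f" using f by (simp add: test_fun_def)
 have "integrable lborel (\<lambda>x. f x * Im (mN (real n) (Complex x 0)))"
  by (rule im_G_eq(1)[where S = R, OF _ fc R(2)]) auto
 then have "integrable lborel (\<lambda>x. f x * Im (mN (real n) (Complex x 0)) / pi)" by (rule integrable_divide)
 then show ?thesis unfolding dens_def complex_of_real_def by simp
qed

lemma smooth_limit:
 assumes g: "smooth_test_fun g"
 obtains L where "((\<lambda>\<epsilon>. \<integral>x. g x * (Im (mlim (Complex x \<epsilon>)) / pi) \<partial>lborel) \<longlongrightarrow> L) (at_right 0)"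
  "(\<lambda>n. pairing n g) \<longlonglongrightarrow> L"
proof -
 obtain L where L: "((\<lambda>\<epsilon>. \<integral>x. g x * Im (mlim (Complex x \<epsilon>)) \<partial>lborel) \<longlongrightarrow> L) (at_right 0)"
   "(\<lambda>n. \<integral>x. g x * Im (mN (real n) (of_real x)) \<partial>lborel) \<longlonglongrightarrow> L"
  using smooth_test_limit[OF g] by blast
 have "((\<lambda>\<epsilon>. (\<integral>x. g x * Im (mlim (Complex x \<epsilon>)) \<partial>lborel) / pi) \<longlongrightarrow> L / pi) (at_right 0)"
   "(\<lambda>n. (\<integral>x. g x * Im (mN (real n) (of_real x)) \<partial>lborel) / pi) \<longlonglongrightarrow> L / pi"
  by (intro tendsto_intros L; simp)+
 then show ?thesis using that[of "L / pi"] by (simp add: dens_def)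
qed

text \<open>\<open>f\<close> is at most a smooth test function plus a bump, and the integrals of
  both converge.\<close>

lemma dens_bounded:
 assumes f: "test_fun f" shows "bdd_above (range (\<lambda>n. pairing n f))"
proof -
 obtain r where r: "r > 0" "\<And>\<eta>. \<eta> > 0 \<Longrightarrow> \<exists>g. smooth_test_fun g \<and> (\<forall>x. \<bar>f x - g x\<bar> \<le> \<eta> * bump 0 r x)"
  using test_fun_approx[OF f] by blast
 obtain g where g: "smooth_test_fun g" "\<And>x. \<bar>f x - g x\<bar> \<le> bump 0 r x" using r(2)[of 1] by auto
 have b: "smooth_test_fun (bump 0 r)" by (rule smooth_test_fun_bump[OF r(1)])
 obtain L1 where L1: "(\<lambda>n. pairing n g) \<longlonglongrightarrow> L1" using smooth_limit[OF g(1)] by blast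
 obtain L2 where L2: "(\<lambda>n. pairing n (bump 0 r)) \<longlonglongrightarrow> L2" using smooth_limit[OF b] by blast
 have "Bseq (\<lambda>n. (pairing n g) + (pairing n (bump 0 r)))"
  by (rule convergent_imp_Bseq, rule convergentI, rule tendsto_add[OF L1 L2])
 then obtain B where B: "\<And>n. \<bar>(pairing n g) + (pairing n (bump 0 r))\<bar> \<le> B"
  unfolding Bseq_def by auto
 have "(pairing n f) \<le> B" for n
 proof -
  note i = dens_integrable[OF smooth_test_fun_imp_test_fun[OF g(1)], of n] dens_integrable[OF smooth_test_fun_imp_test_fun[OF b], of n]
  have "(pairing n f) \<le> (\<integral>x. g x * dens n x + bump 0 r x * dens n x \<partial>lborel)"
  proof (rule integral_mono[OF dens_integrable[OF f] Bochner_Integration.integrable_add[OF i]])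
   fix x
   have "f x \<le> g x + bump 0 r x" using g(2)[of x] by linarith
   then have "f x * dens n x \<le> (g x + bump 0 r x) * dens n x" using dens_pos[of n x] by (intro mult_right_mono) auto
   then show "f x * dens n x \<le> g x * dens n x + bump 0 r x * dens n x" by (simp only: distrib_right)
  qed
  also have "\<dots> = (pairing n g) + (pairing n (bump 0 r))"
   by (rule Bochner_Integration.integral_add[OF i])
  also have "\<dots> \<le> B" using B[of n] by linarith
  finally show ?thesis .
 qed
 then show ?thesis by (intro bdd_aboveI[of _ B]) auto
qed

text \<open>Set to 0 for heights outside \<open>(0, 1]\<close>, the range treated by
  \<open>mN_tendsto\<close>, so that nonnegativity holds for every index.\<close>

definition "mdens \<epsilon> x = (if 0 < \<epsilon> \<and> \<epsilon> \<le> 1 then Im (mlim (Complex x \<epsilon>)) / pi else 0)"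

lemma mdens_nonneg: "mdens \<epsilon> x \<ge> 0"
proof (cases "0 < \<epsilon> \<and> \<epsilon> \<le> 1")
 case True
 have l1: "(\<lambda>n. Im (mN (real n) (Complex x \<epsilon>))) \<longlonglongrightarrow> Im (mlim (Complex x \<epsilon>))"
  by (intro tendsto_intros mN_tendsto) (use True in auto)
 have l2: "Im (mN (real n) (Complex x \<epsilon>)) \<ge> 0" for n
 proof -
  have "energy (ucomb (mN (real n) (Complex x \<epsilon>)) (Complex x \<epsilon>)) (real n) \<ge> 0"
   by (rule Henstock_Kurzweil_Integration.integral_nonneg[OF norm_square_integrable(1)[OF ucomb_sol]]) auto
  then show ?thesis using im_mN[of "real n" "Complex x \<epsilon>"] True by simp
 qed
 have "Im (mlim (Complex x \<epsilon>)) \<ge> 0" by (rule LIMSEQ_le_const[OF l1]) (use l2 in auto)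
 then show ?thesis using True by (simp add: mdens_def)
qed (auto simp: mdens_def)

lemma mdens_integrable:
 assumes \<epsilon>: "\<epsilon> \<in> {0<..<1}" and f: "test_fun f" shows "integrable lborel (\<lambda>x. f x * mdens \<epsilon> x)"
proof -
 have "integrable lborel (\<lambda>x. f x * Im (mlim (Complex x \<epsilon>)) / pi)"
  by (intro integrable_divide mlim_integral(1) f) (use \<epsilon> in auto)
 then show ?thesis using \<epsilon> by (simp add: mdens_def)
qed

text \<open>Compactness provides a limit along a subsequence. Against smooth test functions the
  whole sequence converges, and the m-functions at height \<open>\<epsilon>\<close> have the same
  limit. So this measure is the limit of \<open>dens\<close> and satisfies the description in
  \<open>spectral_measure\<close>, whose uniqueness is \<open>radon_unique\<close>.\<close>

lemma spectral_measure_limit: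
 assumes qV: "\<And>x. x > 0 \<Longrightarrow> q x = V x"
 obtains \<mu> where "radon \<mu>" "spectral_measure V \<theta> = \<mu>"
  "\<And>f. test_fun f \<Longrightarrow> (\<lambda>n. pairing n f) \<longlonglongrightarrow> (\<integral>x. f x \<partial>\<mu>)"
proof -
 obtain \<mu> r where \<mu>: "radon \<mu>" and r: "strict_mono (r :: nat \<Rightarrow> nat)"
  and lr: "\<And>f. test_fun f \<Longrightarrow> (\<lambda>n. pairing (r n) f) \<longlonglongrightarrow> (\<integral>x. f x \<partial>\<mu>)"
  using vague_subsequence[of dens, OF dens_pos dens_continuous dens_integrable dens_bounded] by blast
 have smooth: "((\<lambda>\<epsilon>. \<integral>x. g x * (Im (mlim (Complex x \<epsilon>)) / pi) \<partial>lborel) \<longlongrightarrow> (\<integral>x. g x \<partial>\<mu>)) (at_right 0) \<and>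
   (\<lambda>n. pairing n g) \<longlonglongrightarrow> (\<integral>x. g x \<partial>\<mu>)" if g: "smooth_test_fun g" for g
 proof -
  obtain L where L: "((\<lambda>\<epsilon>. \<integral>x. g x * (Im (mlim (Complex x \<epsilon>)) / pi) \<partial>lborel) \<longlongrightarrow> L) (at_right 0)"
   "(\<lambda>n. pairing n g) \<longlonglongrightarrow> L" using smooth_limit[OF g] by blast
  have "(\<lambda>n. pairing (r n) g) \<longlonglongrightarrow> L" using LIMSEQ_subseq_LIMSEQ[OF L(2) r] by (simp add: o_def)
  then have "L = (\<integral>x. g x \<partial>\<mu>)" using lr[OF smooth_test_fun_imp_test_fun[OF g]] LIMSEQ_unique by blast
  then show ?thesis using L by simp
 qed
 have ev: "eventually (\<lambda>\<epsilon>. \<epsilon> \<in> {0<..<1}) (at_right (0::real))" by (rule eventually_at_right_real) simp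
 have full: "(\<lambda>n. pairing n f) \<longlonglongrightarrow> (\<integral>x. f x \<partial>\<mu>)" if "test_fun f" for f
  by (rule vague_limit_extend[where P = "\<lambda>_. True", OF \<mu> less_imp_le[OF dens_pos] dens_integrable always_eventually _ that]) (use smooth in auto)
 have md: "((\<lambda>\<epsilon>. \<integral>x. f x * mdens \<epsilon> x \<partial>lborel) \<longlongrightarrow> (\<integral>x. f x \<partial>\<mu>)) (at_right 0)" if "test_fun f" for f
 proof (rule vague_limit_extend[OF \<mu> mdens_nonneg mdens_integrable ev _ that])
  fix g assume g: "smooth_test_fun g"
  have "eventually (\<lambda>\<epsilon>. (\<integral>x. g x * (Im (mlim (Complex x \<epsilon>)) / pi) \<partial>lborel) = (\<integral>x. g x * mdens \<epsilon> x \<partial>lborel)) (at_right 0)"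
   using ev by eventually_elim (simp add: mdens_def)
  then show "((\<lambda>\<epsilon>. \<integral>x. g x * mdens \<epsilon> x \<partial>lborel) \<longlongrightarrow> (\<integral>x. g x \<partial>\<mu>)) (at_right 0)"
   using smooth[OF g] by (blast intro: Lim_transform_eventually)
 qed
 let ?h = "\<lambda>\<epsilon> x. Im (weyl_m V \<theta> (Complex x \<epsilon>)) / pi"
 have wl: "weak_limit_of_densities ?h \<mu>"
  unfolding weak_limit_of_densities_def test_fun_def[symmetric]
 proof (intro conjI allI impI)
  show "sets \<mu> = sets borel" using \<mu> by (simp add: radon_def)
  fix f assume f: "test_fun f"
  show "integrable \<mu> f" using \<mu> f by (simp add: radon_def)
  have "eventually (\<lambda>\<epsilon>. (\<integral>x. f x * mdens \<epsilon> x \<partial>lborel) = (\<integral>x. f x * ?h \<epsilon> x \<partial>lborel)) (at_right 0)"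
   using ev
  proof eventually_elim
   case (elim \<epsilon>)
   have "weyl_m V \<theta> (Complex x \<epsilon>) = mlim (Complex x \<epsilon>)" for x
    by (rule weyl_m_eq_mlim[OF _ _ qV]) (use elim in auto)
   then show ?case using elim by (simp add: mdens_def)
  qed
  then show "((\<lambda>\<epsilon>. \<integral>x. f x * ?h \<epsilon> x \<partial>lborel) \<longlongrightarrow> (\<integral>x. f x \<partial>\<mu>)) (at_right 0)"
   using md[OF f] by (blast intro: Lim_transform_eventually)
 qed
 have "spectral_measure V \<theta> = \<mu>"
  unfolding spectral_measure_def
 proof (rule the_equality)
  show "weak_limit_of_densities ?h \<mu>" by (rule wl)
  fix \<nu> assume w: "weak_limit_of_densities ?h \<nu>"
  show "\<nu> = \<mu>"
  proof (rule radon_unique[OF _ \<mu>])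
   show "radon \<nu>" using w unfolding radon_def weak_limit_of_densities_def test_fun_def by blast
   fix f assume f: "test_fun f"
   have "((\<lambda>\<epsilon>. \<integral>x. f x * ?h \<epsilon> x \<partial>lborel) \<longlongrightarrow> (\<integral>x. f x \<partial>\<nu>)) (at_right 0)"
     "((\<lambda>\<epsilon>. \<integral>x. f x * ?h \<epsilon> x \<partial>lborel) \<longlongrightarrow> (\<integral>x. f x \<partial>\<mu>)) (at_right 0)"
    using w wl f unfolding weak_limit_of_densities_def test_fun_def[symmetric] by blast+
   then show "(\<integral>x. f x \<partial>\<nu>) = (\<integral>x. f x \<partial>\<mu>)" by (rule tendsto_unique[OF trivial_limit_at_right_real])
  qed
 qed
 then show ?thesis using that \<mu> full by blast
qed

section \<open>The spectral measure at negative and at positive energies\<close>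

context
 fixes \<mu> :: "real measure"
 assumes \<mu>: "radon \<mu>"
  and lim: "\<And>f. test_fun f \<Longrightarrow> (\<lambda>n. pairing n f) \<longlonglongrightarrow> (\<integral>x. f x \<partial>\<mu>)"
begin

text \<open>Positivity of \<open>pg\<close> at \<open>x0\<close> persists for nearby energies, so
  there \<open>amp\<close> grows at least linearly and the densities are of order
  \<open>1 / n\<close>.\<close>

lemma null_near_growing:
 assumes X: "X \<ge> 0" and \<delta>: "0 < \<delta>" "\<delta> \<le> 1" and ell: "\<And>x E. x \<ge> X \<Longrightarrow> E \<le> b \<Longrightarrow> q x - E \<ge> \<delta>"
  and E0: "E0 < b" and x0: "x0 \<ge> X" "pg E0 x0 > 0"
 obtains U where "open U" "E0 \<in> U" "emeasure \<mu> U = 0"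
proof -
 define c where "c = pg E0 x0 / 2"
 have c: "c > 0" using x0 by (simp add: c_def)
 have "continuous_on UNIV (\<lambda>E. pg E x0)" unfolding pg_def using X x0 by (intro continuous_intros pr_E_continuous) auto
 then have "open {E. c < pg E x0}" by (intro open_Collect_less) auto
 then have "open ({E. c < pg E x0} \<inter> {..<b})" by auto
 moreover have "E0 \<in> {E. c < pg E x0} \<inter> {..<b}" using x0 E0 by (simp add: c_def)
 ultimately obtain r where r: "r > 0" "ball E0 r \<subseteq> {E. c < pg E x0} \<inter> {..<b}" by (meson openE)
 have near: "c \<le> pg E x0 \<and> E \<le> b" if "\<bar>E - E0\<bar> < r" for E
  using r(2) that by (auto simp: dist_real_def abs_minus_commute subset_iff)
 let ?B = "bump E0 r"
 have tf: "test_fun ?B" by (rule smooth_test_fun_imp_test_fun[OF smooth_test_fun_bump[OF r(1)]])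
 have Bi: "integrable lborel ?B"
  by (rule test_fun_integrable[OF tf])
 have up: "(pairing n ?B) \<le> (\<integral>x. ?B x \<partial>lborel) / (pi * (2 * c * (real n - x0)))" if n: "real n > x0" for n
 proof -
  have pos: "0 < pi * (2 * c * (real n - x0))" using c n by simp
  have "(pairing n ?B) \<le> (\<integral>x. ?B x / (pi * (2 * c * (real n - x0))) \<partial>lborel)"
  proof (rule integral_mono[OF dens_integrable[OF tf] integrable_divide[OF Bi]])
   fix E
   show "?B E * dens n E \<le> ?B E / (pi * (2 * c * (real n - x0)))"
   proof (cases "\<bar>E - E0\<bar> < r")
    case True
    have "2 * c * (real n - x0) \<le> amp E (real n)"
     by (rule pr_grows[OF X \<delta> ell]) (use near[OF True] x0 n in auto)
    then have "dens n E \<le> 1 / (pi * (2 * c * (real n - x0)))" unfolding dens_eq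
     by (intro divide_left_mono mult_left_mono mult_pos_pos pi_gt_zero) (use pr_sq_pos pos c n in auto)
    then have "?B E * dens n E \<le> ?B E * (1 / (pi * (2 * c * (real n - x0))))" by (rule mult_left_mono[OF _ bump_nonneg])
    then show ?thesis by (simp only: times_divide_eq_right mult_1_right)
   qed (use bump_zero[OF r(1)] in simp)
  qed
  then show ?thesis by simp
 qed
 have "(\<lambda>n. (\<integral>x. ?B x \<partial>lborel) / (pi * (2 * c * (real n - x0)))) \<longlonglongrightarrow> 0"
 proof -
  have "(\<lambda>n. 1 / (real n - x0)) \<longlonglongrightarrow> 0" by real_asymp
  from tendsto_mult[OF tendsto_const this, of "(\<integral>x. ?B x \<partial>lborel) / (pi * (2 * c))"] show ?thesis
   by (simp add: mult.assoc)
 qed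
 moreover have "eventually (\<lambda>n. (pairing n ?B) \<le> (\<integral>x. ?B x \<partial>lborel) / (pi * (2 * c * (real n - x0)))) sequentially"
 proof -
  obtain m :: nat where "x0 < real m" using reals_Archimedean2 by blast
  then show ?thesis unfolding eventually_sequentially by (intro exI[of _ m] allI impI up) linarith
 qed
 ultimately have "(\<integral>x. ?B x \<partial>\<mu>) \<le> 0" by (intro tendsto_le[OF sequentially_bot _ lim[OF tf]])
 then have "(\<integral>x. ?B x \<partial>\<mu>) = 0" using Bochner_Integration.integral_nonneg[of \<mu> ?B, OF bump_nonneg] by linarith
 moreover have "integrable \<mu> ?B" using \<mu> tf by (simp add: radon_def)
 ultimately have "AE x in \<mu>. ?B x = 0" by (subst (asm) integral_nonneg_eq_0_iff_AE) (auto simp: bump_nonneg)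
 then have "AE x in \<mu>. x \<notin> ball E0 r"
 proof eventually_elim
  case (elim E)
  then show ?case using bump_pos[of E E0 r] by (auto simp: dist_real_def abs_minus_commute)
 qed
 moreover have "ball E0 r \<in> sets \<mu>" using \<mu> by (simp add: radon_def)
 ultimately have "emeasure \<mu> (ball E0 r) = 0" by (metis AE_iff_null_sets null_setsD1)
 then show ?thesis using that[of "ball E0 r"] r by simp
qed

text \<open>As \<open>q\<close> tends to 0, beyond \<open>X k\<close> it exceeds all energies below
  \<open>b k\<close> by at least \<open>\<delta> k\<close>. The candidates are countable for each
  \<open>k\<close>; every other negative energy has a neighbourhood of measure 0, and by Lindeloef
  countably many of these suffice.\<close>

lemma negative_part:
 assumes q0: "(q \<longlongrightarrow> 0) at_top"
 obtains Z where "Z \<in> null_sets lborel" "emeasure \<mu> ({..<0} - Z) = 0"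
proof -
 have "\<exists>X\<ge>0. \<forall>x\<ge>X. \<bar>q x\<bar> < 1 / (2 * real (Suc k))" for k
 proof -
  have "eventually (\<lambda>x. dist (q x) 0 < 1 / (2 * real (Suc k))) at_top" by (rule tendstoD[OF q0]) simp
  then obtain X where "\<And>x. x \<ge> X \<Longrightarrow> \<bar>q x\<bar> < 1 / (2 * real (Suc k))" by (auto simp: eventually_at_top_linorder)
  then show ?thesis by (intro exI[of _ "max 0 X"]) auto
 qed
 then obtain X where X: "\<And>k. X k \<ge> 0" "\<And>k x. x \<ge> X k \<Longrightarrow> \<bar>q x\<bar> < 1 / (2 * real (Suc k))" by metis
 \<comment> \<open>Half of the distance from \<open>b k\<close> to 0 is spent on the size of
   \<open>q\<close>, the other half is \<open>\<delta> k\<close>.\<close>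
 define b where "b k = - (1 / real (Suc k))" for k
 define \<delta> where "\<delta> k = 1 / (2 * real (Suc k))" for k
 have \<delta>: "0 < \<delta> k" "\<delta> k \<le> 1" for k by (simp_all add: \<delta>_def divide_le_eq)
 have ell: "q x - E \<ge> \<delta> k" if "x \<ge> X k" "E \<le> b k" for k x E
 proof -
  have "\<bar>q x\<bar> < \<delta> k" using X(2)[OF that(1)] by (simp only: \<delta>_def)
  moreover have "b k = - 2 * \<delta> k" by (simp add: b_def \<delta>_def field_simps)
  ultimately show ?thesis using that(2) by linarith
 qed
 define Zk where "Zk k = {E. E \<le> b k \<and> (\<forall>x\<ge>X k. pg E x \<le> 0)}" for k
 have "countable (Zk k)" for k
 proof -
  have "countable (evs (X k) (b k))" by (rule evs_countable[OF X(1)[of k] \<delta>[of k]]) (rule ell)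
  then show ?thesis unfolding evs_def Zk_def .
 qed
 then have "countable (\<Union>k. Zk k)" by auto
 then have Z: "(\<Union>k. Zk k) \<in> null_sets lborel" by (rule countable_imp_null_set_lborel)
 define F where "F = {U. open U \<and> emeasure \<mu> U = 0}"
 obtain F' where F': "F' \<subseteq> F" "countable F'" "\<Union>F' = \<Union>F" by (rule Lindelof[of F]) (auto simp: F_def)
 have "{..<0} - (\<Union>k. Zk k) \<subseteq> \<Union>F'"
 proof
  fix E assume E: "E \<in> {..<0} - (\<Union>k. Zk k)"
  then obtain k where "1 / real (Suc k) < - E" using reals_Archimedean[of "- E"] by (auto simp: inverse_eq_divide)
  then have Eb: "E < b k" by (simp add: b_def)
  have "E \<notin> Zk k" using E by blast
  with Eb obtain x where "x \<ge> X k" "pg E x > 0" by (auto simp: Zk_def not_le)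
  then obtain U where "open U" "E \<in> U" "emeasure \<mu> U = 0" using null_near_growing[OF X(1) \<delta> ell Eb] by blast
  then show "E \<in> \<Union>F'" unfolding F' F_def by blast
 qed
 moreover have N: "\<Union>F' \<in> null_sets \<mu>"
 proof -
  have "(\<Union>U\<in>F'. U) \<in> null_sets \<mu>"
   by (rule null_sets_UN'[OF F'(2)]) (use F'(1) \<mu> in \<open>auto simp: F_def null_sets_def radon_def\<close>)
  then show ?thesis by simp
 qed
 ultimately have "emeasure \<mu> ({..<0} - (\<Union>k. Zk k)) \<le> emeasure \<mu> (\<Union>F')" by (intro emeasure_mono null_setsD2[OF N])
 then have "emeasure \<mu> ({..<0} - (\<Union>k. Zk k)) = 0" using null_setsD1[OF N] by simp
 then show ?thesis using that Z by blast
qed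

text \<open>On \<open>F\<close> the densities are at least \<open>1 / (2 * pi * C^2)\<close> for
  every \<open>n\<close>. The estimate is made for \<open>plateau\<close> functions, which lie above
  the indicator of \<open>F\<close>, and survives both limits.\<close>

lemma measure_bounded_below:
 assumes F: "compact F" "F \<noteq> {}" and C: "C > 0"
  and K: "\<And>E x. E \<in> F \<Longrightarrow> 0 \<le> x \<Longrightarrow> norm (phi (of_real E) x) \<le> C \<and> norm (dphi (of_real E) x) \<le> C"
 shows "measure lborel F / (pi * (2 * C\<^sup>2)) \<le> measure \<mu> F"
proof -
 have Fi: "integrable lborel (\<lambda>x. indicat_real F x / (pi * (2 * C\<^sup>2)))"
  using F(1) by (intro integrable_divide integrable_real_indicator borel_compact emeasure_bounded_finite compact_imp_bounded) (auto simp: borel_compact)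
 have I: "(\<integral>x. indicat_real F x / (pi * (2 * C\<^sup>2)) \<partial>lborel) = measure lborel F / (pi * (2 * C\<^sup>2))" by simp
 have low: "measure lborel F / (pi * (2 * C\<^sup>2)) \<le> (pairing n (plateau F (Suc j)))" for j n
  unfolding I[symmetric]
 proof (rule integral_mono[OF Fi dens_integrable[OF plateau_test_fun[OF F]]])
  fix E
  show "indicat_real F E / (pi * (2 * C\<^sup>2)) \<le> plateau F (Suc j) E * dens n E"
  proof (cases "E \<in> F")
   case True
   have "\<bar>pr E (real n)\<bar> \<le> C" "\<bar>dpr E (real n)\<bar> \<le> C"
    using K[OF True, of "real n"] phi_eq_pr[of "real n" E] by simp_all
   then have "(pr E (real n))\<^sup>2 \<le> C\<^sup>2" "(dpr E (real n))\<^sup>2 \<le> C\<^sup>2" using C by (simp_all add: abs_le_square_iff[symmetric])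
   then have le: "amp E (real n) \<le> 2 * C\<^sup>2" by linarith
   have "1 / (pi * (2 * C\<^sup>2)) \<le> dens n E" unfolding dens_eq using le C
    by (intro divide_left_mono mult_left_mono mult_pos_pos pr_sq_pos) auto
   then show ?thesis using True by (simp add: plateau_bounds)
  qed (use plateau_bounds(1)[of F "Suc j" E] dens_pos[of n E] in simp)
 qed simp
 have "measure lborel F / (pi * (2 * C\<^sup>2)) \<le> (\<integral>x. plateau F (Suc j) x \<partial>\<mu>)" for j
  by (rule LIMSEQ_le_const[OF lim[OF plateau_test_fun[OF F]]]) (use low in auto)
 then show ?thesis by (intro LIMSEQ_le_const[OF radon_compact(2)[OF \<mu> F]]) auto
qed

text \<open>The energies with a common bound form closed sets \<open>Kn n\<close>, which cover
  almost all of the positive half-line. Compact subsets of \<open>A\<close> inside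
  \<open>Kn n\<close> are null by the lower bound, and inner regularity of Lebesgue measure passes
  this to \<open>A\<close>.\<close>

lemma positive_part:
 assumes bdd: "AE E in lborel. E > 0 \<longrightarrow> (\<exists>C. \<forall>x\<ge>0. norm (phi (of_real E) x) \<le> C \<and> norm (dphi (of_real E) x) \<le> C)"
  and A: "A \<in> sets borel" "A \<subseteq> {0..}" "emeasure \<mu> A = 0"
 shows "A \<in> null_sets lborel"
proof -
 define Kn where "Kn n = {E. \<forall>x\<ge>0. norm (phi (of_real E) x) \<le> real (Suc n) \<and> norm (dphi (of_real E) x) \<le> real (Suc n)}" for n
 have Kc: "closed (Kn n)" for n
 proof -
  have "Kn n = (\<Inter>x\<in>{0..}. {E. \<bar>pr E x\<bar> \<le> real (Suc n)} \<inter> {E. \<bar>dpr E x\<bar> \<le> real (Suc n)})"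
   by (auto simp: Kn_def phi_eq_pr)
  moreover have "closed {E. \<bar>pr E x\<bar> \<le> real (Suc n)}" "closed {E. \<bar>dpr E x\<bar> \<le> real (Suc n)}" if "x \<in> {0..}" for x
   using that by (intro closed_Collect_le continuous_intros pr_E_continuous; simp)+
  ultimately show ?thesis by (auto intro!: closed_INT closed_Int)
 qed
 have cmp: "emeasure lborel F = 0" if F: "compact F" "F \<subseteq> A \<inter> Kn n" for F n
 proof (cases "F = {}")
  case False
  have Fs: "F \<in> sets borel" using F(1) by (rule borel_compact)
  have "emeasure \<mu> F \<le> emeasure \<mu> A" using F(2) A(1) \<mu> by (intro emeasure_mono) (auto simp: radon_def)
  then have "measure \<mu> F = 0" using A(3) by (simp add: measure_def)
  moreover have "measure lborel F / (pi * (2 * (real (Suc n))\<^sup>2)) \<le> measure \<mu> F"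
   by (rule measure_bounded_below[OF F(1) False]) (use F(2) in \<open>auto simp: Kn_def\<close>)
  ultimately have "measure lborel F / (pi * (2 * (real (Suc n))\<^sup>2)) \<le> 0" by linarith
  moreover have "0 < pi * (2 * (real (Suc n))\<^sup>2)" by simp
  ultimately have "measure lborel F \<le> 0 * (pi * (2 * (real (Suc n))\<^sup>2))" by (simp only: pos_divide_le_eq)
  then have M0: "measure lborel F = 0" using measure_nonneg[of lborel F] by linarith
  have "emeasure lborel F \<noteq> \<infinity>" using emeasure_bounded_finite[OF compact_imp_bounded[OF F(1)]] by auto
  then show ?thesis using M0 by (simp add: emeasure_eq_ennreal_measure)
 qed simp
 have AK: "A \<inter> Kn n \<in> null_sets lborel" for n
 proof -
  have S: "A \<inter> Kn n \<in> sets borel" using A(1) Kc[of n] by auto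
  have small: "emeasure lborel (A \<inter> Kn n) \<le> ennreal e" if e: "e > 0" for e
  proof -
   have "A \<inter> Kn n \<in> sets lebesgue" using S by auto
   then obtain T where T: "closed T" "T \<subseteq> A \<inter> Kn n" "emeasure lebesgue (A \<inter> Kn n - T) < ennreal e"
    using sets_lebesgue_inner_closed[OF _ e] by metis
   have Ts: "T \<in> sets borel" using T(1) by auto
   have "T \<inter> {- real m..real m} \<in> null_sets lborel" for m
   proof -
    have "compact (T \<inter> {- real m..real m})" using T(1) by (intro closed_Int_compact) auto
    then have "emeasure lborel (T \<inter> {- real m..real m}) = 0" by (rule cmp[where n = n]) (use T(2) in auto)
    then show ?thesis using Ts by (auto simp: null_sets_def)
   qed
   then have "(\<Union>m. T \<inter> {- real m..real m}) \<in> null_sets lborel" by (intro null_sets_UN)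
   moreover have "(\<Union>m. T \<inter> {- real m..real m}) = T"
   proof (intro equalityI subsetI)
    fix x assume x: "x \<in> T"
    obtain m :: nat where "\<bar>x\<bar> \<le> real m" using real_arch_simple by blast
    then have "x \<in> T \<inter> {- real m..real m}" using x by auto
    then show "x \<in> (\<Union>m. T \<inter> {- real m..real m})" by blast
   qed auto
   ultimately have T0: "T \<in> null_sets lborel" by simp
   have "emeasure lborel (A \<inter> Kn n) = emeasure lborel (A \<inter> Kn n - T)"
    by (rule emeasure_Diff_null_set[OF T0, symmetric]) (use S in simp)
   also have "\<dots> = emeasure lebesgue (A \<inter> Kn n - T)" using S Ts by (subst emeasure_completion) (auto simp: main_part_sets)
   also have "\<dots> \<le> ennreal e" using T(3) by simp
   finally show ?thesis .
  qed
  have "emeasure lborel (A \<inter> Kn n) \<le> 0"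
  proof (rule ennreal_le_epsilon)
   show "emeasure lborel (A \<inter> Kn n) \<le> 0 + ennreal e" if "0 < e" for e using small[OF that] by (simp only: add_0_left)
  qed
  then show ?thesis using S by (simp add: null_sets_def)
 qed
 define Q where "Q E \<longleftrightarrow> (\<exists>C. \<forall>x\<ge>0. norm (phi (of_real E) x) \<le> C \<and> norm (dphi (of_real E) x) \<le> C)" for E
 have "AE E in lborel. E > 0 \<longrightarrow> Q E" using bdd unfolding Q_def .
 then obtain N where N: "{E \<in> space lborel. \<not> (E > 0 \<longrightarrow> Q E)} \<subseteq> N"
  "emeasure lborel N = 0" "N \<in> sets lborel" by (rule AE_E)
 have N0: "N \<in> null_sets lborel" using N(2,3) by (rule null_setsI)
 have "A \<subseteq> (N \<union> {0}) \<union> (\<Union>n. A \<inter> Kn n)"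
 proof
  fix E assume E: "E \<in> A"
  show "E \<in> (N \<union> {0}) \<union> (\<Union>n. A \<inter> Kn n)"
  proof (cases "E \<in> N \<union> {0}")
   case False
   then have "E > 0" using E A(2) by auto
   then have "Q E" using False N(1) by auto
   then obtain C where C: "\<forall>x\<ge>0. norm (phi (of_real E) x) \<le> C \<and> norm (dphi (of_real E) x) \<le> C" unfolding Q_def by blast
   obtain n :: nat where "C \<le> real n" using real_arch_simple by blast
   then have "C \<le> real (Suc n)" by simp
   then have "E \<in> Kn n" unfolding Kn_def using C order_trans by blast
   then show ?thesis using E by blast
  qed blast
 qed
 moreover have "(N \<union> {0}) \<union> (\<Union>n. A \<inter> Kn n) \<in> null_sets lborel"
  by (intro null_sets.Un null_sets_UN N0 AK countable_imp_null_set_lborel) simp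
 ultimately show ?thesis by (rule null_sets_subset[rotated 2]) (use A(1) in simp)
qed

end

theorem ac_spectrum:
 assumes qV: "\<And>x. x > 0 \<Longrightarrow> q x = V x" and q0: "(q \<longlongrightarrow> 0) at_top"
  and bdd: "AE E in lborel. E > 0 \<longrightarrow> (\<exists>C. \<forall>x\<ge>0. norm (phi (of_real E) x) \<le> C \<and> norm (dphi (of_real E) x) \<le> C)"
 shows "ac_essential_support V \<theta> {0..}"
proof -
 obtain \<mu> where \<mu>: "radon \<mu>" and sm: "spectral_measure V \<theta> = \<mu>"
  and lim: "\<And>f. test_fun f \<Longrightarrow> (\<lambda>n. pairing n f) \<longlonglongrightarrow> (\<integral>x. f x \<partial>\<mu>)"
  using spectral_measure_limit[OF qV] by blast
 obtain Z where Z: "Z \<in> null_sets lborel" "emeasure \<mu> ({..<0} - Z) = 0" using negative_part[OF \<mu> lim q0] by blast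
 show ?thesis by (rule ac_essential_support_criterion[OF sm \<mu> Z positive_part[OF \<mu> lim bdd]])
qed

end

section \<open>Oscillatory potentials of bounded variation\<close>

text \<open>Real-valued, so that differences can be formed, whereas \<open>variation\<close> lives
  in \<open>ennreal\<close>.\<close>

definition partition_sum :: "(real \<Rightarrow> complex) \<Rightarrow> nat \<Rightarrow> (nat \<Rightarrow> real) \<Rightarrow> real" where
 "partition_sum g k p = (\<Sum>j=1..k. norm (g (p j) - g (p (j - 1))))"

definition is_partition :: "real set \<Rightarrow> nat \<Rightarrow> (nat \<Rightarrow> real) \<Rightarrow> bool" where
 "is_partition I k p \<longleftrightarrow> strict_mono_on {0..k} p \<and> p ` {0..k} \<subseteq> I"

lemma partition_sum_nonneg: "partition_sum g k p \<ge> 0"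
 by (simp add: partition_sum_def sum_nonneg)

lemma variation_eq: "variation g I = (SUP k. SUP p\<in>{p. is_partition I k p}. ennreal (partition_sum g k p))"
 unfolding variation_def is_partition_def partition_sum_def by simp

lemma partition_sum_le_variation: "is_partition I k p \<Longrightarrow> ennreal (partition_sum g k p) \<le> variation g I"
 unfolding variation_eq by (rule SUP_upper2[of k]) (auto intro: SUP_upper2)

lemma variation_le:
 assumes "\<And>k p. is_partition I k p \<Longrightarrow> partition_sum g k p \<le> r" shows "variation g I \<le> ennreal r"
 unfolding variation_eq by (intro SUP_least ennreal_leI) (use assms in auto)

lemma variation_mono: "I \<subseteq> I' \<Longrightarrow> variation g I \<le> variation g I'"
proof -
 assume I: "I \<subseteq> I'"
 show ?thesis unfolding variation_eq
 proof (rule SUP_mono)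
  show "\<exists>m\<in>UNIV. (SUP p\<in>{p. is_partition I k p}. ennreal (partition_sum g k p)) \<le> (SUP p\<in>{p. is_partition I' m p}. ennreal (partition_sum g m p))" for k
   by (rule bexI[of _ k], rule SUP_subset_mono) (use I in \<open>auto simp: is_partition_def\<close>)
 qed
qed

lemma partition_append:
 assumes p: "is_partition I k p" and z: "p k < z" and I: "I \<subseteq> I'" "z \<in> I'"
 obtains p' where "is_partition I' (Suc k) p'" "p' (Suc k) = z" "partition_sum g (Suc k) p' = partition_sum g k p + norm (g z - g (p k))"
proof -
 define p' where "p' j = (if j \<le> k then p j else z)" for j
 have sm: "strict_mono_on {0..k} p" and r: "p ` {0..k} \<subseteq> I" using p by (auto simp: is_partition_def)
 have le: "p j \<le> p k" if "j \<le> k" for j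
  using strict_mono_onD[OF sm, of j k] that by (cases "j = k") (auto intro: less_imp_le)
 have "strict_mono_on {0..Suc k} p'"
 proof (rule strict_mono_onI)
  fix i j assume "i \<in> {0..Suc k}" "j \<in> {0..Suc k}" "i < j"
  then show "p' i < p' j"
   using strict_mono_onD[OF sm, of i j] le[of i] z by (cases "j \<le> k") (auto simp: p'_def)
 qed
 moreover have "p' ` {0..Suc k} \<subseteq> I'"
 proof (rule image_subsetI)
  fix j assume "j \<in> {0..Suc k}"
  show "p' j \<in> I'" using r I by (cases "j \<le> k") (auto simp: p'_def image_subset_iff subset_iff)
 qed
 moreover have "partition_sum g (Suc k) p' = partition_sum g k p + norm (g z - g (p k))"
 proof -
  have "(\<Sum>j=1..k. norm (g (p' j) - g (p' (j - 1)))) = (\<Sum>j=1..k. norm (g (p j) - g (p (j - 1))))"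
   by (rule sum.cong) (auto simp: p'_def)
  then show ?thesis by (simp add: partition_sum_def p'_def)
 qed
 ultimately show ?thesis using that[of p'] by (simp add: is_partition_def p'_def)
qed

text \<open>Behind the superadditivity of the variation: the point \<open>x\<close> is appended
  unless it is already the last one, and then \<open>y\<close>. Appending \<open>x\<close> cannot
  decrease the sum.\<close>

lemma partition_extend:
 assumes p: "is_partition {0<..x} k p" and xy: "0 < x" "x < y"
 obtains k' p' where "is_partition {0<..y} k' p'" "partition_sum g k p + norm (g y - g x) \<le> partition_sum g k' p'"
proof -
 have "p k \<in> p ` {0..k}" by (rule imageI) simp
 then have "p k \<in> {0<..x}" using p unfolding is_partition_def by blast
 then have pk: "p k \<le> x" by simp
 show ?thesis
 proof (cases "p k = x")
  case True
  show ?thesis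
   by (rule partition_append[OF p, of y "{0<..y}" g]) (use True xy that in auto)
 next
  case False
  obtain p1 where p1: "is_partition {0<..x} (Suc k) p1" "p1 (Suc k) = x" "partition_sum g (Suc k) p1 = partition_sum g k p + norm (g x - g (p k))"
   by (rule partition_append[OF p, of x "{0<..x}" g]) (use False pk xy in auto)
  obtain p2 where p2: "is_partition {0<..y} (Suc (Suc k)) p2" "partition_sum g (Suc (Suc k)) p2 = partition_sum g (Suc k) p1 + norm (g y - g (p1 (Suc k)))"
   by (rule partition_append[OF p1(1), of y "{0<..y}" g]) (use p1(2) xy in auto)
  show ?thesis by (rule that[OF p2(1)]) (simp add: p2(2) p1(2,3))
 qed
qed

locale oscillatory_potential =
 fixes V :: "real \<Rightarrow> real" and c :: "nat \<Rightarrow> complex" and \<phi> :: "nat \<Rightarrow> real"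
  and \<gamma> :: "nat \<Rightarrow> real \<Rightarrow> complex" and p :: nat and \<alpha> :: real
 assumes potential: "\<And>x. x > 0 \<Longrightarrow> (\<lambda>k. c k * exp (- \<i> * complex_of_real (\<phi> k * x)) * \<gamma> k x) sums complex_of_real (V x)"
  and bounded_variation: "(SUP k. variation (\<gamma> k) {0<..}) < \<infinity>"
  and p: "p \<ge> 2"
  and integrability: "(\<integral>\<^sup>+x\<in>{0<..}. (SUP k. ennreal (norm (\<gamma> k x))) ^ p \<partial>lborel) < \<infinity>"
  and \<alpha>: "\<alpha> \<in> {0<..<1 / (real p - 1)}"
  and c_powr: "summable (\<lambda>k. norm (c k) powr \<alpha>)"
begin

text \<open>The summand 1 secures \<open>C \<ge> 1\<close>, as \<open>bv_amplitudes\<close>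
  demands.\<close>

definition "C = 1 + enn2real (SUP k. variation (\<gamma> k) {0<..})"
definition "T k x = enn2real (variation (\<gamma> k) {0<..x})"

lemma C1: "C \<ge> 1" by (simp add: C_def)

lemma variation_less_top: "variation (\<gamma> k) {0<..x} < \<infinity>"
proof -
 have "variation (\<gamma> k) {0<..x} \<le> variation (\<gamma> k) {0<..}" by (rule variation_mono) auto
 also have "\<dots> \<le> (SUP k. variation (\<gamma> k) {0<..})" by (rule SUP_upper) simp
 finally show ?thesis using bounded_variation by (rule order_le_less_trans)
qed

lemma T_bounds: "0 \<le> T k x" "T k x \<le> C"
proof -
 have "variation (\<gamma> k) {0<..x} \<le> variation (\<gamma> k) {0<..}" by (rule variation_mono) auto
 also have "\<dots> \<le> (SUP k. variation (\<gamma> k) {0<..})" by (rule SUP_upper) simp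
 finally have "T k x \<le> enn2real (SUP k. variation (\<gamma> k) {0<..})"
  unfolding T_def using bounded_variation by (intro enn2real_mono) auto
 then show "T k x \<le> C" by (simp add: C_def)
qed (simp add: T_def)

lemma T_mono: assumes "x \<le> y" shows "T k x \<le> T k y"
proof -
 have "variation (\<gamma> k) {0<..x} \<le> variation (\<gamma> k) {0<..y}" by (rule variation_mono) (use assms in auto)
 then show ?thesis unfolding T_def using variation_less_top[of k y] by (intro enn2real_mono) auto
qed

text \<open>Every partition of \<open>(0, x]\<close> extends to one of \<open>(0, y]\<close> that
  gains the increment from \<open>x\<close> to \<open>y\<close>. The one-point partition supplies
  the nonnegativity under which \<open>ennreal\<close> can be left.\<close>

lemma T_var: assumes "0 < x" "x \<le> y" shows "norm (\<gamma> k y - \<gamma> k x) \<le> T k y - T k x"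
proof (cases "x = y")
 case False
 have le: "partition_sum (\<gamma> k) n P \<le> T k y - norm (\<gamma> k y - \<gamma> k x)" if P: "is_partition {0<..x} n P" for n P
 proof -
  obtain n' P' where P': "is_partition {0<..y} n' P'" "partition_sum (\<gamma> k) n P + norm (\<gamma> k y - \<gamma> k x) \<le> partition_sum (\<gamma> k) n' P'"
   by (rule partition_extend[OF P assms(1), of y "\<gamma> k"]) (use False assms in auto)
  have "partition_sum (\<gamma> k) n' P' = enn2real (ennreal (partition_sum (\<gamma> k) n' P'))"
   by (simp add: partition_sum_nonneg)
  also have "\<dots> \<le> T k y"
   unfolding T_def using variation_less_top[of k y] by (intro enn2real_mono partition_sum_le_variation[OF P'(1)]) auto
  finally show ?thesis using P'(2) by linarith
 qed
 have "is_partition {0<..x} 0 (\<lambda>_. x)" using assms by (auto simp: is_partition_def strict_mono_on_def)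
 from le[OF this] have "0 \<le> T k y - norm (\<gamma> k y - \<gamma> k x)" by (simp add: partition_sum_def)
 moreover have "variation (\<gamma> k) {0<..x} \<le> ennreal (T k y - norm (\<gamma> k y - \<gamma> k x))" by (rule variation_le[OF le])
 ultimately have "T k x \<le> T k y - norm (\<gamma> k y - \<gamma> k x)" unfolding T_def[of k x] by (intro enn2real_leI)
 then show ?thesis by linarith
qed simp

text \<open>Set to 0 off the positive half-line, so that integrals can be taken over the whole
  line.\<close>

definition "absg k x = (if x > 0 then norm (\<gamma> k x) else 0)"
definition "Gam x = (SUP k. ennreal (absg k x))"
definition "\<Gamma> x = enn2real (Gam x)"

lemma Gam_int: "(\<integral>\<^sup>+x. Gam x ^ p \<partial>lborel) < \<infinity>"
proof -
 have "Gam x ^ p = (SUP k. ennreal (norm (\<gamma> k x))) ^ p * indicator {0<..} x" for x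
  using p by (cases "x > 0") (simp_all add: Gam_def absg_def)
 then show ?thesis using integrability by simp
qed

lemma not_bounded_below:
 assumes e: "e > 0" and x: "x > 0" shows "\<not> (\<forall>y\<ge>x. norm (\<gamma> k y) \<ge> e)"
proof
 assume H: "\<forall>y\<ge>x. norm (\<gamma> k y) \<ge> e"
 have "(\<integral>\<^sup>+y. ennreal e ^ p * indicator {x..} y \<partial>lborel) \<le> (\<integral>\<^sup>+y. Gam y ^ p \<partial>lborel)"
 proof (rule nn_integral_mono)
  fix y
  have "ennreal e \<le> Gam y" if "y \<ge> x"
   unfolding Gam_def by (rule SUP_upper2[of k]) (use H that x in \<open>auto simp: absg_def\<close>)
  then show "ennreal e ^ p * indicator {x..} y \<le> Gam y ^ p" by (cases "y \<ge> x") (auto intro: power_mono)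
 qed
 moreover have "(\<integral>\<^sup>+y. ennreal e ^ p * indicator {x..} y \<partial>lborel) = \<infinity>"
 proof -
  have "emeasure lborel {x..} = \<infinity>"
  proof (rule ccontr)
   assume "\<not> ?thesis"
   then obtain n where n: "emeasure lborel {x..} < of_nat n" using ennreal_Ex_less_of_nat[of "emeasure lborel {x..}"] by (auto simp: less_top)
   have "emeasure lborel {x..x + real n} \<le> emeasure lborel {x..}" by (rule emeasure_mono) auto
   then show False using n by (simp add: ennreal_of_nat_eq_real_of_nat not_le[symmetric])
  qed
  then show ?thesis using e by (simp add: nn_integral_cmult_indicator ennreal_mult_top ennreal_power)
 qed
 ultimately show False using Gam_int by simp
qed

text \<open>Where the variation is nearly exhausted, \<open>\<gamma> k\<close> is nearly constant; a
  value of size \<open>e\<close> there would persist with size \<open>e / 2\<close>, against the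
  integrability of the \<open>p\<close>-th power.\<close>

lemma \<gamma>_lim: "(\<gamma> k \<longlongrightarrow> 0) at_top"
proof (rule tendstoI)
 fix e :: real assume e: "e > 0"
 define s where "s = (SUP x. T k x)"
 have bdd: "bdd_above (range (T k))" using T_bounds(2) by (intro bdd_aboveI[of _ C]) auto
 obtain X where X: "s - e / 2 < T k X" using less_cSUP_iff[OF _ bdd, of "s - e/2"] e unfolding s_def by auto
 have s: "T k y \<le> s" for y unfolding s_def by (rule cSUP_upper[OF _ bdd]) simp
 show "eventually (\<lambda>x. dist (\<gamma> k x) 0 < e) at_top"
  unfolding eventually_at_top_linorder
 proof (intro exI[of _ "max 1 X"] allI impI)
  fix x assume x: "x \<ge> max 1 X"
  show "dist (\<gamma> k x) 0 < e"
  proof (rule ccontr)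
   assume "\<not> ?thesis"
   then have nx: "norm (\<gamma> k x) \<ge> e" by simp
   have "norm (\<gamma> k y) \<ge> e / 2" if y: "y \<ge> x" for y
   proof -
    have "norm (\<gamma> k y - \<gamma> k x) \<le> T k y - T k x" by (rule T_var) (use x y in auto)
    also have "\<dots> \<le> e / 2" using s[of y] X T_mono[of X x k] x by simp
    finally show ?thesis using nx norm_triangle_ineq2[of "\<gamma> k x" "\<gamma> k y"] by (simp add: norm_minus_commute)
   qed
   then show False using not_bounded_below[of "e/2" x k] e x by auto
  qed
 qed
qed

text \<open>Comparison with a point tending to infinity, where \<open>\<gamma> k\<close> tends to 0,
  bounds the value by the variation alone.\<close>

lemma \<gamma>_bound: assumes x: "0 < x" shows "norm (\<gamma> k x) \<le> C"
proof -
 have "((\<lambda>y. norm (\<gamma> k y) + C) \<longlongrightarrow> norm (0::complex) + C) at_top" by (intro tendsto_intros \<gamma>_lim)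
 moreover have "eventually (\<lambda>y. norm (\<gamma> k x) \<le> norm (\<gamma> k y) + C) at_top"
  using eventually_ge_at_top[of x]
 proof eventually_elim
  case (elim y)
  have "norm (\<gamma> k y - \<gamma> k x) \<le> C" using T_var[OF x elim, of k] T_bounds(2)[of k y] T_bounds(1)[of k x] by linarith
  then show ?case using norm_triangle_ineq2[of "\<gamma> k x" "\<gamma> k y"] by (simp add: norm_minus_commute)
 qed
 ultimately have "norm (\<gamma> k x) \<le> norm (0::complex) + C" by (rule tendsto_lowerbound) simp
 then show ?thesis by simp
qed

sublocale bv_amplitudes \<gamma> T C
 by unfold_locales (rule C1 T_mono T_bounds T_var \<gamma>_bound \<gamma>_lim; assumption?)+

text \<open>A monotone function has countably many discontinuities, and on the positive half-line
  \<open>\<gamma> k\<close> is continuous wherever \<open>T k\<close> is. The point 0 is added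
  because \<open>q\<close> is cut off there.\<close>

definition "D = insert 0 (\<Union>k. {x. \<not> isCont (T k) x})"

lemma countable_D: "countable D"
 unfolding D_def by (intro countable_insert countable_UN mono_ctble_discont monoI T_mono) auto

lemma \<gamma>_cont: assumes x: "x > 0" "x \<notin> D" shows "isCont (\<gamma> k) x"
proof -
 have T: "isCont (T k) x" using x by (auto simp: D_def)
 have "((\<lambda>y. \<gamma> k y - \<gamma> k x) \<longlongrightarrow> 0) (at x)"
 proof (rule Lim_null_comparison)
  show "((\<lambda>y. \<bar>T k y - T k x\<bar>) \<longlongrightarrow> 0) (at x)"
   using T by (intro tendsto_rabs_zero) (simp add: isCont_def LIM_zero_iff)
  have "eventually (\<lambda>y. y \<in> {0<..}) (at x)" by (rule eventually_at_in_open') (use x in auto)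
  then show "eventually (\<lambda>y. norm (\<gamma> k y - \<gamma> k x) \<le> \<bar>T k y - T k x\<bar>) (at x)"
  proof eventually_elim
   case (elim y)
   then show ?case using T_var[of x y k] T_var[of y x k] x
    by (cases "x \<le> y") (auto simp: norm_minus_commute)
  qed
 qed
 then show ?thesis by (simp add: isCont_def LIM_zero_iff)
qed

lemma Gam_le: "Gam x \<le> ennreal C"
 unfolding Gam_def using \<gamma>_bound C1 by (intro SUP_least ennreal_leI) (auto simp: absg_def)

lemma Gam_eq: "Gam x = ennreal (\<Gamma> x)"
proof -
 have "Gam x < \<infinity>" by (rule order_le_less_trans[OF Gam_le]) simp
 then show ?thesis by (simp add: \<Gamma>_def)
qed

lemma \<Gamma>_props: "0 \<le> \<Gamma> x" "0 < x \<Longrightarrow> norm (\<gamma> k x) \<le> \<Gamma> x" "\<Gamma> x \<le> C"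
proof -
 show g0: "0 \<le> \<Gamma> x" by (simp add: \<Gamma>_def)
 show "\<Gamma> x \<le> C" unfolding \<Gamma>_def using Gam_le[of x] C1 by (intro enn2real_leI) auto
 assume x: "0 < x"
 have "ennreal (absg k x) \<le> Gam x" unfolding Gam_def by (rule SUP_upper) simp
 then show "norm (\<gamma> k x) \<le> \<Gamma> x" unfolding Gam_eq using g0 x by (simp add: absg_def)
qed

lemma \<Gamma>_integrable: "integrable lborel (\<lambda>x. \<Gamma> x ^ p)"
proof (rule integrableI_bounded)
 have "absg k \<in> borel_measurable borel" for k
 proof (rule borel_measurable_continuous_countable_exceptions[OF countable_D])
  show "continuous_on (- D) (absg k)"
   unfolding continuous_on_eq_continuous_within
  proof
   fix x assume "x \<in> - D"
   then have x: "x \<notin> D" "x \<noteq> 0" by (auto simp: D_def)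
   have "isCont (absg k) x"
   proof (cases "x > 0")
    case True
    have "isCont (\<lambda>x. norm (\<gamma> k x)) x" by (intro continuous_norm \<gamma>_cont True x)
    moreover have "eventually (\<lambda>y. absg k y = norm (\<gamma> k y)) (nhds x)"
     using eventually_nhds_in_open[of "{0<..}" x] True by (auto simp: absg_def elim: eventually_mono)
    ultimately show ?thesis using isCont_cong[of "absg k"] by metis
   next
    case False
    have "eventually (\<lambda>y. absg k y = 0) (nhds x)"
     using eventually_nhds_in_open[of "{..<0}" x] False x by (auto simp: absg_def elim: eventually_mono)
    from isCont_cong[OF this] show ?thesis by simp
   qed
   then show "continuous (at x within - D) (absg k)" by (rule continuous_at_imp_continuous_at_within)
  qed
 qed
 then have "Gam \<in> borel_measurable borel" unfolding Gam_def[abs_def] by measurable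
 then show "(\<lambda>x. \<Gamma> x ^ p) \<in> borel_measurable lborel" unfolding \<Gamma>_def[abs_def] by measurable
 have "(\<integral>\<^sup>+x. ennreal (norm (\<Gamma> x ^ p)) \<partial>lborel) = (\<integral>\<^sup>+x. Gam x ^ p \<partial>lborel)"
  by (rule nn_integral_cong) (simp add: Gam_eq ennreal_power \<Gamma>_props)
 then show "(\<integral>\<^sup>+x. ennreal (norm (\<Gamma> x ^ p)) \<partial>lborel) < \<infinity>" using Gam_int by simp
qed

definition "mass = integral UNIV (\<lambda>x. \<Gamma> x ^ p)"

lemma \<Gamma>_int: "(\<lambda>x. \<Gamma> x ^ p) integrable_on {0..b}" "integral {0..b} (\<lambda>x. \<Gamma> x ^ p) \<le> mass"
proof -
 have i: "(\<lambda>x. \<Gamma> x ^ p) integrable_on UNIV" by (rule integrable_on_lborel[OF \<Gamma>_integrable])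
 show i': "(\<lambda>x. \<Gamma> x ^ p) integrable_on {0..b}" using integrable_on_subcbox[OF i, of 0 b] by simp
 show "integral {0..b} (\<lambda>x. \<Gamma> x ^ p) \<le> mass"
  unfolding mass_def by (rule integral_subset_le[OF _ i' i]) (auto simp: \<Gamma>_props)
qed

lemma \<alpha>_bounds: "0 < \<alpha>" "\<alpha> \<le> 1" "real (p - 1) * \<alpha> < 1" "0 < real (p - 1) * \<alpha>" "real (p - 1) = real p - 1" "Suc (p - 1) = p" "1 \<le> p - 1"
proof -
 show r: "real (p - 1) = real p - 1" and "Suc (p - 1) = p" and m: "1 \<le> p - 1" using p by auto
 show a: "0 < \<alpha>" using \<alpha> by simp
 have m': "real (p - 1) \<ge> 1" using m by linarith
 have "\<alpha> < 1 / real (p - 1)" using \<alpha> unfolding r by simp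
 then show b: "real (p - 1) * \<alpha> < 1" using m' by (simp add: less_divide_eq mult.commute)
 show "0 < real (p - 1) * \<alpha>" using a m' by simp
 have "1 * \<alpha> \<le> real (p - 1) * \<alpha>" using a m' by (intro mult_right_mono) auto
 then show "\<alpha> \<le> 1" using b by linarith
qed

lemma c_powr_summable: "(\<lambda>k. norm (c k) powr \<alpha>) summable_on UNIV"
 using c_powr by (simp add: summable_on_UNIV_nonneg_real_iff)

lemma c_summable: "(\<lambda>k. norm (c k)) summable_on UNIV"
 by (rule summable_on_of_powr[OF _ c_powr_summable \<alpha>_bounds(1,2)]) simp

definition "q x = (if x > 0 then V x else 0)"
definition "osc_term k x = c k * exp (- \<i> * of_real (\<phi> k * x)) * \<gamma> k x"
definition "K = infsum (\<lambda>k. norm (c k)) UNIV * C"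

lemma norm_osc_term_le: assumes "x > 0" shows "norm (osc_term k x) \<le> norm (c k) * C"
 unfolding osc_term_def using mult_left_mono[OF \<gamma>_bound[OF assms], of "norm (c k)"] by (simp add: norm_mult norm_exp_eq_Re)

lemma q_series: assumes x: "x > 0" shows "complex_of_real (q x) = infsum (\<lambda>k. osc_term k x) UNIV"
proof -
 have "(\<lambda>k. osc_term k x) summable_on UNIV"
  by (rule infsum_norm_le(1)[OF summable_on_cmult_left[OF c_summable] norm_osc_term_le[OF x]])
 from has_sum_imp_sums[OF has_sum_infsum[OF this]] potential[OF x]
 show ?thesis unfolding osc_term_def q_def using x by (simp add: sums_unique2)
qed

sublocale bounded_potential q D K
proof
 show "countable D" by (rule countable_D)
 have K0: "K \<ge> 0" unfolding K_def using C1 by (intro mult_nonneg_nonneg infsum_nonneg) auto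
 show "\<bar>q x\<bar> \<le> K" for x
 proof (cases "x > 0")
  case True
  have "norm (complex_of_real (q x)) \<le> infsum (\<lambda>k. norm (c k) * C) UNIV" unfolding q_series[OF True]
   by (rule infsum_norm_le(2)[OF summable_on_cmult_left[OF c_summable] norm_osc_term_le[OF True]])
  then show ?thesis by (simp add: K_def infsum_cmult_left')
 qed (use K0 in \<open>simp add: q_def\<close>)
 show "isCont q x" if "x \<notin> D" for x
 proof (cases "x > 0")
  case True
  have "((\<lambda>y. infsum (\<lambda>k. osc_term k y) UNIV) \<longlongrightarrow> infsum (\<lambda>k. osc_term k x) UNIV) (at x)"
  proof (rule infsum_tendsto[OF _ norm_osc_term_le norm_osc_term_le summable_on_cmult_left[OF c_summable]])
   show "(osc_term k \<longlongrightarrow> osc_term k x) (at x)" for k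
    unfolding osc_term_def[abs_def] by (intro tendsto_intros isContD[OF \<gamma>_cont[OF True that]])
   show "eventually (\<lambda>y. y \<in> {0<..}) (at x)" by (rule eventually_at_in_open') (use True in auto)
  qed (use True in auto)
  moreover have "eventually (\<lambda>y. infsum (\<lambda>k. osc_term k y) UNIV = complex_of_real (q y)) (at x)"
   using eventually_at_in_open'[of "{0<..}" x] True by (auto simp: q_series elim: eventually_mono)
  ultimately have "((\<lambda>y. complex_of_real (q y)) \<longlongrightarrow> complex_of_real (q x)) (at x)"
   unfolding q_series[OF True, symmetric] by (blast intro: Lim_transform_eventually)
  from tendsto_Re[OF this] show ?thesis by (simp add: isCont_def)
 next
  case False
  then have "x < 0" using that by (auto simp: D_def)
  then have "eventually (\<lambda>y. q y = 0) (nhds x)"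
   using eventually_nhds_in_open[of "{..<0}" x] by (auto simp: q_def elim: eventually_mono)
  from isCont_cong[OF this] show ?thesis by simp
 qed
qed

lemma q_tendsto_0: "(q \<longlongrightarrow> 0) at_top"
proof -
 have "((\<lambda>y. infsum (\<lambda>k. osc_term k y) UNIV) \<longlongrightarrow> infsum (\<lambda>k. 0) (UNIV :: nat set)) at_top"
 proof (rule infsum_tendsto[OF _ norm_osc_term_le _ summable_on_cmult_left[OF c_summable]])
  show "(osc_term k \<longlongrightarrow> 0) at_top" for k
  proof (rule Lim_null_comparison)
   show "eventually (\<lambda>x. norm (osc_term k x) \<le> norm (c k) * norm (\<gamma> k x)) at_top"
    by (rule always_eventually) (simp add: osc_term_def norm_mult norm_exp_eq_Re)
   show "((\<lambda>x. norm (c k) * norm (\<gamma> k x)) \<longlongrightarrow> 0) at_top"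
    by (intro tendsto_mult_right_zero tendsto_norm_zero \<gamma>_lim)
  qed
  show "eventually (\<lambda>x. x \<in> {0::real<..}) at_top" unfolding greaterThan_iff by (rule eventually_gt_at_top)
 qed (use C1 in auto)
 moreover have "eventually (\<lambda>y. infsum (\<lambda>k. osc_term k y) UNIV = complex_of_real (q y)) at_top"
  using eventually_gt_at_top[of 0] by eventually_elim (simp add: q_series)
 ultimately have "((\<lambda>y. complex_of_real (q y)) \<longlongrightarrow> 0) at_top" by (auto intro: Lim_transform_eventually)
 from tendsto_Re[OF this] show ?thesis by simp
qed

text \<open>In the variable \<open>\<eta> = 2 * \<kappa>\<close>. The resonances are listed
  separately: at \<open>\<eta> = freq \<phi> t\<close> the corresponding term of the potential has
  the value 0 instead of infinity, since \<open>0 powr a = 0\<close>. There are countably many of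
  them, as there are countably many trees.\<close>

definition "Bad = {\<eta>. \<not> (\<lambda>t. leaf_prod (\<lambda>k. norm (c k) powr \<alpha>) t * \<bar>\<eta> - freq \<phi> t\<bar> powr - (real (p - 1) * \<alpha>)) summable_on trees (p - 1)}
 \<union> freq \<phi> ` trees (p - 1)"

lemma Bad_null:
 assumes s: "s > real (p - 1) * \<alpha>" and \<delta>: "\<delta> > 0" shows "hausdorff_content s \<delta> Bad = 0"
proof -
 define P where "P = {\<eta>. \<not> (\<lambda>t. leaf_prod (\<lambda>k. norm (c k) powr \<alpha>) t * \<bar>\<eta> - freq \<phi> t\<bar> powr - (real (p - 1) * \<alpha>)) summable_on trees (p - 1)}"
 define R where "R = freq \<phi> ` trees (p - 1)"
 have "hausdorff_content s \<delta> P = 0"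
  unfolding P_def
 proof (rule potential_infinite_null[OF _ _ \<alpha>_bounds(4) s \<delta>])
  show "leaf_prod (\<lambda>k. norm (c k) powr \<alpha>) summable_on trees (p - 1)"
   by (rule leaf_prod_summable[OF c_powr_summable _ \<alpha>_bounds(7)]) simp
 qed (simp add: leaf_prod_nonneg)
 moreover have "hausdorff_content s \<delta> R = 0"
 proof (rule hausdorff_content_countable)
  show "countable R" unfolding R_def by (intro countable_image countableI_type)
  show "s > 0" using s \<alpha>_bounds(4) by linarith
 qed (use \<delta> in simp)
 ultimately have "hausdorff_content s \<delta> (\<Union>n::nat. if n = 0 then P else R) = 0"
  by (intro hausdorff_content_UN_null) simp
 moreover have "Bad \<subseteq> (\<Union>n::nat. if n = 0 then P else R)"
 proof
  fix x assume "x \<in> Bad"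
  then have "x \<in> P \<or> x \<in> R" by (auto simp: Bad_def P_def R_def)
  then show "x \<in> (\<Union>n::nat. if n = 0 then P else R)" by (auto intro: exI[of _ 0] exI[of _ 1])
 qed
 ultimately show ?thesis using hausdorff_content_mono[of Bad _ s \<delta>] by (metis le_zero_eq)
qed

abbreviation "bad_energies \<equiv> (\<lambda>\<eta>. \<eta>\<^sup>2 / 4) ` Bad"

text \<open>The map from \<open>\<eta> = 2 * \<kappa>\<close> to the energy
  \<open>\<kappa>\<^sup>2\<close> is Lipschitz on bounded intervals, and these exhaust the
  line.\<close>

lemma square_Bad_null:
 assumes s: "s > real (p - 1) * \<alpha>" and \<delta>: "\<delta> > 0" shows "hausdorff_content s \<delta> bad_energies = 0"
proof -
 have "hausdorff_content s \<delta> ((\<lambda>\<eta>. \<eta>\<^sup>2 / 4) ` (Bad \<inter> {- real n..real n})) = 0" for n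
 proof (rule hausdorff_content_lipschitz_null[where L = "real n + 1"])
  show "real n + 1 > 0" by simp
  have "hausdorff_content s (\<delta> / (real n + 1)) Bad = 0" by (rule Bad_null[OF s]) (use \<delta> in simp)
  then show "hausdorff_content s (\<delta> / (real n + 1)) (Bad \<inter> {- real n..real n}) = 0"
   using hausdorff_content_mono[of "Bad \<inter> {- real n..real n}" Bad s "\<delta> / (real n + 1)"] by simp
  show "s > 0" using s \<alpha>_bounds(4) by linarith
  fix x y assume xy: "x \<in> Bad \<inter> {- real n..real n}" "y \<in> Bad \<inter> {- real n..real n}"
  have "\<bar>x + y\<bar> / 4 \<le> real n + 1" using xy by auto
  then have "\<bar>x + y\<bar> / 4 * \<bar>x - y\<bar> \<le> (real n + 1) * \<bar>x - y\<bar>" by (rule mult_right_mono) simp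
  moreover have "\<bar>x\<^sup>2 / 4 - y\<^sup>2 / 4\<bar> = \<bar>x + y\<bar> / 4 * \<bar>x - y\<bar>"
  proof -
   have "x\<^sup>2 / 4 - y\<^sup>2 / 4 = (x + y) / 4 * (x - y)" by (simp add: power2_eq_square algebra_simps)
   then have "\<bar>x\<^sup>2 / 4 - y\<^sup>2 / 4\<bar> = \<bar>(x + y) / 4 * (x - y)\<bar>" by (rule arg_cong)
   then show ?thesis unfolding abs_mult by simp
  qed
  ultimately show "dist (x\<^sup>2 / 4) (y\<^sup>2 / 4) \<le> (real n + 1) * dist x y" unfolding dist_real_def by (simp only:)
 qed
 then have "hausdorff_content s \<delta> (\<Union>n. (\<lambda>\<eta>. \<eta>\<^sup>2 / 4) ` (Bad \<inter> {- real n..real n})) = 0" by (rule hausdorff_content_UN_null)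
 moreover have "bad_energies \<subseteq> (\<Union>n. (\<lambda>\<eta>. \<eta>\<^sup>2 / 4) ` (Bad \<inter> {- real n..real n}))"
 proof
  fix E assume "E \<in> bad_energies"
  then obtain \<eta> where \<eta>: "E = \<eta>\<^sup>2 / 4" "\<eta> \<in> Bad" by blast
  obtain n :: nat where "\<bar>\<eta>\<bar> \<le> real n" using real_arch_simple by blast
  then have "\<eta> \<in> Bad \<inter> {- real n..real n}" using \<eta> by auto
  then show "E \<in> (\<Union>n. (\<lambda>\<eta>. \<eta>\<^sup>2 / 4) ` (Bad \<inter> {- real n..real n}))" using \<eta>(1) by blast
 qed
 ultimately show ?thesis using hausdorff_content_mono[of "bad_energies" _ s \<delta>] by (metis le_zero_eq)
qed

text \<open>With \<open>\<kappa> = sqrt E\<close>, outside \<open>Bad\<close> the tree coefficients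
  at \<open>2 * \<kappa>\<close> are summable and all divisors are nonzero, so the tree sum with
  \<open>M = p - 1\<close> is available.\<close>

lemma good_energy:
 assumes E: "E > 0" "E \<notin> bad_energies" and sol: "ode_solution q D (of_real E) u v"
 shows "\<exists>B. \<forall>x\<ge>0. norm (u x) \<le> B \<and> norm (v x) \<le> B"
proof -
 define \<kappa> where "\<kappa> = sqrt E"
 have \<kappa>: "\<kappa> > 0" "\<kappa>\<^sup>2 = E" using E by (simp_all add: \<kappa>_def)
 have "E = (2 * \<kappa>)\<^sup>2 / 4" using \<kappa> by (simp add: power_mult_distrib)
 then have nb: "2 * \<kappa> \<notin> Bad" using E(2) by blast
 have sol': "ode_solution q D (of_real (\<kappa>\<^sup>2)) u v" using sol by (simp only: \<kappa>(2))
 interpret riccati_series q D K \<gamma> T C c \<phi> \<kappa> "p - 1" \<Gamma> mass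
 proof unfold_locales
  show "freq \<phi> t \<noteq> 2 * \<kappa>" if "leaves t \<le> p - 1" for t
  proof
   assume "freq \<phi> t = 2 * \<kappa>"
   then have "2 * \<kappa> \<in> freq \<phi> ` trees (p - 1)" using that by (intro image_eqI[of _ _ t]) simp_all
   then show False using nb unfolding Bad_def by blast
  qed
  have "(\<lambda>t. leaf_prod (\<lambda>k. norm (c k) powr \<alpha>) t * \<bar>2 * \<kappa> - freq \<phi> t\<bar> powr - (real (p - 1) * \<alpha>)) summable_on trees (p - 1)"
   using nb by (simp add: Bad_def)
  then show "(\<lambda>t. norm (coef c \<phi> (2 * \<kappa>) t)) summable_on trees (p - 1)"
   by (rule coef_summable[OF c_powr_summable \<alpha>_bounds(1,2,7)])
  show "complex_of_real (q x) = infsum (\<lambda>k. c k * exp (- \<i> * of_real (\<phi> k * x)) * \<gamma> k x) UNIV" if "x > 0" for x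
   using q_series[OF that] unfolding osc_term_def .
  show "(\<lambda>x. \<Gamma> x ^ Suc (p - 1)) integrable_on {0..b}" "integral {0..b} (\<lambda>x. \<Gamma> x ^ Suc (p - 1)) \<le> mass" for b
   unfolding \<alpha>_bounds(6) by (rule \<Gamma>_int)+
 qed (use \<kappa> \<alpha>_bounds \<Gamma>_props c_summable in auto)
 show ?thesis by (rule solutions_bounded[OF sol'])
qed

lemma q_eq: "x > 0 \<Longrightarrow> q x = V x" by (simp add: q_def)

lemma dimension:
 "hausdorff_dim {E::real. E > 0 \<and> \<not> (\<forall>u. schroedinger_solution V (complex_of_real E) u \<longrightarrow> bounded (u ` {0<..}))}
  \<le> ennreal ((real p - 1) * \<alpha>)"
 unfolding \<alpha>_bounds(5)[symmetric]
proof (rule hausdorff_dim_le)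
 show "0 \<le> real (p - 1) * \<alpha>" using \<alpha>_bounds(4) by (rule less_imp_le)
 fix s \<delta> :: real assume s: "s > real (p - 1) * \<alpha>" "\<delta> > 0"
 let ?S = "{E::real. E > 0 \<and> \<not> (\<forall>u. schroedinger_solution V (complex_of_real E) u \<longrightarrow> bounded (u ` {0<..}))}"
 have "?S \<subseteq> bad_energies"
 proof (rule subsetI, rule ccontr)
  fix E assume E: "E \<in> ?S" "E \<notin> bad_energies"
  then obtain u where u: "schroedinger_solution V (complex_of_real E) u" "\<not> bounded (u ` {0<..})" by blast
  have "E > 0" using E(1) by simp
  from good_energy[OF this E(2) schroedinger_imp_ode_solution[OF u(1) q_eq]]
  obtain B where "\<forall>x\<ge>0. norm (u x) \<le> B" by blast
  then have "bounded (u ` {0<..})" unfolding bounded_iff by (intro exI[of _ B]) simp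
  then show False using u(2) by simp
 qed
 from hausdorff_content_mono[OF this, of s \<delta>] show "hausdorff_content s \<delta> ?S = 0" unfolding square_Bad_null[OF s] by simp
qed

text \<open>Here \<open>(p - 1) * \<alpha> < 1\<close> enters: the bad energies have vanishing
  content in dimension 1, hence are Lebesgue null, and boundedness holds almost everywhere as
  \<open>ac_spectrum\<close> asks.\<close>

lemma ac_support: "ac_essential_support V \<theta> {0..}"
proof -
 interpret weyl_potential q D K \<theta> by unfold_locales
 show ?thesis
 proof (rule ac_spectrum[OF q_eq q_tendsto_0])
  have "negligible bad_energies"
   by (rule hausdorff_content_1_null_imp_negligible[of 1]) (rule square_Bad_null, use \<alpha>_bounds(3) in auto)
  then have "AE E in lebesgue. E \<notin> bad_energies"
   unfolding negligible_iff_null_sets by (rule AE_not_in)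
  then have "AE E in lborel. E \<notin> bad_energies" unfolding AE_completion_iff .
  then show "AE E in lborel. E > 0 \<longrightarrow> (\<exists>C. \<forall>x\<ge>0. norm (phi (of_real E) x) \<le> C \<and> norm (dphi (of_real E) x) \<le> C)"
  proof eventually_elim
   case (elim E)
   then show ?case using good_energy[OF _ elim phi_sol] by blast
  qed
 qed
qed

end

theorem theorem1p1:
  fixes V :: "real \<Rightarrow> real" and c :: "nat \<Rightarrow> complex" and \<phi> :: "nat \<Rightarrow> real"
    and \<gamma> :: "nat \<Rightarrow> real \<Rightarrow> complex" and p :: nat and \<alpha> \<theta> :: real
  assumes potential: "\<And>x. x > 0 \<Longrightarrow>
      (\<lambda>k. c k * exp (- \<i> * complex_of_real (\<phi> k * x)) * \<gamma> k x) sums complex_of_real (V x)"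
    and bounded_variation: "(SUP k. variation (\<gamma> k) {0<..}) < \<infinity>"
    and "p \<ge> 2"
    and integrability: "(\<integral>\<^sup>+x\<in>{0<..}. (SUP k. ennreal (norm (\<gamma> k x))) ^ p \<partial>lborel) < \<infinity>"
    and "\<alpha> \<in> {0<..<1 / (real p - 1)}"
    and "summable (\<lambda>k. norm (c k) powr \<alpha>)"
    and "0 \<le> \<theta>" and "\<theta> < pi"
  shows "hausdorff_dim {E::real. E > 0 \<and>
            \<not> (\<forall>u. schroedinger_solution V (complex_of_real E) u \<longrightarrow> bounded (u ` {0<..}))}
          \<le> ennreal ((real p - 1) * \<alpha>)
       \<and> ac_essential_support V \<theta> {0..}"
proof -
  interpret oscillatory_potential V c \<phi> \<gamma> p \<alpha> by unfold_locales (fact assms)+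
  show ?thesis using dimension ac_support by blast
qed

end
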